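(* Let $\mathcal K$ be a $0$-framed knot in $S^3$ and let $\alpha_{\mathcal K}(Q,E,q^2)$ be a polynomial annihilating its colored Jones function, i.e. $\alpha_{\mathcal K}(Q,E,q^2)\,J_\bullet(q^2,\mathcal K)=0$. Then the unified invariant is $q$-holonomic and every ADO invariant is $\zeta_{2r}$-holonomic, annihilated by the same polynomial: (1) $\alpha_{\mathcal K}(\tilde Q,\tilde E,q^2)\big(F_\infty(q,q^\alpha,\mathcal K)\big)=0$ in $\mathbb Q[\alpha][[h]]$; (2) for every $r\in\mathbb N^*$, $\alpha_{\mathcal K}(\overline Q,\overline E,\zeta_{2r}^2)\big(ADO_r(\zeta_{2r}^\alpha,\mathcal K)\big)=0$ in $\widehat R_r$.
   Context: $\mathbb N^*=\{1,2,\dots\}$. Knots are oriented, framed, in $S^3$. For $r\in\mathbb N^*$, $\zeta_{2r}=e^{i\pi/r}$. $\{n\}=q^n-q^{-n}$, $[n]=\{n\}/\{1\}$, $[n]!=\prod_{i=1}^n[i]$, $\binom{n}{k}_q=\frac{[n]!}{[n-k]![k]!}$. $A$ is a formal variable, also written $q^\alpha$ or $\zeta_{2r}^\alpha$; $\{\alpha+k\}_q=q^kA-q^{-k}A^{-1}$ and $\{\alpha+k;n\}_q=\prod_{i=0}^{n-1}\{\alpha+k-i\}_q$ (similarly with $q$ replaced by $\zeta_{2r}$). Rings. $R=\mathbb Z[q^{\pm1},A^{\pm1}]$, $I_n\subset R$ is the ideal generated by $\{\alpha+l;n\}_q$, $l\in\mathbb Z$, and $\widehat R=\varprojlim_n R/I_n$.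 It is a subring of $\mathbb Q[\alpha][[h]]$ via $q=e^h$, $A=q^\alpha=e^{\alpha h}$. $R_r=\mathbb Z[\zeta_{2r},A^{\pm1}]$, $I\subset R_r$ is the ideal generated by $\{r\alpha\}:=A^r-A^{-r}$, and $\widehat R_r=\varprojlim_n R_r/I^n\supset R_r$. Operators. The colored Jones function is $J_\bullet(q^2,\mathcal K)=\{J_n(q^2,\mathcal K)\}_{n\in\mathbb N^*}\in\mathbb Z[q^{\pm1}]^{\mathbb N^*}$. On $\mathbb Z[q^{\pm1}]^{\mathbb N^*}$: $(Qg)(n)=q^{2n}g(n)$, $(Eg)(n)=g(n+1)$. A polynomial $\alpha_{\mathcal K}(Q,E,q^2)$ is a finite sum $\sum c_{ij}(q^2)Q^iE^j$ with coefficients $c_{ij}$ integral Laurent polynomials in $q^2$; (by Garoufalidis–Lê, such an annihilating (nonzero) polynomial exists for every knot, i.e. $J_\bullet$ is $q$-holonomic). On $\mathbb Q[\alpha][[h]]$: $\tilde Q(x(\alpha))=q^{2\alpha}x(\alpha)$, $\tilde E(x(\alpha))=x(\alpha+1)$ (coefficientwise in $h$). On $\widehat R_r$: $\overline Q(x)=\zeta_{2r}^{2\alpha}x=A^2x$, and $\overline E$ is $\alpha\mapsto\alpha+1$, i.e. the continuous ring endomorphism induced by $A\mapsto\zeta_{2r}A$ (so $\{r\alpha\}\mapsto-\{r\alpha\}$). $q$-holonomic (resp. $\zeta_{2r}$-holonomic) means annihilated by such a polynomial in these operators. Colored Jones polynomials. $J_n(q^2,\mathcal K)\in\mathbb Z[q^{\pm2}]$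 is the scalar by which the Reshetikhin–Turaev operator of a 1-1 tangle with $0$-framed closure $\mathcal K$ acts on the $(n+1)$-dimensional irreducible representation of quantum $\mathfrak{sl}_2$, using $q^{\frac{H\otimes H}{2}}\sum_{n\ge 0}\frac{\{1\}^nq^{n(n-1)/2}}{[n]!}E^n\otimes F^n$ as $R$-matrix and pivotal element $K=q^H$, where $[E,F]=\frac{K-K^{-1}}{q-q^{-1}}$ (so $J_n(\text{unknot})=1$). ADO invariant. Write $\zeta=\zeta_{2r}$. Let $V$ be the module with basis $v_0,\dots,v_{r-1}$ over $\mathbb Z[\zeta,A^{\pm1}]$ with $Ev_0=0$, $Ev_i=v_{i-1}$, $F^{(n)}v_i=\binom{n+i}{n}_{\zeta}\{\alpha-i;n\}_{\zeta}\,v_{n+i}$ (zero if $n+i\ge r$), $Kv_i=\zeta^{\alpha-2i}v_i$, $\zeta^{\frac{H\otimes H}{2}}(v_i\otimes v_j)=\zeta^{\frac{\alpha^2}{2}}\zeta^{-(i+j)\alpha}\zeta^{2ij}v_i\otimes v_j$ ($\zeta^{\alpha^2/2}$ a formal invertible symbol). With $R$-matrix $\zeta^{\frac{H\otimes H}{2}}\sum_{n=0}^{r-1}\zeta^{\frac{n(n-1)}{2}}E^n\otimes F^{(n)}$, its inverse, and pivotal element $K^{1-r}$, the Reshetikhin–Turaev operator of a 1-1 tangle with closure $\mathcal K$ is a scalar on $V$; this scalar is $ADO_r(A,\mathcal K)=ADO_r(\zeta_{2r}^\alpha,\mathcal K)$, in $\mathbb Z[\zeta,A^{\pm1}]$ for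 $0$-framed $\mathcal K$. Unified invariant. Let $D$ be a diagram of a 1-1 tangle with closure $\mathcal K$ (blackboard framing), open strand running from bottom to top, all crossings drawn with both strands oriented upward; number the crossings $1,\dots,N$. For $(i_1,\dots,i_N)\in\mathbb N^N$ label the edges of $D$: the bottom and top edges have label $0$; at the $k$-th crossing the under-strand has incoming label $a_k$ and outgoing label $a_k+i_k$, the over-strand has incoming label $b_k$ and outgoing label $b_k-i_k$ (terms with a negative label are zero). Let $j=1,\dots,S$ run over the local maxima (caps) and minima (cups) of $D$ traversed from left to right, $\epsilon_j$ the label there, $\sigma_j=+1$ for a cap, $-1$ for a cup. Put $$D(i_1,\dots,i_N)=\prod_{j=1}^Sq^{\sigma_j(\alpha-2\epsilon_j)}\prod_{k\,\mathrm{pos}}q^{\frac{i_k(i_k-1)}2}\binom{a_k+i_k}{i_k}_q\{\alpha-a_k;i_k\}_q\,q^{-(a_k+b_k)\alpha}q^{2(a_k+i_k)(b_k-i_k)}$$ $$\times\prod_{k\,\mathrm{neg}}(-1)^{i_k}q^{-\frac{i_k(i_k-1)}2}\binom{a_k+i_k}{i_k}_q\{\alpha-a_k;i_k\}_q\,q^{(a_k+b_k)\alpha}q^{-2a_kb_k}.$$ For $0$-framed $\mathcal K$, $F_\infty(q,A,\mathcal K)=\sum_{i_1,\dots,i_N=0}^{\infty}D(i_1,\dots,i_N)\in\widehat R$, independent of $D$. *)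

theory Defs
  imports
    Complex_Main
    "HOL-Library.Poly_Mapping"
    "HOL-Library.FuncSet"
    "HOL-Library.Product_Plus"
    "HOL-Computational_Algebra.Polynomial"
    "HOL-Computational_Algebra.Fraction_Field"
    "HOL-Computational_Algebra.Formal_Power_Series"
    "HOL-Algebra.Ideal_Product"
    "HOL-Algebra.QuotRing"
    "HOL-Algebra.Algebraic_Closure_Type"
begin

section \<open>Diagrams of 1-1 tangles\<close>

text \<open>
  A diagram in general position is read from bottom to top as a list of layers. A layer \<open>(p, P)\<close>
  applies the piece \<open>P\<close> to the strands starting at position \<open>p\<close> (counted from the left, from \<open>0\<close>)
  and is vertical elsewhere. Both strands of a crossing point upward; in \<open>PosX\<close> the over-strand
  goes from bottom left to top right, in \<open>NegX\<close> from bottom right to top left.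
  Caps (maxima) and cups (minima) are traversed left to right (\<open>LR\<close>) or right to left (\<open>RL\<close>).
\<close>

datatype orientation = Up | Down

datatype piece = PosX | NegX | CapLR | CapRL | CupLR | CupRL

type_synonym diagram = "(nat \<times> piece) list"

fun below :: "piece \<Rightarrow> orientation list" where
  "below PosX = [Up, Up]"
| "below NegX = [Up, Up]"
| "below CapLR = [Up, Down]"
| "below CapRL = [Down, Up]"
| "below CupLR = []"
| "below CupRL = []"

fun above :: "piece \<Rightarrow> orientation list" where
  "above PosX = [Up, Up]"
| "above NegX = [Up, Up]"
| "above CapLR = []"
| "above CapRL = []"
| "above CupLR = [Down, Up]"
| "above CupRL = [Up, Down]"

abbreviation n_in :: "piece \<Rightarrow> nat" where "n_in P \<equiv> length (below P)"
abbreviation n_out :: "piece \<Rightarrow> nat" where "n_out P \<equiv> length (above P)"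

fun layer_orient :: "nat \<times> piece \<Rightarrow> orientation list \<Rightarrow> orientation list" where
  "layer_orient (p, P) s = take p s @ above P @ drop (p + n_in P) s"

text \<open>The orientations of the strands at height \<open>t\<close>, just below the layer \<open>D ! t\<close>.\<close>

definition orient :: "diagram \<Rightarrow> nat \<Rightarrow> orientation list" where
  "orient D t = fold layer_orient (take t D) [Up]"

definition tangle_1_1 :: "diagram \<Rightarrow> bool" where
  "tangle_1_1 D \<longleftrightarrow>
     (\<forall>t<length D. case D ! t of (p, P) \<Rightarrow>
        p + n_in P \<le> length (orient D t) \<and> take (n_in P) (drop p (orient D t)) = below P) \<and>
     orient D (length D) = [Up]"

text \<open>
  The point \<open>(t, k)\<close> is the \<open>k\<close>-th strand at height \<open>t\<close>. \<open>strands (p, P)\<close> relates the positions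
  below and above a layer that are joined by a strand going through it.
\<close>

fun strands :: "nat \<times> piece \<Rightarrow> (nat \<times> nat) set" where
  "strands (p, P) = {(k, k) | k. k < p} \<union> {(k + n_in P, k + n_out P) | k. p \<le> k} \<union>
     (if P = PosX \<or> P = NegX then {(p, p + 1), (p + 1, p)} else {})"

inductive follows :: "diagram \<Rightarrow> nat \<times> nat \<Rightarrow> nat \<times> nat \<Rightarrow> bool" for D where
  up: "\<lbrakk>t < length D; (j, k) \<in> strands (D ! t); j < length (orient D t); orient D t ! j = Up\<rbrakk>
         \<Longrightarrow> follows D (t, j) (Suc t, k)"
| down: "\<lbrakk>t < length D; (j, k) \<in> strands (D ! t); j < length (orient D t); orient D t ! j = Down\<rbrakk>
         \<Longrightarrow> follows D (Suc t, k) (t, j)"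
| cap_lr: "\<lbrakk>t < length D; D ! t = (p, CapLR)\<rbrakk> \<Longrightarrow> follows D (t, p) (t, p + 1)"
| cap_rl: "\<lbrakk>t < length D; D ! t = (p, CapRL)\<rbrakk> \<Longrightarrow> follows D (t, p + 1) (t, p)"
| cup_lr: "\<lbrakk>t < length D; D ! t = (p, CupLR)\<rbrakk> \<Longrightarrow> follows D (Suc t, p) (Suc t, p + 1)"
| cup_rl: "\<lbrakk>t < length D; D ! t = (p, CupRL)\<rbrakk> \<Longrightarrow> follows D (Suc t, p + 1) (Suc t, p)"

text \<open>The closure is a knot iff the open strand is the only component of the tangle.\<close>

definition knot_diagram :: "diagram \<Rightarrow> bool" where
  "knot_diagram D \<longleftrightarrow> tangle_1_1 D \<and>
     (\<forall>t\<le>length D. \<forall>k<length (orient D t). (follows D)\<^sup>*\<^sup>* (0, 0) (t, k))"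

definition writhe :: "diagram \<Rightarrow> int" where
  "writhe D = int (length (filter (\<lambda>(p, P). P = PosX) D))
            - int (length (filter (\<lambda>(p, P). P = NegX) D))"

text \<open>The framing number of the closure with its blackboard framing is the writhe.\<close>

definition zero_framed_knot_diagram :: "diagram \<Rightarrow> bool" where
  "zero_framed_knot_diagram D \<longleftrightarrow> knot_diagram D \<and> writhe D = 0"


section \<open>Laurent polynomials and quantum numbers\<close>

text \<open>
  Laurent polynomials are the group rings of \<open>\<int>\<close> and \<open>\<int>\<^sup>2\<close>: \<open>single k 1\<close> is \<open>q\<^sup>k\<close>, and
  \<open>single (k, l) 1\<close> is \<open>q\<^sup>k A\<^sup>l\<close>. The map \<open>evalL c m\<close> applies \<open>c\<close> to the coefficients and
  replaces the monomial with exponent \<open>k\<close> by \<open>m k\<close>.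
\<close>

type_synonym laurent_q = "int \<Rightarrow>\<^sub>0 int"
type_synonym laurent_qA = "int \<times> int \<Rightarrow>\<^sub>0 int"

definition evalL :: "('c::zero \<Rightarrow> 'b::comm_ring_1) \<Rightarrow> ('k \<Rightarrow> 'b) \<Rightarrow> ('k \<Rightarrow>\<^sub>0 'c) \<Rightarrow> 'b" where
  "evalL c m p = (\<Sum>k\<in>Poly_Mapping.keys p. c (Poly_Mapping.lookup p k) * m k)"

definition qbrace :: "'a::field \<Rightarrow> nat \<Rightarrow> 'a" where
  "qbrace q n = q powi (int n) - q powi (- int n)"

definition qint :: "'a::field \<Rightarrow> nat \<Rightarrow> 'a" where
  "qint q n = qbrace q n / qbrace q 1"

definition qfact :: "'a::field \<Rightarrow> nat \<Rightarrow> 'a" where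
  "qfact q n = (\<Prod>i=1..n. qint q i)"

definition qbinom :: "'a::field \<Rightarrow> nat \<Rightarrow> nat \<Rightarrow> 'a" where
  "qbinom q n k = qfact q n / (qfact q (n - k) * qfact q k)"

text \<open>The field \<open>\<rat>(s)\<close> with \<open>s\<^sup>2 = q\<close>; half-integral powers of \<open>q\<close> occur in the \<open>R\<close>-matrix.\<close>

type_synonym qfield = "int poly fract"

definition sqrt_q :: qfield where "sqrt_q = Fract [:0, 1:] 1"

definition q_gen :: qfield where "q_gen = sqrt_q ^ 2"

definition laurent_to_field :: "laurent_q \<Rightarrow> qfield" where
  "laurent_to_field = evalL of_int (\<lambda>k. q_gen powi k)"

text \<open>The Laurent polynomial equal to a given element of \<open>\<int>[q\<^sup>\<plusminus>\<^sup>1] \<subseteq> \<rat>(s)\<close>.\<close>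

definition field_to_laurent :: "qfield \<Rightarrow> laurent_q" where
  "field_to_laurent x = (THE p. laurent_to_field p = x)"


section \<open>The Reshetikhin-Turaev operators\<close>

text \<open>
  Matrices are functions of two indices; \<open>M i j\<close> is the coefficient of \<open>v\<^sub>j\<close> in \<open>M v\<^sub>i\<close>.
  For an \<open>R\<close>-matrix, \<open>M (i, j) (k, l)\<close> is the coefficient of \<open>v\<^sub>k \<otimes> v\<^sub>l\<close> in \<open>M (v\<^sub>i \<otimes> v\<^sub>j)\<close>.
\<close>

fun mat_pow :: "nat \<Rightarrow> (nat \<Rightarrow> nat \<Rightarrow> 'a::comm_ring_1) \<Rightarrow> nat \<Rightarrow> nat \<Rightarrow> nat \<Rightarrow> 'a" where
  "mat_pow d M 0 i j = (if i = j then 1 else 0)"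
| "mat_pow d M (Suc m) i j = (\<Sum>k<d. M i k * mat_pow d M m k j)"

definition mutually_inverse ::
    "'i set \<Rightarrow> ('i \<Rightarrow> 'i \<Rightarrow> 'a::comm_ring_1) \<Rightarrow> ('i \<Rightarrow> 'i \<Rightarrow> 'a) \<Rightarrow> bool" where
  "mutually_inverse B M N \<longleftrightarrow> (\<forall>x\<in>B. \<forall>y\<in>B.
     (\<Sum>z\<in>B. M x z * N z y) = (if x = y then 1 else 0) \<and>
     (\<Sum>z\<in>B. N x z * M z y) = (if x = y then 1 else 0))"

text \<open>
  The data needed: the dimension, the \<open>R\<close>-matrix, and the eigenvalues on the basis of the
  (diagonal) pivotal element and of its inverse.
\<close>

record 'a rt_data =
  dim :: nat
  Rmat :: "nat \<times> nat \<Rightarrow> nat \<times> nat \<Rightarrow> 'a"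
  piv :: "nat \<Rightarrow> 'a"
  piv_inv :: "nat \<Rightarrow> 'a"

definition Rinv :: "'a::comm_ring_1 rt_data \<Rightarrow> nat \<times> nat \<Rightarrow> nat \<times> nat \<Rightarrow> 'a" where
  "Rinv T = (SOME N. mutually_inverse ({..<dim T} \<times> {..<dim T}) (Rmat T) N)"

text \<open>
  Upward strands carry \<open>V\<close>, downward ones \<open>V\<^sup>*\<close> with the dual basis. Crossings are \<open>\<tau> \<circ> R\<close> and its
  inverse \<open>R\<^sup>-\<^sup>1 \<circ> \<tau>\<close>. With \<open>g\<close> the pivotal element, \<open>CapLR\<close> is \<open>v \<otimes> f \<mapsto> f (g v)\<close>, \<open>CapRL\<close> is
  \<open>f \<otimes> v \<mapsto> f v\<close>, \<open>CupLR\<close> is \<open>1 \<mapsto> \<Sum>i. v\<^sub>i\<^sup>* \<otimes> g\<^sup>-\<^sup>1 v\<^sub>i\<close> and \<open>CupRL\<close> is \<open>1 \<mapsto> \<Sum>i. v\<^sub>i \<otimes> v\<^sub>i\<^sup>*\<close>.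
\<close>

fun piece_entry :: "'a::comm_ring_1 rt_data \<Rightarrow> piece \<Rightarrow> nat list \<Rightarrow> nat list \<Rightarrow> 'a" where
  "piece_entry T PosX [x, y] [z, w] = Rmat T (x, y) (w, z)"
| "piece_entry T NegX [x, y] [z, w] = Rinv T (y, x) (z, w)"
| "piece_entry T CapLR [x, y] [] = (if x = y then piv T x else 0)"
| "piece_entry T CapRL [x, y] [] = (if x = y then 1 else 0)"
| "piece_entry T CupLR [] [z, w] = (if z = w then piv_inv T z else 0)"
| "piece_entry T CupRL [] [z, w] = (if z = w then 1 else 0)"
| "piece_entry T _ _ _ = 0"

fun layer_entry :: "'a::comm_ring_1 rt_data \<Rightarrow> nat \<times> piece \<Rightarrow> nat list \<Rightarrow> nat list \<Rightarrow> 'a" where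
  "layer_entry T (p, P) xs ys =
     (if take p xs = take p ys \<and> drop (p + n_in P) xs = drop (p + n_out P) ys
      then piece_entry T P (take (n_in P) (drop p xs)) (take (n_out P) (drop p ys)) else 0)"

fun RT :: "'a::comm_ring_1 rt_data \<Rightarrow> diagram \<Rightarrow> nat list \<Rightarrow> nat list \<Rightarrow> 'a" where
  "RT T [] xs ys = (if xs = ys then 1 else 0)"
| "RT T ((p, P) # D) xs ys =
     (\<Sum>zs\<in>{zs. length zs = length xs - n_in P + n_out P \<and> set zs \<subseteq> {..<dim T}}.
        layer_entry T (p, P) xs zs * RT T D zs ys)"

definition acts_by_scalar :: "'a::comm_ring_1 rt_data \<Rightarrow> diagram \<Rightarrow> 'a \<Rightarrow> bool" where
  "acts_by_scalar T D c \<longleftrightarrow>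
     (\<forall>i<dim T. \<forall>j<dim T. RT T D [i] [j] = (if i = j then c else 0))"


subsection \<open>The colored Jones polynomials\<close>

text \<open>
  The \<open>(n+1)\<close>-dimensional irreducible representation, with highest weight vector \<open>v\<^sub>0\<close>:
  \<open>E v\<^sub>i = v\<^sub>i\<^sub>-\<^sub>1\<close>, \<open>F v\<^sub>i = [i+1][n-i] v\<^sub>i\<^sub>+\<^sub>1\<close>, \<open>H v\<^sub>i = (n-2i) v\<^sub>i\<close>, \<open>K = q\<^sup>H\<close>.
\<close>

definition E_mat :: "nat \<Rightarrow> nat \<Rightarrow> 'a::comm_ring_1" where
  "E_mat i j = (if i = Suc j then 1 else 0)"

definition F_mat :: "nat \<Rightarrow> nat \<Rightarrow> nat \<Rightarrow> qfield" where
  "F_mat n i j = (if j = Suc i \<and> j \<le> n then qint q_gen (i + 1) * qint q_gen (n - i) else 0)"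

definition weight :: "nat \<Rightarrow> nat \<Rightarrow> int" where
  "weight n i = int n - 2 * int i"

definition jones_data :: "nat \<Rightarrow> qfield rt_data" where
  "jones_data n = \<lparr>
     dim = n + 1,
     Rmat = (\<lambda>(i, j) (k, l). sqrt_q powi (weight n k * weight n l) *
        (\<Sum>m\<le>n. qbrace q_gen 1 ^ m * q_gen ^ (m * (m - 1) div 2) / qfact q_gen m *
           mat_pow (n + 1) E_mat m i k * mat_pow (n + 1) (F_mat n) m j l)),
     piv = (\<lambda>i. q_gen powi weight n i),
     piv_inv = (\<lambda>i. q_gen powi (- weight n i))\<rparr>"

definition colored_jones :: "diagram \<Rightarrow> nat \<Rightarrow> laurent_q" where
  "colored_jones D n = field_to_laurent (THE c. acts_by_scalar (jones_data n) D c)"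


subsection \<open>The ADO invariants\<close>

definition zeta :: "nat \<Rightarrow> complex" where
  "zeta r = exp (\<i> * of_real pi / of_nat r)"

text \<open>
  The exponent pair \<open>(k, l)\<close> stands for \<open>A\<^sup>k T\<^sup>l\<close>, where \<open>T\<close> is the symbol \<open>\<zeta>\<^bsup>\<alpha>\<^sup>2/2\<^esup>\<close>.
\<close>

type_synonym laurent_AT = "int \<times> int \<Rightarrow>\<^sub>0 complex"

definition zeta_brace_prod :: "nat \<Rightarrow> int \<Rightarrow> nat \<Rightarrow> laurent_AT" where
  "zeta_brace_prod r k n = (\<Prod>m<n. Poly_Mapping.single (1, 0) (zeta r powi (k - int m))
                                - Poly_Mapping.single (- 1, 0) (zeta r powi (int m - k)))"

definition F_div :: "nat \<Rightarrow> nat \<Rightarrow> nat \<Rightarrow> nat \<Rightarrow> laurent_AT" where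
  "F_div r n i j = (if j = n + i \<and> n + i < r
     then Poly_Mapping.single 0 (qbinom (zeta r) (n + i) n) * zeta_brace_prod r (- int i) n
     else 0)"

definition ado_data :: "nat \<Rightarrow> laurent_AT rt_data" where
  "ado_data r = \<lparr>
     dim = r,
     Rmat = (\<lambda>(i, j) (k, l).
        Poly_Mapping.single (- int (k + l), 1) (zeta r powi int (2 * k * l)) *
        (\<Sum>n<r. Poly_Mapping.single 0 (zeta r ^ (n * (n - 1) div 2)) *
           mat_pow r E_mat n i k * F_div r n j l)),
     piv = (\<lambda>i. Poly_Mapping.single (1 - int r, 0) (zeta r powi (- 2 * int i * (1 - int r)))),
     piv_inv = (\<lambda>i. Poly_Mapping.single (int r - 1, 0) (zeta r powi (- 2 * int i * (int r - 1))))\<rparr>"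

definition Z_zeta :: "nat \<Rightarrow> complex set" where
  "Z_zeta r = range (\<lambda>p :: int poly. poly (map_poly of_int p) (zeta r))"

text \<open>\<open>R\<^sub>r = \<int>[\<zeta>, A\<^sup>\<plusminus>\<^sup>1]\<close>\<close>

definition ring_Rr :: "nat \<Rightarrow> (int \<Rightarrow>\<^sub>0 complex) ring" where
  "ring_Rr r = ring_of_type_algebra
     \<lparr>carrier := {p. \<forall>k. Poly_Mapping.lookup p k \<in> Z_zeta r}\<rparr>"

definition ADO :: "nat \<Rightarrow> diagram \<Rightarrow> int \<Rightarrow>\<^sub>0 complex" where
  "ADO r D = (THE p. p \<in> carrier (ring_Rr r) \<and>
     acts_by_scalar (ado_data r) D
       (evalL (Poly_Mapping.single 0) (\<lambda>k. Poly_Mapping.single (k, 0) 1) p))"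


section \<open>Completions\<close>

text \<open>
  For a decreasing sequence of ideals \<open>I n\<close>, the inverse limit of the rings \<open>R Quot I n\<close>. Elements
  are sequences of cosets; the projection sends a coset of \<open>I (Suc n)\<close> to the coset of \<open>I n\<close>
  containing it.
\<close>

definition completion :: "'a ring \<Rightarrow> (nat \<Rightarrow> 'a set) \<Rightarrow> (nat \<Rightarrow> 'a set) ring" where
  "completion R I = \<lparr>
     carrier = {x. (\<forall>n. x n \<in> carrier (R Quot I n)) \<and> (\<forall>n. x (Suc n) \<subseteq> x n)},
     monoid.mult = (\<lambda>x y n. x n \<otimes>\<^bsub>R Quot I n\<^esub> y n),
     one = (\<lambda>n. \<one>\<^bsub>R Quot I n\<^esub>),
     zero = (\<lambda>n. \<zero>\<^bsub>R Quot I n\<^esub>),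
     add = (\<lambda>x y n. x n \<oplus>\<^bsub>R Quot I n\<^esub> y n)\<rparr>"

definition to_completion :: "'a ring \<Rightarrow> (nat \<Rightarrow> 'a set) \<Rightarrow> 'a \<Rightarrow> nat \<Rightarrow> 'a set" where
  "to_completion R I a = (\<lambda>n. I n +>\<^bsub>R\<^esub> a)"

fun ideal_pow :: "'a ring \<Rightarrow> 'a set \<Rightarrow> nat \<Rightarrow> 'a set" where
  "ideal_pow R I 0 = carrier R"
| "ideal_pow R I (Suc n) = ideal_prod R I (ideal_pow R I n)"


section \<open>The unified invariant\<close>

definition ring_R :: "laurent_qA ring" where
  "ring_R = ring_of_type_algebra"

text \<open>\<open>{\<alpha>+k; n}\<close>\<close>

definition alpha_brace :: "int \<Rightarrow> nat \<Rightarrow> laurent_qA" where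
  "alpha_brace k n = (\<Prod>i<n. Poly_Mapping.single (k - int i, 1) 1
                           - Poly_Mapping.single (int i - k, - 1) 1)"

definition I_R :: "nat \<Rightarrow> laurent_qA set" where
  "I_R n = Idl\<^bsub>ring_R\<^esub> (range (\<lambda>l. alpha_brace l n))"

definition R_hat :: "(nat \<Rightarrow> laurent_qA set) ring" where
  "R_hat = completion ring_R I_R"

definition qbinom_R :: "nat \<Rightarrow> nat \<Rightarrow> laurent_qA" where
  "qbinom_R n k = evalL of_int (\<lambda>j. Poly_Mapping.single (j, 0) 1) (field_to_laurent (qbinom q_gen n k))"

text \<open>
  Crossings are numbered by the index of their layer, so a multi-index \<open>i\<close> is an extensional
  function on \<open>crossings D\<close>. In \<open>label_rule\<close> and \<open>label_weight\<close> the lists are the labels below and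
  above a piece; \<open>a\<close> belongs to the under-strand and \<open>b\<close> to the over-strand.
\<close>

definition crossings :: "diagram \<Rightarrow> nat set" where
  "crossings D = {t. t < length D \<and> snd (D ! t) \<in> {PosX, NegX}}"

fun label_rule :: "piece \<Rightarrow> nat \<Rightarrow> nat list \<Rightarrow> nat list \<Rightarrow> bool" where
  "label_rule PosX i [b, a] [a', b'] \<longleftrightarrow> a' = a + i \<and> b' + i = b"
| "label_rule NegX i [a, b] [b', a'] \<longleftrightarrow> a' = a + i \<and> b' + i = b"
| "label_rule CapLR i [x, y] [] \<longleftrightarrow> x = y"
| "label_rule CapRL i [x, y] [] \<longleftrightarrow> x = y"
| "label_rule CupLR i [] [z, w] \<longleftrightarrow> z = w"
| "label_rule CupRL i [] [z, w] \<longleftrightarrow> z = w"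
| "label_rule _ i _ _ \<longleftrightarrow> False"

definition qA :: "int \<Rightarrow> int \<Rightarrow> laurent_qA" where
  "qA k l = Poly_Mapping.single (k, l) 1"

definition tri :: "nat \<Rightarrow> int" where
  "tri i = int (i * (i - 1) div 2)"

fun label_weight :: "piece \<Rightarrow> nat \<Rightarrow> nat list \<Rightarrow> nat list \<Rightarrow> laurent_qA" where
  "label_weight PosX i [b, a] _ =
     qA (tri i) 0 * qbinom_R (a + i) i * alpha_brace (- int a) i *
     qA 0 (- int (a + b)) * qA (2 * (int a + int i) * (int b - int i)) 0"
| "label_weight NegX i [a, b] _ =
     (- 1) ^ i * qA (- tri i) 0 * qbinom_R (a + i) i * alpha_brace (- int a) i *
     qA 0 (int (a + b)) * qA (- 2 * int a * int b) 0"
| "label_weight CapLR i [x, _] [] = qA (- 2 * int x) 1"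
| "label_weight CupLR i [] [z, _] = qA (2 * int z) (- 1)"
| "label_weight _ i _ _ = 1"

text \<open>\<open>L ! t\<close> is the list of labels at height \<open>t\<close>.\<close>

definition labelling :: "diagram \<Rightarrow> (nat \<Rightarrow> nat) \<Rightarrow> nat list list \<Rightarrow> bool" where
  "labelling D i L \<longleftrightarrow>
     length L = Suc (length D) \<and> L ! 0 = [0] \<and> L ! length D = [0] \<and>
     (\<forall>t<length D. case D ! t of (p, P) \<Rightarrow>
        (\<exists>us ws zs vs. L ! t = us @ ws @ vs \<and> L ! Suc t = us @ zs @ vs \<and> length us = p \<and>
           label_rule P (i t) ws zs))"

text \<open>
  For a knot diagram the labels are determined by \<open>i\<close>. Labels being natural numbers, there is no
  labelling when one of them would be negative.
\<close>

definition state_term :: "diagram \<Rightarrow> (nat \<Rightarrow> nat) \<Rightarrow> laurent_qA" where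
  "state_term D i =
     (if \<exists>L. labelling D i L then
        let L = (THE L. labelling D i L) in
        (\<Prod>t<length D. case D ! t of (p, P) \<Rightarrow>
           label_weight P (i t) (take (n_in P) (drop p (L ! t))) (take (n_out P) (drop p (L ! Suc t))))
      else 0)"

definition unified_invariant :: "diagram \<Rightarrow> nat \<Rightarrow> laurent_qA set" where
  "unified_invariant D = (THE x. x \<in> carrier R_hat \<and>
     (\<forall>n. \<forall>\<^sub>F S in finite_subsets_at_top (crossings D \<rightarrow>\<^sub>E UNIV).
        to_completion ring_R I_R (\<Sum>i\<in>S. state_term D i) n = x n))"

text \<open>The embedding of \<open>R_hat\<close> into \<open>\<rat>[\<alpha>][[h]]\<close>; here \<open>exp_h c = e\<^bsup>c h\<^esup>\<close>.\<close>

definition exp_h :: "rat poly \<Rightarrow> rat poly fps" where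
  "exp_h c = Abs_fps (\<lambda>m. smult (1 / fact m) (c ^ m))"

definition R_to_series :: "laurent_qA \<Rightarrow> rat poly fps" where
  "R_to_series = evalL of_int (\<lambda>(k, l). exp_h [:of_int k, of_int l:])"

definition R_hat_to_series :: "(nat \<Rightarrow> laurent_qA set) \<Rightarrow> rat poly fps" where
  "R_hat_to_series x =
     (THE y. \<forall>n. \<forall>a\<in>x n. \<forall>m<n. fps_nth y m = fps_nth (R_to_series a) m)"


section \<open>Operators\<close>

text \<open>
  A polynomial \<open>\<alpha>(Q, E, u) = \<Sum> c\<^sub>i\<^sub>j(u) Q\<^sup>i E\<^sup>j\<close>: the Laurent polynomial \<open>c\<^sub>i\<^sub>j\<close> in the variable
  \<open>u\<close> is the coefficient at \<open>(i, j)\<close>. Below, \<open>u\<close> is specialized to \<open>q\<^sup>2\<close>, \<open>e\<^sup>2\<^sup>h\<close> and \<open>\<zeta>\<^sup>2\<close>.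
\<close>

type_synonym qoperator = "nat \<times> nat \<Rightarrow>\<^sub>0 laurent_q"

definition Q_op :: "(nat \<Rightarrow> laurent_q) \<Rightarrow> nat \<Rightarrow> laurent_q" where
  "Q_op g n = Poly_Mapping.single (2 * int n) 1 * g n"

definition E_op :: "(nat \<Rightarrow> laurent_q) \<Rightarrow> nat \<Rightarrow> laurent_q" where
  "E_op g n = g (n + 1)"

definition act_seq :: "qoperator \<Rightarrow> (nat \<Rightarrow> laurent_q) \<Rightarrow> nat \<Rightarrow> laurent_q" where
  "act_seq P g n = (\<Sum>(i, j)\<in>Poly_Mapping.keys P.
     evalL of_int (\<lambda>k. Poly_Mapping.single (2 * k) 1) (Poly_Mapping.lookup P (i, j)) *
     (Q_op ^^ i) ((E_op ^^ j) g) n)"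

definition Q_tilde :: "rat poly fps \<Rightarrow> rat poly fps" where
  "Q_tilde x = exp_h [:0, 2:] * x"

definition E_tilde :: "rat poly fps \<Rightarrow> rat poly fps" where
  "E_tilde x = Abs_fps (\<lambda>m. pcompose (fps_nth x m) [:1, 1:])"

definition act_series :: "qoperator \<Rightarrow> rat poly fps \<Rightarrow> rat poly fps" where
  "act_series P x = (\<Sum>(i, j)\<in>Poly_Mapping.keys P.
     evalL of_int (\<lambda>k. exp_h [:2 * of_int k:]) (Poly_Mapping.lookup P (i, j)) *
     (Q_tilde ^^ i) ((E_tilde ^^ j) x))"

definition I_Rr :: "nat \<Rightarrow> nat \<Rightarrow> (int \<Rightarrow>\<^sub>0 complex) set" where
  "I_Rr r = ideal_pow (ring_Rr r)
     (Idl\<^bsub>ring_Rr r\<^esub> {Poly_Mapping.single (int r) 1 - Poly_Mapping.single (- int r) 1})"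

definition Rr_hat :: "nat \<Rightarrow> (nat \<Rightarrow> (int \<Rightarrow>\<^sub>0 complex) set) ring" where
  "Rr_hat r = completion (ring_Rr r) (I_Rr r)"

definition to_Rr_hat :: "nat \<Rightarrow> (int \<Rightarrow>\<^sub>0 complex) \<Rightarrow> nat \<Rightarrow> (int \<Rightarrow>\<^sub>0 complex) set" where
  "to_Rr_hat r = to_completion (ring_Rr r) (I_Rr r)"

definition shift_A :: "nat \<Rightarrow> (int \<Rightarrow>\<^sub>0 complex) \<Rightarrow> int \<Rightarrow>\<^sub>0 complex" where
  "shift_A r = evalL (Poly_Mapping.single 0) (\<lambda>k. Poly_Mapping.single k (zeta r powi k))"

definition Q_bar :: "nat \<Rightarrow> (nat \<Rightarrow> (int \<Rightarrow>\<^sub>0 complex) set) \<Rightarrow> nat \<Rightarrow> (int \<Rightarrow>\<^sub>0 complex) set" where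
  "Q_bar r x = to_Rr_hat r (Poly_Mapping.single 2 1) \<otimes>\<^bsub>Rr_hat r\<^esub> x"

text \<open>
  \<open>A \<mapsto> \<zeta>A\<close> is an automorphism of \<open>R\<^sub>r\<close> preserving each \<open>I\<^sup>n\<close>, so it maps cosets onto cosets.
\<close>

definition E_bar :: "nat \<Rightarrow> (nat \<Rightarrow> (int \<Rightarrow>\<^sub>0 complex) set) \<Rightarrow> nat \<Rightarrow> (int \<Rightarrow>\<^sub>0 complex) set" where
  "E_bar r x = (\<lambda>n. shift_A r ` x n)"

definition act_Rr_hat :: "nat \<Rightarrow> qoperator \<Rightarrow> (nat \<Rightarrow> (int \<Rightarrow>\<^sub>0 complex) set) \<Rightarrow>
    nat \<Rightarrow> (int \<Rightarrow>\<^sub>0 complex) set" where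
  "act_Rr_hat r P x = (\<Oplus>\<^bsub>Rr_hat r\<^esub>e\<in>Poly_Mapping.keys P. case e of (i, j) \<Rightarrow>
     to_Rr_hat r (Poly_Mapping.single 0
       (evalL of_int (\<lambda>k. zeta r powi (2 * k)) (Poly_Mapping.lookup P (i, j))))
     \<otimes>\<^bsub>Rr_hat r\<^esub> (Q_bar r ^^ i) ((E_bar r ^^ j) x))"

end

theory Submission
  imports Defs
begin

text \<open>
  Over \<open>\<int>[q\<^sup>\<plusminus>\<^sup>1, A\<^sup>\<plusminus>\<^sup>1]\<close> there is one state sum behind all the invariants. At \<open>A = q\<^sup>n\<close> the
  term of a labelling with a label greater than \<open>n\<close> vanishes, and what remains is the colored Jones
  polynomial: the Reshetikhin-Turaev operator of the tangle commutes with \<open>E\<close>, hence is a scalar, and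
  its entry at the highest weight vector is the state sum. The unit by which the two \<open>R\<close>-matrices
  differ disappears as the writhe is zero.

  The series obtained by applying the operator to the unified invariant has coefficients that are
  polynomials in \<open>\<alpha>\<close>. They vanish at \<open>\<alpha> = n\<close> for every positive integer \<open>n\<close>, so they are zero.

  At \<open>q = \<zeta>\<close>, split every label into quotient and remainder by \<open>r\<close>. By the \<open>q\<close>-Lucas theorem and by
  conservation of the labels, the terms with remainders that produce a carry vanish and the weights
  factorize. So the state sum with increments less than \<open>r N\<close> is, up to a power of \<open>A\<^sup>r\<close>, the ADO
  invariant times a sum \<open>S\<^sub>N\<close> over the quotients. That sum is invariant under \<open>A \<mapsto> \<zeta> A\<close> (its terms have
  signs that cancel by a parity property of labellings) and takes the value \<open>1\<close> at \<open>A = 1\<close>.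
  Approaching \<open>q = \<zeta>\<close> through \<open>q = \<zeta> e\<^bsup>h/n\<^esup>\<close>, \<open>A = q\<^sup>n\<close> with \<open>2r\<close> dividing \<open>n\<close>, and interpolating in \<open>1/n\<close>,
  the recursion of the colored Jones polynomials gives \<open>S\<^sub>N\<close> times the recursion of the ADO invariant
  modulo \<open>h\<^sup>N\<close> at \<open>A = e\<^sup>h\<close>. As \<open>S\<^sub>N\<close> is a unit there, the recursion holds for the ADO invariant.
\<close>

section \<open>Evaluation homomorphisms\<close>

text \<open>Setting q = \<open>zeta r\<close> directly in the recursion of the colored Jones
  polynomials loses too much: A = q^n then takes only finitely many values. Hence the auxiliary
  variable x with q = zeta e^(x h). The coefficient of each power of h is a polynomial in x that is
  controlled at the infinitely many points x = 1/n; its value at x = 0 belongs to a Laurent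
  polynomial in A read at A = e^h, and such a polynomial is determined by its series. The sum over
  the quotients is cut off at N so that it stays a Laurent polynomial; the price is that each
  comparison holds modulo h^N only.

  The pivotal element K^(1-r) is A^(-r) K, since K^r is the scalar A^r on V. The state sum therefore
  differs from the ADO invariant by a power of A^r, and A^r changes sign under A -> zeta A. The
  recursion survives because that exponent is even up to the factor r, which is a statement about
  the turning number of a diagram with zero writhe.

  The recursion for the ADO invariant is proved between Laurent polynomials; the completion is
  reached at the end through the canonical map.\<close>

locale ringhom =
  fixes f :: "'a::comm_ring_1 \<Rightarrow> 'b::comm_ring_1"
  assumes one [simp]: "f 1 = 1"
    and add: "f (x + y) = f x + f y"
    and mult: "f (x * y) = f x * f y"
begin

lemma zero [simp]: "f 0 = 0"
  using add[of 0 0] by simp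

lemma uminus: "f (- x) = - f x"
  using add[of x "- x"] by (simp add: eq_neg_iff_add_eq_0 add.commute)

lemma diff: "f (x - y) = f x - f y"
  using add[of x "- y"] by (simp add: uminus)

lemma sum: "f (\<Sum>i\<in>I. g i) = (\<Sum>i\<in>I. f (g i))"
  by (induction I rule: infinite_finite_induct) (simp_all add: add)

lemma prod: "f (\<Prod>i\<in>I. g i) = (\<Prod>i\<in>I. f (g i))"
  by (induction I rule: infinite_finite_induct) (simp_all add: mult)

lemma power: "f (x ^ n) = f x ^ n"
  by (induction n) (simp_all add: mult)

lemma of_nat [simp]: "f (of_nat n) = of_nat n"
  by (induction n) (simp_all add: add)

lemma of_int [simp]: "f (of_int n) = of_int n"
  by (cases n) (simp_all add: uminus diff add)

end

lemma ringhom_of_int: "ringhom (of_int :: int \<Rightarrow> 'a::comm_ring_1)"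
  by unfold_locales simp_all

lemma ringhom_id: "ringhom (\<lambda>x. x)"
  by unfold_locales simp_all

lemma ringhom_single: "ringhom (Poly_Mapping.single (0::'k::comm_monoid_add) :: 'a::comm_ring_1 \<Rightarrow> _)"
  by unfold_locales (simp_all add: single_add mult_single)

lemma ringhom_comp: "ringhom f \<Longrightarrow> ringhom g \<Longrightarrow> ringhom (\<lambda>x. f (g x))"
  by (simp add: ringhom_def)

text \<open>A homomorphism from the additive monoid of exponents to the multiplicative monoid of the
  target. This is the condition under which \<open>evalL\<close> is multiplicative.\<close>

definition character :: "('k::comm_monoid_add \<Rightarrow> 'b::comm_ring_1) \<Rightarrow> bool" where
  "character m \<longleftrightarrow> m 0 = 1 \<and> (\<forall>a b. m (a + b) = m a * m b)"

lemma character_0: "character m \<Longrightarrow> m 0 = 1"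
  and character_add: "character m \<Longrightarrow> m (a + b) = m a * m b"
  by (simp_all add: character_def)

lemma character_single:
  "character (\<lambda>k. Poly_Mapping.single k (1 :: 'a::comm_ring_1))"
  by (simp add: character_def mult_single)

lemma poly_mapping_sum_single:
  fixes p :: "'k \<Rightarrow>\<^sub>0 'a::comm_monoid_add"
  shows "p = (\<Sum>k\<in>Poly_Mapping.keys p. Poly_Mapping.single k (Poly_Mapping.lookup p k))"
proof (rule poly_mapping_eqI)
  fix k
  show "Poly_Mapping.lookup p k = Poly_Mapping.lookup
      (\<Sum>k\<in>Poly_Mapping.keys p. Poly_Mapping.single k (Poly_Mapping.lookup p k)) k"
    by (simp add: lookup_sum lookup_single when_def sum.delta in_keys_iff)
qed

lemma poly_mapping_additive_induct [case_names zero single add]: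
  fixes p :: "'k \<Rightarrow>\<^sub>0 'a::comm_monoid_add"
  assumes "P 0" "\<And>k v. P (Poly_Mapping.single k v)" "\<And>p q. P p \<Longrightarrow> P q \<Longrightarrow> P (p + q)"
  shows "P p"
proof -
  have "P (\<Sum>k\<in>K. Poly_Mapping.single k (Poly_Mapping.lookup p k))" if "finite K" for K
    using that by (induction K) (auto intro: assms)
  then show ?thesis
    using poly_mapping_sum_single[of p] finite_keys[of p] by metis
qed

lemma evalL_superset:
  assumes "finite K" "Poly_Mapping.keys p \<subseteq> K" "c 0 = 0"
  shows "evalL c m p = (\<Sum>k\<in>K. c (Poly_Mapping.lookup p k) * m k)"
  unfolding evalL_def using assms by (intro sum.mono_neutral_left) (auto simp: in_keys_iff)

lemma evalL_single:
  assumes "c 0 = 0"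
  shows "evalL c m (Poly_Mapping.single k v) = c v * m k"
  using evalL_superset[of "{k}" "Poly_Mapping.single k v" c m] assms by simp

lemma evalL_add:
  assumes "ringhom c"
  shows "evalL c m (p + q) = evalL c m p + evalL c m q"
proof -
  interpret ringhom c by fact
  let ?K = "Poly_Mapping.keys p \<union> Poly_Mapping.keys q"
  have "Poly_Mapping.keys (p + q) \<subseteq> ?K" by (rule keys_add)
  then show ?thesis
    by (simp add: evalL_superset[of ?K] lookup_add add sum.distrib algebra_simps)
qed

lemma ringhom_evalL:
  fixes m :: "'k::comm_monoid_add \<Rightarrow> 'b::comm_ring_1"
  assumes c: "ringhom c" and m: "character m"
  shows "ringhom (evalL c m)"
proof -
  interpret c: ringhom c by fact
  show ?thesis
  proof
    have "evalL c m (Poly_Mapping.single 0 1) = 1"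
      by (subst evalL_single) (simp_all add: character_0[OF m])
    then show "evalL c m 1 = 1" by simp
    show "evalL c m (x + y) = evalL c m x + evalL c m y" for x y
      by (rule evalL_add[OF c])
    show "evalL c m (x * y) = evalL c m x * evalL c m y" for x y
    proof (induction x rule: poly_mapping_additive_induct)
      case zero
      then show ?case by (simp add: evalL_def)
    next
      case (add p q)
      then show ?case by (simp add: evalL_add[OF c] algebra_simps)
    next
      case (single k v)
      show ?case
      proof (induction y rule: poly_mapping_additive_induct)
        case zero
        then show ?case by (simp add: evalL_def)
      next
        case (add p q)
        then show ?case by (simp add: evalL_add[OF c] algebra_simps)
      next
        case (single l w)
        then show ?case
          by (simp add: mult_single evalL_single c.mult character_add[OF m] algebra_simps)
      qed
    qed
  qed
qed

lemma ringhom_eqI: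
  fixes f g :: "('k::comm_monoid_add \<Rightarrow>\<^sub>0 'a::comm_ring_1) \<Rightarrow> 'b::comm_ring_1"
  assumes "ringhom f" "ringhom g"
    and "\<And>k v. f (Poly_Mapping.single k v) = g (Poly_Mapping.single k v)"
  shows "f p = g p"
proof -
  interpret f: ringhom f by fact
  interpret g: ringhom g by fact
  show ?thesis
    by (induction p rule: poly_mapping_additive_induct) (simp_all add: f.add g.add assms(3))
qed

text \<open>Integer coefficients are respected by every ring homomorphism, so monomials suffice.
  Each comparison of two specializations of the state sum ends here.\<close>

lemma ringhom_int_eqI:
  fixes f g :: "('k::comm_monoid_add \<Rightarrow>\<^sub>0 int) \<Rightarrow> 'b::comm_ring_1"
  assumes f: "ringhom f" and g: "ringhom g"
    and eq: "\<And>k. f (Poly_Mapping.single k 1) = g (Poly_Mapping.single k 1)"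
  shows "f p = g p"
proof (rule ringhom_eqI[OF f g])
  interpret f: ringhom f by fact
  interpret g: ringhom g by fact
  fix k :: 'k and v :: int
  have "Poly_Mapping.single k v = of_int v * Poly_Mapping.single k (1::int)"
    using mult_single[of "0::'k" v k 1] by (simp flip: single_of_int)
  then show "f (Poly_Mapping.single k v) = g (Poly_Mapping.single k v)"
    by (simp add: f.mult g.mult eq)
qed

section \<open>Gaussian binomial coefficients\<close>

text \<open>The Gaussian binomial with w in the role of q^2, given by a Pascal recursion. It makes
  sense in every commutative ring, in particular at roots of unity, where the quotient of factorials
  becomes 0/0.\<close>

fun gauss :: "'a::comm_ring_1 \<Rightarrow> nat \<Rightarrow> nat \<Rightarrow> 'a" where
  "gauss w n 0 = 1"
| "gauss w 0 (Suc k) = 0"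
| "gauss w (Suc n) (Suc k) = gauss w n k + w ^ Suc k * gauss w n (Suc k)"

lemma gauss_eq_0: "n < k \<Longrightarrow> gauss w n k = 0"
  by (induction w n k rule: gauss.induct) auto

lemma gauss_self [simp]: "gauss w n n = 1"
  by (induction n) (simp_all add: gauss_eq_0)

lemma (in ringhom) gauss: "f (gauss w n k) = gauss (f w) n k"
  by (induction w n k rule: gauss.induct) (simp_all add: add mult power)

text \<open>The q-analogue of (k+1) C(n,k+1) = (n-k) C(n,k), without division because 1 - w^(k+1)
  may vanish.\<close>

lemma gauss_shift:
  "k \<le> n \<Longrightarrow> (1 - w ^ Suc k) * gauss w n (Suc k) = (1 - w ^ (n - k)) * gauss w n k"
proof (induction n arbitrary: k)
  case 0
  then show ?case by simp
next
  case (Suc n)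
  show ?case
  proof (cases k)
    case 0
    have "(1 - w) * gauss w n (Suc 0) = 1 - w ^ n" using Suc.IH[of 0] by simp
    then have "(1 - w) + w * ((1 - w) * gauss w n (Suc 0)) = 1 - w + w * (1 - w ^ n)"
      by simp
    then show ?thesis using 0 by (simp add: algebra_simps)
  next
    case (Suc j)
    have jn: "j \<le> n" using Suc.prems Suc by simp
    show ?thesis
    proof (cases "j = n")
      case True
      then show ?thesis using Suc by (simp add: gauss_eq_0)
    next
      case False
      then have kn: "Suc j \<le> n" using jn by simp
      let ?a = "gauss w n j" and ?b = "gauss w n (Suc j)" and ?c = "gauss w n (Suc (Suc j))"
      have 1: "(1 - w ^ Suc j) * ?b = (1 - w ^ (n - j)) * ?a" using Suc.IH[OF jn] .
      have 2: "(1 - w ^ Suc (Suc j)) * ?c = (1 - w ^ (n - Suc j)) * ?b" using Suc.IH[OF kn] .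
      have e1: "w ^ (n - j) = w * w ^ (n - Suc j)"
        using kn by (metis Suc_diff_le diff_Suc_Suc power_Suc)
      define u where "u = w ^ (n - Suc j)"
      define v where "v = w ^ Suc j"
      have "(1 - w * v) * (?b + w * v * ?c) = (1 - w * v) * ?b + w * v * ((1 - w * v) * ?c)"
        by (simp add: algebra_simps)
      also have "(1 - w * v) * ?c = (1 - u) * ?b" using 2 by (simp add: u_def v_def)
      also have "(1 - w * v) * ?b + w * v * ((1 - u) * ?b) = (1 - v) * ?b + v * ?b - w * u * v * ?b"
        by (simp add: algebra_simps)
      also have "(1 - v) * ?b = (1 - w * u) * ?a" using 1 by (simp add: u_def v_def e1)
      also have "(1 - w * u) * ?a + v * ?b - w * u * v * ?b = (1 - w * u) * (?a + v * ?b)"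
        by (simp add: algebra_simps)
      finally show ?thesis using Suc by (simp add: u_def v_def e1)
    qed
  qed
qed

text \<open>The q-analogue of (k+1) C(n+1,k+1) = (n+1) C(n,k).\<close>

lemma gauss_absorb:
  assumes "k \<le> n"
  shows "(1 - w ^ Suc k) * gauss w (Suc n) (Suc k) = (1 - w ^ Suc n) * gauss w n k"
proof -
  have e: "w ^ Suc n = w ^ Suc k * w ^ (n - k)"
    using assms by (simp flip: power_Suc power_add)
  define u where "u = w ^ (n - k)"
  define v where "v = w ^ Suc k"
  have s: "(1 - v) * gauss w n (Suc k) = (1 - u) * gauss w n k"
    using gauss_shift[OF assms, of w] by (simp only: u_def v_def)
  have "(1 - v) * (gauss w n k + v * gauss w n (Suc k)) = (1 - v * u) * gauss w n k"
  proof -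
    have "(1 - v) * (gauss w n k + v * gauss w n (Suc k))
      = (1 - v) * gauss w n k + v * ((1 - v) * gauss w n (Suc k))" by (simp add: algebra_simps)
    then show ?thesis unfolding s by (simp add: algebra_simps)
  qed
  then show ?thesis by (simp only: gauss.simps e u_def v_def)
qed

lemma gauss_Suc':
  assumes "k \<le> n"
  shows "gauss w (Suc n) (Suc k) = w ^ (n - k) * gauss w n k + gauss w n (Suc k)"
  using gauss_shift[OF assms, of w] by (simp add: algebra_simps)

text \<open>The q-Pochhammer symbol (w;w)_n, playing the part of a factorial.\<close>

definition qpoch :: "'a::comm_ring_1 \<Rightarrow> nat \<Rightarrow> 'a" where
  "qpoch w n = (\<Prod>i=1..n. 1 - w ^ i)"

lemma qpoch_Suc: "qpoch w (Suc n) = qpoch w n * (1 - w ^ Suc n)"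
  by (simp add: qpoch_def)

lemma gauss_qpoch: "k \<le> n \<Longrightarrow> gauss w n k * (qpoch w k * qpoch w (n - k)) = qpoch w n"
proof (induction k arbitrary: n)
  case 0
  then show ?case by (simp add: qpoch_def)
next
  case (Suc k)
  then obtain m where n: "n = Suc m" and km: "k \<le> m" by (cases n) auto
  have "gauss w n (Suc k) * (qpoch w (Suc k) * qpoch w (n - Suc k))
      = ((1 - w ^ Suc k) * gauss w (Suc m) (Suc k)) * (qpoch w k * qpoch w (m - k))"
    unfolding n qpoch_Suc[of w k] diff_Suc_Suc by (simp only: ac_simps)
  also have "\<dots> = (1 - w ^ Suc m) * (gauss w m k * (qpoch w k * qpoch w (m - k)))"
    unfolding gauss_absorb[OF km] by (simp only: ac_simps)
  also have "\<dots> = qpoch w n" unfolding Suc.IH[OF km] n qpoch_Suc by (simp only: ac_simps)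
  finally show ?case .
qed

text \<open>The Pascal rule turns each summand into a difference \<open>t (Suc m) - t m\<close>, so
  the sum telescopes to a Gaussian binomial below the diagonal, which is 0. This identity makes the
  R-matrix invertible.\<close>

lemma gauss_alternating_sum:
  "(\<Sum>m\<le>Suc M. (-1) ^ m * w ^ (m * (m - 1) div 2) * gauss w (Suc M) m) = 0"
proof -
  define t where "t m = (-1) ^ m * w ^ (m * (m - 1) div 2 + m) * gauss w M m" for m
  have tri: "Suc m * (Suc m - 1) div 2 = m * (m - 1) div 2 + m" for m :: nat
    by (cases m) (simp_all add: algebra_simps flip: div_add1_eq)
  have step: "(-1) ^ Suc m * w ^ (Suc m * (Suc m - 1) div 2) * gauss w (Suc M) (Suc m)
      = t (Suc m) - t m" for m
    unfolding tri t_def gauss.simps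
    by (simp add: algebra_simps power_add)
  have "(\<Sum>m\<le>k. (-1) ^ m * w ^ (m * (m - 1) div 2) * gauss w (Suc M) m) = t k" for k
  proof (induction k)
    case 0
    then show ?case by (simp add: t_def)
  next
    case (Suc k)
    then show ?case using step[of k] by simp
  qed
  then show ?thesis by (simp add: t_def gauss_eq_0)
qed

text \<open>Both sides are the same quotient of factorials. Cancelling the factorials requires a
  domain in which w is not a root of unity; the identity is transported from there to other
  rings.\<close>

lemma gauss_product:
  fixes w :: "'a::idom"
  assumes w: "\<And>i. i \<ge> 1 \<Longrightarrow> w ^ i \<noteq> 1" and m: "m \<le> M"
  shows "gauss w (y + m) m * gauss w (y + M) (M - m) = gauss w (y + M) M * gauss w M m"
proof -
  have nz: "qpoch w n \<noteq> 0" for n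
    using w by (auto simp: qpoch_def)
  have 1: "gauss w (y + m) m * (qpoch w m * qpoch w y) = qpoch w (y + m)"
    using gauss_qpoch[of m "y + m" w] by simp
  have 2: "gauss w (y + M) (M - m) * (qpoch w (M - m) * qpoch w (y + m)) = qpoch w (y + M)"
    using gauss_qpoch[of "M - m" "y + M" w] m by simp
  have 3: "gauss w (y + M) M * (qpoch w M * qpoch w y) = qpoch w (y + M)"
    using gauss_qpoch[of M "y + M" w] by simp
  have 4: "gauss w M m * (qpoch w m * qpoch w (M - m)) = qpoch w M"
    using gauss_qpoch[of m M w] m by simp
  let ?c = "qpoch w m * qpoch w y * qpoch w (M - m)"
  have "?c * (gauss w (y + m) m * gauss w (y + M) (M - m))
      = gauss w (y + M) (M - m) * (qpoch w (M - m) * (gauss w (y + m) m * (qpoch w m * qpoch w y)))"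
    by (simp only: ac_simps)
  also have "\<dots> = gauss w (y + M) M * (qpoch w M * qpoch w y)" unfolding 1 2 3 ..
  also have "\<dots> = ?c * (gauss w (y + M) M * gauss w M m)"
    by (simp only: ac_simps flip: 4)
  finally show ?thesis using nz by (metis mult_cancel_left mult_eq_0_iff)
qed

text \<open>The power of q converts the symmetric normalization into the polynomial one.
  Nonvanishing is assumed up to n only, so that the lemma also applies at \<open>zeta r\<close> for
  n < r.\<close>

lemma qbinom_eq_gauss:
  fixes q :: "'a::field"
  assumes q: "q \<noteq> 0" and n: "\<And>i. 1 \<le> i \<Longrightarrow> i \<le> n \<Longrightarrow> (q^2) ^ i \<noteq> 1" and k: "k \<le> n"
  shows "qbinom q n k = q powi (- int (k * (n - k))) * gauss (q^2) n k"
proof -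
  have brace: "qbrace q i = - (q powi (- int i)) * (1 - (q^2) ^ i)" for i
    using q by (simp add: qbrace_def algebra_simps power_int_minus flip: power_mult)
       (simp add: field_simps power_mult power2_eq_square)
  have qi: "qint q i \<noteq> 0" if "1 \<le> i" "i \<le> n" for i
    using n[OF that] n[of 1] that q unfolding qint_def brace by auto
  have qf: "qfact q i \<noteq> 0" if "i \<le> n" for i
    using qi that by (auto simp: qfact_def)
  have ratio: "qint q (Suc a) / qint q (Suc b)
      = q powi (int b - int a) * ((1 - (q^2) ^ Suc a) / (1 - (q^2) ^ Suc b))"
    if "Suc a \<le> n" "Suc b \<le> n" for a b
  proof -
    have b1: "qbrace q 1 \<noteq> 0" using n[of 1] that q unfolding brace by auto
    have "q powi (- int (Suc a)) = q powi (int b - int a) * q powi (- int (Suc b))"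
      using q by (simp flip: power_int_add add: algebra_simps)
    moreover have "(- x * u / e) / (- y * v / e) = c * (u / v)"
      if "x = c * y" "y \<noteq> 0" "e \<noteq> 0" for x y c u v e :: 'a
      using that by (cases "v = 0") (simp_all add: field_simps)
    ultimately show ?thesis
      using b1 q unfolding qint_def brace[of "Suc a"] brace[of "Suc b"] by simp
  qed
  have "k \<le> m \<Longrightarrow> m \<le> n \<Longrightarrow> qbinom q m k = q powi (- int (k * (m - k))) * gauss (q^2) m k" for m
  proof (induction k arbitrary: m)
    case 0
    then show ?case using qf[of m] by (simp add: qbinom_def qfact_def)
  next
    case (Suc k)
    then obtain j where m: "m = Suc j" and kj: "k \<le> j" by (cases m) auto
    have wk: "1 - (q^2) ^ Suc k \<noteq> 0" using n[of "Suc k"] Suc.prems by simp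
    have "qbinom q m (Suc k) = (qint q (Suc j) / qint q (Suc k)) * qbinom q j k"
      unfolding m qbinom_def by (simp add: qfact_def mult.commute mult.left_commute)
    also have "\<dots> = q powi (int k - int j) * ((1 - (q^2) ^ Suc j) / (1 - (q^2) ^ Suc k)) *
        (q powi (- int (k * (j - k))) * gauss (q^2) j k)"
      using Suc.prems kj by (subst ratio) (simp_all add: m Suc.IH)
    also have "\<dots> = (q powi (int k - int j) * q powi (- int (k * (j - k)))) *
        (((1 - (q^2) ^ Suc j) * gauss (q^2) j k) / (1 - (q^2) ^ Suc k))"
      by simp
    also have "((1 - (q^2) ^ Suc j) * gauss (q^2) j k) / (1 - (q^2) ^ Suc k)
        = gauss (q^2) (Suc j) (Suc k)"
      unfolding gauss_absorb[OF kj, of "q^2", symmetric] using wk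
      by (rule nonzero_mult_div_cancel_left)
    also have "q powi (int k - int j) * q powi (- int (k * (j - k)))
        = q powi (- int (Suc k * (m - Suc k)))"
    proof -
      from kj obtain d where "j = k + d" by (auto simp: le_iff_add)
      then have "(int k - int j) + - int (k * (j - k)) = - int (Suc k * (m - Suc k))"
        by (simp add: m algebra_simps)
      then show ?thesis using power_int_add[of q] q by metis
    qed
    finally show ?case by (simp only: m)
  qed
  then show ?thesis using k by simp
qed

section \<open>Laurent polynomials as elements of the fraction field\<close>

lemma sqrt_q_nz [simp]: "sqrt_q \<noteq> 0"
  by (simp add: sqrt_q_def Zero_fract_def eq_fract)

lemma q_gen_nz [simp]: "q_gen \<noteq> 0"
  by (simp add: q_gen_def)

lemma character_powi:
  fixes q :: "'a::field"
  shows "q \<noteq> 0 \<Longrightarrow> character (\<lambda>k. q powi k)"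
  by (simp add: character_def power_int_add)

lemma ringhom_laurent_to_field: "ringhom laurent_to_field"
  unfolding laurent_to_field_def
  by (intro ringhom_evalL ringhom_of_int character_powi q_gen_nz)

lemma Fract_monom: "Fract (monom c n) 1 = of_int c * sqrt_q ^ n"
proof -
  have "sqrt_q ^ n = Fract (monom 1 n) 1"
    by (induction n) (simp_all add: sqrt_q_def One_fract_def mult_fract monom_Suc)
  moreover have "of_nat k = Fract (of_nat k :: int poly) 1" for k
    by (induction k) (simp_all add: One_fract_def Zero_fract_def)
  then have "of_int c = Fract (of_int c :: int poly) 1"
    by (cases c) (simp_all del: of_nat_Suc)
  ultimately show ?thesis
    by (simp add: of_int_poly smult_monom)
qed

lemma Fract_sum: "Fract (\<Sum>i\<in>I. g i) 1 = (\<Sum>i\<in>I. Fract (g i) (1::'a::idom))"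
proof (induction I rule: infinite_finite_induct)
  case (insert x F)
  then show ?case using add_fract[of 1 1 "g x" "sum g F"] by simp
qed (simp_all add: Zero_fract_def)

text \<open>Multiplication by a power of q that exceeds every exponent in absolute value turns the
  image into the fraction of an honest polynomial P in s. Its exponents are doubled, since q = s^2,
  and its coefficients are those of p.\<close>

lemma laurent_to_field_eq_0:
  assumes "laurent_to_field p = 0"
  shows "p = 0"
proof (rule poly_mapping_eqI)
  fix k0
  define N where "N = (\<Sum>k\<in>Poly_Mapping.keys p. nat \<bar>k\<bar>)"
  have N: "k + int N \<ge> 0" if "k \<in> Poly_Mapping.keys p" for k
  proof -
    have "nat \<bar>k\<bar> \<le> N" unfolding N_def by (rule member_le_sum[OF that]) auto
    then show ?thesis by linarith
  qed
  define P where "P = (\<Sum>k\<in>Poly_Mapping.keys p.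
    monom (Poly_Mapping.lookup p k) (nat (2 * (k + int N))))"
  have "Fract P 1 = (\<Sum>k\<in>Poly_Mapping.keys p.
      of_int (Poly_Mapping.lookup p k) * sqrt_q ^ nat (2 * (k + int N)))"
    by (simp add: P_def Fract_sum Fract_monom)
  also have "\<dots> = (\<Sum>k\<in>Poly_Mapping.keys p.
      of_int (Poly_Mapping.lookup p k) * (q_gen powi k * q_gen powi int N))"
  proof (intro sum.cong refl)
    fix k assume k: "k \<in> Poly_Mapping.keys p"
    have "sqrt_q ^ nat (2 * (k + int N)) = q_gen powi (k + int N)"
      using N[OF k] by (simp add: q_gen_def power_int_def nat_mult_distrib power_mult
          del: distrib_left_numeral)
    then show "of_int (Poly_Mapping.lookup p k) * sqrt_q ^ nat (2 * (k + int N)) =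
      of_int (Poly_Mapping.lookup p k) * (q_gen powi k * q_gen powi int N)"
      by (simp add: power_int_add)
  qed
  also have "\<dots> = laurent_to_field p * q_gen powi int N"
    by (simp add: laurent_to_field_def evalL_def sum_distrib_right mult.assoc)
  also have "\<dots> = 0" using assms by simp
  finally have "P = 0" by (simp add: Zero_fract_def eq_fract)
  show "Poly_Mapping.lookup p k0 = Poly_Mapping.lookup 0 k0"
  proof (cases "k0 \<in> Poly_Mapping.keys p")
    case True
    have "coeff P (nat (2 * (k0 + int N))) = (\<Sum>k\<in>Poly_Mapping.keys p.
        if k = k0 then Poly_Mapping.lookup p k else 0)"
      unfolding P_def coeff_sum
    proof (intro sum.cong refl)
      fix k assume "k \<in> Poly_Mapping.keys p"
      from N[OF this] N[OF True]
      show "coeff (monom (Poly_Mapping.lookup p k) (nat (2 * (k + int N)))) (nat (2 * (k0 + int N)))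
        = (if k = k0 then Poly_Mapping.lookup p k else 0)"
        by (auto simp: nat_eq_iff2)
    qed
    then show ?thesis using True \<open>P = 0\<close> by simp
  qed (simp add: in_keys_iff)
qed

lemma laurent_to_field_inj: "laurent_to_field p = laurent_to_field p' \<longleftrightarrow> p = p'"
proof -
  interpret ringhom laurent_to_field by (rule ringhom_laurent_to_field)
  show ?thesis
    using laurent_to_field_eq_0[of "p - p'"] by (auto simp: diff)
qed

lemma field_to_laurent [simp]: "field_to_laurent (laurent_to_field p) = p"
  unfolding field_to_laurent_def by (rule the_equality) (simp_all add: laurent_to_field_inj)

lemma laurent_to_field_single: "laurent_to_field (Poly_Mapping.single k 1) = q_gen powi k"
  by (simp add: laurent_to_field_def evalL_single)

lemma single_power: "Poly_Mapping.single k (1::'a::comm_ring_1) ^ n = Poly_Mapping.single (of_nat n * k) 1"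
  for k :: "'k::comm_ring_1"
  by (induction n) (simp_all add: mult_single algebra_simps)

lemma q_gen_power_neq_1: "i \<ge> 1 \<Longrightarrow> (q_gen^2) ^ i \<noteq> 1"
proof
  assume i: "i \<ge> 1" and "(q_gen^2) ^ i = 1"
  then have "laurent_to_field (Poly_Mapping.single (int (2 * i)) 1) = laurent_to_field 1"
    using ringhom.one[OF ringhom_laurent_to_field]
    by (simp only: laurent_to_field_single power_int_of_nat power_mult)
  then have "Poly_Mapping.single (int (2 * i)) (1::int) = Poly_Mapping.single 0 1"
    by (simp add: laurent_to_field_inj)
  then have "Poly_Mapping.lookup (Poly_Mapping.single (int (2 * i)) (1::int)) 0 =
    Poly_Mapping.lookup (Poly_Mapping.single (0::int) (1::int)) 0" by (simp only:)
  then show False using i by (simp add: lookup_single)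
qed

text \<open>An explicit preimage of the quantum binomial in the Laurent polynomials. It shows that
  \<open>field_to_laurent\<close> is applied to an element of its proper domain in
  \<open>qbinom_R\<close>.\<close>

definition qbinom_laurent :: "nat \<Rightarrow> nat \<Rightarrow> laurent_q" where
  "qbinom_laurent n k =
     Poly_Mapping.single (- int (k * (n - k))) 1 * gauss (Poly_Mapping.single 2 1) n k"

lemma laurent_to_field_qbinom:
  "k \<le> n \<Longrightarrow> laurent_to_field (qbinom_laurent n k) = qbinom q_gen n k"
proof -
  interpret ringhom laurent_to_field by (rule ringhom_laurent_to_field)
  assume "k \<le> n"
  then show ?thesis
    by (subst qbinom_eq_gauss)
      (simp_all add: q_gen_power_neq_1 qbinom_laurent_def mult gauss laurent_to_field_single)
qed

lemma character_comp_left: "character m \<Longrightarrow> character (\<lambda>j. m (j, 0::int))"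
  unfolding character_def zero_prod_def by (metis add_Pair add_0)

lemma qbinom_R_eq:
  assumes "k \<le> n"
  shows "qbinom_R n k = qA (- int (k * (n - k))) 0 * gauss (qA 2 0) n k"
proof -
  have m: "character (\<lambda>j::int. Poly_Mapping.single (j, 0::int) (1::int))"
    by (rule character_comp_left[OF character_single])
  interpret ringhom "evalL of_int (\<lambda>j::int. Poly_Mapping.single (j, 0::int) (1::int))"
    by (rule ringhom_evalL[OF ringhom_of_int m])
  have "qbinom_R n k = evalL of_int (\<lambda>j. Poly_Mapping.single (j, 0) 1) (qbinom_laurent n k)"
    unfolding qbinom_R_def laurent_to_field_qbinom[OF assms, symmetric] by simp
  then show ?thesis
    by (simp add: qbinom_laurent_def mult gauss evalL_single qA_def)
qed

section \<open>Traversing a knot diagram\<close>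

lemma orient_0 [simp]: "orient D 0 = [Up]"
  by (simp add: orient_def)

lemma orient_Suc: "t < length D \<Longrightarrow> orient D (Suc t) = layer_orient (D ! t) (orient D t)"
  by (simp add: orient_def take_Suc_conv_app_nth)

lemma tangle_layerE:
  assumes "tangle_1_1 D" "t < length D" "D ! t = (p, P)"
  obtains us vs where "orient D t = us @ below P @ vs" "orient D (Suc t) = us @ above P @ vs"
    "length us = p"
proof
  have *: "p + n_in P \<le> length (orient D t)" "take (n_in P) (drop p (orient D t)) = below P"
    using assms(1)[unfolded tangle_1_1_def, THEN conjunct1, rule_format, OF assms(2)]
    by (simp_all add: assms(3))
  have "orient D t = take p (orient D t) @ take (n_in P) (drop p (orient D t)) @
      drop (n_in P) (drop p (orient D t))"
    by (metis append_take_drop_id)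
  then show "orient D t = take p (orient D t) @ below P @ drop (p + n_in P) (orient D t)"
    unfolding *(2) drop_drop by (simp only: add.commute)
  show "orient D (Suc t) = take p (orient D t) @ above P @ drop (p + n_in P) (orient D t)"
    using assms by (simp add: orient_Suc)
  show "length (take p (orient D t)) = p" using * by simp
qed

lemma tangle_layer_nth:
  assumes "tangle_1_1 D" "t < length D" "D ! t = (p, P)"
  shows "i < n_in P \<Longrightarrow> p + i < length (orient D t) \<and> orient D t ! (p + i) = below P ! i"
    and "i < n_out P \<Longrightarrow> p + i < length (orient D (Suc t)) \<and> orient D (Suc t) ! (p + i) = above P ! i"
proof -
  obtain us vs where *: "orient D t = us @ below P @ vs" "orient D (Suc t) = us @ above P @ vs"
    "length us = p" using tangle_layerE[OF assms] .
  show "i < n_in P \<Longrightarrow> p + i < length (orient D t) \<and> orient D t ! (p + i) = below P ! i"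
    "i < n_out P \<Longrightarrow> p + i < length (orient D (Suc t)) \<and> orient D (Suc t) ! (p + i) = above P ! i"
    using * by (simp_all add: nth_append)
qed

lemma strand_upper:
  assumes "tangle_1_1 D" "t < length D" "(j, k) \<in> strands (D ! t)" "j < length (orient D t)"
  shows "k < length (orient D (Suc t))" "orient D (Suc t) ! k = orient D t ! j"
proof -
  obtain p P where pP: "D ! t = (p, P)" by fastforce
  obtain us vs where *: "orient D t = us @ below P @ vs" "orient D (Suc t) = us @ above P @ vs"
    "length us = p" using tangle_layerE[OF assms(1,2) pP] .
  show "k < length (orient D (Suc t))" "orient D (Suc t) ! k = orient D t ! j"
    using assms(3,4) * by (cases P; auto simp: pP nth_append)+
qed

lemma strand_unique_upper:
  "(j, k) \<in> strands l \<Longrightarrow> (j, k') \<in> strands l \<Longrightarrow> k = k'"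
  by (cases l; cases "snd l") auto

lemma strand_unique_lower:
  "(j, k) \<in> strands l \<Longrightarrow> (j', k) \<in> strands l \<Longrightarrow> j = j'"
  by (cases l; cases "snd l") auto

text \<open>The orientation at a point decides whether the strand goes on through the layer above it
  or the layer below it. Sorting the steps by their source in this way makes the relation visibly
  deterministic.\<close>

lemma follows_cases:
  assumes tg: "tangle_1_1 D" and f: "follows D x y"
  shows "(\<exists>t j. x = (t, j) \<and> t < length D \<and> j < length (orient D t) \<and> orient D t ! j = Up \<and>
      ((\<exists>k. y = (Suc t, k) \<and> (j, k) \<in> strands (D ! t)) \<or>
       (D ! t = (j, CapLR) \<and> y = (t, j + 1)) \<or>
       (\<exists>p. D ! t = (p, CapRL) \<and> j = p + 1 \<and> y = (t, p)))) \<or>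
    (\<exists>t k. x = (Suc t, k) \<and> t < length D \<and> k < length (orient D (Suc t)) \<and>
      orient D (Suc t) ! k = Down \<and>
      ((\<exists>j. y = (t, j) \<and> (j, k) \<in> strands (D ! t)) \<or>
       (D ! t = (k, CupLR) \<and> y = (Suc t, k + 1)) \<or>
       (\<exists>p. D ! t = (p, CupRL) \<and> k = p + 1 \<and> y = (Suc t, p))))"
  using f
proof cases
  case (up t j k)
  then show ?thesis by auto
next
  case (down t j k)
  then show ?thesis using strand_upper[OF tg down(3-5)] by auto
next
  case (cap_lr t p)
  then show ?thesis using tangle_layer_nth(1)[OF tg cap_lr(3,4), of 0]
      tangle_layer_nth(1)[OF tg cap_lr(3,4), of 1] by auto
next
  case (cap_rl t p)
  then show ?thesis using tangle_layer_nth(1)[OF tg cap_rl(3,4), of 0]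
      tangle_layer_nth(1)[OF tg cap_rl(3,4), of 1] by auto
next
  case (cup_lr t p)
  then show ?thesis using tangle_layer_nth(2)[OF tg cup_lr(3,4), of 0]
      tangle_layer_nth(2)[OF tg cup_lr(3,4), of 1] by auto
next
  case (cup_rl t p)
  then show ?thesis using tangle_layer_nth(2)[OF tg cup_rl(3,4), of 0]
      tangle_layer_nth(2)[OF tg cup_rl(3,4), of 1] by auto
qed

lemma follows_functional:
  assumes tg: "tangle_1_1 D" and "follows D x y" "follows D x z"
  shows "y = z"
  using follows_cases[OF tg assms(2)] follows_cases[OF tg assms(3)]
  by (auto dest: strand_unique_upper strand_unique_lower)

lemma follows_terminal:
  assumes tg: "tangle_1_1 D"
  shows "\<not> follows D (length D, 0) y"
proof
  assume "follows D (length D, 0) y"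
  moreover have "orient D (length D) ! 0 = Up" using tg by (simp add: tangle_1_1_def)
  ultimately show False using follows_cases[OF tg] by fastforce
qed

lemma follows_valid:
  assumes tg: "tangle_1_1 D" and f: "follows D x (t, k)"
  shows "t \<le> length D \<and> k < length (orient D t)"
  using f
proof cases
  case (up t' j)
  then show ?thesis using strand_upper[OF tg up(3-5)] by auto
next
  case (cap_lr p)
  then show ?thesis using tangle_layer_nth(1)[OF tg cap_lr(3,4), of 0]
      tangle_layer_nth(1)[OF tg cap_lr(3,4), of 1] by auto
next
  case (cap_rl)
  then show ?thesis using tangle_layer_nth(1)[OF tg cap_rl(2,3), of 0]
      tangle_layer_nth(1)[OF tg cap_rl(2,3), of 1] by auto
next
  case (cup_lr t p)
  then show ?thesis using tangle_layer_nth(2)[OF tg cup_lr(4,5), of 0]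
      tangle_layer_nth(2)[OF tg cup_lr(4,5), of 1] by auto
next
  case (cup_rl t)
  then show ?thesis using tangle_layer_nth(2)[OF tg cup_rl(3,4), of 0]
      tangle_layer_nth(2)[OF tg cup_rl(3,4), of 1] by auto
qed auto

lemma relpowp_functional:
  fixes R :: "'a \<Rightarrow> 'a \<Rightarrow> bool"
  assumes "\<And>x y z. R x y \<Longrightarrow> R x z \<Longrightarrow> y = z" "(R ^^ n) x y" "(R ^^ n) x z"
  shows "y = z"
  using assms(2,3)
proof (induction n arbitrary: y z)
  case (Suc n)
  from Suc.prems obtain u v where "(R ^^ n) x u" "R u y" "(R ^^ n) x v" "R v z"
    by (auto elim!: relpowp_Suc_E)
  with Suc.IH[of u v] assms(1)[of u y z] show ?case by simp
qed simp

locale knot_tangle =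
  fixes D :: diagram
  assumes knot: "knot_diagram D"
begin

lemma tangle: "tangle_1_1 D"
  using knot by (simp add: knot_diagram_def)

definition point :: "nat \<times> nat \<Rightarrow> bool" where
  "point x \<longleftrightarrow> fst x \<le> length D \<and> snd x < length (orient D (fst x))"

lemma reachable: "point x \<Longrightarrow> (follows D)\<^sup>*\<^sup>* (0, 0) x"
  using knot by (cases x) (auto simp: knot_diagram_def point_def)

text \<open>This is how the hypothesis of a single component is used: a property is carried along
  the open strand from its bottom end to all points of the diagram.\<close>

lemma point_induct [consumes 1, case_names start step]:
  assumes "point x" "P (0, 0)"
    "\<And>x y. point x \<Longrightarrow> point y \<Longrightarrow> follows D x y \<Longrightarrow> P x \<Longrightarrow> P y"
  shows "P x"
proof -
  have "point x \<and> P x"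
    using reachable[OF assms(1)]
  proof (induction rule: rtranclp_induct)
    case base
    then show ?case using assms(2) by (simp add: point_def)
  next
    case (step y z)
    then show ?case
      using assms(3)[of y z] follows_valid[OF tangle, of y "fst z" "snd z"]
      by (auto simp: point_def)
  qed
  then show ?thesis ..
qed

text \<open>The choice is harmless: the walk along the strand is deterministic, and
  \<open>walk_length_unique\<close> leaves only one possible length.\<close>

definition time :: "nat \<times> nat \<Rightarrow> nat" where
  "time x = (SOME n. (follows D ^^ n) (0, 0) x)"

lemma time: "point x \<Longrightarrow> (follows D ^^ time x) (0, 0) x"
  unfolding time_def using reachable[of x] by (metis rtranclp_imp_relpowp someI_ex)

lemma walk_functional:
  "(follows D ^^ n) x y \<Longrightarrow> (follows D ^^ n) x z \<Longrightarrow> y = z"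
  by (rule relpowp_functional[where R = "follows D"]) (rule follows_functional[OF tangle])

lemma time_inj: "point x \<Longrightarrow> point y \<Longrightarrow> time x = time y \<Longrightarrow> x = y"
  using time[of x] time[of y] by (auto intro: walk_functional)

text \<open>A longer walk would pass through the top end by determinism, and the top end has no
  successor.\<close>

lemma walk_bounded:
  assumes "(follows D ^^ n) (0, 0) x"
  shows "n \<le> time (length D, 0)"
proof (rule ccontr)
  let ?e = "(length D, 0)"
  assume "\<not> n \<le> time ?e"
  then obtain m where n: "n = time ?e + Suc m" by (metis add_Suc_right less_imp_Suc_add linorder_not_le)
  have e: "point ?e" using tangle by (simp add: point_def tangle_1_1_def)
  from assms obtain y where y: "(follows D ^^ time ?e) (0, 0) y" "(follows D ^^ Suc m) y x"
    unfolding n relpowp_add by blast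
  have "y = ?e" using walk_functional[OF y(1) time[OF e]] .
  moreover obtain z where "follows D y z" using relpowp_Suc_D2[OF y(2)] by blast
  ultimately show False using follows_terminal[OF tangle] by blast
qed

text \<open>Two lengths would give a closed walk at x; running through it repeatedly contradicts
  \<open>walk_bounded\<close>.\<close>

lemma walk_length_unique:
  assumes "(follows D ^^ n) (0, 0) x" "(follows D ^^ (n + d)) (0, 0) x"
  shows "d = 0"
proof (rule ccontr)
  assume d: "d \<noteq> 0"
  from assms(2) obtain y where "(follows D ^^ n) (0, 0) y" "(follows D ^^ d) y x"
    unfolding relpowp_add by blast
  then have cyc: "(follows D ^^ d) x x"
    using walk_functional[OF assms(1), of y] by blast
  have "(follows D ^^ (n + d * k)) (0, 0) x" for k
  proof (induction k)
    case (Suc k)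
    have "(follows D ^^ ((n + d * k) + d)) (0, 0) x"
      unfolding relpowp_add[of "n + d * k" d] using Suc cyc by blast
    then show ?case by (simp add: algebra_simps)
  qed (use assms in simp)
  from walk_bounded[OF this[of "Suc (time (length D, 0))"]] d show False
    by (cases d) auto
qed

lemma time_eq: "(follows D ^^ n) (0, 0) x \<Longrightarrow> point x \<Longrightarrow> time x = n"
  using walk_length_unique[of n x] walk_length_unique[of "time x" x] time[of x]
  by (metis le_add_diff_inverse nat_le_linear add.right_neutral)

lemma time_follows:
  assumes "point x" "point y" "follows D x y"
  shows "time y = Suc (time x)"
  using time[OF assms(1)] assms(3) by (intro time_eq) (auto simp: assms(2) intro: relpowp_Suc_I)

end

section \<open>The turning number of a zero-framed diagram is even\<close>

definition piece_count :: "diagram \<Rightarrow> piece \<Rightarrow> nat" where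
  "piece_count D P = card {t. t < length D \<and> snd (D ! t) = P}"

lemma piece_count_eq_sum: "piece_count D P = (\<Sum>t<length D. if snd (D ! t) = P then 1 else 0)"
proof -
  have "{t. t < length D \<and> snd (D ! t) = P} = {..<length D} \<inter> {t. snd (D ! t) = P}" by auto
  then show ?thesis by (simp add: piece_count_def sum.If_cases)
qed

lemma writhe_eq_piece_count: "writhe D = int (piece_count D PosX) - int (piece_count D NegX)"
  by (simp add: writhe_def piece_count_def length_filter_conv_card case_prod_unfold)

lemma prod_pieces:
  fixes f :: "piece \<Rightarrow> 'a::comm_ring_1"
  shows "(\<Prod>t<length D. f (snd (D ! t))) =
    f PosX ^ piece_count D PosX * f NegX ^ piece_count D NegX *
    f CapLR ^ piece_count D CapLR * f CapRL ^ piece_count D CapRL *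
    f CupLR ^ piece_count D CupLR * f CupRL ^ piece_count D CupRL"
proof -
  have *: "(\<Prod>t<length D. if snd (D ! t) = P then f P else 1) = f P ^ piece_count D P" for P
    by (simp add: piece_count_eq_sum power_sum if_distrib[of "\<lambda>n. f P ^ n"] cong: if_cong)
  have "f (snd (D ! t)) =
      (if snd (D ! t) = PosX then f PosX else 1) * (if snd (D ! t) = NegX then f NegX else 1) *
      (if snd (D ! t) = CapLR then f CapLR else 1) * (if snd (D ! t) = CapRL then f CapRL else 1) *
      (if snd (D ! t) = CupLR then f CupLR else 1) * (if snd (D ! t) = CupRL then f CupRL else 1)" for t
    by (cases "snd (D ! t)") auto
  then have "(\<Prod>t<length D. f (snd (D ! t))) = (\<Prod>t<length D.
      (if snd (D ! t) = PosX then f PosX else 1) * (if snd (D ! t) = NegX then f NegX else 1) *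
      (if snd (D ! t) = CapLR then f CapLR else 1) * (if snd (D ! t) = CapRL then f CapRL else 1) *
      (if snd (D ! t) = CupLR then f CupLR else 1) * (if snd (D ! t) = CupRL then f CupRL else 1))"
    by (rule prod.cong[OF refl])
  then show ?thesis by (simp only: prod.distrib *)
qed

section \<open>Inversion numbers of lists modulo 2\<close>

fun inversions :: "('a \<Rightarrow> 'a \<Rightarrow> bool) \<Rightarrow> 'a list \<Rightarrow> nat" where
  "inversions R [] = 0"
| "inversions R (x # xs) = length (filter (R x) xs) + inversions R xs"

definition cross_inversions :: "('a \<Rightarrow> 'a \<Rightarrow> bool) \<Rightarrow> 'a list \<Rightarrow> 'a list \<Rightarrow> nat" where
  "cross_inversions R xs ys = (\<Sum>x\<leftarrow>xs. length (filter (R x) ys))"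

lemma inversions_append:
  "inversions R (xs @ ys) = inversions R xs + inversions R ys + cross_inversions R xs ys"
  by (induction xs) (simp_all add: cross_inversions_def)

lemma cross_inversions_append:
  "cross_inversions R (xs @ xs') ys = cross_inversions R xs ys + cross_inversions R xs' ys"
  "cross_inversions R xs (ys @ ys') = cross_inversions R xs ys + cross_inversions R xs ys'"
  by (simp_all add: cross_inversions_def sum_list_addf)

lemma cross_inversions_cong:
  assumes "\<And>x y. x \<in> set xs \<Longrightarrow> y \<in> set ys \<Longrightarrow> R (f x) (g y) \<longleftrightarrow> R x y"
  shows "cross_inversions R (map f xs) (map g ys) = cross_inversions R xs ys"
proof -
  have "length (filter (R (f x)) (map g ys)) = length (filter (R x) ys)" if "x \<in> set xs" for x
    using assms[OF that] by (simp add: filter_map comp_def cong: filter_cong)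
  then show ?thesis by (simp add: cross_inversions_def comp_def cong: map_cong)
qed

lemma inversions_cong:
  assumes "\<And>x y. x \<in> set xs \<Longrightarrow> y \<in> set xs \<Longrightarrow> x \<noteq> y \<Longrightarrow> R (f x) (f y) \<longleftrightarrow> R x y" "distinct xs"
  shows "inversions R (map f xs) = inversions R xs"
  using assms
proof (induction xs)
  case (Cons x xs)
  have "R (f x) (f y) \<longleftrightarrow> R x y" if "y \<in> set xs" for y
    using Cons.prems that by auto
  then have "length (filter (R (f x)) (map f xs)) = length (filter (R x) xs)"
    by (simp add: filter_map comp_def cong: filter_cong)
  then show ?case using Cons by simp
qed simp

lemma cross_inversions_even_left:
  assumes "\<And>u. u \<in> set us \<Longrightarrow> R u x \<longleftrightarrow> R u y"
  shows "even (cross_inversions R us [x, y])"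
  using assms by (induction us) (auto simp: cross_inversions_def)

lemma cross_inversions_even_right:
  assumes "\<And>u. u \<in> set us \<Longrightarrow> R x u \<longleftrightarrow> R y u"
  shows "even (cross_inversions R [x, y] us)"
proof -
  have "filter (R x) us = filter (R y) us" using assms by (simp cong: filter_cong)
  then show ?thesis by (simp add: cross_inversions_def)
qed

text \<open>An adjacent transposition changes the number of inversions by one. The map f renames the
  entries, from the points below a crossing to those above, without changing their order.\<close>

lemma inversions_swap:
  assumes f: "\<And>u v. u \<in> set (us @ [x, y] @ vs) \<Longrightarrow> v \<in> set (us @ [x, y] @ vs) \<Longrightarrow> u \<noteq> v \<Longrightarrow>
      R (f u) (f v) \<longleftrightarrow> R u v"
    and dist: "distinct (us @ [x, y] @ vs)" and xy: "R x y \<longleftrightarrow> \<not> R y x"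
  shows "even (inversions R (us @ [x, y] @ vs) + inversions R (map f us @ [f y, f x] @ map f vs)) = False"
proof -
  have 1: "inversions R (map f us) = inversions R us" "inversions R (map f vs) = inversions R vs"
    using f dist by (intro inversions_cong; auto)+
  have swap: "cross_inversions R us' [f y, f x] = cross_inversions R us' [f x, f y]"
    "cross_inversions R [f y, f x] us' = cross_inversions R [f x, f y] us'" for us'
    by (induction us') (auto simp: cross_inversions_def)
  have "cross_inversions R (map f us) (map f [x, y]) = cross_inversions R us [x, y]"
    using f dist by (intro cross_inversions_cong) auto
  then have 2: "cross_inversions R (map f us) [f y, f x] = cross_inversions R us [x, y]"
    by (simp add: swap)
  have "cross_inversions R (map f [x, y]) (map f vs) = cross_inversions R [x, y] vs"
    using f dist by (intro cross_inversions_cong) auto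
  then have 3: "cross_inversions R [f y, f x] (map f vs) = cross_inversions R [x, y] vs"
    by (simp add: swap)
  have 4: "cross_inversions R (map f us) (map f vs) = cross_inversions R us vs"
    using f dist by (intro cross_inversions_cong) auto
  have 5: "R (f y) (f x) \<longleftrightarrow> R y x" using f[of y x] dist by auto
  define N where "N = inversions R us + inversions R vs + cross_inversions R [x, y] vs +
    cross_inversions R us [x, y] + cross_inversions R us vs"
  have "inversions R (us @ [x, y] @ vs) + inversions R (map f us @ [f y, f x] @ map f vs)
      = 2 * N + (inversions R [x, y] + inversions R [f y, f x])"
    unfolding inversions_append cross_inversions_append 1 2 3 4 N_def by simp
  moreover have "inversions R [x, y] + inversions R [f y, f x] = 1" using xy 5 by simp
  ultimately show ?thesis by simp
qed

text \<open>No other entry separates x from y in the relation, so every entry counts the pair twice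
  or not at all; modulo 2 only the order within the pair remains.\<close>

lemma inversions_insert:
  assumes f: "\<And>u v. u \<in> set (us @ vs) \<Longrightarrow> v \<in> set (us @ vs) \<Longrightarrow> u \<noteq> v \<Longrightarrow> R (f u) (f v) \<longleftrightarrow> R u v"
    and dist: "distinct (us @ vs)"
    and xy: "\<And>u. u \<in> set (us @ vs) \<Longrightarrow> (R u x \<longleftrightarrow> R u y) \<and> (R x u \<longleftrightarrow> R y u)"
  shows "even (inversions R (us @ [x, y] @ vs) + inversions R (map f us @ map f vs)) \<longleftrightarrow> \<not> R x y"
proof -
  have 1: "inversions R (map f us) = inversions R us" "inversions R (map f vs) = inversions R vs"
    using f dist by (intro inversions_cong; auto)+
  have 2: "even (cross_inversions R us [x, y])" "even (cross_inversions R [x, y] vs)"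
    using xy by (auto intro!: cross_inversions_even_left cross_inversions_even_right)
  have 4: "cross_inversions R (map f us) (map f vs) = cross_inversions R us vs"
    using f dist by (intro cross_inversions_cong) auto
  show ?thesis
    unfolding inversions_append cross_inversions_append 1 4 using 2 by auto
qed

context knot_tangle
begin

text \<open>The two ends of a strand differ in time by exactly one and all times are distinct, so
  the order of two strands cannot change across a layer.\<close>

lemma time_strand_order:
  assumes t: "t < length D" and s: "(j, k) \<in> strands (D ! t)" "(j', k') \<in> strands (D ! t)"
    and j: "j < length (orient D t)" "j' < length (orient D t)" and ne: "j \<noteq> j'"
  shows "time (Suc t, k) < time (Suc t, k') \<longleftrightarrow> time (t, j) < time (t, j')"
proof -
  have kk: "k \<noteq> k'" using strand_unique_lower s ne by metis
  have pts: "point (t, j)" "point (t, j')" "point (Suc t, k)" "point (Suc t, k')"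
    using t j strand_upper[OF tangle t] s by (auto simp: point_def)
  have step: "(orient D t ! j = Up \<longrightarrow> time (Suc t, k) = Suc (time (t, j))) \<and>
      (orient D t ! j = Down \<longrightarrow> time (t, j) = Suc (time (Suc t, k)))"
    if "(j, k) \<in> strands (D ! t)" "j < length (orient D t)" "point (t, j)" "point (Suc t, k)" for j k
  proof (intro conjI impI)
    assume "orient D t ! j = Up"
    from time_follows[OF that(3,4) follows.up[OF t that(1,2) this]]
    show "time (Suc t, k) = Suc (time (t, j))" .
  next
    assume "orient D t ! j = Down"
    from time_follows[OF that(4,3) follows.down[OF t that(1,2) this]]
    show "time (t, j) = Suc (time (Suc t, k))" .
  qed
  have ne_times: "time (t, j) \<noteq> time (Suc t, k')" "time (t, j') \<noteq> time (Suc t, k)"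
    "time (t, j) \<noteq> time (t, j')" "time (Suc t, k) \<noteq> time (Suc t, k')"
  proof -
    show "time (t, j) \<noteq> time (Suc t, k')" using time_inj[OF pts(1,4)] by (metis Pair_inject n_not_Suc_n)
    show "time (t, j') \<noteq> time (Suc t, k)" using time_inj[OF pts(2,3)] by (metis Pair_inject n_not_Suc_n)
    show "time (t, j) \<noteq> time (t, j')" using time_inj[OF pts(1,2)] ne by (metis Pair_inject)
    show "time (Suc t, k) \<noteq> time (Suc t, k')" using time_inj[OF pts(3,4)] kk by (metis Pair_inject)
  qed
  show ?thesis
  proof -
    have "time (Suc t, k) = Suc (time (t, j)) \<or> time (t, j) = Suc (time (Suc t, k))"
      "time (Suc t, k') = Suc (time (t, j')) \<or> time (t, j') = Suc (time (Suc t, k'))"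
      using step[OF s(1) j(1) pts(1,3)] step[OF s(2) j(2) pts(2,4)] orientation.exhaust by metis+
    then show ?thesis using ne_times by linarith
  qed
qed

definition later :: "nat \<times> nat \<Rightarrow> nat \<times> nat \<Rightarrow> bool" where
  "later x y \<longleftrightarrow> time y < time x"

definition inv_at :: "nat \<Rightarrow> nat" where
  "inv_at t = inversions later (map (Pair t) [0..<length (orient D t)])"

text \<open>Consecutive times leave no room for a third time between them.\<close>

lemma later_adjacent:
  assumes "point x" "point y" "point u" "u \<noteq> x" "u \<noteq> y" "follows D x y \<or> follows D y x"
  shows "(later u x \<longleftrightarrow> later u y) \<and> (later x u \<longleftrightarrow> later y u)"
proof -
  have "time y = Suc (time x) \<or> time x = Suc (time y)"
    using assms time_follows by blast
  moreover have "time u \<noteq> time x" "time u \<noteq> time y"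
    using assms time_inj by blast+
  ultimately show ?thesis unfolding later_def by linarith
qed

text \<open>A crossing transposes two neighbours. A cap or cup removes or creates two neighbours
  with consecutive times, and these form an inversion exactly if the turn is traversed from right to
  left.\<close>

lemma inv_at_step:
  assumes t: "t < length D" and pP: "D ! t = (p, P)"
  shows "odd (inv_at t + inv_at (Suc t)) \<longleftrightarrow> P \<in> {PosX, NegX, CapRL, CupRL}"
proof -
  obtain us vs where o: "orient D t = us @ below P @ vs" "orient D (Suc t) = us @ above P @ vs"
    "length us = p" using tangle_layerE[OF tangle t pP] .
  define q where "q = length vs"
  have shift: "map (Pair s) [p + m..<p + m + q] = map (\<lambda>k. (s, k + m)) [p..<p + q]" for s m :: nat
    by (intro nth_equalityI) auto
  have split: "map (Pair s) [0..<p + m + q] = map (Pair s) [0..<p] @ map (Pair s) [p..<p + m] @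
      map (\<lambda>k. (s, k + m)) [p..<p + q]" for s m :: nat
  proof -
    have "[0..<p + m + q] = [0..<p] @ [p..<p + m] @ [p + m..<p + m + q]"
      by (metis append.assoc le_add1 upt_add_eq_append zero_le)
    then show ?thesis using shift[of s m] by simp
  qed
  have u2: "[p..<p + 2] = [p, p + 1]" by (simp add: upt_rec)
  have lens: "length (orient D t) = p + n_in P + q" "length (orient D (Suc t)) = p + n_out P + q"
    using o by (simp_all add: q_def)
  have pts: "point (t, k)" if "k < p + n_in P + q" for k
    using that t lens by (simp add: point_def)
  have pts': "point (Suc t, k)" if "k < p + n_out P + q" for k
    using that t lens by (simp add: point_def)
  let ?m = "n_in P" and ?m' = "n_out P"
  consider (X) "P = PosX \<or> P = NegX" | (cap) "P = CapLR \<or> P = CapRL" | (cup) "P = CupLR \<or> P = CupRL"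
    by (cases P) auto
  then show ?thesis
  proof cases
    case X
    then have m: "?m = 2" "?m' = 2" by auto
    \<comment> \<open>\<open>f\<close> takes a point below the crossing to the upper end of its
      strand, hence exchanges the positions p and p + 1.\<close>
    define f where "f = (\<lambda>(t::nat, k::nat). (Suc t, if k = p then p + 1 else if k = p + 1 then p else k))"
    have str: "(k, snd (f (t, k))) \<in> strands (D ! t)" for k
      using X unfolding pP f_def
      by (cases "k < p"; cases "k \<ge> p + 2") (auto intro: exI[of _ "k - 2"])
    have ord: "later (f u) (f v) \<longleftrightarrow> later u v"
      if uv: "u \<in> Pair t ` {..<p + 2 + q}" "v \<in> Pair t ` {..<p + 2 + q}" "u \<noteq> v" for u v
    proof -
      obtain j k where jk: "u = (t, j)" "v = (t, k)" "j < p + 2 + q" "k < p + 2 + q" "j \<noteq> k"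
        using uv by auto
      have "fst (f u) = Suc t" "fst (f v) = Suc t" by (simp_all add: f_def jk)
      then show ?thesis
        using time_strand_order[OF t str[of k] str[of j]] jk lens m
        by (simp add: later_def) (metis prod.collapse)
    qed
    have "p + 2 + q = p + (2 + q)" by simp
    let ?us = "map (Pair t) [0..<p]" and ?vs = "map (\<lambda>k. (t, k + 2)) [p..<p + q]"
    have B: "map (Pair t) [0..<length (orient D t)] = ?us @ [(t, p), (t, p + 1)] @ ?vs"
      unfolding lens m split u2 by simp
    have A: "map (Pair (Suc t)) [0..<length (orient D (Suc t))]
        = map f ?us @ [f (t, p + 1), f (t, p)] @ map f ?vs"
      unfolding lens m split u2 by (auto simp: f_def)
    have xy: "later (t, p) (t, p + 1) \<longleftrightarrow> \<not> later (t, p + 1) (t, p)"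
    proof -
      have "time (t, p) \<noteq> time (t, p + 1)" using time_inj[OF pts[of p] pts[of "p + 1"]] m by auto
      then show ?thesis by (auto simp: later_def)
    qed
    have "even (inv_at t + inv_at (Suc t)) = False"
      unfolding inv_at_def A B
    proof (rule inversions_swap[where R = later and f = f])
      show "later (t, p) (t, p + 1) \<longleftrightarrow> \<not> later (t, p + 1) (t, p)" by (rule xy)
      show "distinct (?us @ [(t, p), (t, p + 1)] @ ?vs)"
        unfolding B[symmetric] by (simp add: distinct_map inj_on_def)
      show "later (f u) (f v) \<longleftrightarrow> later u v"
        if "u \<in> set (?us @ [(t, p), (t, p + 1)] @ ?vs)" "v \<in> set (?us @ [(t, p), (t, p + 1)] @ ?vs)" "u \<noteq> v"
        for u v using that(1,2) ord[OF _ _ that(3)]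
        unfolding B[symmetric] lens m set_map set_upt atLeast0LessThan by blast
    qed
    then show ?thesis using X by auto
  next
    case cap
    then have m: "?m = 2" "?m' = 0" by auto
    define f where "f = (\<lambda>(t::nat, k::nat). (Suc t, if k < p then k else k - 2))"
    have str: "(k, snd (f (t, k))) \<in> strands (D ! t)" if "k < p \<or> k \<ge> p + 2" for k
      using cap that unfolding pP f_def
      by (cases "k < p") (auto intro: exI[of _ "k - 2"])
    let ?us = "map (Pair t) [0..<p]" and ?vs = "map (\<lambda>k. (t, k + 2)) [p..<p + q]"
    have B: "map (Pair t) [0..<length (orient D t)] = ?us @ [(t, p), (t, p + 1)] @ ?vs"
      unfolding lens m split u2 by simp
    have A: "map (Pair (Suc t)) [0..<length (orient D (Suc t))] = map f ?us @ map f ?vs"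
      unfolding lens m split by (auto simp: f_def)
    have fol: "follows D (t, p) (t, p + 1) \<or> follows D (t, p + 1) (t, p)"
      using cap pP follows.cap_lr[OF t, of p] follows.cap_rl[OF t, of p] by auto
    have "even (inv_at t + inv_at (Suc t)) \<longleftrightarrow> \<not> later (t, p) (t, p + 1)"
      unfolding inv_at_def A B
    proof (rule inversions_insert[where R = later and f = f])
      show "distinct (?us @ ?vs)" by (auto simp: distinct_map inj_on_def)
      fix u assume u: "u \<in> set (?us @ ?vs)"
      show "(later u (t, p) \<longleftrightarrow> later u (t, p + 1)) \<and> (later (t, p) u \<longleftrightarrow> later (t, p + 1) u)"
        using u fol m by (intro later_adjacent pts) (auto intro!: pts)
      fix v assume v: "v \<in> set (?us @ ?vs)" "u \<noteq> v"
      obtain j where j: "u = (t, j)" "j < p + 2 + q" "j < p \<or> j \<ge> p + 2" using u by auto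
      obtain k where k: "v = (t, k)" "k < p + 2 + q" "k < p \<or> k \<ge> p + 2" using v by auto
      have "j \<noteq> k" using v j k by auto
      note jk = this j k
      have "fst (f u) = Suc t" "fst (f v) = Suc t" by (simp_all add: f_def jk)
      then show "later (f u) (f v) \<longleftrightarrow> later u v"
        using time_strand_order[OF t str[of k] str[of j]] jk lens m
        by (simp add: later_def) (metis prod.collapse)
    qed
    moreover have "later (t, p) (t, p + 1) \<longleftrightarrow> P = CapRL"
      using cap
    proof
      assume "P = CapLR"
      then show ?thesis
        using time_follows[OF pts[of p] pts[of "p + 1"] follows.cap_lr[OF t, of p]] pP m
        by (simp add: later_def)
    next
      assume "P = CapRL"
      then show ?thesis
        using time_follows[OF pts[of "p + 1"] pts[of p] follows.cap_rl[OF t, of p]] pP m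
        by (simp add: later_def)
    qed
    ultimately show ?thesis using cap by auto
  next
    case cup
    then have m: "?m = 0" "?m' = 2" by auto
    \<comment> \<open>For a cup the longer list is the upper one, so here \<open>f\<close> descends,
      and the inserted pair lies at height t + 1.\<close>
    define f where "f = (\<lambda>(t::nat, k::nat). (t - 1, if k < p then k else k - 2))"
    have str: "(snd (f (Suc t, k)), k) \<in> strands (D ! t)" if "k < p \<or> k \<ge> p + 2" for k
      using cup that unfolding pP f_def
      by (cases "k < p") (auto intro: exI[of _ "k - 2"])
    let ?us = "map (Pair (Suc t)) [0..<p]" and ?vs = "map (\<lambda>k. (Suc t, k + 2)) [p..<p + q]"
    have B: "map (Pair (Suc t)) [0..<length (orient D (Suc t))] =
        ?us @ [(Suc t, p), (Suc t, p + 1)] @ ?vs"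
      unfolding lens m split u2 by simp
    have A: "map (Pair t) [0..<length (orient D t)] = map f ?us @ map f ?vs"
      unfolding lens m split by (auto simp: f_def)
    have fol: "follows D (Suc t, p) (Suc t, p + 1) \<or> follows D (Suc t, p + 1) (Suc t, p)"
      using cup pP follows.cup_lr[OF t, of p] follows.cup_rl[OF t, of p] by auto
    have "even (inv_at (Suc t) + inv_at t) \<longleftrightarrow> \<not> later (Suc t, p) (Suc t, p + 1)"
      unfolding inv_at_def A B
    proof (rule inversions_insert[where R = later and f = f])
      show "distinct (?us @ ?vs)" by (auto simp: distinct_map inj_on_def)
      fix u assume u: "u \<in> set (?us @ ?vs)"
      show "(later u (Suc t, p) \<longleftrightarrow> later u (Suc t, p + 1)) \<and>
          (later (Suc t, p) u \<longleftrightarrow> later (Suc t, p + 1) u)"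
        using u fol m by (intro later_adjacent pts') (auto intro!: pts')
      fix v assume v: "v \<in> set (?us @ ?vs)" "u \<noteq> v"
      obtain j where j: "u = (Suc t, j)" "j < p + 2 + q" "j < p \<or> j \<ge> p + 2" using u by auto
      obtain k where k: "v = (Suc t, k)" "k < p + 2 + q" "k < p \<or> k \<ge> p + 2" using v by auto
      have "j \<noteq> k" using v j k by auto
      note jk = this j k
      have "fst (f u) = t" "fst (f v) = t" by (simp_all add: f_def jk)
      moreover have "snd (f u) < p + q" "snd (f v) < p + q" "snd (f u) \<noteq> snd (f v)"
        using jk by (auto simp: f_def)
      ultimately show "later (f u) (f v) \<longleftrightarrow> later u v"
        using time_strand_order[OF t str[of k] str[of j]] jk lens m
        by (simp add: later_def) (metis prod.collapse)
    qed
    moreover have "later (Suc t, p) (Suc t, p + 1) \<longleftrightarrow> P = CupRL"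
      using cup
    proof
      assume "P = CupLR"
      then show ?thesis
        using time_follows[OF pts'[of p] pts'[of "p + 1"] follows.cup_lr[OF t, of p]] pP m
        by (simp add: later_def)
    next
      assume "P = CupRL"
      then show ?thesis
        using time_follows[OF pts'[of "p + 1"] pts'[of p] follows.cup_rl[OF t, of p]] pP m
        by (simp add: later_def)
    qed
    ultimately show ?thesis using cup by (auto simp: add.commute)
  qed
qed

lemma inv_at_parity:
  "t \<le> length D \<Longrightarrow>
    even (inv_at t + (\<Sum>s<t. if snd (D ! s) \<in> {PosX, NegX, CapRL, CupRL} then 1 else 0))"
proof (induction t)
  case 0
  then show ?case by (simp add: inv_at_def)
next
  case (Suc t)
  then show ?case using inv_at_step[of t "fst (D ! t)" "snd (D ! t)"] by auto
qed

lemma orient_length_count: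
  "t \<le> length D \<Longrightarrow> length (orient D t) + (\<Sum>s<t. 2 * (if snd (D ! s) \<in> {CapLR, CapRL} then 1 else 0))
    = 1 + (\<Sum>s<t. 2 * (if snd (D ! s) \<in> {CupLR, CupRL} then 1 else 0))"
proof (induction t)
  case (Suc t)
  obtain p P where pP: "D ! t = (p, P)" by fastforce
  obtain us vs where "orient D t = us @ below P @ vs" "orient D (Suc t) = us @ above P @ vs"
    using tangle_layerE[OF tangle _ pP] Suc.prems by (metis Suc_le_lessD)
  then show ?case using Suc pP by (cases P) auto
qed simp

text \<open>At both ends there is a single strand and so no inversion; hence crossings and
  right-to-left turns together are even in number. The crossings alone are even because the writhe
  is zero, and all turns together are even because there are as many caps as cups. This leaves the
  left-to-right turns, which are the ones carrying the pivotal element.\<close>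

theorem even_turning:
  assumes "writhe D = 0"
  shows "even (piece_count D CapLR + piece_count D CupLR)"
proof -
  have e: "(\<Sum>s<length D. if snd (D ! s) \<in> {PosX, NegX, CapRL, CupRL} then 1 else 0) =
     piece_count D PosX + piece_count D NegX + piece_count D CapRL + piece_count D CupRL"
    unfolding piece_count_eq_sum sum.distrib[symmetric] by (intro sum.cong) auto
  have end_or: "orient D (length D) = [Up]" using tangle by (simp add: tangle_1_1_def)
  have 1: "even (piece_count D PosX + piece_count D NegX + piece_count D CapRL + piece_count D CupRL)"
    using inv_at_parity[of "length D"] unfolding e by (simp add: inv_at_def end_or)
  have 2: "2 * (piece_count D CapLR + piece_count D CapRL) = 2 * (piece_count D CupLR + piece_count D CupRL)"
  proof -
    have "(\<Sum>s<length D. 2 * (if snd (D ! s) \<in> {CapLR, CapRL} then 1 else 0))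
       = (\<Sum>s<length D. 2 * (if snd (D ! s) \<in> {CupLR, CupRL} then 1 else (0::nat)))"
      using orient_length_count[of "length D"] end_or by simp
    moreover have "(\<Sum>s<length D. 2 * (if snd (D ! s) \<in> {CapLR, CapRL} then 1 else 0)) =
       2 * (piece_count D CapLR + piece_count D CapRL)"
      unfolding piece_count_eq_sum sum.distrib[symmetric] sum_distrib_left by (intro sum.cong) auto
    moreover have "(\<Sum>s<length D. 2 * (if snd (D ! s) \<in> {CupLR, CupRL} then 1 else 0)) =
       2 * (piece_count D CupLR + piece_count D CupRL)"
      unfolding piece_count_eq_sum sum.distrib[symmetric] sum_distrib_left by (intro sum.cong) auto
    ultimately show ?thesis by simp
  qed
  have 3: "piece_count D PosX = piece_count D NegX"
    using assms writhe_eq_piece_count[of D] by simp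
  show ?thesis using 1 2 3 by presburger
qed

end

section \<open>Labellings\<close>

fun layer_rule :: "nat \<times> piece \<Rightarrow> nat \<Rightarrow> nat list \<Rightarrow> nat list \<Rightarrow> bool" where
  "layer_rule (p, P) i xs ys \<longleftrightarrow> (\<exists>us ws zs vs. xs = us @ ws @ vs \<and> ys = us @ zs @ vs \<and>
     length us = p \<and> label_rule P i ws zs)"

declare layer_rule.simps [simp del]

lemma labelling_iff:
  "labelling D i L \<longleftrightarrow> length L = Suc (length D) \<and> L ! 0 = [0] \<and> L ! length D = [0] \<and>
     (\<forall>t<length D. layer_rule (D ! t) (i t) (L ! t) (L ! Suc t))"
  by (simp add: labelling_def layer_rule.simps case_prod_unfold split_paired_all
      flip: layer_rule.simps)

abbreviation lower :: "diagram \<Rightarrow> nat list list \<Rightarrow> nat \<Rightarrow> nat list" where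
  "lower D L t \<equiv> take (n_in (snd (D ! t))) (drop (fst (D ! t)) (L ! t))"

abbreviation upper :: "diagram \<Rightarrow> nat list list \<Rightarrow> nat \<Rightarrow> nat list" where
  "upper D L t \<equiv> take (n_out (snd (D ! t))) (drop (fst (D ! t)) (L ! Suc t))"

lemma label_rule_length: "label_rule P i ws zs \<Longrightarrow> length ws = n_in P \<and> length zs = n_out P"
  by (induction P i ws zs rule: label_rule.induct) auto

lemma layer_rule_iff:
  "layer_rule (p, P) i xs ys \<longleftrightarrow> p + n_in P \<le> length xs \<and> p + n_out P \<le> length ys \<and>
     take p xs = take p ys \<and> drop (p + n_in P) xs = drop (p + n_out P) ys \<and>
     label_rule P i (take (n_in P) (drop p xs)) (take (n_out P) (drop p ys))"
  (is "_ \<longleftrightarrow> ?R")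
proof
  assume "layer_rule (p, P) i xs ys"
  then show ?R unfolding layer_rule.simps using label_rule_length by fastforce
next
  assume R: ?R
  have "xs = take p xs @ take (n_in P) (drop p xs) @ drop (p + n_in P) xs"
    by (metis append_take_drop_id drop_drop add.commute)
  moreover have "ys = take p xs @ take (n_out P) (drop p ys) @ drop (p + n_in P) xs"
    using R by (metis append_take_drop_id drop_drop add.commute)
  moreover have "length (take p xs) = p" using R by simp
  ultimately show "layer_rule (p, P) i xs ys" unfolding layer_rule.simps using R by blast
qed

lemma labelling_rule:
  assumes "labelling D i L" "t < length D"
  shows "label_rule (snd (D ! t)) (i t) (lower D L t) (upper D L t)"
  using assms by (cases "D ! t") (fastforce simp: labelling_iff layer_rule_iff)

lemma label_rule_unique:
  "label_rule P i ws zs \<Longrightarrow> label_rule P i' ws zs \<Longrightarrow> P = PosX \<or> P = NegX \<Longrightarrow> i = i'"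
  by (induction P i ws zs rule: label_rule.induct) auto

lemma label_rule_no_crossing:
  "P \<noteq> PosX \<Longrightarrow> P \<noteq> NegX \<Longrightarrow> label_rule P i ws zs = label_rule P i' ws zs"
  by (induction P i ws zs rule: label_rule.induct) auto

lemma label_rule_crossing:
  assumes "label_rule P i ws zs"
  shows "P = PosX \<Longrightarrow> \<exists>a b. ws = [b, a] \<and> i \<le> b \<and> zs = [a + i, b - i]"
    and "P = NegX \<Longrightarrow> \<exists>a b. ws = [a, b] \<and> i \<le> b \<and> zs = [b - i, a + i]"
    and "P = CapLR \<or> P = CapRL \<Longrightarrow> \<exists>x. ws = [x, x] \<and> zs = []"
    and "P = CupLR \<or> P = CupRL \<Longrightarrow> \<exists>x. ws = [] \<and> zs = [x, x]"
  using assms by (induction P i ws zs rule: label_rule.induct) auto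

text \<open>The change of label from the lower end j of a strand to its upper end: the over-strand
  loses i, the under-strand gains i.\<close>

fun strand_shift :: "nat \<times> piece \<Rightarrow> nat \<Rightarrow> nat \<Rightarrow> int" where
  "strand_shift (p, PosX) i j = (if j = p then - int i else if j = p + 1 then int i else 0)"
| "strand_shift (p, NegX) i j = (if j = p then int i else if j = p + 1 then - int i else 0)"
| "strand_shift (p, _) i j = 0"

lemma layer_rule_strand:
  assumes lr: "layer_rule l i xs ys" and s: "(j, k) \<in> strands l" and j: "j < length xs"
  shows "int (ys ! k) = int (xs ! j) + strand_shift l i j"
proof -
  obtain p P where l: "l = (p, P)" by fastforce
  obtain us ws zs vs where *: "xs = us @ ws @ vs" "ys = us @ zs @ vs" "length us = p"
    "label_rule P i ws zs" using lr unfolding l layer_rule.simps by blast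
  have len: "length ws = n_in P" "length zs = n_out P" using label_rule_length[OF *(4)] by auto
  from s consider (lo) "j < p" "k = j"
    | (hi) m where "p \<le> m" "j = m + n_in P" "k = m + n_out P"
    | (x1) "P = PosX \<or> P = NegX" "j = p" "k = p + 1"
    | (x2) "P = PosX \<or> P = NegX" "j = p + 1" "k = p"
    unfolding l by (auto split: if_splits)
  then show ?thesis
  proof cases
    case lo
    then show ?thesis using * by (cases P) (auto simp: l nth_append)
  next
    case hi
    then show ?thesis using * len by (cases P) (auto simp: l nth_append)
  next
    case x1
    then show ?thesis using * label_rule_crossing[OF *(4)] by (auto simp: l nth_append)
  next
    case x2
    then show ?thesis using * label_rule_crossing[OF *(4)] by (auto simp: l nth_append)
  qed
qed

lemma layer_rule_cap_cup:
  assumes lr: "layer_rule (p, P) i xs ys"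
  shows "P = CapLR \<or> P = CapRL \<Longrightarrow> xs ! (p + 1) = xs ! p"
    and "P = CupLR \<or> P = CupRL \<Longrightarrow> ys ! (p + 1) = ys ! p"
proof -
  obtain us ws zs vs where *: "xs = us @ ws @ vs" "ys = us @ zs @ vs" "length us = p"
    "label_rule P i ws zs" using lr unfolding layer_rule.simps by blast
  show "P = CapLR \<or> P = CapRL \<Longrightarrow> xs ! (p + 1) = xs ! p"
    "P = CupLR \<or> P = CupRL \<Longrightarrow> ys ! (p + 1) = ys ! p"
    using * label_rule_crossing[OF *(4)] by (auto simp: nth_append)
qed

lemma layer_rule_length:
  "layer_rule (p, P) i xs ys \<Longrightarrow> length ys + n_in P = length xs + n_out P"
  unfolding layer_rule.simps using label_rule_length by fastforce

lemma labelling_length: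
  assumes tg: "tangle_1_1 D" and L: "labelling D i L"
  shows "t \<le> length D \<Longrightarrow> length (L ! t) = length (orient D t)"
proof (induction t)
  case 0
  then show ?case using L by (simp add: labelling_def)
next
  case (Suc t)
  obtain p P where pP: "D ! t = (p, P)" by fastforce
  have t: "t < length D" using Suc.prems by simp
  have "layer_rule (p, P) (i t) (L ! t) (L ! Suc t)"
    using L t pP unfolding labelling_iff by metis
  from layer_rule_length[OF this] tangle_layerE[OF tg t pP] Suc show ?case
    by (smt (verit) Suc_leD add_left_cancel add_right_cancel length_append add.commute add.left_commute)
qed

text \<open>The under-strand leaves a positive crossing at the bottom right, a negative one at the bottom left.\<close>

definition under_label :: "diagram \<Rightarrow> nat list list \<Rightarrow> nat \<Rightarrow> nat" where
  "under_label D L t = L ! t ! (if snd (D ! t) = PosX then fst (D ! t) + 1 else fst (D ! t))"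

context knot_tangle
begin

lemma labelling_follows:
  assumes L: "labelling D i L" and L': "labelling D i L'"
    and f: "follows D x y" and x: "L ! fst x ! snd x = L' ! fst x ! snd x"
  shows "L ! fst y ! snd y = L' ! fst y ! snd y"
  using f
proof cases
  case (up t j k)
  have len: "j < length (L ! t)" "j < length (L' ! t)"
    using up labelling_length[OF tangle L, of t] labelling_length[OF tangle L', of t] by auto
  have r: "layer_rule (D ! t) (i t) (L ! t) (L ! Suc t)" "layer_rule (D ! t) (i t) (L' ! t) (L' ! Suc t)"
    using L L' up(3) by (auto simp: labelling_iff)
  show ?thesis
    using layer_rule_strand[OF r(1) up(4) len(1)] layer_rule_strand[OF r(2) up(4) len(2)] x up(1,2)
    by simp
next
  case (down t j k)
  have len: "j < length (L ! t)" "j < length (L' ! t)"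
    using down labelling_length[OF tangle L, of t] labelling_length[OF tangle L', of t] by auto
  have r: "layer_rule (D ! t) (i t) (L ! t) (L ! Suc t)" "layer_rule (D ! t) (i t) (L' ! t) (L' ! Suc t)"
    using L L' down(3) by (auto simp: labelling_iff)
  show ?thesis
    using layer_rule_strand[OF r(1) down(4) len(1)] layer_rule_strand[OF r(2) down(4) len(2)] x down(1,2)
    by simp
next
  case (cap_lr t p)
  have r: "layer_rule (p, CapLR) (i t) (L ! t) (L ! Suc t)" "layer_rule (p, CapLR) (i t) (L' ! t) (L' ! Suc t)"
    using L L' cap_lr(3,4) by (auto simp: labelling_iff)
  show ?thesis using layer_rule_cap_cup(1)[OF r(1)] layer_rule_cap_cup(1)[OF r(2)] x cap_lr(1,2) by simp
next
  case (cap_rl t p)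
  have r: "layer_rule (p, CapRL) (i t) (L ! t) (L ! Suc t)" "layer_rule (p, CapRL) (i t) (L' ! t) (L' ! Suc t)"
    using L L' cap_rl(3,4) by (auto simp: labelling_iff)
  show ?thesis using layer_rule_cap_cup(1)[OF r(1)] layer_rule_cap_cup(1)[OF r(2)] x cap_rl(1,2) by simp
next
  case (cup_lr t p)
  have r: "layer_rule (p, CupLR) (i t) (L ! t) (L ! Suc t)" "layer_rule (p, CupLR) (i t) (L' ! t) (L' ! Suc t)"
    using L L' cup_lr(3,4) by (auto simp: labelling_iff)
  show ?thesis using layer_rule_cap_cup(2)[OF r(1)] layer_rule_cap_cup(2)[OF r(2)] x cup_lr(1,2) by simp
next
  case (cup_rl t p)
  have r: "layer_rule (p, CupRL) (i t) (L ! t) (L ! Suc t)" "layer_rule (p, CupRL) (i t) (L' ! t) (L' ! Suc t)"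
    using L L' cup_rl(3,4) by (auto simp: labelling_iff)
  show ?thesis using layer_rule_cap_cup(2)[OF r(1)] layer_rule_cap_cup(2)[OF r(2)] x cup_rl(1,2) by simp
qed

text \<open>The increments prescribe every change of label along the open strand, which starts with
  label 0 and visits all points.\<close>

lemma labelling_unique:
  assumes L: "labelling D i L" and L': "labelling D i L'"
  shows "L = L'"
proof (rule nth_equalityI)
  show "length L = length L'" using L L' by (simp add: labelling_def)
  fix t assume "t < length L"
  then have t: "t \<le> length D" using L by (simp add: labelling_def)
  show "L ! t = L' ! t"
  proof (rule nth_equalityI)
    show "length (L ! t) = length (L' ! t)"
      using labelling_length[OF tangle L t] labelling_length[OF tangle L' t] by simp
    fix k assume "k < length (L ! t)"
    then have "point (t, k)" using t labelling_length[OF tangle L t] by (simp add: point_def)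
    then have "L ! fst (t, k) ! snd (t, k) = L' ! fst (t, k) ! snd (t, k)"
    proof (induction rule: point_induct)
      case start
      then show ?case using L L' by (simp add: labelling_def)
    next
      case (step x y)
      then show ?case using labelling_follows[OF L L'] by blast
    qed
    then show "L ! t ! k = L' ! t ! k" by simp
  qed
qed

lemma labelling_the: "labelling D i L \<Longrightarrow> (THE L. labelling D i L) = L"
  using labelling_unique by blast

lemma state_term_eq:
  assumes "labelling D i L"
  shows "state_term D i = (\<Prod>t<length D. label_weight (snd (D ! t)) (i t) (lower D L t) (upper D L t))"
  using assms unfolding state_term_def Let_def labelling_the[OF assms]
  by (auto simp: case_prod_unfold)

text \<open>Along the strand a label grows only at passages under a crossing. So the first label
  reaching d would arise from an under-strand whose incoming label is still below d.\<close>

lemma labels_less: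
  assumes L: "labelling D i L" and d: "0 < d"
    and under: "\<And>t. t \<in> crossings D \<Longrightarrow> under_label D L t < d \<Longrightarrow> under_label D L t + i t < d"
    and t: "t \<le> length D"
  shows "set (L ! t) \<subseteq> {..<d}"
proof -
  have "L ! fst x ! snd x < d" if "point x" for x
    using that
  proof (induction rule: point_induct)
    case start
    then show ?case using L d by (simp add: labelling_def)
  next
    case (step x y)
    from step(3) show ?case
    proof cases
      case (up t j k)
      have len: "j < length (L ! t)" using up labelling_length[OF tangle L, of t] by auto
      have r: "layer_rule (D ! t) (i t) (L ! t) (L ! Suc t)" using L up(3) by (auto simp: labelling_iff)
      have eq: "int (L ! Suc t ! k) = int (L ! t ! j) + strand_shift (D ! t) (i t) j"
        by (rule layer_rule_strand[OF r up(4) len])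
      obtain p P where pP: "D ! t = (p, P)" by fastforce
      have "t \<in> crossings D \<Longrightarrow> under_label D L t < d \<Longrightarrow> under_label D L t + i t < d" by (rule under)
      then show ?thesis using eq step.IH up(1-3)
        by (cases P) (auto simp: pP crossings_def under_label_def split: if_splits)
    next
      case (down t j k)
      have len: "j < length (L ! t)" using down labelling_length[OF tangle L, of t] by auto
      have r: "layer_rule (D ! t) (i t) (L ! t) (L ! Suc t)" using L down(3) by (auto simp: labelling_iff)
      have eq: "int (L ! Suc t ! k) = int (L ! t ! j) + strand_shift (D ! t) (i t) j"
        by (rule layer_rule_strand[OF r down(4) len])
      obtain p P where pP: "D ! t = (p, P)" by fastforce
      \<comment> \<open>Both strands of a crossing point upward, so a downward strand keeps its
        label.\<close>
      have "strand_shift (D ! t) (i t) j = 0"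
        using tangle_layer_nth(1)[OF tangle down(3) pP, of 0] tangle_layer_nth(1)[OF tangle down(3) pP, of 1]
          down(6) by (cases P) (auto simp: pP)
      then show ?thesis using eq step.IH down(1,2) by simp
    next
      case (cap_lr t p)
      have "layer_rule (p, CapLR) (i t) (L ! t) (L ! Suc t)"
        using L cap_lr(3,4) by (auto simp: labelling_iff)
      then show ?thesis using layer_rule_cap_cup(1) step.IH cap_lr(1,2) by fastforce
    next
      case (cap_rl t p)
      have "layer_rule (p, CapRL) (i t) (L ! t) (L ! Suc t)"
        using L cap_rl(3,4) by (auto simp: labelling_iff)
      then show ?thesis using layer_rule_cap_cup(1) step.IH cap_rl(1,2) by fastforce
    next
      case (cup_lr t p)
      have "layer_rule (p, CupLR) (i t) (L ! t) (L ! Suc t)"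
        using L cup_lr(3,4) by (auto simp: labelling_iff)
      then show ?thesis using layer_rule_cap_cup(2) step.IH cup_lr(1,2) by fastforce
    next
      case (cup_rl t p)
      have "layer_rule (p, CupRL) (i t) (L ! t) (L ! Suc t)"
        using L cup_rl(3,4) by (auto simp: labelling_iff)
      then show ?thesis using layer_rule_cap_cup(2) step.IH cup_rl(1,2) by fastforce
    qed
  qed
  then show ?thesis
    using t labelling_length[OF tangle L t] by (force simp: in_set_conv_nth point_def)
qed

end

subsection \<open>Conservation laws\<close>

text \<open>The flow of labels through a horizontal line. Up to sign and factor it is the weight of
  the basis word, hence it is conserved.\<close>

fun signed_sum :: "orientation list \<Rightarrow> int list \<Rightarrow> int" where
  "signed_sum (b # bs) (x # xs) = (if b = Up then x else - x) + signed_sum bs xs"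
| "signed_sum _ _ = 0"

lemma signed_sum_append:
  "length bs = length xs \<Longrightarrow> signed_sum (bs @ cs) (xs @ ys) = signed_sum bs xs + signed_sum cs ys"
  by (induction bs xs rule: list_induct2) simp_all

fun potential :: "nat \<Rightarrow> orientation list \<Rightarrow> nat list \<Rightarrow> nat" where
  "potential n (b # bs) (x # xs) = (if b = Up then n else Suc n) * x + potential (Suc n) bs xs"
| "potential n _ _ = 0"

lemma potential_append:
  "length bs = length xs \<Longrightarrow>
    potential n (bs @ cs) (xs @ ys) = potential n bs xs + potential (n + length bs) cs ys"
  by (induction bs xs arbitrary: n rule: list_induct2) simp_all

text \<open>Caps and cups move the strands to their right by two positions, which this parity does
  not see.\<close>

lemma potential_parity: "even (potential (Suc (Suc n)) bs xs) \<longleftrightarrow> even (potential n bs xs)"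
  by (induction n bs xs rule: potential.induct) auto

text \<open>
  The total incoming label plus the increment has even sum over all crossings: modulo 2 it is the
  change of the sum of (position + 1 if the strand points down) * label.
\<close>

lemma labelling_parity:
  assumes tg: "tangle_1_1 D" and L: "labelling D i L"
  shows "even (\<Sum>t<length D. if snd (D ! t) = PosX \<or> snd (D ! t) = NegX
      then sum_list (lower D L t) + i t else 0)"
proof -
  let ?c = "\<lambda>t. if snd (D ! t) = PosX \<or> snd (D ! t) = NegX then sum_list (lower D L t) + i t else 0"
  have "t \<le> length D \<Longrightarrow> even (potential 0 (orient D t) (L ! t) + (\<Sum>s<t. ?c s))" for t
  proof (induction t)
    case 0
    then show ?case using L by (simp add: labelling_def)
  next
    case (Suc t)
    obtain p P where pP: "D ! t = (p, P)" by fastforce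
    have t: "t < length D" using Suc.prems by simp
    obtain bs cs where o: "orient D t = bs @ below P @ cs" "orient D (Suc t) = bs @ above P @ cs"
      "length bs = p" using tangle_layerE[OF tg t pP] .
    have "layer_rule (p, P) (i t) (L ! t) (L ! Suc t)"
      using L t pP unfolding labelling_iff by metis
    then obtain us ws zs vs where *: "L ! t = us @ ws @ vs" "L ! Suc t = us @ zs @ vs" "length us = p"
      "label_rule P (i t) ws zs" unfolding layer_rule.simps by blast
    have len: "length ws = n_in P" "length zs = n_out P" using label_rule_length[OF *(4)] by auto
    have low: "lower D L t = ws" using * len by (simp add: pP)
    have pot: "potential 0 (orient D t) (L ! t) =
        potential 0 bs us + (potential p (below P) ws + potential (p + n_in P) cs vs)"
      "potential 0 (orient D (Suc t)) (L ! Suc t) =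
        potential 0 bs us + (potential p (above P) zs + potential (p + n_out P) cs vs)"
      using o * len by (simp_all add: potential_append)
    have rest: "even (potential (p + n_in P) cs vs) \<longleftrightarrow> even (potential (p + n_out P) cs vs)"
      using potential_parity[of p cs vs] by (cases P) simp_all
    have loc: "even (potential p (below P) ws + potential p (above P) zs + ?c t)"
      using label_rule_crossing[OF *(4)] unfolding low unfolding pP
      by (cases P) (auto simp: algebra_simps dest!: le_Suc_ex)
    show ?case using Suc.IH t pot rest loc by auto
  qed
  from this[of "length D"] show ?thesis
    using L tg by (simp add: labelling_def tangle_1_1_def)
qed

lemma layer_rule_signed_sum:
  assumes tg: "tangle_1_1 D" and t: "t < length D" and lr: "layer_rule (D ! t) i xs ys"
    and len: "length xs = length (orient D t)"
  shows "signed_sum (orient D (Suc t)) (map int ys) = signed_sum (orient D t) (map int xs)"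
proof -
  obtain p P where pP: "D ! t = (p, P)" by fastforce
  obtain bs cs where o: "orient D t = bs @ below P @ cs" "orient D (Suc t) = bs @ above P @ cs"
    "length bs = p" using tangle_layerE[OF tg t pP] .
  obtain us ws zs vs where *: "xs = us @ ws @ vs" "ys = us @ zs @ vs" "length us = p"
    "label_rule P i ws zs" using lr unfolding pP layer_rule.simps by blast
  have len: "length ws = n_in P" "length zs = n_out P" using label_rule_length[OF *(4)] by auto
  have "signed_sum (above P) (map int zs) = signed_sum (below P) (map int ws)"
    using label_rule_crossing[OF *(4)] by (cases P) auto
  then show ?thesis using o * len by (simp add: signed_sum_append)
qed

text \<open>
  Splitting all labels into quotient and remainder by \<open>r\<close>: if no under-strand produces a carry, then
  no over-strand produces a borrow, since the signed sum of the remainders could only increase.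
\<close>

lemma label_rule_digits:
  assumes lr: "label_rule P i ws zs" and r: "0 < r"
    and no_carry: "P = PosX \<or> P = NegX \<Longrightarrow> (if P = PosX then ws ! 1 else ws ! 0) mod r + i mod r < r"
  shows "signed_sum (below P) (map (\<lambda>x. int (x mod r)) ws) \<le>
      signed_sum (above P) (map (\<lambda>x. int (x mod r)) zs)"
    and "signed_sum (below P) (map (\<lambda>x. int (x mod r)) ws) =
      signed_sum (above P) (map (\<lambda>x. int (x mod r)) zs) \<Longrightarrow>
      label_rule P (i mod r) (map (\<lambda>x. x mod r) ws) (map (\<lambda>x. x mod r) zs) \<and>
      label_rule P (i div r) (map (\<lambda>x. x div r) ws) (map (\<lambda>x. x div r) zs)"
proof -
  have carry: "(a + i) mod r = a mod r + i mod r \<and> (a + i) div r = a div r + i div r"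
    if "a mod r + i mod r < r" for a
    using that by (metis mod_add_eq mod_less div_add1_eq div_less add.right_neutral)
  have borrow: "b mod r \<le> (b - i) mod r + i mod r \<and>
      (b mod r = (b - i) mod r + i mod r \<longrightarrow> b div r = (b - i) div r + i div r)" if "i \<le> b" for b
  proof -
    have b: "b = (b - i) + i" using that by simp
    have m: "b mod r = ((b - i) mod r + i mod r) mod r"
      by (subst b) (simp add: mod_add_eq)
    have d: "b div r = (b - i) div r + i div r + ((b - i) mod r + i mod r) div r"
      by (subst b) (rule div_add1_eq)
    show ?thesis using m d r by (metis add.right_neutral div_less mod_less_divisor mod_less_eq_dividend)
  qed
  have "signed_sum (below P) (map (\<lambda>x. int (x mod r)) ws) \<le>
      signed_sum (above P) (map (\<lambda>x. int (x mod r)) zs) \<and>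
    (signed_sum (below P) (map (\<lambda>x. int (x mod r)) ws) =
      signed_sum (above P) (map (\<lambda>x. int (x mod r)) zs) \<longrightarrow>
      label_rule P (i mod r) (map (\<lambda>x. x mod r) ws) (map (\<lambda>x. x mod r) zs) \<and>
      label_rule P (i div r) (map (\<lambda>x. x div r) ws) (map (\<lambda>x. x div r) zs))"
  proof (cases "P = PosX \<or> P = NegX")
    case True
    then obtain a b where ab: "i \<le> b" "(P = PosX \<and> ws = [b, a] \<and> zs = [a + i, b - i]) \<or>
        (P = NegX \<and> ws = [a, b] \<and> zs = [b - i, a + i])"
      using label_rule_crossing[OF lr] by blast
    have "a mod r + i mod r < r" using no_carry[OF True] ab(2) by auto
    from carry[OF this] borrow[OF ab(1)] show ?thesis using ab(2) by auto
  next
    case False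
    then show ?thesis using label_rule_crossing[OF lr] by (cases P) auto
  qed
  then show "signed_sum (below P) (map (\<lambda>x. int (x mod r)) ws) \<le>
      signed_sum (above P) (map (\<lambda>x. int (x mod r)) zs)"
    "signed_sum (below P) (map (\<lambda>x. int (x mod r)) ws) =
      signed_sum (above P) (map (\<lambda>x. int (x mod r)) zs) \<Longrightarrow>
      label_rule P (i mod r) (map (\<lambda>x. x mod r) ws) (map (\<lambda>x. x mod r) zs) \<and>
      label_rule P (i div r) (map (\<lambda>x. x div r) ws) (map (\<lambda>x. x div r) zs)"
    by blast+
qed

lemma labelling_digits:
  assumes tg: "tangle_1_1 D" and L: "labelling D i L" and r: "0 < r"
    and no_carry: "\<And>t. t \<in> crossings D \<Longrightarrow> under_label D L t mod r + i t mod r < r"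
  shows "labelling D (\<lambda>t. i t mod r) (map (map (\<lambda>x. x mod r)) L)"
    and "labelling D (\<lambda>t. i t div r) (map (map (\<lambda>x. x div r)) L)"
proof -
  define S where "S t = signed_sum (orient D t) (map (\<lambda>x. int (x mod r)) (L ! t))" for t
  have step: "S t \<le> S (Suc t) \<and> (S t = S (Suc t) \<longrightarrow>
      layer_rule (D ! t) (i t mod r) (map (\<lambda>x. x mod r) (L ! t)) (map (\<lambda>x. x mod r) (L ! Suc t)) \<and>
      layer_rule (D ! t) (i t div r) (map (\<lambda>x. x div r) (L ! t)) (map (\<lambda>x. x div r) (L ! Suc t)))"
    if t: "t < length D" for t
  proof -
    obtain p P where pP: "D ! t = (p, P)" by fastforce
    obtain bs cs where o: "orient D t = bs @ below P @ cs" "orient D (Suc t) = bs @ above P @ cs"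
      "length bs = p" using tangle_layerE[OF tg t pP] .
    have "layer_rule (p, P) (i t) (L ! t) (L ! Suc t)"
      using L t pP unfolding labelling_iff by metis
    then obtain us ws zs vs where *: "L ! t = us @ ws @ vs" "L ! Suc t = us @ zs @ vs" "length us = p"
      "label_rule P (i t) ws zs" unfolding layer_rule.simps by blast
    have len: "length ws = n_in P" "length zs = n_out P" using label_rule_length[OF *(4)] by auto
    have nc: "(if P = PosX then ws ! 1 else ws ! 0) mod r + i t mod r < r" if "P = PosX \<or> P = NegX"
    proof -
      have "t \<in> crossings D" using that t pP by (auto simp: crossings_def)
      moreover have "under_label D L t = (if P = PosX then ws ! 1 else ws ! 0)"
        using that * len by (auto simp: under_label_def pP nth_append)
      ultimately show ?thesis using no_carry[of t] by simp
    qed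
    have S: "S t = signed_sum bs (map (\<lambda>x. int (x mod r)) us) +
          (signed_sum (below P) (map (\<lambda>x. int (x mod r)) ws) + signed_sum cs (map (\<lambda>x. int (x mod r)) vs))"
        "S (Suc t) = signed_sum bs (map (\<lambda>x. int (x mod r)) us) +
          (signed_sum (above P) (map (\<lambda>x. int (x mod r)) zs) + signed_sum cs (map (\<lambda>x. int (x mod r)) vs))"
      using o * len by (simp_all add: S_def signed_sum_append)
    have "S t \<le> S (Suc t)" using label_rule_digits(1)[OF *(4) r nc] S by simp
    moreover have "layer_rule (D ! t) (i t mod r) (map (\<lambda>x. x mod r) (L ! t)) (map (\<lambda>x. x mod r) (L ! Suc t)) \<and>
      layer_rule (D ! t) (i t div r) (map (\<lambda>x. x div r) (L ! t)) (map (\<lambda>x. x div r) (L ! Suc t))"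
      if "S t = S (Suc t)"
    proof -
      have "signed_sum (below P) (map (\<lambda>x. int (x mod r)) ws) =
        signed_sum (above P) (map (\<lambda>x. int (x mod r)) zs)" using that S by simp
      from label_rule_digits(2)[OF *(4) r nc this] show ?thesis
        unfolding pP layer_rule.simps using * by (metis length_map map_append)
    qed
    ultimately show ?thesis by blast
  qed
  \<comment> \<open>The tangle begins and ends with label 0, so the nondecreasing sequence
    \<open>S\<close> is constant and every layer satisfies the equality case.\<close>
  have ends: "S 0 = 0" "S (length D) = 0"
    using L tg by (simp_all add: S_def labelling_def tangle_1_1_def)
  have mono: "s \<le> t \<Longrightarrow> t \<le> length D \<Longrightarrow> S s \<le> S t" for s t
  proof (induction t)
    case (Suc t)
    then show ?case using step[of t] by (cases "s = Suc t") auto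
  qed simp
  have eq: "S t = S (Suc t)" if "t < length D" for t
    using mono[of 0 t] mono[of "Suc t" "length D"] mono[of t "Suc t"] that ends by simp
  show "labelling D (\<lambda>t. i t mod r) (map (map (\<lambda>x. x mod r)) L)"
    "labelling D (\<lambda>t. i t div r) (map (map (\<lambda>x. x div r)) L)"
    using L step eq unfolding labelling_iff by auto
qed

text \<open>The label rules are linear in labels and increments.\<close>

lemma labelling_from_digits:
  assumes L1: "labelling D i1 L1" and L2: "labelling D i2 L2" and tg: "tangle_1_1 D"
  shows "labelling D (\<lambda>t. i1 t + r * i2 t) (map2 (map2 (\<lambda>x y. x + r * y)) L1 L2)"
  unfolding labelling_iff
proof (intro conjI allI impI)
  have len: "length L1 = Suc (length D)" "length L2 = Suc (length D)"
    using L1 L2 by (auto simp: labelling_def)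
  show "length (map2 (map2 (\<lambda>x y. x + r * y)) L1 L2) = Suc (length D)" using len by simp
  show "map2 (map2 (\<lambda>x y. x + r * y)) L1 L2 ! 0 = [0]"
    "map2 (map2 (\<lambda>x y. x + r * y)) L1 L2 ! length D = [0]"
    using L1 L2 len by (simp_all add: labelling_def)
  fix t assume t: "t < length D"
  obtain p P where pP: "D ! t = (p, P)" by fastforce
  have "layer_rule (p, P) (i1 t) (L1 ! t) (L1 ! Suc t)" "layer_rule (p, P) (i2 t) (L2 ! t) (L2 ! Suc t)"
    using L1 L2 t pP unfolding labelling_iff by metis+
  then obtain us ws zs vs us' ws' zs' vs' where
    *: "L1 ! t = us @ ws @ vs" "L1 ! Suc t = us @ zs @ vs" "length us = p" "label_rule P (i1 t) ws zs"
    "L2 ! t = us' @ ws' @ vs'" "L2 ! Suc t = us' @ zs' @ vs'" "length us' = p" "label_rule P (i2 t) ws' zs'"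
    unfolding layer_rule.simps by blast
  have len2: "length ws = n_in P" "length zs = n_out P" "length ws' = n_in P" "length zs' = n_out P"
    using label_rule_length[OF *(4)] label_rule_length[OF *(8)] by auto
  have rule: "label_rule P (i1 t + r * i2 t) (map2 (\<lambda>x y. x + r * y) ws ws') (map2 (\<lambda>x y. x + r * y) zs zs')"
  proof (cases "P = PosX \<or> P = NegX")
    case True
    then show ?thesis using label_rule_crossing(1,2)[OF *(4)] label_rule_crossing(1,2)[OF *(8)]
      by (auto simp: distrib_left dest!: le_Suc_ex)
  next
    case False
    then show ?thesis using label_rule_crossing(3,4)[OF *(4)] label_rule_crossing(3,4)[OF *(8)]
      by (cases P) auto
  qed
  have "map2 (\<lambda>x y. x + r * y) (L1 ! t) (L2 ! t) =
      map2 (\<lambda>x y. x + r * y) us us' @ map2 (\<lambda>x y. x + r * y) ws ws' @ map2 (\<lambda>x y. x + r * y) vs vs'"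
    "map2 (\<lambda>x y. x + r * y) (L1 ! Suc t) (L2 ! Suc t) =
      map2 (\<lambda>x y. x + r * y) us us' @ map2 (\<lambda>x y. x + r * y) zs zs' @ map2 (\<lambda>x y. x + r * y) vs vs'"
    using * len2 by simp_all
  moreover have "length (map2 (\<lambda>x y. x + r * y) us us') = p" using * by simp
  ultimately have "layer_rule (p, P) (i1 t + r * i2 t)
      (map2 (\<lambda>x y. x + r * y) (L1 ! t) (L2 ! t)) (map2 (\<lambda>x y. x + r * y) (L1 ! Suc t) (L2 ! Suc t))"
    unfolding layer_rule.simps using rule by blast
  then show "layer_rule (D ! t) (i1 t + r * i2 t)
      (map2 (map2 (\<lambda>x y. x + r * y)) L1 L2 ! t) (map2 (map2 (\<lambda>x y. x + r * y)) L1 L2 ! Suc t)"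
    using t len by (simp add: pP)
qed

section \<open>Identities behind the R-matrix\<close>

lemma qA_mult: "qA a b * qA c d = qA (a + c) (b + d)"
  by (simp add: qA_def mult_single)

lemma qA_swap: "qA a b * (x * qA c d) = x * qA (a + c) (b + d)"
  by (simp add: qA_mult mult.left_commute[of _ x])

lemma qA_0 [simp]: "qA 0 0 = 1"
  by (simp add: qA_def flip: zero_prod_def)

lemma qA_power: "qA a b ^ n = qA (int n * a) (int n * b)"
  by (induction n) (simp_all add: qA_mult algebra_simps)

text \<open>The symmetric quantum binomial written inside R. The exponent is computed with integers,
  so the recursions below need no care about truncated subtraction.\<close>

definition qb :: "nat \<Rightarrow> nat \<Rightarrow> laurent_qA" where
  "qb n k = qA (- int k * (int n - int k)) 0 * gauss (qA 2 0) n k"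

lemma qbinom_R_eq_qb: "k \<le> n \<Longrightarrow> qbinom_R n k = qb n k"
  by (simp add: qbinom_R_eq qb_def of_nat_diff)

lemma qb_self [simp]: "qb n n = 1"
  by (simp add: qb_def)

lemma qb_Suc:
  "qb (Suc n) (Suc k) = qA (int (Suc k)) 0 * qb n (Suc k) + qA (int k - int n) 0 * qb n k"
  by (simp add: qb_def qA_power qA_mult qA_swap algebra_simps)

lemma qb_Suc':
  assumes "k \<le> n"
  shows "qb (Suc n) (Suc k) = qA (- int (Suc k)) 0 * qb n (Suc k) + qA (int n - int k) 0 * qb n k"
  unfolding qb_def gauss_Suc'[OF assms] using assms
  by (simp add: qA_power qA_mult qA_swap algebra_simps of_nat_diff)

lemma character_first: "character (\<lambda>j::int. Poly_Mapping.single (j, 0::int) (1::int))"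
  by (rule character_comp_left[OF character_single])

text \<open>Arguments that cancel factorials are carried out in the one-variable Laurent ring, a
  domain, and transported along this inclusion.\<close>

lemma gauss_R_eq_image:
  "gauss (qA 2 0) n k = evalL of_int (\<lambda>j. Poly_Mapping.single (j, 0) 1) (gauss (Poly_Mapping.single 2 1) n k)"
proof -
  interpret ringhom "evalL of_int (\<lambda>j::int. Poly_Mapping.single (j, 0::int) (1::int))"
    by (rule ringhom_evalL[OF ringhom_of_int character_first])
  show ?thesis by (simp add: gauss evalL_single qA_def)
qed

lemma single_2_power_neq_1:
  "i \<ge> 1 \<Longrightarrow> Poly_Mapping.single (2::int) (1::int) ^ i \<noteq> 1"
proof
  assume i: "i \<ge> 1" and "Poly_Mapping.single (2::int) (1::int) ^ i = 1"
  then have "Poly_Mapping.lookup (Poly_Mapping.single (int i * 2) (1::int)) 0 = Poly_Mapping.lookup (1 :: laurent_q) 0"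
    by (simp add: single_power)
  then show False using i by (simp add: lookup_single)
qed

lemma gauss_R_product:
  assumes "m \<le> M"
  shows "gauss (qA 2 0) (y + m) m * gauss (qA 2 0) (y + M) (M - m)
    = gauss (qA 2 0) (y + M) M * gauss (qA 2 0) M m"
proof -
  interpret ringhom "evalL of_int (\<lambda>j::int. Poly_Mapping.single (j, 0::int) (1::int))"
    by (rule ringhom_evalL[OF ringhom_of_int character_first])
  show ?thesis
    using gauss_product[OF single_2_power_neq_1 assms, of y]
    by (simp add: gauss_R_eq_image flip: mult)
qed

lemma gauss_symmetric:
  fixes w :: "'a::idom"
  assumes w: "\<And>i. i \<ge> 1 \<Longrightarrow> w ^ i \<noteq> 1" and k: "k \<le> n"
  shows "gauss w n (n - k) = gauss w n k"
proof -
  have nz: "qpoch w n \<noteq> 0" for n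
    using w by (auto simp: qpoch_def)
  have "gauss w n (n - k) * (qpoch w k * qpoch w (n - k)) = gauss w n k * (qpoch w k * qpoch w (n - k))"
    using gauss_qpoch[OF k, of w] gauss_qpoch[of "n - k" n w] k by (simp add: mult.commute)
  then show ?thesis using nz by simp
qed

lemma gauss_R_symmetric: "k \<le> n \<Longrightarrow> gauss (qA 2 0) n (n - k) = gauss (qA 2 0) n k"
  using gauss_symmetric[OF single_2_power_neq_1] by (simp add: gauss_R_eq_image)

lemma qb_product:
  assumes "m \<le> M"
  shows "qb (y + m) m * qb (y + M) (M - m) = qb (y + M) M * qb M m"
proof -
  have *: "qb (y + m) m * qb (y + M) (M - m) =
    qA (- int m * int y - (int M - int m) * (int y + int m)) 0 *
      (gauss (qA 2 0) (y + m) m * gauss (qA 2 0) (y + M) (M - m))"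
    unfolding qb_def using assms
    by (simp add: qA_mult qA_swap algebra_simps of_nat_diff)
  have **: "qb (y + M) M * qb M m =
    qA (- int M * int y - int m * (int M - int m)) 0 * (gauss (qA 2 0) (y + M) M * gauss (qA 2 0) M m)"
    unfolding qb_def by (simp add: qA_mult qA_swap algebra_simps)
  show ?thesis unfolding * ** gauss_R_product[OF assms] by (simp add: algebra_simps)
qed

lemma alpha_brace_add: "alpha_brace k (m + n) = alpha_brace k m * alpha_brace (k - int m) n"
proof -
  have "alpha_brace k (m + n) = alpha_brace k m *
    (\<Prod>i<n. Poly_Mapping.single (k - int (m + i), 1) 1 - Poly_Mapping.single (int (m + i) - k, - 1) 1)"
    unfolding alpha_brace_def by (induction n) (simp_all add: mult.assoc)
  then show ?thesis by (simp add: alpha_brace_def algebra_simps)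
qed

lemma alpha_brace_1: "alpha_brace k (Suc 0) = qA k 1 - qA (- k) (- 1)"
  by (simp add: alpha_brace_def qA_def)

lemma alpha_brace_0 [simp]: "alpha_brace k 0 = 1"
  by (simp add: alpha_brace_def)

lemma alpha_brace_Suc: "alpha_brace k (Suc n) = alpha_brace k n * (qA (k - int n) 1 - qA (int n - k) (- 1))"
  using alpha_brace_add[of k n 1] by (simp add: alpha_brace_1)

lemma alpha_brace_Suc': "alpha_brace k (Suc n) = (qA k 1 - qA (- k) (- 1)) * alpha_brace (k - 1) n"
  using alpha_brace_add[of k 1 n] by (simp add: alpha_brace_1)

text \<open>The coefficient of the divided power of F acting on the basis vector with index y.\<close>

definition fdiv :: "nat \<Rightarrow> nat \<Rightarrow> laurent_qA" where
  "fdiv m y = qbinom_R (y + m) m * alpha_brace (- int y) m"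

lemma fdiv_0 [simp]: "fdiv 0 y = 1"
  by (simp add: fdiv_def qbinom_R_eq_qb qb_def)

lemma label_weight_PosX:
  "label_weight PosX i [b, a] zs =
    fdiv i a * qA (tri i + 2 * (int a + int i) * (int b - int i)) (- int (a + b))"
proof -
  have "qA (tri i) 0 * g * f * qA 0 u * qA v 0 = g * f * qA (tri i + v) u" for f g u v
    using qA_mult[of "tri i" 0 0 u] qA_mult[of "tri i" u v 0] by (simp add: ac_simps)
  then show ?thesis by (simp add: fdiv_def)
qed

lemma label_weight_NegX:
  "label_weight NegX i [a, b] zs =
    (-1) ^ i * fdiv i a * qA (- 2 * int a * int b - tri i) (int (a + b))"
proof -
  have "s * qA (- tri i) 0 * g * f * qA 0 u * qA v 0 = s * (g * f) * qA (- tri i + v) u" for s f g u v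
    using qA_mult[of "- tri i" 0 0 u] qA_mult[of "- tri i" u v 0] by (simp add: ac_simps)
  then show ?thesis by (simp add: fdiv_def)
qed

lemma tri_Suc: "tri (Suc n) = tri n + int n"
proof -
  have "Suc n * (Suc n - 1) div 2 = n * (n - 1) div 2 + n"
    by (cases n) (simp_all add: algebra_simps flip: div_add1_eq)
  then show ?thesis unfolding tri_def by simp
qed

lemma tri_0 [simp]: "tri 0 = 0"
  by (simp add: tri_def)

lemma tri_add: "tri (m + n) = tri m + tri n + int m * int n"
  by (induction n) (simp_all add: tri_Suc algebra_simps)

text \<open>The product rule for divided powers, F^(m) F^(M-m) = binom(M,m) F^(M), read off on a
  basis vector.\<close>

lemma fdiv_mult:
  assumes "m \<le> M"
  shows "fdiv m y * fdiv (M - m) (y + m) = fdiv M y * qb M m"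
proof -
  have "y + m + (M - m) = y + M" "M - m \<le> y + M" using assms by auto
  moreover have "- int (y + m) = - int y - int m" by simp
  ultimately have "fdiv (M - m) (y + m) = qb (y + M) (M - m) * alpha_brace (- int y - int m) (M - m)"
    by (simp only: fdiv_def qbinom_R_eq_qb)
  then have "fdiv m y * fdiv (M - m) (y + m) = (qb (y + m) m * qb (y + M) (M - m)) *
      (alpha_brace (- int y) m * alpha_brace (- int y - int m) (M - m))"
    by (simp add: fdiv_def qbinom_R_eq_qb)
  also have "alpha_brace (- int y) m * alpha_brace (- int y - int m) (M - m) = alpha_brace (- int y) M"
    using alpha_brace_add[of "- int y" m "M - m"] assms by simp
  finally show ?thesis
    unfolding qb_product[OF assms] by (simp add: fdiv_def qbinom_R_eq_qb ac_simps)
qed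

text \<open>Once q^(-\<open>tri M\<close>) is taken out, the first sum is
  \<open>gauss_alternating_sum\<close> at w = q^2. The second is the first one read backwards, by
  the symmetry of the binomials.\<close>

lemma alternating_qb_sum:
  "(\<Sum>m\<le>M. (-1) ^ m * qb M m * qA (tri m - tri (M - m)) 0) = (if M = 0 then 1 else 0)"
  "(\<Sum>m\<le>M. (-1) ^ m * qb M m * qA (tri (M - m) - tri m) 0) = (if M = 0 then 1 else 0)"
proof -
  have term1: "(-1) ^ m * qb M m * qA (tri m - tri (M - m)) 0 =
      qA (- tri M) 0 * ((-1) ^ m * qA 2 0 ^ (m * (m - 1) div 2) * gauss (qA 2 0) M m)" if "m \<le> M" for m
  proof -
    have t: "tri M = tri m + tri (M - m) + int m * (int M - int m)"
      using tri_add[of m "M - m"] that by simp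
    have "qA 2 0 ^ (m * (m - 1) div 2) = qA (2 * tri m) 0"
      unfolding qA_power tri_def by (simp add: mult.commute)
    then have w: "qA 2 0 ^ (m * (m - 1) div 2) = qA (2 * tri m) 0" .
    have "s * (qA u 0 * g) * qA v 0 = s * g * qA (u + v) 0"
      "qA u 0 * (s * qA v 0 * g) = s * g * qA (u + v) 0" for s g u v
      by (simp_all add: ac_simps flip: qA_mult[of _ 0 _ 0, simplified])
    moreover have "- int m * (int M - int m) + (tri m - tri (M - m)) = - tri M + 2 * tri m" using t by simp
    ultimately show ?thesis unfolding w qb_def by (simp only:)
  qed
  have "(\<Sum>m\<le>M. (-1) ^ m * qb M m * qA (tri m - tri (M - m)) 0) =
      qA (- tri M) 0 * (\<Sum>m\<le>M. (-1) ^ m * qA 2 0 ^ (m * (m - 1) div 2) * gauss (qA 2 0) M m)"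
    unfolding sum_distrib_left by (intro sum.cong refl term1) simp
  also have "\<dots> = (if M = 0 then 1 else 0)"
    using gauss_alternating_sum[of "qA 2 0" "M - 1"] by (cases M) simp_all
  finally show 1: "(\<Sum>m\<le>M. (-1) ^ m * qb M m * qA (tri m - tri (M - m)) 0) = (if M = 0 then 1 else 0)" .
  have sgn: "(-1::laurent_qA) ^ (M - m) = (-1) ^ M * (-1) ^ m" if "m \<le> M" for m
    using that by (metis (no_types, lifting) le_add_diff_inverse2 left_minus_one_mult_self mult.commute power_add)
  have sym: "qb M (M - m) = qb M m" if "m \<le> M" for m
    using that gauss_R_symmetric[OF that] by (simp add: qb_def of_nat_diff algebra_simps)
  have "(\<Sum>m\<le>M. (-1) ^ m * qb M m * qA (tri (M - m) - tri m) 0) =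
     (\<Sum>m\<le>M. (-1) ^ (M - m) * qb M (M - m) * qA (tri m - tri (M - m)) 0)"
    by (rule sum.reindex_bij_witness[where i = "\<lambda>m. M - m" and j = "\<lambda>m. M - m"]) auto
  also have "\<dots> = (-1) ^ M * (\<Sum>m\<le>M. (-1) ^ m * qb M m * qA (tri m - tri (M - m)) 0)"
    unfolding sum_distrib_left by (intro sum.cong refl) (simp add: sgn sym mult.assoc)
  also have "\<dots> = (if M = 0 then 1 else 0)" unfolding 1 by simp
  finally show "(\<Sum>m\<le>M. (-1) ^ m * qb M m * qA (tri (M - m) - tri m) 0) = (if M = 0 then 1 else 0)" .
qed

text \<open>By \<open>fdiv_mult\<close> every summand contains \<open>fdiv M y\<close>, the
  monomials in A cancel, and an alternating sum of binomials remains. Thus the two crossings are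
  mutually inverse before any truncation of the label range.\<close>

lemma crossing_weights_inverse:
  assumes "M \<le> x"
  shows "(\<Sum>m\<le>M. label_weight PosX m [x, y] [] * label_weight NegX (M - m) [y + m, x - m] []) =
      (if M = 0 then 1 else 0)"
    and "(\<Sum>m\<le>M. label_weight NegX m [y, x] [] * label_weight PosX (M - m) [x - m, y + m] []) =
      (if M = 0 then 1 else 0)"
proof -
  have sgn: "(-1::laurent_qA) ^ (M - m) = (-1) ^ M * (-1) ^ m" if "m \<le> M" for m
    using that by (metis (no_types, lifting) le_add_diff_inverse2 left_minus_one_mult_self mult.commute power_add)
  have "label_weight PosX m [x, y] [] * label_weight NegX (M - m) [y + m, x - m] [] =
      (-1) ^ M * fdiv M y * ((-1) ^ m * qb M m * qA (tri m - tri (M - m)) 0)" if "m \<le> M" for m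
  proof -
    have *: "qA (tri m + 2 * (int y + int m) * (int x - int m)) (- int (y + x)) *
        qA (- 2 * int (y + m) * int (x - m) - tri (M - m)) (int (y + m + (x - m))) =
        qA (tri m - tri (M - m)) 0"
      unfolding qA_mult using that assms by (simp add: of_nat_diff algebra_simps)
    have "(f1 * p) * (s * f2 * q) = s * (f1 * f2) * (p * q)" for f1 p s f2 q :: laurent_qA
      by (simp only: ac_simps)
    then show ?thesis unfolding label_weight_PosX label_weight_NegX add.commute[of x y] sgn[OF that]
      by (simp only: fdiv_mult[OF that] *) (simp only: ac_simps)
  qed
  then have "(\<Sum>m\<le>M. label_weight PosX m [x, y] [] * label_weight NegX (M - m) [y + m, x - m] []) =
      (-1) ^ M * fdiv M y * (\<Sum>m\<le>M. (-1) ^ m * qb M m * qA (tri m - tri (M - m)) 0)"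
    unfolding sum_distrib_left by (intro sum.cong) simp_all
  then show "(\<Sum>m\<le>M. label_weight PosX m [x, y] [] * label_weight NegX (M - m) [y + m, x - m] []) =
      (if M = 0 then 1 else 0)"
    unfolding alternating_qb_sum by simp
  \<comment> \<open>In this order of the crossings a power q^c is left over; it is 1 for M = 0 and
    multiplies a vanishing sum otherwise.\<close>
  define c where "c = 2 * (int y + int M) * (int x - int M) - 2 * int y * int x"
  have "label_weight NegX m [y, x] [] * label_weight PosX (M - m) [x - m, y + m] [] =
      qA c 0 * fdiv M y * ((-1) ^ m * qb M m * qA (tri (M - m) - tri m) 0)" if "m \<le> M" for m
  proof -
    have *: "qA (- 2 * int y * int x - tri m) (int (y + x)) *
        qA (tri (M - m) + 2 * (int (y + m) + int (M - m)) * (int (x - m) - int (M - m))) (- int (y + m + (x - m))) =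
        qA c 0 * qA (tri (M - m) - tri m) 0"
      unfolding qA_mult using that assms by (simp add: of_nat_diff c_def algebra_simps)
    have "(s * f1 * p) * (f2 * q) = s * (f1 * f2) * (p * q)" for f1 p s f2 q :: laurent_qA
      by (simp only: ac_simps)
    then show ?thesis unfolding label_weight_PosX label_weight_NegX
      by (simp only: fdiv_mult[OF that] *) (simp only: ac_simps)
  qed
  then have "(\<Sum>m\<le>M. label_weight NegX m [y, x] [] * label_weight PosX (M - m) [x - m, y + m] []) =
      qA c 0 * fdiv M y * (\<Sum>m\<le>M. (-1) ^ m * qb M m * qA (tri (M - m) - tri m) 0)"
    unfolding sum_distrib_left by (intro sum.cong) simp_all
  then show "(\<Sum>m\<le>M. label_weight NegX m [y, x] [] * label_weight PosX (M - m) [x - m, y + m] []) =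
      (if M = 0 then 1 else 0)"
    unfolding alternating_qb_sum by (simp add: c_def)
qed

text \<open>The commutator of E with the divided power F^(n+1), which is F^(n) times a combination
  of K and its inverse, evaluated at the basis vector y and scaled by q^n. For y = 0 the term
  containing E v_0 = 0 is absent.\<close>

lemma fdiv_commutator:
  "qA (int n) 0 * (fdiv (Suc n) y - (if y = 0 then 0 else fdiv (Suc n) (y - 1))) =
    fdiv n y * (qA (- 2 * int y) 1 - qA (2 * (int y + int n)) (- 1))"
proof (cases y)
  case 0
  then show ?thesis
    by (simp add: fdiv_def qbinom_R_eq_qb alpha_brace_Suc qA_mult algebra_simps)
next
  case (Suc z)
  define g1 where "g1 = qb (z + n + 1) (Suc n)"
  define g2 where "g2 = qb (z + n + 1) n"
  define a where "a = alpha_brace (- int z - 1) n"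
  have f1: "fdiv (Suc n) y = qb (Suc (z + n + 1)) (Suc n) * (a * (qA (- int z - 1 - int n) 1 - qA (int n + int z + 1) (- 1)))"
  proof -
    have yz: "- int y = - int z - 1" by (simp add: Suc)
    have "alpha_brace (- int y) (Suc n) = a * (qA (- int z - 1 - int n) 1 - qA (int n + int z + 1) (- 1))"
      unfolding alpha_brace_Suc yz a_def by (simp add: algebra_simps)
    moreover have "y + Suc n = Suc (z + n + 1)" by (simp add: Suc)
    ultimately show ?thesis by (simp only: fdiv_def) (simp add: qbinom_R_eq_qb)
  qed
  have f2: "fdiv (Suc n) z = g1 * ((qA (- int z) 1 - qA (int z) (- 1)) * a)"
    by (simp add: fdiv_def qbinom_R_eq_qb alpha_brace_Suc' Suc a_def g1_def algebra_simps)
  have f3: "fdiv n y = g2 * a"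
  proof -
    have yz: "- int y = - int z - 1" by (simp add: Suc)
    show ?thesis unfolding fdiv_def yz a_def g2_def by (simp add: Suc qbinom_R_eq_qb)
  qed
  \<comment> \<open>The two Pascal rules serve the two summands of the last brace: \<open>p1\<close>
    goes with A and \<open>p2\<close> with its inverse. With this choice all contributions of
    \<open>g1\<close> cancel.\<close>
  have p1: "qb (Suc (z + n + 1)) (Suc n) = qA (int n + 1) 0 * g1 + qA (- int z - 1) 0 * g2"
  proof -
    have "int n - int (z + n + 1) = - int z - 1" "int (Suc n) = int n + 1" by simp_all
    then show ?thesis unfolding qb_Suc g1_def g2_def by (simp only:)
  qed
  have nz: "n \<le> z + n + 1" by simp
  have p2: "qb (Suc (z + n + 1)) (Suc n) = qA (- int n - 1) 0 * g1 + qA (int z + 1) 0 * g2"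
  proof -
    have "int (z + n + 1) - int n = int z + 1" "- int (Suc n) = - int n - 1" by simp_all
    then show ?thesis using qb_Suc'[OF nz] unfolding g1_def g2_def by (simp only:)
  qed
  have dist: "(qA a b * g1 + qA c d * g2) * qA e f = qA (a + e) (b + f) * g1 + qA (c + e) (d + f) * g2"
    for a b c d e f by (simp add: algebra_simps flip: qA_mult)
  have e1: "qb (Suc (z + n + 1)) (Suc n) * qA (- int z - 1 - int n) 1 =
      qA (- int z) 1 * g1 + qA (- 2 * int z - 2 - int n) 1 * g2"
    unfolding p1 dist
    by (rule arg_cong2[where f = "(+)"]; (rule arg_cong2[where f = "(*)"], rule arg_cong2[where f = qA], simp_all))
  have e2: "qb (Suc (z + n + 1)) (Suc n) * qA (int n + int z + 1) (- 1) =
      qA (int z) (- 1) * g1 + qA (2 * int z + 2 + int n) (- 1) * g2"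
    unfolding p2 dist
    by (rule arg_cong2[where f = "(+)"]; (rule arg_cong2[where f = "(*)"], rule arg_cong2[where f = qA], simp_all))
  have "fdiv (Suc n) y - fdiv (Suc n) z = a *
      (qb (Suc (z + n + 1)) (Suc n) * qA (- int z - 1 - int n) 1
       - qb (Suc (z + n + 1)) (Suc n) * qA (int n + int z + 1) (- 1)
       - g1 * (qA (- int z) 1 - qA (int z) (- 1)))"
    unfolding f1 f2 by (simp add: algebra_simps)
  also have "\<dots> = a * (qA (- 2 * int z - 2 - int n) 1 * g2 - qA (2 * int z + 2 + int n) (- 1) * g2)"
    unfolding e1 e2 by (simp add: algebra_simps)
  finally have E: "fdiv (Suc n) y - fdiv (Suc n) z =
      a * (qA (- 2 * int z - 2 - int n) 1 * g2 - qA (2 * int z + 2 + int n) (- 1) * g2)" .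
  have c: "int n + (- 2 * int z - 2 - int n) = - 2 * int y" "int n + (2 * int z + 2 + int n) = 2 * (int y + int n)"
    by (simp_all add: Suc)
  have "qA (int n) 0 * (fdiv (Suc n) y - fdiv (Suc n) z) =
     (qA (int n) 0 * qA (- 2 * int z - 2 - int n) 1) * (g2 * a) - (qA (int n) 0 * qA (2 * int z + 2 + int n) (- 1)) * (g2 * a)"
    unfolding E by (simp add: algebra_simps)
  also have "\<dots> = qA (- 2 * int y) 1 * (g2 * a) - qA (2 * (int y + int n)) (- 1) * (g2 * a)"
    unfolding qA_mult c by simp
  finally show ?thesis unfolding f3 by (simp add: Suc algebra_simps)
qed

text \<open>
  Compatibility of the R-matrix with the coproduct E \<mapsto> 1 \<otimes> E + E \<otimes> K, coefficient by coefficient.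
\<close>

lemma PosX_commutes_E:
  assumes "n < x"
  shows "label_weight PosX n [x, y] [] + qA (- 2 * int (x - Suc n)) 1 * label_weight PosX (Suc n) [x, y] [] =
    (if y = 0 then 0 else label_weight PosX (Suc n) [x, y - 1] []) +
    qA (- 2 * int y) 1 * label_weight PosX n [x - 1, y] []"
proof -
  define c where "c = 2 * (int y + int n) * (int x - int n - 1) + tri n"
  define d where "d = 1 - int y - int x"
  have w1: "label_weight PosX n [x, y] [] = qA c d * (fdiv n y * qA (2 * (int y + int n)) (- 1))"
    unfolding label_weight_PosX qA_swap c_def d_def by (simp add: algebra_simps)
  have w2: "qA (- 2 * int (x - Suc n)) 1 * label_weight PosX (Suc n) [x, y] [] =
      qA c d * (fdiv (Suc n) y * qA (int n) 0)"
    unfolding label_weight_PosX qA_swap c_def d_def using assms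
    by (simp add: tri_Suc algebra_simps of_nat_diff)
  have w3: "(if y = 0 then 0 else label_weight PosX (Suc n) [x, y - 1] []) =
      qA c d * ((if y = 0 then 0 else fdiv (Suc n) (y - 1)) * qA (int n) 0)"
    unfolding label_weight_PosX qA_swap c_def d_def
    by (cases y) (simp_all add: tri_Suc algebra_simps)
  have w4: "qA (- 2 * int y) 1 * label_weight PosX n [x - 1, y] [] =
      qA c d * (fdiv n y * qA (- 2 * int y) 1)"
    unfolding label_weight_PosX qA_swap c_def d_def using assms
    by (simp add: algebra_simps of_nat_diff)
  have *: "u + v = w + t" if "v - w = t - u" for u v w t :: laurent_qA
    using that by (simp add: algebra_simps)
  have "fdiv n y * qA (2 * (int y + int n)) (- 1) + fdiv (Suc n) y * qA (int n) 0 =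
      (if y = 0 then 0 else fdiv (Suc n) (y - 1)) * qA (int n) 0 + fdiv n y * qA (- 2 * int y) 1"
    using fdiv_commutator[of n y]
    by (intro *) (simp only: mult.commute[of _ "qA (int n) 0"] flip: right_diff_distrib)
  then show ?thesis unfolding w1 w2 w3 w4 by (simp only: flip: distrib_left)
qed

text \<open>The boundary term of the same compatibility, where nothing is transferred between the
  strands.\<close>

lemma PosX_0_shift:
  "y \<noteq> 0 \<Longrightarrow> qA (- 2 * int x) 1 * label_weight PosX 0 [x, y] [] = label_weight PosX 0 [x, y - 1] []"
  unfolding label_weight_PosX by (cases y) (simp_all add: qA_mult algebra_simps)

section \<open>State sums for the Reshetikhin-Turaev operators\<close>

fun step_ok :: "nat \<Rightarrow> nat \<times> piece \<Rightarrow> nat list \<Rightarrow> nat list \<Rightarrow> bool" where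
  "step_ok d l xs zs \<longleftrightarrow> (\<exists>i. layer_rule l i xs zs) \<and> set zs \<subseteq> {..<d}"

declare step_ok.simps [simp del]

fun paths :: "nat \<Rightarrow> diagram \<Rightarrow> nat list \<Rightarrow> nat list \<Rightarrow> nat list list set" where
  "paths d [] xs ys = (if xs = ys then {[xs]} else {})"
| "paths d (l # D) xs ys = (\<Union>zs\<in>{zs. step_ok d l xs zs}. (#) xs ` paths d D zs ys)"

lemma paths_iff:
  "L \<in> paths d D xs ys \<longleftrightarrow> length L = Suc (length D) \<and> L ! 0 = xs \<and> L ! length D = ys \<and>
     (\<forall>t<length D. step_ok d (D ! t) (L ! t) (L ! Suc t))"
proof (induction D arbitrary: xs L)
  case Nil
  then show ?case by (cases L) auto
next
  case (Cons l D)
  show ?case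
  proof
    assume "L \<in> paths d (l # D) xs ys"
    then obtain zs M where "step_ok d l xs zs" "M \<in> paths d D zs ys" "L = xs # M" by auto
    then show "length L = Suc (length (l # D)) \<and> L ! 0 = xs \<and> L ! length (l # D) = ys \<and>
        (\<forall>t<length (l # D). step_ok d ((l # D) ! t) (L ! t) (L ! Suc t))"
      using Cons.IH[of M zs] by (auto simp: less_Suc_eq_0_disj)
  next
    assume R: "length L = Suc (length (l # D)) \<and> L ! 0 = xs \<and> L ! length (l # D) = ys \<and>
        (\<forall>t<length (l # D). step_ok d ((l # D) ! t) (L ! t) (L ! Suc t))"
    then obtain M where M: "L = xs # M" by (cases L) auto
    have "step_ok d l xs (M ! 0)" using R M by force
    moreover have "M \<in> paths d D (M ! 0) ys" using R unfolding Cons.IH M by auto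
    ultimately show "L \<in> paths d (l # D) xs ys" unfolding M by auto
  qed
qed

definition words :: "nat \<Rightarrow> nat \<Rightarrow> nat list set" where
  "words d n = {zs. length zs = n \<and> set zs \<subseteq> {..<d}}"

lemma finite_words [simp]: "finite (words d n)"
  using finite_lists_length_eq[of "{..<d}" n] by (simp add: words_def conj_commute)

lemma words_0: "words d 0 = {[]}"
  by (auto simp: words_def)

lemma sum_words_2: "(\<Sum>zs\<in>words d (Suc (Suc 0)). f zs) = (\<Sum>(z, w)\<in>{..<d} \<times> {..<d}. f [z, w])"
proof -
  have "words d (Suc (Suc 0)) = (\<lambda>(z, w). [z, w]) ` ({..<d} \<times> {..<d})"
    by (auto simp: words_def length_Suc_conv image_iff)
  moreover have "inj_on (\<lambda>(z, w). [z, w]) ({..<d} \<times> {..<d})" by (auto simp: inj_on_def)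
  ultimately show ?thesis by (simp add: sum.reindex case_prod_unfold)
qed

lemma finite_step_ok: "finite {zs. step_ok d (p, P) xs zs}"
proof (rule finite_subset)
  show "{zs. step_ok d (p, P) xs zs} \<subseteq> words d (length xs + n_out P - n_in P)"
    using layer_rule_length by (fastforce simp: step_ok.simps words_def)
qed simp

lemma finite_paths: "finite (paths d D xs ys)"
proof (induction D arbitrary: xs)
  case (Cons l D)
  then show ?case using finite_step_ok[of d "fst l" "snd l" xs] by auto
qed simp

text \<open>Guarantees that the subtraction \<open>length xs - n_in P\<close> in \<open>RT\<close>
  is never truncated.\<close>

fun fits :: "nat \<Rightarrow> diagram \<Rightarrow> bool" where
  "fits n [] \<longleftrightarrow> True"
| "fits n ((p, P) # D) \<longleftrightarrow> p + n_in P \<le> n \<and> fits (n - n_in P + n_out P) D"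

lemma tangle_fits:
  assumes tg: "tangle_1_1 D"
  shows "t \<le> length D \<Longrightarrow> fits (length (orient D t)) (drop t D)"
proof (induction rule: inc_induct)
  case (step t)
  obtain p P where pP: "D ! t = (p, P)" by fastforce
  obtain us vs where "orient D t = us @ below P @ vs" "orient D (Suc t) = us @ above P @ vs"
    "length us = p" using tangle_layerE[OF tg step(2) pP] .
  then show ?case using step pP by (simp add: Cons_nth_drop_Suc[symmetric] ac_simps)
qed simp

lemma RT_Cons_sum:
  "RT T ((p, P) # D) xs ys =
     (\<Sum>zs\<in>words (dim T) (length xs - n_in P + n_out P). layer_entry T (p, P) xs zs * RT T D zs ys)"
  by (simp add: words_def)

text \<open>The iterated matrix product is expanded over all sequences of basis words; by
  \<open>entry\<close> a sequence violating a label rule contributes 0.\<close>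

lemma RT_paths:
  assumes entry: "\<And>P ws zs. ws \<in> words (dim T) (n_in P) \<Longrightarrow> zs \<in> words (dim T) (n_out P) \<Longrightarrow>
      piece_entry T P ws zs \<noteq> 0 \<Longrightarrow> \<exists>i. label_rule P i ws zs"
  shows "set xs \<subseteq> {..<dim T} \<Longrightarrow> fits (length xs) D \<Longrightarrow>
    RT T D xs ys = (\<Sum>L\<in>paths (dim T) D xs ys. \<Prod>t<length D. layer_entry T (D ! t) (L ! t) (L ! Suc t))"
proof (induction D arbitrary: xs)
  case (Cons l D)
  obtain p P where l: "l = (p, P)" by fastforce
  let ?n = "length xs - n_in P + n_out P"
  have le: "p + n_in P \<le> length xs" using Cons.prems l by simp
  have sub: "{zs. step_ok (dim T) l xs zs} \<subseteq> words (dim T) ?n"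
    using le layer_rule_length unfolding l by (fastforce simp: step_ok.simps words_def)
  have zero: "layer_entry T l xs zs = 0" if zs: "zs \<in> words (dim T) ?n" and nok: "\<not> step_ok (dim T) l xs zs" for zs
  proof (rule ccontr)
    assume ne: "layer_entry T l xs zs \<noteq> 0"
    let ?ws = "take (n_in P) (drop p xs)" and ?zs = "take (n_out P) (drop p zs)"
    have len: "length zs = ?n" "set zs \<subseteq> {..<dim T}" using zs by (auto simp: words_def)
    have e: "take p xs = take p zs" "drop (p + n_in P) xs = drop (p + n_out P) zs"
      "piece_entry T P ?ws ?zs \<noteq> 0"
      using ne unfolding l by (auto split: if_splits)
    have "?ws \<in> words (dim T) (n_in P)" "?zs \<in> words (dim T) (n_out P)"
      using le len Cons.prems(1) by (auto simp: words_def dest!: in_set_takeD in_set_dropD)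
    from entry[OF this e(3)] obtain i where "label_rule P i ?ws ?zs" by blast
    then have "layer_rule l i xs zs" unfolding l layer_rule_iff using e le len by auto
    then show False using nok len by (auto simp: step_ok.simps)
  qed
  have "RT T (l # D) xs ys = (\<Sum>zs\<in>words (dim T) ?n. layer_entry T l xs zs * RT T D zs ys)"
    unfolding l by (rule RT_Cons_sum)
  also have "\<dots> = (\<Sum>zs\<in>{zs. step_ok (dim T) l xs zs}. layer_entry T l xs zs * RT T D zs ys)"
    using sub zero by (intro sum.mono_neutral_right) auto
  also have "\<dots> = (\<Sum>zs\<in>{zs. step_ok (dim T) l xs zs}. \<Sum>L\<in>(#) xs ` paths (dim T) D zs ys.
      \<Prod>t<length (l # D). layer_entry T ((l # D) ! t) (L ! t) (L ! Suc t))"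
  proof (intro sum.cong refl)
    fix zs assume zs: "zs \<in> {zs. step_ok (dim T) l xs zs}"
    have "length zs = ?n" "set zs \<subseteq> {..<dim T}" using zs sub by (auto simp: words_def)
    then have IH: "RT T D zs ys = (\<Sum>L\<in>paths (dim T) D zs ys. \<Prod>t<length D. layer_entry T (D ! t) (L ! t) (L ! Suc t))"
      using Cons.IH[of zs] Cons.prems(2) unfolding l by (simp only: fits.simps)
    have "(\<Sum>L\<in>(#) xs ` paths (dim T) D zs ys. \<Prod>t<length (l # D). layer_entry T ((l # D) ! t) (L ! t) (L ! Suc t))
      = (\<Sum>L\<in>paths (dim T) D zs ys. layer_entry T l xs (L ! 0) * (\<Prod>t<length D. layer_entry T (D ! t) (L ! t) (L ! Suc t)))"
      by (subst sum.reindex) (auto simp: prod.lessThan_Suc_shift simp del: prod.lessThan_Suc)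
    also have "\<dots> = layer_entry T l xs zs * RT T D zs ys"
      unfolding IH sum_distrib_left by (intro sum.cong) (auto simp: paths_iff)
    finally show "layer_entry T l xs zs * RT T D zs ys = (\<Sum>L\<in>(#) xs ` paths (dim T) D zs ys.
      \<Prod>t<length (l # D). layer_entry T ((l # D) ! t) (L ! t) (L ! Suc t))" by simp
  qed
  also have "\<dots> = (\<Sum>L\<in>paths (dim T) (l # D) xs ys.
      \<Prod>t<length (l # D). layer_entry T ((l # D) ! t) (L ! t) (L ! Suc t))"
    unfolding paths.simps
  proof (rule sum.UNION_disjoint[symmetric])
    show "finite {zs. step_ok (dim T) l xs zs}" unfolding l by (rule finite_step_ok)
    show "\<forall>zs\<in>{zs. step_ok (dim T) l xs zs}. finite ((#) xs ` paths (dim T) D zs ys)"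
      by (simp add: finite_paths)
    show "\<forall>i\<in>{zs. step_ok (dim T) l xs zs}. \<forall>j\<in>{zs. step_ok (dim T) l xs zs}. i \<noteq> j \<longrightarrow>
        (#) xs ` paths (dim T) D i ys \<inter> (#) xs ` paths (dim T) D j ys = {}"
      by (auto simp: paths_iff)
  qed
  finally show ?case .
qed simp

definition bounded_indices :: "nat \<Rightarrow> diagram \<Rightarrow> (nat \<Rightarrow> nat) set" where
  "bounded_indices d D = {i \<in> crossings D \<rightarrow>\<^sub>E UNIV. \<exists>L. labelling D i L \<and> (\<forall>t\<le>length D. set (L ! t) \<subseteq> {..<d})}"

lemma label_rule_le:
  "label_rule P i ws zs \<Longrightarrow> P = PosX \<or> P = NegX \<Longrightarrow> set ws \<subseteq> {..<d} \<Longrightarrow> i < d"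
  by (induction P i ws zs rule: label_rule.induct) auto

lemma finite_bounded_indices: "finite (bounded_indices d D)"
proof (rule finite_subset)
  show "bounded_indices d D \<subseteq> crossings D \<rightarrow>\<^sub>E {..<d}"
  proof
    fix i assume "i \<in> bounded_indices d D"
    then obtain L where i: "i \<in> crossings D \<rightarrow>\<^sub>E UNIV" and L: "labelling D i L"
      and b: "\<forall>t\<le>length D. set (L ! t) \<subseteq> {..<d}" by (auto simp: bounded_indices_def)
    have "i t < d" if t: "t \<in> crossings D" for t
    proof -
      have "t < length D" using t by (simp add: crossings_def)
      moreover from this have "set (lower D L t) \<subseteq> {..<d}"
        using b by (meson less_imp_le order_trans set_drop_subset set_take_subset)
      ultimately show ?thesis
        using label_rule_le[OF labelling_rule[OF L]] t by (auto simp: crossings_def)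
    qed
    then show "i \<in> crossings D \<rightarrow>\<^sub>E {..<d}" using i by auto
  qed
  show "finite (crossings D \<rightarrow>\<^sub>E {..<d})"
    by (intro finite_PiE) (simp_all add: crossings_def)
qed

context knot_tangle
begin

lemma label_index_exists:
  assumes L: "labelling D i L"
  shows "labelling D (restrict i (crossings D)) L"
  unfolding labelling_iff
proof (intro conjI allI impI)
  fix t assume t: "t < length D"
  obtain p P where pP: "D ! t = (p, P)" by fastforce
  have "layer_rule (p, P) (i t) (L ! t) (L ! Suc t)" using L t pP unfolding labelling_iff by metis
  then show "layer_rule (D ! t) (restrict i (crossings D) t) (L ! t) (L ! Suc t)"
    using label_rule_no_crossing[of P] t pP
    by (cases "P = PosX \<or> P = NegX") (auto simp: layer_rule_iff crossings_def restrict_def)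
qed (use L in \<open>simp_all add: labelling_def\<close>)

lemma label_index_unique:
  assumes "labelling D i L" "labelling D i' L" "i \<in> crossings D \<rightarrow>\<^sub>E UNIV" "i' \<in> crossings D \<rightarrow>\<^sub>E UNIV"
  shows "i = i'"
proof (rule PiE_ext[OF assms(3,4)])
  fix t assume "t \<in> crossings D"
  then show "i t = i' t"
    using label_rule_unique[OF labelling_rule[OF assms(1)] labelling_rule[OF assms(2)], of t]
    by (auto simp: crossings_def)
qed

lemma paths_eq_labellings:
  assumes "0 < d"
  shows "paths d D [0] [0] = {L. \<exists>i. labelling D i L \<and> (\<forall>t\<le>length D. set (L ! t) \<subseteq> {..<d})}"
proof (rule Set.set_eqI, rule iffI)
  fix L assume "L \<in> paths d D [0] [0]"
  then have *: "length L = Suc (length D)" "L ! 0 = [0]" "L ! length D = [0]"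
    "\<forall>t<length D. step_ok d (D ! t) (L ! t) (L ! Suc t)" by (auto simp: paths_iff)
  then obtain i where "\<forall>t<length D. layer_rule (D ! t) (i t) (L ! t) (L ! Suc t)"
    unfolding step_ok.simps by metis
  then have "labelling D i L" using * by (simp add: labelling_iff)
  moreover have "set (L ! t) \<subseteq> {..<d}" if "t \<le> length D" for t
    using * that assms by (cases t) (auto simp: step_ok.simps Suc_le_eq)
  ultimately show "L \<in> {L. \<exists>i. labelling D i L \<and> (\<forall>t\<le>length D. set (L ! t) \<subseteq> {..<d})}" by blast
next
  fix L assume "L \<in> {L. \<exists>i. labelling D i L \<and> (\<forall>t\<le>length D. set (L ! t) \<subseteq> {..<d})}"
  then show "L \<in> paths d D [0] [0]" by (auto simp: paths_iff labelling_iff step_ok.simps)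
qed

text \<open>In a knot diagram the increments determine the labels by
  \<open>labelling_unique\<close>, and the labels determine the increments at the crossings. So
  sequences of words may be replaced by multi-indices.\<close>

lemma sum_over_paths:
  assumes d: "0 < d" and f: "\<And>i L. labelling D i L \<Longrightarrow> (\<And>t. t \<le> length D \<Longrightarrow> set (L ! t) \<subseteq> {..<d}) \<Longrightarrow> f L = g i"
  shows "(\<Sum>L\<in>paths d D [0] [0]. f L) = (\<Sum>i\<in>bounded_indices d D. g i)"
proof (rule sum.reindex_bij_witness[where
      i = "\<lambda>i. THE L. labelling D i L" and j = "\<lambda>L. THE i. labelling D i L \<and> i \<in> crossings D \<rightarrow>\<^sub>E UNIV"])
  have the: "(THE i. labelling D i L \<and> i \<in> crossings D \<rightarrow>\<^sub>E UNIV) = i"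
    if "labelling D i L" "i \<in> crossings D \<rightarrow>\<^sub>E UNIV" for i L
    using that by (intro the_equality) (auto intro: label_index_unique)
  {
    fix L assume "L \<in> paths d D [0] [0]"
    then obtain i0 where "labelling D i0 L" and b: "\<forall>t\<le>length D. set (L ! t) \<subseteq> {..<d}"
      unfolding paths_eq_labellings[OF d] by blast
    then have i: "labelling D (restrict i0 (crossings D)) L" using label_index_exists by blast
    have e: "restrict i0 (crossings D) \<in> crossings D \<rightarrow>\<^sub>E UNIV" by auto
    show "(THE La. labelling D (THE i. labelling D i L \<and> i \<in> crossings D \<rightarrow>\<^sub>E UNIV) La) = L"
      unfolding the[OF i e] by (rule labelling_the[OF i])
    show "(THE i. labelling D i L \<and> i \<in> crossings D \<rightarrow>\<^sub>E UNIV) \<in> bounded_indices d D"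
      unfolding the[OF i e] using i e b by (auto simp: bounded_indices_def)
    show "g (THE i. labelling D i L \<and> i \<in> crossings D \<rightarrow>\<^sub>E UNIV) = f L"
      unfolding the[OF i e] using f[OF i] b by simp
  next
    fix i assume "i \<in> bounded_indices d D"
    then obtain L where i: "i \<in> crossings D \<rightarrow>\<^sub>E UNIV" and L: "labelling D i L"
      and b: "\<forall>t\<le>length D. set (L ! t) \<subseteq> {..<d}" by (auto simp: bounded_indices_def)
    show "(THE ia. labelling D ia (THE L. labelling D i L) \<and> ia \<in> crossings D \<rightarrow>\<^sub>E UNIV) = i"
      unfolding labelling_the[OF L] by (rule the[OF L i])
    show "(THE L. labelling D i L) \<in> paths d D [0] [0]"
      unfolding labelling_the[OF L] paths_eq_labellings[OF d] using L b by blast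
  }
qed

end

section \<open>Models of the R-matrix\<close>

text \<open>
  Both the colored Jones and the ADO data are images of the universal weights: the R-matrix up to a
  unit \<open>u\<close> (the framing correction), the pivotal element up to a unit \<open>g\<close>.
\<close>

declare label_weight.simps(1-2) [simp del]

locale rt_model = hom: ringhom \<Phi>
  for \<Phi> :: "laurent_qA \<Rightarrow> 'a::comm_ring_1" +
  fixes T :: "'a rt_data" and u ui g gi :: 'a
  assumes units: "u * ui = 1" "g * gi = 1"
    and dim_pos: "0 < dim T"
    and Rmat: "\<And>x y k l. x < dim T \<Longrightarrow> y < dim T \<Longrightarrow> k < dim T \<Longrightarrow> l < dim T \<Longrightarrow>
      Rmat T (x, y) (k, l) = (if k \<le> x \<and> k + l = x + y then u * \<Phi> (label_weight PosX (x - k) [x, y] []) else 0)"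
    and truncation: "\<And>m y. y < dim T \<Longrightarrow> m < dim T \<Longrightarrow> dim T \<le> y + m \<Longrightarrow> \<Phi> (fdiv m y) = 0"
    and piv: "\<And>i. i < dim T \<Longrightarrow> piv T i = g * \<Phi> (qA (- 2 * int i) 1)"
    and piv_inv: "\<And>i. i < dim T \<Longrightarrow> piv_inv T i = gi * \<Phi> (qA (2 * int i) (- 1))"
begin

abbreviation "d \<equiv> dim T"

definition Bas :: "(nat \<times> nat) set" where "Bas = {..<d} \<times> {..<d}"

lemma finite_Bas [simp]: "finite Bas" by (simp add: Bas_def)

lemma sum_Bas_swap: "(\<Sum>(z, w)\<in>Bas. f z w) = (\<Sum>(w, z)\<in>Bas. f z w)"
  unfolding Bas_def sum.cartesian_product[symmetric] by (rule sum.swap)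

text \<open>The R-matrix conserves the sum of the two labels, so its entries are parametrized by the
  amount m moved from the first factor to the second.\<close>

lemma sum_Bas_antidiagonal:
  assumes "x < d"
  shows "(\<Sum>(k, l)\<in>Bas. if k \<le> x \<and> k + l = x + y then f k l else (0::'a)) =
    (\<Sum>m\<le>x. if y + m < d then f (x - m) (y + m) else 0)"
proof -
  have "(\<Sum>(k, l)\<in>Bas. if k \<le> x \<and> k + l = x + y then f k l else (0::'a)) =
    (\<Sum>(k, l)\<in>{(k, l)\<in>Bas. k \<le> x \<and> k + l = x + y}. f k l)"
    by (rule sum.mono_neutral_cong_right) (auto simp: Bas_def split: if_splits)
  also have "\<dots> = (\<Sum>m\<in>{m. m \<le> x \<and> y + m < d}. f (x - m) (y + m))"
    using assms
    by (intro sum.reindex_bij_witness[where i = "\<lambda>m. (x - m, y + m)" and j = "\<lambda>(k, l). x - k"])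
       (auto simp: Bas_def intro!: arg_cong2[where f = f])
  also have "\<dots> = (\<Sum>m\<le>x. if y + m < d then f (x - m) (y + m) else 0)"
    by (rule sum.mono_neutral_cong_left) auto
  finally show ?thesis .
qed

text \<open>The weights of the negative crossing. They list the under-strand first, hence the
  exchanged labels \<open>[y, x]\<close>.\<close>

definition R_inverse :: "nat \<times> nat \<Rightarrow> nat \<times> nat \<Rightarrow> 'a" where
  "R_inverse = (\<lambda>(x, y) (k, l). if k \<le> x \<and> k + l = x + y
     then ui * \<Phi> (label_weight NegX (x - k) [y, x] []) else 0)"

lemma weight_truncation:
  assumes "y < d" "m < d" "d \<le> y + m"
  shows "\<Phi> (label_weight PosX m [x, y] zs) = 0" "\<Phi> (label_weight NegX m [y, x] zs) = 0"
  unfolding label_weight_PosX label_weight_NegX hom.mult truncation[OF assms] by simp_all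

text \<open>Composition of two operators that move label from the first factor to the second. By
  \<open>trunc\<close> an intermediate label beyond the dimension contributes 0, so m runs over the
  full range that \<open>crossing_weights_inverse\<close> expects.\<close>

lemma sum_two_steps:
  assumes x: "x < d" and y: "y < d" and k: "k < d" and l: "l < d"
    and trunc: "\<And>m. m \<le> x \<Longrightarrow> d \<le> y + m \<Longrightarrow> f m = (0::'a)"
  shows "(\<Sum>(a, b)\<in>Bas. (if a \<le> x \<and> a + b = x + y then f (x - a) else 0) *
      (if k \<le> a \<and> k + l = a + b then h a b else 0)) =
    (if k \<le> x \<and> k + l = x + y then \<Sum>m\<le>x - k. f m * h (x - m) (y + m) else 0)"
proof -
  have "(\<Sum>(a, b)\<in>Bas. (if a \<le> x \<and> a + b = x + y then f (x - a) else 0) *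
      (if k \<le> a \<and> k + l = a + b then h a b else 0)) =
    (\<Sum>(a, b)\<in>Bas. if a \<le> x \<and> a + b = x + y then f (x - a) *
      (if k \<le> a \<and> k + l = a + b then h a b else 0) else 0)"
    by (intro sum.cong) auto
  also have "\<dots> = (\<Sum>m\<le>x. if y + m < d then f (x - (x - m)) *
      (if k \<le> x - m \<and> k + l = x - m + (y + m) then h (x - m) (y + m) else 0) else 0)"
    by (rule sum_Bas_antidiagonal[OF x])
  also have "\<dots> = (\<Sum>m\<le>x. if k \<le> x - m \<and> k + l = x + y then f m * h (x - m) (y + m) else 0)"
    using trunc by (intro sum.cong) (auto simp: not_less)
  also have "\<dots> = (if k \<le> x \<and> k + l = x + y then \<Sum>m\<le>x - k. f m * h (x - m) (y + m) else 0)"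
  proof (cases "k \<le> x \<and> k + l = x + y")
    case True
    then have "(\<Sum>m\<le>x. if k \<le> x - m \<and> k + l = x + y then f m * h (x - m) (y + m) else 0) =
        (\<Sum>m\<le>x - k. f m * h (x - m) (y + m))"
      by (intro sum.mono_neutral_cong_right) auto
    then show ?thesis using True by simp
  next
    case False
    then show ?thesis by (intro trans[OF sum.neutral]) auto
  qed
  finally show ?thesis .
qed

lemma R_inverse: "mutually_inverse Bas (Rmat T) R_inverse"
  unfolding mutually_inverse_def
proof (intro ballI conjI)
  fix p q assume "p \<in> Bas" "q \<in> Bas"
  then obtain x y k l where p: "p = (x, y)" and q: "q = (k, l)" and
    b: "x < d" "y < d" "k < d" "l < d" by (auto simp: Bas_def)
  have "(\<Sum>z\<in>Bas. Rmat T p z * R_inverse z q) = (\<Sum>(a, b)\<in>Bas.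
      (if a \<le> x \<and> a + b = x + y then u * \<Phi> (label_weight PosX (x - a) [x, y] []) else 0) *
      (if k \<le> a \<and> k + l = a + b then ui * \<Phi> (label_weight NegX (a - k) [b, a] []) else 0))"
    unfolding p q R_inverse_def using b by (intro sum.cong) (auto simp: Bas_def Rmat)
  also have "\<dots> = (if k \<le> x \<and> k + l = x + y then \<Sum>m\<le>x - k. u * \<Phi> (label_weight PosX m [x, y] []) *
      (ui * \<Phi> (label_weight NegX (x - m - k) [y + m, x - m] [])) else 0)"
    by (rule sum_two_steps[OF b, where f = "\<lambda>m. u * \<Phi> (label_weight PosX m [x, y] [])"
        and h = "\<lambda>a b. ui * \<Phi> (label_weight NegX (a - k) [b, a] [])"])
       (use b weight_truncation in auto)
  also have "\<dots> = (if k \<le> x \<and> k + l = x + y then \<Phi> (\<Sum>m\<le>x - k. label_weight PosX m [x, y] [] *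
      label_weight NegX ((x - k) - m) [y + m, x - m] []) else 0)"
  proof -
    have "u * c * (ui * c') = c * c'" for c c' using units by (metis mult.assoc mult.left_commute mult_1)
    then show ?thesis unfolding hom.sum hom.mult by (simp add: add.commute)
  qed
  also have "\<dots> = (if p = q then 1 else 0)"
    unfolding crossing_weights_inverse(1)[of "x - k" x y, OF diff_le_self] p q by auto
  finally show "(\<Sum>z\<in>Bas. Rmat T p z * R_inverse z q) = (if p = q then 1 else 0)" .
  have "(\<Sum>z\<in>Bas. R_inverse p z * Rmat T z q) = (\<Sum>(a, b)\<in>Bas.
      (if a \<le> x \<and> a + b = x + y then ui * \<Phi> (label_weight NegX (x - a) [y, x] []) else 0) *
      (if k \<le> a \<and> k + l = a + b then u * \<Phi> (label_weight PosX (a - k) [a, b] []) else 0))"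
    unfolding p q R_inverse_def using b by (intro sum.cong) (auto simp: Bas_def Rmat)
  also have "\<dots> = (if k \<le> x \<and> k + l = x + y then \<Sum>m\<le>x - k. ui * \<Phi> (label_weight NegX m [y, x] []) *
      (u * \<Phi> (label_weight PosX (x - m - k) [x - m, y + m] [])) else 0)"
    by (rule sum_two_steps[OF b, where f = "\<lambda>m. ui * \<Phi> (label_weight NegX m [y, x] [])"
        and h = "\<lambda>a b. u * \<Phi> (label_weight PosX (a - k) [a, b] [])"])
       (use b weight_truncation in auto)
  also have "\<dots> = (if k \<le> x \<and> k + l = x + y then \<Phi> (\<Sum>m\<le>x - k. label_weight NegX m [y, x] [] *
      label_weight PosX ((x - k) - m) [x - m, y + m] []) else 0)"
  proof -
    have "ui * c * (u * c') = c * c'" for c c' using units by (metis mult.assoc mult.commute mult_1)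
    then show ?thesis unfolding hom.sum hom.mult by (simp add: add.commute)
  qed
  also have "\<dots> = (if p = q then 1 else 0)"
    unfolding crossing_weights_inverse(2)[of "x - k" x y, OF diff_le_self] p q by auto
  finally show "(\<Sum>z\<in>Bas. R_inverse p z * Rmat T z q) = (if p = q then 1 else 0)" .
qed

lemma Rinv_mutually_inverse: "mutually_inverse Bas (Rmat T) (Rinv T)"
  unfolding Rinv_def Bas_def[symmetric] using R_inverse by (rule someI[of "mutually_inverse Bas (Rmat T)"])

text \<open>\<open>Rinv\<close> is chosen by \<open>SOME\<close> and is arbitrary outside the basis;
  on the basis a left inverse agrees with a right inverse.\<close>

lemma Rinv_eq:
  assumes p: "p \<in> Bas" and q: "q \<in> Bas"
  shows "Rinv T p q = R_inverse p q"
proof -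
  have "Rinv T p q = (\<Sum>w\<in>Bas. Rinv T p w * (if w = q then 1 else 0))"
    using q by (simp add: if_distrib[of "\<lambda>c. _ * c"] sum.delta' cong: if_cong)
  also have "\<dots> = (\<Sum>w\<in>Bas. Rinv T p w * (\<Sum>z\<in>Bas. Rmat T w z * R_inverse z q))"
    using R_inverse q by (intro sum.cong) (auto simp: mutually_inverse_def)
  also have "\<dots> = (\<Sum>z\<in>Bas. (\<Sum>w\<in>Bas. Rinv T p w * Rmat T w z) * R_inverse z q)"
    unfolding sum_distrib_left sum_distrib_right by (subst sum.swap) (simp add: mult.assoc)
  also have "\<dots> = (\<Sum>z\<in>Bas. (if p = z then 1 else 0) * R_inverse z q)"
    using Rinv_mutually_inverse p by (intro sum.cong) (auto simp: mutually_inverse_def)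
  also have "\<dots> = R_inverse p q"
    using p by (simp add: if_distrib[of "\<lambda>c. c * _"] sum.delta cong: if_cong)
  finally show ?thesis .
qed

fun piece_unit :: "piece \<Rightarrow> 'a" where
  "piece_unit PosX = u"
| "piece_unit NegX = ui"
| "piece_unit CapLR = g"
| "piece_unit CupLR = gi"
| "piece_unit _ = 1"

lemma words_cases:
  assumes "ws \<in> words d (n_in P)" "zs \<in> words d (n_out P)"
  shows "(P = PosX \<or> P = NegX) \<and> (\<exists>x y z w. ws = [x, y] \<and> zs = [z, w] \<and> x < d \<and> y < d \<and> z < d \<and> w < d) \<or>
    (P = CapLR \<or> P = CapRL) \<and> (\<exists>x y. ws = [x, y] \<and> zs = [] \<and> x < d \<and> y < d) \<or>
    (P = CupLR \<or> P = CupRL) \<and> (\<exists>z w. ws = [] \<and> zs = [z, w] \<and> z < d \<and> w < d)"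
  using assms by (cases P) (auto simp: words_def length_Suc_conv numeral_2_eq_2)

lemma piece_entry_rule:
  assumes w: "ws \<in> words d (n_in P)" "zs \<in> words d (n_out P)" and r: "label_rule P i ws zs"
  shows "piece_entry T P ws zs = piece_unit P * \<Phi> (label_weight P i ws zs)"
proof -
  from words_cases[OF w] show ?thesis
  proof (elim disjE conjE exE)
    fix x y z w assume a: "P = PosX" "ws = [x, y]" "zs = [z, w]" "x < d" "y < d" "z < d" "w < d"
    have "w \<le> x" "w + z = x + y" "x - w = i" using r a by auto
    then show ?thesis using a Rmat[of x y w z] by (simp add: label_weight_PosX)
  next
    fix x y z w assume a: "P = NegX" "ws = [x, y]" "zs = [z, w]" "x < d" "y < d" "z < d" "w < d"
    have "z \<le> y" "z + w = y + x" "y - z = i" using r a by auto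
    then show ?thesis using a Rinv_eq[of "(y, x)" "(z, w)"]
      by (simp add: label_weight_NegX R_inverse_def Bas_def)
  qed (use r in \<open>auto simp: piv piv_inv\<close>)
qed

lemma piece_entry_nonzero:
  assumes w: "ws \<in> words d (n_in P)" "zs \<in> words d (n_out P)" and r: "piece_entry T P ws zs \<noteq> 0"
  shows "\<exists>i. label_rule P i ws zs"
proof -
  from words_cases[OF w] show ?thesis
  proof (elim disjE conjE exE)
    fix x y z w assume a: "P = PosX" "ws = [x, y]" "zs = [z, w]" "x < d" "y < d" "z < d" "w < d"
    have "w \<le> x" "w + z = x + y" using r a Rmat[of x y w z] by (auto split: if_splits)
    then have "label_rule P (x - w) ws zs" using a by auto
    then show ?thesis ..
  next
    fix x y z w assume a: "P = NegX" "ws = [x, y]" "zs = [z, w]" "x < d" "y < d" "z < d" "w < d"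
    have "z \<le> y" "z + w = y + x" using r a Rinv_eq[of "(y, x)" "(z, w)"]
      by (auto simp: R_inverse_def Bas_def split: if_splits)
    then have "label_rule P (y - z) ws zs" using a by auto
    then show ?thesis ..
  qed (use r in \<open>auto split: if_splits\<close>)
qed

lemma layer_entry_rule:
  assumes r: "layer_rule (p, P) i xs ys" and "set xs \<subseteq> {..<d}" "set ys \<subseteq> {..<d}"
  shows "layer_entry T (p, P) xs ys = piece_unit P *
    \<Phi> (label_weight P i (take (n_in P) (drop p xs)) (take (n_out P) (drop p ys)))"
proof -
  have "take (n_in P) (drop p xs) \<in> words d (n_in P)" "take (n_out P) (drop p ys) \<in> words d (n_out P)"
    using assms by (auto simp: words_def layer_rule_iff dest!: in_set_takeD in_set_dropD)
  then show ?thesis using r piece_entry_rule by (auto simp: layer_rule_iff)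
qed

lemma RT_state_sum:
  assumes "knot_diagram D"
  shows "RT T D [0] [0] = (\<Prod>t<length D. piece_unit (snd (D ! t))) *
    \<Phi> (\<Sum>i\<in>bounded_indices d D. state_term D i)"
proof -
  interpret knot_tangle D by unfold_locales fact
  have "RT T D [0] [0] = (\<Sum>L\<in>paths d D [0] [0]. \<Prod>t<length D. layer_entry T (D ! t) (L ! t) (L ! Suc t))"
    using dim_pos tangle_fits[OF tangle, of 0]
    by (intro RT_paths piece_entry_nonzero) auto
  also have "\<dots> = (\<Sum>i\<in>bounded_indices d D. (\<Prod>t<length D. piece_unit (snd (D ! t))) * \<Phi> (state_term D i))"
  proof (rule sum_over_paths[OF dim_pos])
    fix i L assume L: "labelling D i L" and b: "\<And>t. t \<le> length D \<Longrightarrow> set (L ! t) \<subseteq> {..<d}"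
    have "layer_entry T (D ! t) (L ! t) (L ! Suc t) =
      piece_unit (snd (D ! t)) * \<Phi> (label_weight (snd (D ! t)) (i t) (lower D L t) (upper D L t))"
      if t: "t < length D" for t
    proof -
      have "layer_rule (fst (D ! t), snd (D ! t)) (i t) (L ! t) (L ! Suc t)"
        using L t unfolding labelling_iff by simp
      from layer_entry_rule[OF this] b[of t] b[of "Suc t"] t show ?thesis by simp
    qed
    then show "(\<Prod>t<length D. layer_entry T (D ! t) (L ! t) (L ! Suc t)) =
      (\<Prod>t<length D. piece_unit (snd (D ! t))) * \<Phi> (state_term D i)"
      unfolding state_term_eq[OF L] hom.prod prod.distrib[symmetric] by (intro prod.cong) auto
  qed
  finally show ?thesis by (simp add: hom.sum sum_distrib_left)
qed

subsection \<open>Equivariance\<close>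

text \<open>
  The generator E acts through E \<mapsto> 1 \<otimes> E + E \<otimes> K and, on duals, by minus the transpose of E K^-1.
  As the operators are encoded by their action on the functions \<open>\<psi>\<close> of basis words, so is E.
\<close>

fun K_eigen :: "orientation list \<Rightarrow> nat list \<Rightarrow> 'a" where
  "K_eigen (b # bs) (x # xs) =
     \<Phi> (if b = Up then qA (- 2 * int x) 1 else qA (2 * int x) (- 1)) * K_eigen bs xs"
| "K_eigen _ _ = 1"

fun E_act :: "orientation list \<Rightarrow> (nat list \<Rightarrow> 'a) \<Rightarrow> nat list \<Rightarrow> 'a" where
  "E_act (b # bs) \<psi> (x # xs) = E_act bs (\<lambda>ys. \<psi> (x # ys)) xs + K_eigen bs xs *
     (if b = Up then (if x = 0 then 0 else \<psi> ((x - 1) # xs))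
      else (if Suc x < d then - \<Phi> (qA (2 * int (Suc x)) (- 1)) * \<psi> (Suc x # xs) else 0))"
| "E_act _ _ _ = 0"

lemma K_eigen_append:
  "length bs = length us \<Longrightarrow> K_eigen (bs @ cs) (us @ vs) = K_eigen bs us * K_eigen cs vs"
  by (induction bs us rule: list_induct2) (simp_all add: mult.assoc)

text \<open>Coassociativity for words: E acts on the right block, or on the left block while K acts
  on the right one.\<close>

lemma E_act_append:
  "length bs = length us \<Longrightarrow> length cs = length vs \<Longrightarrow> E_act (bs @ cs) \<psi> (us @ vs) =
    E_act cs (\<lambda>ys. \<psi> (us @ ys)) vs + K_eigen cs vs * E_act bs (\<lambda>ys. \<psi> (ys @ vs)) us"
proof (induction bs us arbitrary: \<psi> rule: list_induct2)
  case (Cons b bs x us)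
  then show ?case by (simp add: K_eigen_append algebra_simps)
qed simp

lemma E_act_cong:
  assumes "length bs = length xs" "set xs \<subseteq> {..<d}"
    and "\<And>ys. length ys = length xs \<Longrightarrow> set ys \<subseteq> {..<d} \<Longrightarrow> \<psi> ys = \<psi>' ys"
  shows "E_act bs \<psi> xs = E_act bs \<psi>' xs"
  using assms
proof (induction bs xs arbitrary: \<psi> \<psi>' rule: list_induct2)
  case (Cons b bs x xs)
  have "E_act bs (\<lambda>ys. \<psi> (x # ys)) xs = E_act bs (\<lambda>ys. \<psi>' (x # ys)) xs"
    using Cons.prems by (intro Cons.IH) auto
  then show ?case using Cons.prems by (auto simp: Cons.prems(2))
qed simp

lemma E_act_sum:
  "E_act bs (\<lambda>ys. \<Sum>z\<in>Z. c z * f z ys) xs = (\<Sum>z\<in>Z. c z * E_act bs (f z) xs)"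
proof (induction bs "\<lambda>ys. \<Sum>z\<in>Z. c z * f z ys" xs arbitrary: f rule: E_act.induct)
  case (1 b bs x xs)
  have "E_act bs (\<lambda>ys. \<Sum>z\<in>Z. c z * f z (x # ys)) xs = (\<Sum>z\<in>Z. c z * E_act bs (\<lambda>ys. f z (x # ys)) xs)"
    by (rule 1) simp
  then show ?case
    by (simp add: sum.distrib distrib_left sum_distrib_left sum_negf mult.left_commute)
qed simp_all

definition piece_op :: "piece \<Rightarrow> (nat list \<Rightarrow> 'a) \<Rightarrow> nat list \<Rightarrow> 'a" where
  "piece_op P \<psi> ws = (\<Sum>zs\<in>words d (n_out P). piece_entry T P ws zs * \<psi> zs)"

lemma piece_op_cong:
  "(\<And>zs. zs \<in> words d (n_out P) \<Longrightarrow> \<psi> zs = \<psi>' zs) \<Longrightarrow> piece_op P \<psi> ws = piece_op P \<psi>' ws"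
  unfolding piece_op_def by (intro sum.cong) auto

lemma E_act_piece_op_below:
  assumes "ws \<in> words d (n_in P)" "\<And>ys. ys \<in> words d (n_in P) \<Longrightarrow> \<psi> ys = \<psi>' ys"
  shows "E_act (below P) \<psi> ws = E_act (below P) \<psi>' ws"
  using assms by (intro E_act_cong) (auto simp: words_def)

lemma PosX_op:
  assumes x: "x < d" and y: "y < d"
  shows "piece_op PosX \<psi> [x, y] = (\<Sum>m\<le>x. u * \<Phi> (label_weight PosX m [x, y] []) * \<psi> [y + m, x - m])"
proof -
  have "piece_op PosX \<psi> [x, y] = (\<Sum>(z, w)\<in>Bas. Rmat T (x, y) (w, z) * \<psi> [z, w])"
    by (simp add: piece_op_def sum_words_2 Bas_def)
  also have "\<dots> = (\<Sum>(w, z)\<in>Bas. Rmat T (x, y) (w, z) * \<psi> [z, w])"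
    by (rule sum_Bas_swap)
  also have "\<dots> = (\<Sum>(w, z)\<in>Bas. if w \<le> x \<and> w + z = x + y then
      u * \<Phi> (label_weight PosX (x - w) [x, y] []) * \<psi> [z, w] else 0)"
    using x y by (intro sum.cong) (auto simp: Bas_def Rmat)
  also have "\<dots> = (\<Sum>m\<le>x. if y + m < d then
      u * \<Phi> (label_weight PosX (x - (x - m)) [x, y] []) * \<psi> [y + m, x - m] else 0)"
    by (rule sum_Bas_antidiagonal[OF x])
  also have "\<dots> = (\<Sum>m\<le>x. u * \<Phi> (label_weight PosX m [x, y] []) * \<psi> [y + m, x - m])"
    using x y weight_truncation(1)[of y _ x "[]"] by (intro sum.cong) auto
  finally show ?thesis .
qed

lemma E_act_two:
  "E_act [Up, Up] \<psi> [x, y] = (if y = 0 then 0 else \<psi> [x, y - 1]) +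
     \<Phi> (qA (- 2 * int y) 1) * (if x = 0 then 0 else \<psi> [x - 1, y])"
  by simp

text \<open>Both sides are expanded in the values \<psi> \<open>[y + m - 1, x - m]\<close>. The
  coefficients agree by \<open>PosX_commutes_E\<close> for m = n + 1 and by
  \<open>PosX_0_shift\<close> for m = 0.\<close>

lemma PosX_equivariant:
  assumes x: "x < d" and y: "y < d"
  shows "piece_op PosX (E_act [Up, Up] \<psi>) [x, y] = E_act [Up, Up] (piece_op PosX \<psi>) [x, y]"
proof -
  define c where "c m x y = u * \<Phi> (label_weight PosX m [x, y] [])" for m x y
  \<comment> \<open>The common basis of the two expansions. Its value 0 at y = m = 0 reflects that E
    kills the highest weight vector.\<close>
  define F where "F m = (if y + m = 0 then 0 else \<psi> [y + m - 1, x - m])" for m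
  have shift: "(\<Sum>m\<le>x. if m < x then f m else 0) = (\<Sum>m\<le>x. if m = 0 then 0 else f (m - 1))" for f :: "nat \<Rightarrow> 'a"
  proof -
    have "(\<Sum>m\<le>x. if m < x then f m else 0) = (\<Sum>m<x. f m)"
      by (rule sum.mono_neutral_cong_right) auto
    also have "\<dots> = (\<Sum>m\<le>x. if m = 0 then 0 else f (m - 1))"
      by (simp add: sum.atMost_shift)
    finally show ?thesis .
  qed
  have "piece_op PosX (E_act [Up, Up] \<psi>) [x, y] = (\<Sum>m\<le>x. c m x y * (
      (if x - m = 0 then 0 else \<psi> [y + m, x - m - 1]) + \<Phi> (qA (- 2 * int (x - m)) 1) * F m))"
    unfolding PosX_op[OF x y] c_def E_act_two F_def by simp
  also have "\<dots> = (\<Sum>m\<le>x. if m < x then c m x y * \<psi> [y + m, x - m - 1] else 0) +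
      (\<Sum>m\<le>x. c m x y * (\<Phi> (qA (- 2 * int (x - m)) 1) * F m))"
    by (simp add: distrib_left sum.distrib if_distrib[of "\<lambda>z. _ * z"] cong: if_cong)
       (auto intro!: sum.cong)
  also have "(\<Sum>m\<le>x. if m < x then c m x y * \<psi> [y + m, x - m - 1] else 0) =
      (\<Sum>m\<le>x. if m = 0 then 0 else c (m - 1) x y * F m)"
    unfolding shift F_def by (intro sum.cong) auto
  also have "(\<Sum>m\<le>x. if m = 0 then 0 else c (m - 1) x y * F m) +
      (\<Sum>m\<le>x. c m x y * (\<Phi> (qA (- 2 * int (x - m)) 1) * F m)) = (\<Sum>m\<le>x.
      ((if m = 0 then 0 else c (m - 1) x y) + \<Phi> (qA (- 2 * int (x - m)) 1) * c m x y) * F m)"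
    unfolding sum.distrib[symmetric] by (intro sum.cong) (auto simp: algebra_simps)
  finally have lhs: "piece_op PosX (E_act [Up, Up] \<psi>) [x, y] = (\<Sum>m\<le>x.
      ((if m = 0 then 0 else c (m - 1) x y) + \<Phi> (qA (- 2 * int (x - m)) 1) * c m x y) * F m)" .
  have "E_act [Up, Up] (piece_op PosX \<psi>) [x, y] =
      (if y = 0 then 0 else \<Sum>m\<le>x. c m x (y - 1) * \<psi> [y - 1 + m, x - m]) +
      \<Phi> (qA (- 2 * int y) 1) * (if x = 0 then 0 else \<Sum>m\<le>x - 1. c m (x - 1) y * \<psi> [y + m, x - 1 - m])"
    unfolding E_act_two c_def using x y by (simp add: PosX_op)
  also have "(if y = 0 then 0 else \<Sum>m\<le>x. c m x (y - 1) * \<psi> [y - 1 + m, x - m]) =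
      (\<Sum>m\<le>x. (if y = 0 then 0 else c m x (y - 1)) * F m)"
    unfolding F_def by (cases y) auto
  also have "(if x = 0 then 0 else \<Sum>m\<le>x - 1. c m (x - 1) y * \<psi> [y + m, x - 1 - m]) =
      (\<Sum>m\<le>x. if m < x then c m (x - 1) y * \<psi> [y + m, x - 1 - m] else 0)"
    by (cases x) (auto simp: less_Suc_eq_le intro!: sum.mono_neutral_cong_left)
  also have "\<dots> = (\<Sum>m\<le>x. if m = 0 then 0 else c (m - 1) (x - 1) y * F m)"
    unfolding shift F_def by (intro sum.cong) auto
  also have "(\<Sum>m\<le>x. (if y = 0 then 0 else c m x (y - 1)) * F m) +
      \<Phi> (qA (- 2 * int y) 1) * (\<Sum>m\<le>x. if m = 0 then 0 else c (m - 1) (x - 1) y * F m) = (\<Sum>m\<le>x.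
      ((if y = 0 then 0 else c m x (y - 1)) + \<Phi> (qA (- 2 * int y) 1) * (if m = 0 then 0 else c (m - 1) (x - 1) y)) * F m)"
    unfolding sum_distrib_left sum.distrib[symmetric] by (intro sum.cong) (auto simp: algebra_simps)
  finally have rhs: "E_act [Up, Up] (piece_op PosX \<psi>) [x, y] = (\<Sum>m\<le>x.
      ((if y = 0 then 0 else c m x (y - 1)) + \<Phi> (qA (- 2 * int y) 1) * (if m = 0 then 0 else c (m - 1) (x - 1) y)) * F m)" .
  show ?thesis unfolding lhs rhs
  proof (intro sum.cong refl)
    fix m assume m: "m \<in> {..x}"
    show "((if m = 0 then 0 else c (m - 1) x y) + \<Phi> (qA (- 2 * int (x - m)) 1) * c m x y) * F m =
      ((if y = 0 then 0 else c m x (y - 1)) + \<Phi> (qA (- 2 * int y) 1) * (if m = 0 then 0 else c (m - 1) (x - 1) y)) * F m"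
    proof (cases m)
      case 0
      show ?thesis
      proof (cases "y = 0")
        case False
        have "\<Phi> (qA (- 2 * int x) 1) * \<Phi> (label_weight PosX 0 [x, y] []) = \<Phi> (label_weight PosX 0 [x, y - 1] [])"
          using PosX_0_shift[OF False, of x] hom.mult by metis
        then show ?thesis using 0 False by (simp add: c_def mult.left_commute)
      qed (simp add: F_def 0)
    next
      case (Suc n)
      have "\<Phi> (label_weight PosX n [x, y] []) + \<Phi> (qA (- 2 * int (x - Suc n)) 1) * \<Phi> (label_weight PosX (Suc n) [x, y] []) =
        (if y = 0 then 0 else \<Phi> (label_weight PosX (Suc n) [x, y - 1] [])) +
        \<Phi> (qA (- 2 * int y) 1) * \<Phi> (label_weight PosX n [x - 1, y] [])"
        using arg_cong[OF PosX_commutes_E[of n x y], of \<Phi>] m Suc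
        by (simp add: hom.add hom.mult if_distrib[of \<Phi>] cong: if_cong)
      from arg_cong[OF this, of "\<lambda>z. u * z"] show ?thesis
        by (simp add: c_def Suc algebra_simps if_distrib[of "\<lambda>z. u * z"] cong: if_cong)
    qed
  qed
qed

lemma crossing_ops_inverse:
  assumes "x < d" "y < d"
  shows "piece_op PosX (piece_op NegX \<psi>) [x, y] = \<psi> [x, y]"
    and "piece_op NegX (piece_op PosX \<psi>) [x, y] = \<psi> [x, y]"
proof -
  have P: "piece_op PosX \<phi> [x, y] = (\<Sum>(w, z)\<in>Bas. Rmat T (x, y) (w, z) * \<phi> [z, w])" for \<phi> x y
    by (subst sum_Bas_swap) (simp add: piece_op_def sum_words_2 Bas_def)
  have N: "piece_op NegX \<phi> [x, y] = (\<Sum>(z, w)\<in>Bas. Rinv T (y, x) (z, w) * \<phi> [z, w])" for \<phi> x y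
    by (simp add: piece_op_def sum_words_2 Bas_def)
  have b: "(x, y) \<in> Bas" "(y, x) \<in> Bas" using assms by (auto simp: Bas_def)
  have "piece_op PosX (piece_op NegX \<psi>) [x, y] =
      (\<Sum>p\<in>Bas. Rmat T (x, y) p * (\<Sum>q\<in>Bas. Rinv T p q * \<psi> [fst q, snd q]))"
    unfolding P N by (simp add: case_prod_unfold)
  also have "\<dots> = (\<Sum>q\<in>Bas. (\<Sum>p\<in>Bas. Rmat T (x, y) p * Rinv T p q) * \<psi> [fst q, snd q])"
    unfolding sum_distrib_left sum_distrib_right by (subst sum.swap) (simp add: mult.assoc)
  also have "\<dots> = (\<Sum>q\<in>Bas. (if (x, y) = q then 1 else 0) * \<psi> [fst q, snd q])"
    using Rinv_mutually_inverse b by (intro sum.cong) (auto simp: mutually_inverse_def)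
  also have "\<dots> = \<psi> [x, y]"
    using b by (simp add: if_distrib[of "\<lambda>c. c * _"] sum.delta cong: if_cong)
  finally show "piece_op PosX (piece_op NegX \<psi>) [x, y] = \<psi> [x, y]" .
  have "piece_op NegX (piece_op PosX \<psi>) [x, y] =
      (\<Sum>p\<in>Bas. Rinv T (y, x) p * (\<Sum>q\<in>Bas. Rmat T p q * \<psi> [snd q, fst q]))"
    unfolding P N by (simp add: case_prod_unfold)
  also have "\<dots> = (\<Sum>q\<in>Bas. (\<Sum>p\<in>Bas. Rinv T (y, x) p * Rmat T p q) * \<psi> [snd q, fst q])"
    unfolding sum_distrib_left sum_distrib_right by (subst sum.swap) (simp add: mult.assoc)
  also have "\<dots> = (\<Sum>q\<in>Bas. (if (y, x) = q then 1 else 0) * \<psi> [snd q, fst q])"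
    using Rinv_mutually_inverse b by (intro sum.cong) (auto simp: mutually_inverse_def)
  also have "\<dots> = \<psi> [x, y]"
    using b by (simp add: if_distrib[of "\<lambda>c. c * _"] sum.delta cong: if_cong)
  finally show "piece_op NegX (piece_op PosX \<psi>) [x, y] = \<psi> [x, y]" .
qed

text \<open>The inverse of an equivariant operator is equivariant: the identity, written as
  \<open>PosX\<close> after \<open>NegX\<close> on functions, is inserted behind E and E is then
  moved across \<open>PosX\<close>.\<close>

lemma NegX_equivariant:
  assumes x: "x < d" and y: "y < d"
  shows "piece_op NegX (E_act [Up, Up] \<psi>) [x, y] = E_act [Up, Up] (piece_op NegX \<psi>) [x, y]"
proof -
  have "piece_op NegX (E_act [Up, Up] \<psi>) [x, y] =
      piece_op NegX (E_act [Up, Up] (piece_op PosX (piece_op NegX \<psi>))) [x, y]"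
  proof (rule piece_op_cong)
    fix zs assume "zs \<in> words d (n_out NegX)"
    then show "E_act [Up, Up] \<psi> zs = E_act [Up, Up] (piece_op PosX (piece_op NegX \<psi>)) zs"
      by (intro E_act_cong)
        (auto simp: words_def numeral_2_eq_2 length_Suc_conv crossing_ops_inverse)
  qed
  also have "\<dots> = piece_op NegX (piece_op PosX (E_act [Up, Up] (piece_op NegX \<psi>))) [x, y]"
  proof (rule piece_op_cong)
    fix zs assume "zs \<in> words d (n_out NegX)"
    then obtain z w where "zs = [z, w]" "z < d" "w < d"
      by (auto simp: words_def numeral_2_eq_2 length_Suc_conv)
    then show "E_act [Up, Up] (piece_op PosX (piece_op NegX \<psi>)) zs =
        piece_op PosX (E_act [Up, Up] (piece_op NegX \<psi>)) zs"
      using PosX_equivariant by simp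
  qed
  also have "\<dots> = E_act [Up, Up] (piece_op NegX \<psi>) [x, y]"
    by (rule crossing_ops_inverse(2)[OF x y])
  finally show ?thesis .
qed

end

context rt_model
begin

lemma \<Phi>_qA_mult: "\<Phi> (qA a b) * \<Phi> (qA c e) = \<Phi> (qA (a + c) (b + e))"
  by (simp add: qA_mult flip: hom.mult)

lemma sum_shift:
  "(\<Sum>z<d. if z = 0 then 0 else f z) = (\<Sum>z<d. if Suc z < d then f (Suc z) else (0::'a))"
proof -
  obtain n where n: "d = Suc n" using dim_pos by (cases d) auto
  have "(\<Sum>z<d. if z = 0 then 0 else f z) = (\<Sum>z<n. f (Suc z))"
    unfolding n by (simp add: sum.lessThan_Suc_shift del: sum.lessThan_Suc)
  also have "\<dots> = (\<Sum>z<d. if Suc z < d then f (Suc z) else 0)"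
    unfolding n by simp
  finally show ?thesis .
qed

text \<open>A cap maps to the trivial representation, where E is 0. Only words with neighbouring
  labels give terms; there are two of them, and they cancel through the ratio of pivotal eigenvalues
  for \<open>CapLR\<close> and through the K of the coproduct for \<open>CapRL\<close>.\<close>

lemma cap_equivariant:
  assumes "P = CapLR \<or> P = CapRL" "x < d" "y < d"
  shows "E_act (below P) (piece_op P \<psi>) [x, y] = 0"
  using assms(1)
proof
  assume P: "P = CapLR"
  have op: "piece_op CapLR \<psi> [a, b] = (if a = b then piv T a else 0) * \<psi> []" for a b
    by (simp add: piece_op_def words_0)
  show ?thesis
  proof (cases "x = Suc y")
    case True
    have "\<Phi> (qA (2 * int (Suc y)) (- 1)) * piv T (Suc y) = \<Phi> (qA (2 * int y) (- 1)) * piv T y"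
      using assms True by (simp add: piv mult.left_commute \<Phi>_qA_mult)
    then show ?thesis using True assms unfolding P
      by (simp add: op flip: mult.assoc)
  qed (use assms in \<open>auto simp: P op\<close>)
next
  assume P: "P = CapRL"
  have op: "piece_op CapRL \<psi> [a, b] = (if a = b then 1 else 0) * \<psi> []" for a b
    by (simp add: piece_op_def words_0)
  show ?thesis
  proof (cases "y = Suc x")
    case True
    have "\<Phi> (qA (- 2 * int y) 1) * \<Phi> (qA (2 * int (Suc x)) (- 1)) = 1"
      unfolding \<Phi>_qA_mult using True by simp
    then show ?thesis using True assms unfolding P
      by (simp add: op flip: mult.assoc)
  qed (use assms in \<open>auto simp: P op\<close>)
qed

text \<open>The vector created by a cup is invariant: its image under E is a difference of two sums
  that are shifts of one another.\<close>

lemma cup_equivariant: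
  assumes "P = CupLR \<or> P = CupRL"
  shows "piece_op P (E_act (above P) \<psi>) [] = 0"
  using assms
proof
  assume P: "P = CupLR"
  have op: "piece_op CupLR \<phi> [] = (\<Sum>z<d. piv_inv T z * \<phi> [z, z])" for \<phi>
    by (simp add: piece_op_def sum_words_2 if_distrib[of "\<lambda>c. c * _"] sum.delta cong: if_cong
        flip: sum.cartesian_product)
  have "piece_op P (E_act (above P) \<psi>) [] = (\<Sum>z<d. piv_inv T z *
      ((if z = 0 then 0 else \<psi> [z, z - 1]) + \<Phi> (qA (- 2 * int z) 1) *
       (if Suc z < d then - \<Phi> (qA (2 * int (Suc z)) (- 1)) * \<psi> [Suc z, z] else 0)))"
    by (simp add: P op)
  also have "\<dots> = (\<Sum>z<d. (if z = 0 then 0 else gi * \<Phi> (qA (2 * int z) (- 1)) * \<psi> [z, z - 1]) -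
      (if Suc z < d then gi * \<Phi> (qA (2 * int (Suc z)) (- 1)) * \<psi> [Suc z, Suc z - 1] else 0))"
  proof (intro sum.cong refl)
    fix z assume "z \<in> {..<d}"
    then have piv': "piv_inv T z = gi * \<Phi> (qA (2 * int z) (- 1))" by (simp add: piv_inv)
    have one: "\<Phi> (qA (2 * int z) (- 1)) * \<Phi> (qA (- 2 * int z) 1) = 1"
      by (simp add: \<Phi>_qA_mult)
    have "gi * k * (a + k' * b) = gi * k * a + gi * b" if "k * k' = 1" for k k' a b :: 'a
      using that by (simp add: distrib_left) (metis mult.assoc mult_1_right)
    from this[OF one] show "piv_inv T z * ((if z = 0 then 0 else \<psi> [z, z - 1]) + \<Phi> (qA (- 2 * int z) 1) *
       (if Suc z < d then - \<Phi> (qA (2 * int (Suc z)) (- 1)) * \<psi> [Suc z, z] else 0)) =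
       (if z = 0 then 0 else gi * \<Phi> (qA (2 * int z) (- 1)) * \<psi> [z, z - 1]) -
      (if Suc z < d then gi * \<Phi> (qA (2 * int (Suc z)) (- 1)) * \<psi> [Suc z, Suc z - 1] else 0)"
      unfolding piv' by (simp add: mult.assoc)
  qed
  also have "\<dots> = 0" unfolding sum_subtractf sum_shift by simp
  finally show ?thesis .
next
  assume P: "P = CupRL"
  have op: "piece_op CupRL \<phi> [] = (\<Sum>z<d. \<phi> [z, z])" for \<phi>
    by (simp add: piece_op_def sum_words_2 if_distrib[of "\<lambda>c. c * _"] sum.delta cong: if_cong
        flip: sum.cartesian_product)
  have "piece_op P (E_act (above P) \<psi>) [] = (\<Sum>z<d.
      (if z = 0 then 0 else \<Phi> (qA (2 * int z) (- 1)) * \<psi> [z - 1, z]) -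
      (if Suc z < d then \<Phi> (qA (2 * int (Suc z)) (- 1)) * \<psi> [Suc z - 1, Suc z] else 0))"
    unfolding P op by (intro sum.cong) auto
  also have "\<dots> = 0" unfolding sum_subtractf sum_shift by simp
  finally show ?thesis .
qed

lemma piece_equivariant:
  assumes "ws \<in> words d (n_in P)"
  shows "piece_op P (E_act (above P) \<psi>) ws = E_act (below P) (piece_op P \<psi>) ws"
proof -
  have zero: "piece_op P (\<lambda>zs. 0) us = 0" for us by (simp add: piece_op_def)
  have "(P = PosX \<or> P = NegX) \<and> (\<exists>x y. ws = [x, y] \<and> x < d \<and> y < d) \<or>
      (P = CapLR \<or> P = CapRL) \<and> (\<exists>x y. ws = [x, y] \<and> x < d \<and> y < d) \<or>
      (P = CupLR \<or> P = CupRL) \<and> ws = []"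
    using assms by (cases P) (auto simp: words_def length_Suc_conv)
  then show ?thesis
  proof (elim disjE conjE exE)
    fix x y assume "P = PosX" "ws = [x, y]" "x < d" "y < d"
    then show ?thesis using PosX_equivariant[of x y \<psi>] by (simp only: below.simps above.simps)
  next
    fix x y assume "P = NegX" "ws = [x, y]" "x < d" "y < d"
    then show ?thesis using NegX_equivariant[of x y \<psi>] by (simp only: below.simps above.simps)
  next
    fix x y assume "P = CapLR" "ws = [x, y]" "x < d" "y < d"
    then show ?thesis using cap_equivariant[of P x y \<psi>] by (simp add: piece_op_def words_0)
  next
    fix x y assume "P = CapRL" "ws = [x, y]" "x < d" "y < d"
    then show ?thesis using cap_equivariant[of P x y \<psi>] by (simp add: piece_op_def words_0)
  qed (use cup_equivariant[of P \<psi>] in auto)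
qed

text \<open>Weights are conserved at every piece. This moves the factor K of the coproduct across a
  layer.\<close>

lemma K_eigen_rule:
  assumes "label_rule P i ws zs"
  shows "K_eigen (above P) zs = K_eigen (below P) ws"
  using label_rule_crossing[OF assms]
  by (cases P) (auto simp: \<Phi>_qA_mult of_nat_diff algebra_simps)

lemma layer_sum:
  assumes "us @ ws @ vs \<in> words d n" "length us = p" "length ws = n_in P"
  shows "(\<Sum>zs\<in>words d (n - n_in P + n_out P). layer_entry T (p, P) (us @ ws @ vs) zs * \<psi> zs) =
    piece_op P (\<lambda>zs. \<psi> (us @ zs @ vs)) ws"
proof -
  let ?f = "\<lambda>zs. us @ zs @ vs"
  have n: "n = p + n_in P + length vs" and b: "set us \<subseteq> {..<d}" "set vs \<subseteq> {..<d}"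
    using assms by (auto simp: words_def)
  have "(\<Sum>zs\<in>words d (n - n_in P + n_out P). layer_entry T (p, P) (us @ ws @ vs) zs * \<psi> zs) =
      (\<Sum>zs\<in>?f ` words d (n_out P). layer_entry T (p, P) (us @ ws @ vs) zs * \<psi> zs)"
  proof (rule sum.mono_neutral_right)
    show "?f ` words d (n_out P) \<subseteq> words d (n - n_in P + n_out P)"
      using assms n b by (auto simp: words_def)
    show "\<forall>zs\<in>words d (n - n_in P + n_out P) - ?f ` words d (n_out P).
        layer_entry T (p, P) (us @ ws @ vs) zs * \<psi> zs = 0"
    proof
      fix zs assume zs: "zs \<in> words d (n - n_in P + n_out P) - ?f ` words d (n_out P)"
      have len: "length zs = p + length vs + n_out P" "set zs \<subseteq> {..<d}" using zs n by (auto simp: words_def)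
      have "\<not> (us = take p zs \<and> vs = drop (p + n_out P) zs)"
      proof
        assume "us = take p zs \<and> vs = drop (p + n_out P) zs"
        moreover have "zs = take p zs @ take (n_out P) (drop p zs) @ drop (p + n_out P) zs"
          by (metis append_take_drop_id drop_drop add.commute)
        ultimately have "zs = ?f (take (n_out P) (drop p zs))" by simp
        moreover have "take (n_out P) (drop p zs) \<in> words d (n_out P)"
          using len by (auto simp: words_def dest!: in_set_takeD in_set_dropD)
        ultimately show False using zs by blast
      qed
      then show "layer_entry T (p, P) (us @ ws @ vs) zs * \<psi> zs = 0" using assms by auto
    qed
  qed simp
  also have "\<dots> = (\<Sum>zs\<in>words d (n_out P). layer_entry T (p, P) (us @ ws @ vs) (?f zs) * \<psi> (?f zs))"
    by (subst sum.reindex) (auto simp: inj_on_def)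
  also have "\<dots> = piece_op P (\<lambda>zs. \<psi> (us @ zs @ vs)) ws"
    unfolding piece_op_def using assms by (intro sum.cong) (auto simp: words_def)
  finally show ?thesis .
qed

text \<open>The coproduct splits E into its actions on the strands to the right of the piece, on the
  piece itself and on the strands to the left. The first commutes with the piece, the second is
  \<open>piece_equivariant\<close>, and the third picks up the weight of the piece, which is
  conserved.\<close>

lemma layer_equivariant:
  assumes xs: "us @ ws @ vs \<in> words d n" and len: "length us = length bs" "length ws = n_in P" "length vs = length cs"
  shows "(\<Sum>zs\<in>words d (n - n_in P + n_out P).
      layer_entry T (length us, P) (us @ ws @ vs) zs * E_act (bs @ above P @ cs) \<psi> zs) =
    E_act (bs @ below P @ cs) (\<lambda>xs. \<Sum>zs\<in>words d (n - n_in P + n_out P). layer_entry T (length us, P) xs zs * \<psi> zs) (us @ ws @ vs)"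
    (is "?L = E_act _ ?M _")
proof -
  have ws: "ws \<in> words d (n_in P)" and us: "set us \<subseteq> {..<d}" and vs: "set vs \<subseteq> {..<d}"
    using xs len by (auto simp: words_def)
  have n: "n = length us + n_in P + length vs" using xs len by (auto simp: words_def)
  have "?L = (\<Sum>zs\<in>words d (n_out P). piece_entry T P ws zs * E_act (bs @ above P @ cs) \<psi> (us @ zs @ vs))"
    unfolding layer_sum[OF xs refl len(2)] piece_op_def ..
  also have "\<dots> = (\<Sum>zs\<in>words d (n_out P). piece_entry T P ws zs * E_act cs (\<lambda>ys. \<psi> (us @ zs @ ys)) vs) +
      K_eigen cs vs * (\<Sum>zs\<in>words d (n_out P). piece_entry T P ws zs * E_act (above P) (\<lambda>ys. \<psi> (us @ ys @ vs)) zs) +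
      K_eigen cs vs * K_eigen (below P) ws * (\<Sum>zs\<in>words d (n_out P). piece_entry T P ws zs * E_act bs (\<lambda>ys. \<psi> (ys @ zs @ vs)) us)"
    unfolding sum_distrib_left sum.distrib[symmetric]
  proof (intro sum.cong refl)
    fix zs assume zs: "zs \<in> words d (n_out P)"
    then have lz: "length zs = n_out P" by (simp add: words_def)
    have E: "E_act (bs @ above P @ cs) \<psi> (us @ zs @ vs) = E_act cs (\<lambda>ys. \<psi> (us @ zs @ ys)) vs +
        K_eigen cs vs * E_act (above P) (\<lambda>ys. \<psi> (us @ ys @ vs)) zs +
        K_eigen (above P) zs * K_eigen cs vs * E_act bs (\<lambda>ys. \<psi> (ys @ zs @ vs)) us"
      using len lz by (simp add: E_act_append K_eigen_append)
    have K: "piece_entry T P ws zs * K_eigen (above P) zs = piece_entry T P ws zs * K_eigen (below P) ws"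
      using piece_entry_nonzero[OF ws zs] K_eigen_rule by fastforce
    show "piece_entry T P ws zs * E_act (bs @ above P @ cs) \<psi> (us @ zs @ vs) =
      piece_entry T P ws zs * E_act cs (\<lambda>ys. \<psi> (us @ zs @ ys)) vs +
      K_eigen cs vs * (piece_entry T P ws zs * E_act (above P) (\<lambda>ys. \<psi> (us @ ys @ vs)) zs) +
      K_eigen cs vs * K_eigen (below P) ws * (piece_entry T P ws zs * E_act bs (\<lambda>ys. \<psi> (ys @ zs @ vs)) us)"
    proof -
      have R: "e * (a + k * b + k' * k * c) = e * a + k * (e * b) + k * (e * k') * c" for e a b c k k' :: 'a
        by (simp add: algebra_simps)
      show ?thesis unfolding E R K by (simp only: ac_simps)
    qed
  qed
  also have "(\<Sum>zs\<in>words d (n_out P). piece_entry T P ws zs * E_act (above P) (\<lambda>ys. \<psi> (us @ ys @ vs)) zs) =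
      E_act (below P) (piece_op P (\<lambda>ys. \<psi> (us @ ys @ vs))) ws"
    using piece_equivariant[OF ws] by (simp add: piece_op_def)
  finally have L: "?L = E_act cs (\<lambda>ys. \<Sum>zs\<in>words d (n_out P). piece_entry T P ws zs * \<psi> (us @ zs @ ys)) vs +
      K_eigen cs vs * E_act (below P) (piece_op P (\<lambda>ys. \<psi> (us @ ys @ vs))) ws +
      K_eigen cs vs * K_eigen (below P) ws *
        E_act bs (\<lambda>ys. \<Sum>zs\<in>words d (n_out P). piece_entry T P ws zs * \<psi> (ys @ zs @ vs)) us"
    unfolding E_act_sum .
  have "E_act (bs @ below P @ cs) ?M (us @ ws @ vs) = E_act cs (\<lambda>ys. ?M (us @ ws @ ys)) vs +
      K_eigen cs vs * E_act (below P) (\<lambda>ys. ?M (us @ ys @ vs)) ws +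
      K_eigen cs vs * K_eigen (below P) ws * E_act bs (\<lambda>ys. ?M (ys @ ws @ vs)) us"
    using len by (simp add: E_act_append K_eigen_append algebra_simps)
  also have "E_act cs (\<lambda>ys. ?M (us @ ws @ ys)) vs =
      E_act cs (\<lambda>ys. \<Sum>zs\<in>words d (n_out P). piece_entry T P ws zs * \<psi> (us @ zs @ ys)) vs"
  proof (rule E_act_cong[OF len(3)[symmetric] vs])
    fix ys :: "nat list" assume ys: "length ys = length vs" "set ys \<subseteq> {..<d}"
    then have "us @ ws @ ys \<in> words d n" using xs by (auto simp: words_def)
    from layer_sum[OF this refl len(2), of \<psi>]
    show "?M (us @ ws @ ys) = (\<Sum>zs\<in>words d (n_out P). piece_entry T P ws zs * \<psi> (us @ zs @ ys))"
      by (simp add: piece_op_def)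
  qed
  also have "E_act bs (\<lambda>ys. ?M (ys @ ws @ vs)) us =
      E_act bs (\<lambda>ys. \<Sum>zs\<in>words d (n_out P). piece_entry T P ws zs * \<psi> (ys @ zs @ vs)) us"
  proof (rule E_act_cong[OF len(1)[symmetric] us])
    fix ys :: "nat list" assume ys: "length ys = length us" "set ys \<subseteq> {..<d}"
    then have "ys @ ws @ vs \<in> words d n" using xs by (auto simp: words_def)
    from layer_sum[OF this ys(1) len(2), of \<psi>]
    show "?M (ys @ ws @ vs) = (\<Sum>zs\<in>words d (n_out P). piece_entry T P ws zs * \<psi> (ys @ zs @ vs))"
      by (simp add: piece_op_def)
  qed
  also have "E_act (below P) (\<lambda>ys. ?M (us @ ys @ vs)) ws =
      E_act (below P) (piece_op P (\<lambda>ys. \<psi> (us @ ys @ vs))) ws"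
  proof (rule E_act_piece_op_below[OF ws])
    fix ys assume ys: "ys \<in> words d (n_in P)"
    then have "us @ ys @ vs \<in> words d n" using xs len by (auto simp: words_def)
    from layer_sum[OF this refl, of P \<psi>] ys
    show "?M (us @ ys @ vs) = piece_op P (\<lambda>ys. \<psi> (us @ ys @ vs)) ys"
      by (simp add: words_def)
  qed
  finally show ?thesis unfolding L ..
qed

text \<open>Since E v_(j+1) = v_j, the coefficient at j + 1 of the output is the coefficient at j
  after applying E. The claim thus says that E may be moved from the top of the tangle to its
  bottom, layer by layer.\<close>

lemma RT_E_act:
  assumes tg: "tangle_1_1 D"
  shows "t \<le> length D \<Longrightarrow> xs \<in> words d (length (orient D t)) \<Longrightarrow>
    RT T (drop t D) xs [Suc j] = E_act (orient D t) (\<lambda>xs. RT T (drop t D) xs [j]) xs"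
proof (induction arbitrary: xs rule: inc_induct)
  case base
  have "orient D (length D) = [Up]" using tg by (simp add: tangle_1_1_def)
  then show ?case using base by (auto simp: words_def length_Suc_conv split: if_splits)
next
  case (step t)
  obtain p P where pP: "D ! t = (p, P)" by fastforce
  obtain bs cs where o: "orient D t = bs @ below P @ cs" "orient D (Suc t) = bs @ above P @ cs"
    "length bs = p" using tangle_layerE[OF tg step(2) pP] .
  define n where "n = length (orient D t)"
  have n': "length (orient D (Suc t)) = n - n_in P + n_out P" by (simp add: n_def o)
  define us where "us = take p xs"
  define ws where "ws = take (n_in P) (drop p xs)"
  define vs where "vs = drop (p + n_in P) xs"
  have xs: "xs = us @ ws @ vs" unfolding us_def ws_def vs_def
    by (metis append_take_drop_id drop_drop add.commute)
  have len: "length us = length bs" "length ws = n_in P" "length vs = length cs"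
    using step.prems o by (auto simp: words_def us_def ws_def vs_def)
  have w: "us @ ws @ vs \<in> words d n" using step.prems xs n_def by simp
  have RT: "RT T (drop t D) ys zs = (\<Sum>y\<in>words d (n - n_in P + n_out P). layer_entry T (length us, P) ys y * RT T (drop (Suc t) D) y zs)"
    if "length ys = n" for ys zs
  proof -
    have "drop t D = (length us, P) # drop (Suc t) D"
      using step(2) pP o len by (simp add: Cons_nth_drop_Suc[symmetric])
    then show ?thesis by (simp only: RT_Cons_sum that)
  qed
  have "RT T (drop t D) xs [Suc j] = (\<Sum>y\<in>words d (n - n_in P + n_out P).
      layer_entry T (length us, P) (us @ ws @ vs) y * E_act (orient D (Suc t)) (\<lambda>xs. RT T (drop (Suc t) D) xs [j]) y)"
    using w step.IH unfolding xs n' by (subst RT) (auto simp: words_def intro!: sum.cong)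
  also have "\<dots> = E_act (orient D t) (\<lambda>xs. \<Sum>zs\<in>words d (n - n_in P + n_out P).
      layer_entry T (length us, P) xs zs * RT T (drop (Suc t) D) zs [j]) (us @ ws @ vs)"
    unfolding o by (rule layer_equivariant[OF w len])
  also have "\<dots> = E_act (orient D t) (\<lambda>xs. RT T (drop t D) xs [j]) xs"
    unfolding xs[symmetric]
  proof (rule E_act_cong)
    show "length (orient D t) = length xs" "set xs \<subseteq> {..<d}" using step.prems by (auto simp: words_def)
    fix ys :: "nat list" assume "length ys = length xs"
    then have "length ys = n" using step.prems by (simp add: words_def n_def)
    from RT[OF this] show "(\<Sum>zs\<in>words d (n - n_in P + n_out P). layer_entry T (length us, P) ys zs * RT T (drop (Suc t) D) zs [j])
      = RT T (drop t D) ys [j]" by simp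
  qed
  finally show ?case .
qed

text \<open>The signed sum of the labels is the same at all heights of a contributing sequence, so
  it is i at the bottom and j at the top.\<close>

lemma RT_lower_zero:
  assumes tg: "tangle_1_1 D" and i: "i < d" and ne: "RT T D [i] [j] \<noteq> 0"
  shows "i = j"
proof -
  have eq: "RT T D [i] [j] = (\<Sum>L\<in>paths d D [i] [j]. \<Prod>t<length D. layer_entry T (D ! t) (L ! t) (L ! Suc t))"
  proof (rule RT_paths)
    show "set [i] \<subseteq> {..<d}" using i by simp
    show "fits (length [i]) D" using tangle_fits[OF tg, of 0] by simp
    show "\<exists>i. label_rule P i ws zs" if "ws \<in> words d (n_in P)" "zs \<in> words d (n_out P)"
      "piece_entry T P ws zs \<noteq> 0" for P ws zs
      using that by (rule piece_entry_nonzero)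
  qed
  have "paths d D [i] [j] \<noteq> {}"
  proof
    assume "paths d D [i] [j] = {}"
    then show False using ne unfolding eq by (simp only: sum.empty simp_thms)
  qed
  then obtain L where "L \<in> paths d D [i] [j]" by blast
  then have L: "length L = Suc (length D)" "L ! 0 = [i]" "L ! length D = [j]"
    "\<forall>t<length D. step_ok d (D ! t) (L ! t) (L ! Suc t)" by (auto simp: paths_iff)
  have "t \<le> length D \<Longrightarrow> length (L ! t) = length (orient D t) \<and>
      signed_sum (orient D t) (map int (L ! t)) = int i" for t
  proof (induction t)
    case (Suc t)
    obtain p P where pP: "D ! t = (p, P)" by fastforce
    have t: "t < length D" using Suc.prems by simp
    obtain k where k: "layer_rule (D ! t) k (L ! t) (L ! Suc t)" using L(4) t by (auto simp: step_ok.simps)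
    have "length (L ! Suc t) = length (orient D (Suc t))"
      using layer_rule_length[of p P k "L ! t" "L ! Suc t"] k pP Suc.IH t tangle_layerE[OF tg t pP]
      by (smt (verit) Suc_leD Suc.prems add_left_cancel add_right_cancel length_append add.commute add.left_commute)
    then show ?case using layer_rule_signed_sum[OF tg t k] Suc by simp
  qed (use L in simp)
  from this[of "length D"] show ?thesis
    using L tg by (simp add: tangle_1_1_def)
qed

text \<open>Conservation of weight makes the operator diagonal, and commuting with E makes
  neighbouring diagonal entries equal.\<close>

theorem RT_acts_by_scalar:
  assumes "knot_diagram D"
  shows "acts_by_scalar T D (RT T D [0] [0])"
proof -
  have tg: "tangle_1_1 D" using assms by (simp add: knot_diagram_def)
  have step: "RT T D [Suc i] [Suc i] = RT T D [i] [i]" if "Suc i < d" for i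
  proof -
    have "RT T (drop 0 D) [Suc i] [Suc i] = E_act (orient D 0) (\<lambda>xs. RT T (drop 0 D) xs [i]) [Suc i]"
      by (rule RT_E_act[OF tg]) (use that in \<open>simp_all add: words_def\<close>)
    then show ?thesis by simp
  qed
  have diag: "i < d \<Longrightarrow> RT T D [i] [i] = RT T D [0] [0]" for i
    by (induction i) (simp_all add: step)
  show ?thesis unfolding acts_by_scalar_def
  proof (intro allI impI)
    fix i j assume i: "i < d"
    show "RT T D [i] [j] = (if i = j then RT T D [0] [0] else 0)"
    proof (cases "i = j")
      case True
      then show ?thesis using diag[OF i] by simp
    next
      case False
      then have "RT T D [i] [j] = 0" using RT_lower_zero[OF tg i] by blast
      then show ?thesis using False by (simp only: if_False)
    qed
  qed
qed

lemma acts_by_scalar_unique: "acts_by_scalar T D c \<Longrightarrow> acts_by_scalar T D c' \<Longrightarrow> c = c'"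
  unfolding acts_by_scalar_def using dim_pos by (metis)

end

section \<open>The colored Jones polynomials as state sums\<close>

text \<open>The divided power of F on the under-strand divides the weight of its crossing. All
  vanishing and all convergence of state sums come from this factor.\<close>

lemma crossing_weight_fdiv:
  assumes L: "labelling D i L" and t: "t \<in> crossings D"
  shows "\<exists>c. label_weight (snd (D ! t)) (i t) (lower D L t) (upper D L t) = fdiv (i t) (under_label D L t) * c"
proof -
  have tl: "t < length D" using t by (simp add: crossings_def)
  obtain p P where pP: "D ! t = (p, P)" by fastforce
  note r = labelling_rule[OF L tl]
  have "layer_rule (p, P) (i t) (L ! t) (L ! Suc t)"
    using L tl pP unfolding labelling_iff by metis
  then have len: "p + n_in P \<le> length (L ! t)" by (simp add: layer_rule_iff)
  have nth: "k < n_in P \<Longrightarrow> lower D L t ! k = L ! t ! (p + k)" for k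
    using len by (simp add: pP)
  have "P = PosX \<or> P = NegX" using t by (auto simp: crossings_def pP)
  then show ?thesis
  proof
    assume P: "P = PosX"
    then obtain a b where ab: "lower D L t = [b, a]"
      using label_rule_crossing(1)[OF r] by (auto simp: pP)
    have "L ! t ! (p + 1) = a" using nth[of 1] P unfolding ab by simp
    then have "under_label D L t = a" using P by (simp add: under_label_def pP)
    then show ?thesis using ab P by (simp add: pP label_weight_PosX) (rule exI, rule refl)
  next
    assume P: "P = NegX"
    then obtain a b where ab: "lower D L t = [a, b]"
      using label_rule_crossing(2)[OF r] by (auto simp: pP)
    have "L ! t ! p = a" using nth[of 0] P unfolding ab by simp
    then have "under_label D L t = a" using P by (simp add: under_label_def pP)
    then show ?thesis using ab P
      by (simp add: pP label_weight_NegX mult.left_commute[of _ "fdiv _ _"] mult.assoc)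
        (rule exI, rule refl)
  qed
qed

lemma state_term_fdiv:
  assumes L: "labelling D i L" and t: "t \<in> crossings D" and k: "knot_diagram D"
  shows "\<exists>c. state_term D i = fdiv (i t) (under_label D L t) * c"
proof -
  interpret knot_tangle D by unfold_locales fact
  have tl: "t < length D" using t by (simp add: crossings_def)
  obtain c where c: "label_weight (snd (D ! t)) (i t) (lower D L t) (upper D L t) = fdiv (i t) (under_label D L t) * c"
    using crossing_weight_fdiv[OF L t] by blast
  have "state_term D i = label_weight (snd (D ! t)) (i t) (lower D L t) (upper D L t) *
      (\<Prod>t\<in>{..<length D} - {t}. label_weight (snd (D ! t)) (i t) (lower D L t) (upper D L t))"
    unfolding state_term_eq[OF L] using tl by (intro prod.remove) auto
  then show ?thesis unfolding c mult.assoc by blast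
qed

lemma state_term_no_labelling: "\<nexists>L. labelling D i L \<Longrightarrow> state_term D i = 0"
  by (simp add: state_term_def)

text \<open>If the labels leave the range below d, then by \<open>labels_less\<close> some
  under-strand jumps from below d to at least d, and the factor \<open>fdiv\<close> of that crossing
  is killed.\<close>

lemma state_term_vanishes:
  assumes hom: "ringhom \<Phi>" and k: "knot_diagram D" and d: "0 < d"
    and vanish: "\<And>t y. t \<in> crossings D \<Longrightarrow> y < d \<Longrightarrow> d \<le> y + i t \<Longrightarrow> \<Phi> (fdiv (i t) y) = 0"
    and i: "i \<in> crossings D \<rightarrow>\<^sub>E UNIV" "i \<notin> bounded_indices d D"
  shows "\<Phi> (state_term D i) = 0"
proof -
  interpret ringhom \<Phi> by fact
  interpret knot_tangle D by unfold_locales fact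
  show ?thesis
  proof (cases "\<exists>L. labelling D i L")
    case True
    then obtain L where L: "labelling D i L" by blast
    then obtain t where "t \<le> length D" "\<not> set (L ! t) \<subseteq> {..<d}"
      using i unfolding bounded_indices_def by blast
    then obtain s where s: "s \<in> crossings D" "under_label D L s < d" "d \<le> under_label D L s + i s"
      using labels_less[OF L d, of t] by (meson not_less)
    then have "\<Phi> (fdiv (i s) (under_label D L s)) = 0" by (rule vanish)
    then show ?thesis using state_term_fdiv[OF L s(1) k] by (auto simp: mult)
  qed (simp add: state_term_no_labelling)
qed

section \<open>The colored Jones data as a specialization at A = q^n\<close>

lemma mat_pow_E:
  "i < d \<Longrightarrow> mat_pow d (E_mat :: nat \<Rightarrow> nat \<Rightarrow> 'a::comm_ring_1) m i k = (if i = k + m then 1 else 0)"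
proof (induction m arbitrary: i)
  case (Suc m)
  show ?case
  proof (cases i)
    case 0
    then show ?thesis by (simp add: E_mat_def)
  next
    case (Suc j)
    have "mat_pow d E_mat (Suc m) i k = (\<Sum>l<d. if l = j then mat_pow d (E_mat :: nat \<Rightarrow> nat \<Rightarrow> 'a) m l k else 0)"
      unfolding mat_pow.simps using Suc by (intro sum.cong) (auto simp: E_mat_def)
    also have "\<dots> = mat_pow d (E_mat :: nat \<Rightarrow> nat \<Rightarrow> 'a) m j k" using Suc.prems Suc by (simp add: sum.delta)
    finally show ?thesis using Suc.IH[of j] Suc.prems Suc by (simp del: mat_pow.simps)
  qed
qed simp

lemma mat_pow_F:
  "j \<le> n \<Longrightarrow> mat_pow (n + 1) (F_mat n) m j l =
    (if l = j + m \<and> l \<le> n then \<Prod>t<m. qint q_gen (j + t + 1) * qint q_gen (n - j - t) else 0)"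
proof (induction m arbitrary: j)
  case (Suc m)
  have "mat_pow (n + 1) (F_mat n) (Suc m) j l = (\<Sum>k<n + 1. if k = Suc j then
      (qint q_gen (j + 1) * qint q_gen (n - j)) * mat_pow (n + 1) (F_mat n) m k l else 0)"
    unfolding mat_pow.simps by (intro sum.cong) (auto simp: F_mat_def)
  also have "\<dots> = (if Suc j \<le> n then (qint q_gen (j + 1) * qint q_gen (n - j)) * mat_pow (n + 1) (F_mat n) m (Suc j) l else 0)"
    by (subst sum.delta) auto
  finally show ?case using Suc.IH[of "Suc j"]
    by (auto simp: prod.lessThan_Suc_shift simp del: prod.lessThan_Suc mat_pow.simps)
qed auto

definition jones_char :: "nat \<Rightarrow> int \<times> int \<Rightarrow> int" where
  "jones_char n = (\<lambda>(k, l). k + int n * l)"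

definition jones_laurent :: "nat \<Rightarrow> laurent_qA \<Rightarrow> laurent_q" where
  "jones_laurent n = evalL of_int (\<lambda>e. Poly_Mapping.single (jones_char n e) 1)"

definition jones_hom :: "nat \<Rightarrow> laurent_qA \<Rightarrow> qfield" where
  "jones_hom n x = laurent_to_field (jones_laurent n x)"

lemma character_jones: "character (\<lambda>e. Poly_Mapping.single (jones_char n e) (1::int))"
  by (auto simp: character_def jones_char_def zero_prod_def mult_single algebra_simps)

lemma ringhom_jones_laurent: "ringhom (jones_laurent n)"
  unfolding jones_laurent_def by (intro ringhom_evalL ringhom_of_int character_jones)

lemma ringhom_jones: "ringhom (jones_hom n)"
  using ringhom_comp[OF ringhom_laurent_to_field ringhom_jones_laurent[of n]]
  by (simp add: jones_hom_def[abs_def])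

lemma jones_laurent_qA: "jones_laurent n (qA k l) = Poly_Mapping.single (k + int n * l) 1"
  by (simp add: jones_laurent_def qA_def evalL_single jones_char_def)

lemma jones_hom_qA: "jones_hom n (qA k l) = q_gen powi (k + int n * l)"
  by (simp add: jones_hom_def jones_laurent_qA laurent_to_field_single)

lemma jones_hom_qbinom: "k \<le> m \<Longrightarrow> jones_hom n (qbinom_R m k) = qbinom q_gen m k"
proof -
  assume k: "k \<le> m"
  interpret ringhom "jones_hom n" by (rule ringhom_jones)
  interpret l: ringhom laurent_to_field by (rule ringhom_laurent_to_field)
  show ?thesis
    unfolding laurent_to_field_qbinom[OF k, symmetric] qbinom_R_eq[OF k]
    by (simp add: mult gauss jones_hom_qA qbinom_laurent_def l.mult l.gauss laurent_to_field_single)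
qed

lemma jones_hom_alpha_brace:
  "jones_hom n (alpha_brace k m) = (\<Prod>t<m. q_gen powi (int n + k - int t) - q_gen powi - (int n + k - int t))"
proof -
  interpret ringhom "jones_hom n" by (rule ringhom_jones)
  show ?thesis
    unfolding alpha_brace_def qA_def[symmetric] prod diff jones_hom_qA
    by (intro prod.cong) (auto simp: algebra_simps)
qed

text \<open>At A = q^n the brace {n - y - t} with t = n - y is zero: no vector lies below the lowest
  weight vector.\<close>

lemma jones_fdiv_zero:
  assumes "y \<le> n" "n < y + m"
  shows "jones_hom n (fdiv m y) = 0"
proof -
  interpret ringhom "jones_hom n" by (rule ringhom_jones)
  have "jones_hom n (alpha_brace (- int y) m) = 0"
    unfolding jones_hom_alpha_brace using assms
    by (intro prod_zero bexI[of _ "n - y"]) (auto simp: of_nat_diff)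
  then show ?thesis by (simp add: fdiv_def mult)
qed

lemma qint_nz: "i \<ge> 1 \<Longrightarrow> qint q_gen i \<noteq> 0"
proof -
  assume i: "i \<ge> 1"
  have b: "qbrace q_gen i \<noteq> 0" if "i \<ge> 1" for i
  proof
    assume "qbrace q_gen i = 0"
    then have "q_gen powi int i * q_gen powi int i = q_gen powi - int i * q_gen powi int i"
      by (simp add: qbrace_def)
    then have "(q_gen^2) ^ i = 1"
      by (simp add: power_int_minus power2_eq_square power_mult_distrib)
    then show False using q_gen_power_neq_1[OF that] by simp
  qed
  show ?thesis using b[OF i] b[of 1] by (simp add: qint_def)
qed

lemma qfact_nz: "qfact q_gen n \<noteq> 0"
  using qint_nz by (simp add: qfact_def)

lemma qfact_add: "qfact q (y + m) = qfact q y * (\<Prod>t<m. qint q (y + t + 1))"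
  by (induction m) (simp_all add: qfact_def mult.assoc)

text \<open>The coefficient {1}^m / [m]! of the R-matrix combines with the matrix entry of F^m: it
  turns [y+1]...[y+m] into a binomial and the factors [n-y-t] into braces.\<close>

lemma jones_fdiv:
  assumes "y + m \<le> n"
  shows "qbrace q_gen 1 ^ m / qfact q_gen m * (\<Prod>t<m. qint q_gen (y + t + 1) * qint q_gen (n - y - t)) =
    jones_hom n (fdiv m y)"
proof -
  interpret ringhom "jones_hom n" by (rule ringhom_jones)
  have b1: "qbrace q_gen 1 \<noteq> 0" using qint_nz[of 1] by (auto simp: qint_def)
  have "jones_hom n (alpha_brace (- int y) m) = (\<Prod>t<m. qbrace q_gen (n - y - t))"
    unfolding jones_hom_alpha_brace qbrace_def
  proof (intro prod.cong refl)
    fix t assume "t \<in> {..<m}"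
    then have "int n + - int y - int t = int (n - y - t)" using assms by simp
    then show "q_gen powi (int n + - int y - int t) - q_gen powi - (int n + - int y - int t) =
        q_gen powi int (n - y - t) - q_gen powi - int (n - y - t)" by (simp only:)
  qed
  also have "\<dots> = qbrace q_gen 1 ^ m * (\<Prod>t<m. qint q_gen (n - y - t))"
    using b1 by (simp add: qint_def prod_dividef)
  finally show ?thesis
    by (simp add: fdiv_def mult jones_hom_qbinom qbinom_def qfact_add qfact_nz prod.distrib)
qed

lemma sqrt_q_double: "sqrt_q powi (2 * k) = q_gen powi k"
  unfolding q_gen_def by (simp add: power_int_mult)

text \<open>The product of two weights is n^2 plus an even number. The first part is the framing
  unit q^(n^2/2), expressed by \<open>sqrt_q\<close>; the second gives the monomial of the positive
  crossing at A = q^n.\<close>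

lemma jones_model:
  "rt_model (jones_hom n) (jones_data n) (sqrt_q powi (int n * int n)) (sqrt_q powi - (int n * int n)) 1 1"
proof -
  interpret ringhom "jones_hom n" by (rule ringhom_jones)
  show ?thesis
  proof unfold_locales
    show "sqrt_q powi (int n * int n) * sqrt_q powi - (int n * int n) = 1"
      by (simp add: power_int_minus)
    show "(1::qfield) * 1 = 1" by simp
    show "0 < dim (jones_data n)" by (simp add: jones_data_def)
    show "piv (jones_data n) i = 1 * jones_hom n (qA (- 2 * int i) 1)" for i
      by (simp add: jones_data_def jones_hom_qA weight_def)
    show "piv_inv (jones_data n) i = 1 * jones_hom n (qA (2 * int i) (- 1))" for i
      by (simp add: jones_data_def jones_hom_qA weight_def)
    show "jones_hom n (fdiv m y) = 0" if "y < dim (jones_data n)" "m < dim (jones_data n)" "dim (jones_data n) \<le> y + m" for m y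
      using that by (intro jones_fdiv_zero) (simp_all add: jones_data_def)
    fix x y k l assume b: "x < dim (jones_data n)" "y < dim (jones_data n)" "k < dim (jones_data n)" "l < dim (jones_data n)"
    then have b': "x \<le> n" "y \<le> n" "k \<le> n" "l \<le> n" by (simp_all add: jones_data_def)
    have e: "Rmat (jones_data n) (x, y) (k, l) = sqrt_q powi (weight n k * weight n l) *
        (\<Sum>m\<le>n. if x = k + m then qbrace q_gen 1 ^ m * q_gen ^ (m * (m - 1) div 2) / qfact q_gen m *
           mat_pow (n + 1) (F_mat n) m y l else 0)"
      using b' by (auto simp: jones_data_def mat_pow_E simp del: mat_pow.simps intro!: sum.cong)
    show "Rmat (jones_data n) (x, y) (k, l) = (if k \<le> x \<and> k + l = x + y
      then sqrt_q powi (int n * int n) * jones_hom n (label_weight PosX (x - k) [x, y] []) else 0)"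
    proof (cases "k \<le> x")
      case False
      then show ?thesis unfolding e by (auto intro!: sum.neutral)
    next
      case True
      define m where "m = x - k"
      have m: "m \<le> n" "x = k + m" using True b' by (auto simp: m_def)
      have "(\<Sum>m\<le>n. if x = k + m then qbrace q_gen 1 ^ m * q_gen ^ (m * (m - 1) div 2) / qfact q_gen m *
           mat_pow (n + 1) (F_mat n) m y l else 0) = (\<Sum>j\<le>n. if j = m then qbrace q_gen 1 ^ j * q_gen ^ (j * (j - 1) div 2) / qfact q_gen j *
           mat_pow (n + 1) (F_mat n) j y l else 0)"
        using m by (intro sum.cong) auto
      also have "\<dots> = qbrace q_gen 1 ^ m * q_gen ^ (m * (m - 1) div 2) / qfact q_gen m * mat_pow (n + 1) (F_mat n) m y l"
        using m by (simp add: sum.delta)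
      finally have e': "Rmat (jones_data n) (x, y) (k, l) = sqrt_q powi (weight n k * weight n l) *
        (qbrace q_gen 1 ^ m * q_gen ^ (m * (m - 1) div 2) / qfact q_gen m * mat_pow (n + 1) (F_mat n) m y l)"
        unfolding e by simp
      show ?thesis
      proof (cases "l = y + m")
        case False
        then show ?thesis unfolding e' mat_pow_F[OF b'(2)] using m by auto
      next
        case l: True
        have "Rmat (jones_data n) (x, y) (k, l) = sqrt_q powi (weight n k * weight n l) * q_gen powi tri m *
            (qbrace q_gen 1 ^ m / qfact q_gen m * (\<Prod>t<m. qint q_gen (y + t + 1) * qint q_gen (n - y - t)))"
          unfolding e' mat_pow_F[OF b'(2)] using l b' by (simp add: tri_def)
        also have "\<dots> = sqrt_q powi (weight n k * weight n l) * q_gen powi tri m * jones_hom n (fdiv m y)"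
          using l b' by (subst jones_fdiv) auto
        also have "sqrt_q powi (weight n k * weight n l) =
            sqrt_q powi (int n * int n) * q_gen powi (2 * int k * int l - int n * (int k + int l))"
        proof -
          have "weight n k * weight n l = int n * int n + 2 * (2 * int k * int l - int n * (int k + int l))"
            by (simp add: weight_def algebra_simps)
          then show ?thesis by (simp add: power_int_add sqrt_q_double del: distrib_left_numeral right_diff_distrib_numeral)
        qed
        also have "sqrt_q powi (int n * int n) * q_gen powi (2 * int k * int l - int n * (int k + int l)) *
            q_gen powi tri m * jones_hom n (fdiv m y) =
            sqrt_q powi (int n * int n) * jones_hom n (label_weight PosX (x - k) [x, y] [])"
        proof -
          have "q_gen powi (2 * int k * int l - int n * (int k + int l)) * q_gen powi tri m =
              jones_hom n (qA (tri m + 2 * (int y + int m) * (int x - int m)) (- int (y + x)))"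
            unfolding jones_hom_qA power_int_add[OF disjI1[OF q_gen_nz], symmetric]
            by (rule arg_cong[where f = "\<lambda>e. q_gen powi e"]) (simp add: m l algebra_simps)
          then show ?thesis unfolding label_weight_PosX m_def[symmetric] mult by (simp add: ac_simps)
        qed
        finally show ?thesis using True l m by simp
      qed
    qed
  qed
qed

lemma dim_jones [simp]: "dim (jones_data n) = Suc n"
  by (simp add: jones_data_def)

text \<open>Additional indices contribute 0 at A = q^n. The freedom in S allows the same finite sum
  to serve as an approximation of the unified invariant. The framing units cancel since zero writhe
  means equally many crossings of each sign.\<close>

theorem colored_jones_eq:
  assumes D: "zero_framed_knot_diagram D"
    and S: "finite S" "bounded_indices (Suc n) D \<subseteq> S" "S \<subseteq> crossings D \<rightarrow>\<^sub>E UNIV"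
  shows "colored_jones D n = jones_laurent n (\<Sum>i\<in>S. state_term D i)"
proof -
  have k: "knot_diagram D" and w: "writhe D = 0" using D by (auto simp: zero_framed_knot_diagram_def)
  let ?u = "sqrt_q powi (int n * int n)" and ?ui = "sqrt_q powi - (int n * int n)"
  interpret rt_model "jones_hom n" "jones_data n" ?u ?ui 1 1 by (rule jones_model)
  have "piece_count D PosX = piece_count D NegX" using w by (simp add: writhe_eq_piece_count)
  then have one: "(\<Prod>t<length D. piece_unit (snd (D ! t))) = 1"
    unfolding prod_pieces using units(1) by (simp flip: power_mult_distrib)
  have "RT (jones_data n) D [0] [0] = jones_hom n (\<Sum>i\<in>bounded_indices (Suc n) D. state_term D i)"
    using RT_state_sum[OF k] by (simp add: one)
  also have "\<dots> = jones_hom n (\<Sum>i\<in>S. state_term D i)"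
    unfolding hom.sum
    using S k jones_fdiv_zero[of _ n]
    by (intro sum.mono_neutral_left) (auto intro!: state_term_vanishes[OF hom.ringhom_axioms, of D "Suc n"])
  finally have c: "acts_by_scalar (jones_data n) D (jones_hom n (\<Sum>i\<in>S. state_term D i))"
    using RT_acts_by_scalar[OF k] by simp
  then have "(THE c. acts_by_scalar (jones_data n) D c) = jones_hom n (\<Sum>i\<in>S. state_term D i)"
    using acts_by_scalar_unique by blast
  then show ?thesis unfolding colored_jones_def jones_hom_def by simp
qed

section \<open>Convergence of the unified invariant\<close>

lemma ring_R_simps [simp]:
  "carrier ring_R = UNIV" "x \<otimes>\<^bsub>ring_R\<^esub> y = x * y" "x \<oplus>\<^bsub>ring_R\<^esub> y = x + y"
  "\<one>\<^bsub>ring_R\<^esub> = 1" "\<zero>\<^bsub>ring_R\<^esub> = 0"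
  by (simp_all add: ring_R_def ring_of_type_algebra_def)

lemma cring_ring_R: "cring ring_R"
  unfolding ring_R_def by (rule cring_from_type_algebra)

lemma ideal_I_R: "ideal (I_R n) ring_R"
proof -
  interpret cring ring_R by (rule cring_ring_R)
  show ?thesis unfolding I_R_def by (rule genideal_ideal) simp
qed

lemma I_R_add: "a \<in> I_R n \<Longrightarrow> b \<in> I_R n \<Longrightarrow> a + b \<in> I_R n"
  using additive_subgroup.a_closed[OF ideal.axioms(1)[OF ideal_I_R]] by fastforce

lemma I_R_mult: "a \<in> I_R n \<Longrightarrow> c * a \<in> I_R n"
  using ideal.I_l_closed[OF ideal_I_R, of a n c] by simp

lemma I_R_0: "0 \<in> I_R n"
  using additive_subgroup.zero_closed[OF ideal.axioms(1)[OF ideal_I_R]] by fastforce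

lemma I_R_diff: "a \<in> I_R n \<Longrightarrow> b \<in> I_R n \<Longrightarrow> a - b \<in> I_R n"
  using I_R_add[of a n "- 1 * b"] I_R_mult[of b n "- 1"] by simp

lemma I_R_sum: "(\<And>i. i \<in> S \<Longrightarrow> f i \<in> I_R n) \<Longrightarrow> (\<Sum>i\<in>S. f i) \<in> I_R n"
  by (induction S rule: infinite_finite_induct) (auto intro: I_R_0 I_R_add)

lemma alpha_brace_in_I_R: "alpha_brace l n \<in> I_R n"
proof -
  interpret cring ring_R by (rule cring_ring_R)
  show ?thesis unfolding I_R_def by (rule subsetD[OF genideal_self]) auto
qed

text \<open>An induction principle for membership in I_n: it is enough to treat the
  generators.\<close>

lemma I_R_subset:
  assumes "0 \<in> J" "\<And>a b. a \<in> J \<Longrightarrow> b \<in> J \<Longrightarrow> a + b \<in> J" "\<And>a c. a \<in> J \<Longrightarrow> c * a \<in> J"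
    "\<And>l. alpha_brace l n \<in> J"
  shows "I_R n \<subseteq> J"
proof -
  interpret cring ring_R by (rule cring_ring_R)
  have "- a \<in> J" if "a \<in> J" for a using assms(3)[OF that, of "- 1"] by simp
  moreover have "a * c \<in> J" if "a \<in> J" for a c
    using assms(3)[OF that, of c] by (simp only: mult.commute)
  moreover have inv: "\<ominus>\<^bsub>ring_R\<^esub> a = - a" for a
    by (rule minus_equality) simp_all
  moreover have "inv\<^bsub>add_monoid ring_R\<^esub> a = - a" for a
    using inv[of a] by (simp add: a_inv_def)
  ultimately have "ideal J ring_R"
    by (intro idealI subgroup.intro ring_axioms)
      (auto intro: assms)
  then show ?thesis unfolding I_R_def using assms(4) by (intro genideal_minimal) auto
qed

lemma I_R_antimono: "m \<le> n \<Longrightarrow> I_R n \<subseteq> I_R m"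
proof (rule I_R_subset)
  fix l assume "m \<le> n"
  then have "alpha_brace l n = alpha_brace l m * alpha_brace (l - int m) (n - m)"
    using alpha_brace_add[of l m "n - m"] by simp
  then show "alpha_brace l n \<in> I_R m"
    using I_R_mult[OF alpha_brace_in_I_R[of l m], of "alpha_brace (l - int m) (n - m)"]
    by (simp only: mult.commute)
qed (auto intro: I_R_0 I_R_add I_R_mult)

lemma coset_I_R: "I_R n +>\<^bsub>ring_R\<^esub> a = {x. x - a \<in> I_R n}"
proof (rule Set.set_eqI)
  fix x
  have "x \<in> I_R n +>\<^bsub>ring_R\<^esub> a \<longleftrightarrow> (\<exists>h\<in>I_R n. x = h + a)"
    by (simp add: a_r_coset_def' )
  also have "\<dots> \<longleftrightarrow> x - a \<in> I_R n" by (metis add_diff_cancel_right' diff_add_cancel)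
  finally show "x \<in> I_R n +>\<^bsub>ring_R\<^esub> a \<longleftrightarrow> x \<in> {x. x - a \<in> I_R n}" by simp
qed

lemma fdiv_in_I_R:
  assumes "n \<le> m"
  shows "fdiv m y \<in> I_R n"
  unfolding fdiv_def using I_R_antimono[OF assms] alpha_brace_in_I_R by (blast intro: I_R_mult)

definition box :: "diagram \<Rightarrow> nat \<Rightarrow> (nat \<Rightarrow> nat) set" where
  "box D n = crossings D \<rightarrow>\<^sub>E {..<n}"

lemma finite_crossings [simp]: "finite (crossings D)"
  by (simp add: crossings_def)

lemma finite_box [simp]: "finite (box D n)"
  unfolding box_def by (intro finite_PiE) simp_all

lemma box_subset: "box D n \<subseteq> crossings D \<rightarrow>\<^sub>E UNIV"
  by (auto simp: box_def)

text \<open>One increment of at least n suffices, since the divided power at that crossing contains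
  a brace product of length at least n.\<close>

lemma state_term_in_I_R:
  assumes "knot_diagram D" "i \<in> crossings D \<rightarrow>\<^sub>E UNIV" "i \<notin> box D n"
  shows "state_term D i \<in> I_R n"
proof (cases "\<exists>L. labelling D i L")
  case True
  then obtain L where L: "labelling D i L" by blast
  obtain t where t: "t \<in> crossings D" "n \<le> i t"
    using assms(2,3) by (auto simp: box_def PiE_iff not_less)
  obtain c where "state_term D i = fdiv (i t) (under_label D L t) * c"
    using state_term_fdiv[OF L t(1) assms(1)] by blast
  then show ?thesis using I_R_mult[OF fdiv_in_I_R[OF t(2)]] by (simp add: mult.commute)
qed (simp add: state_term_no_labelling I_R_0)

definition box_sum :: "diagram \<Rightarrow> nat \<Rightarrow> laurent_qA" where
  "box_sum D n = (\<Sum>i\<in>box D n. state_term D i)"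

lemma sum_minus_box_sum:
  assumes "knot_diagram D" "finite S" "box D n \<subseteq> S" "S \<subseteq> crossings D \<rightarrow>\<^sub>E UNIV"
  shows "(\<Sum>i\<in>S. state_term D i) - box_sum D n \<in> I_R n"
proof -
  have "(\<Sum>i\<in>S. state_term D i) - box_sum D n = (\<Sum>i\<in>S - box D n. state_term D i)"
    unfolding box_sum_def by (rule sum_diff[OF assms(2,3), symmetric])
  also have "\<dots> \<in> I_R n"
    using assms by (intro I_R_sum state_term_in_I_R) auto
  finally show ?thesis .
qed

lemma box_mono: "m \<le> n \<Longrightarrow> box D m \<subseteq> box D n"
  unfolding box_def by (intro PiE_mono) auto

text \<open>Terms outside \<open>box D n\<close> lie in I_n, so all finite sums over larger sets
  have the same coset. The limit is unique because two eventual values are attained at a common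
  finite set.\<close>

lemma unified_invariant_eq:
  assumes D: "knot_diagram D"
  shows "unified_invariant D n = {x. x - box_sum D n \<in> I_R n}"
proof -
  define u where "u n = {x. x - box_sum D n \<in> I_R n}" for n
  have conv: "(\<forall>\<^sub>F S in finite_subsets_at_top (crossings D \<rightarrow>\<^sub>E UNIV).
      to_completion ring_R I_R (\<Sum>i\<in>S. state_term D i) n = u n)" for n
    unfolding eventually_finite_subsets_at_top
  proof (intro exI[of _ "box D n"] conjI allI impI)
    fix S assume "finite S \<and> box D n \<subseteq> S \<and> S \<subseteq> crossings D \<rightarrow>\<^sub>E UNIV"
    then have d: "(\<Sum>i\<in>S. state_term D i) - box_sum D n \<in> I_R n"
      using sum_minus_box_sum[OF D] by blast
    have "x - (\<Sum>i\<in>S. state_term D i) \<in> I_R n \<longleftrightarrow> x - box_sum D n \<in> I_R n" for x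
      using I_R_add[OF _ d, of "x - (\<Sum>i\<in>S. state_term D i)"] I_R_diff[OF _ d, of "x - box_sum D n"] by auto
    then show "to_completion ring_R I_R (\<Sum>i\<in>S. state_term D i) n = u n"
      unfolding to_completion_def coset_I_R u_def by simp
  qed (use box_subset[of D n] in auto)
  have "unified_invariant D = u"
    unfolding unified_invariant_def
  proof (rule the_equality)
    have "u n \<in> carrier (ring_R Quot I_R n)" for n
      unfolding u_def coset_I_R[symmetric] by (auto simp: FactRing_def A_RCOSETS_def')
    moreover have "u (Suc n) \<subseteq> u n" for n
    proof
      fix x assume "x \<in> u (Suc n)"
      then have "x - box_sum D (Suc n) \<in> I_R n" using I_R_antimono[of n "Suc n"] by (auto simp: u_def)
      moreover have "box_sum D (Suc n) - box_sum D n \<in> I_R n"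
        using sum_minus_box_sum[OF D finite_box box_mono[of n "Suc n"] box_subset]
        by (simp add: box_sum_def)
      ultimately show "x \<in> u n" using I_R_add unfolding u_def by fastforce
    qed
    ultimately show "u \<in> carrier R_hat \<and> (\<forall>n. \<forall>\<^sub>F S in finite_subsets_at_top (crossings D \<rightarrow>\<^sub>E UNIV).
        to_completion ring_R I_R (\<Sum>i\<in>S. state_term D i) n = u n)"
      using conv by (simp add: R_hat_def completion_def)
  next
    fix x assume x: "x \<in> carrier R_hat \<and> (\<forall>n. \<forall>\<^sub>F S in finite_subsets_at_top (crossings D \<rightarrow>\<^sub>E UNIV).
        to_completion ring_R I_R (\<Sum>i\<in>S. state_term D i) n = x n)"
    show "x = u"
    proof
      fix n
      have "\<forall>\<^sub>F S in finite_subsets_at_top (crossings D \<rightarrow>\<^sub>E UNIV).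
        to_completion ring_R I_R (\<Sum>i\<in>S. state_term D i) n = x n \<and>
        to_completion ring_R I_R (\<Sum>i\<in>S. state_term D i) n = u n"
        using x conv[of n] by (auto intro: eventually_conj)
      then show "x n = u n"
        using eventually_happens'[OF finite_subsets_at_top_neq_bot] by fastforce
    qed
  qed
  then show ?thesis by (simp add: u_def)
qed

section \<open>Power series with vanishing low coefficients\<close>

text \<open>The ideal generated by h^n.\<close>

definition low :: "nat \<Rightarrow> 'a::comm_ring_1 fps set" where
  "low n = {f. \<forall>m<n. fps_nth f m = 0}"

lemma low_0: "0 \<in> low n"
  by (simp add: low_def)

lemma low_add: "f \<in> low n \<Longrightarrow> g \<in> low n \<Longrightarrow> f + g \<in> low n"
  by (simp add: low_def)

lemma low_diff: "f \<in> low n \<Longrightarrow> g \<in> low n \<Longrightarrow> f - g \<in> low n"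
  by (simp add: low_def)

lemma low_mult_low: "f \<in> low m \<Longrightarrow> g \<in> low n \<Longrightarrow> f * g \<in> low (m + n)"
proof -
  assume f: "f \<in> low m" and g: "g \<in> low n"
  have "fps_nth (f * g) k = 0" if k: "k < m + n" for k
    unfolding fps_mult_nth
  proof (intro sum.neutral ballI)
    fix i assume "i \<in> {0..k}"
    then have "i < m \<or> k - i < n" using k by auto
    then show "fps_nth f i * fps_nth g (k - i) = 0" using f g by (auto simp: low_def)
  qed
  then show ?thesis by (simp add: low_def)
qed

lemma low_mult: "g \<in> low n \<Longrightarrow> f * g \<in> low n"
  using low_mult_low[of f 0 g n] by (simp add: low_def)

lemma low_sum: "(\<And>i. i \<in> S \<Longrightarrow> f i \<in> low n) \<Longrightarrow> (\<Sum>i\<in>S. f i) \<in> low n"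
  by (induction S rule: infinite_finite_induct) (auto intro: low_0 low_add)

lemma I_R_to_low:
  assumes "ringhom \<Phi>" "\<And>l. \<Phi> (alpha_brace l n) \<in> low k" "a \<in> I_R n"
  shows "\<Phi> a \<in> low k"
proof -
  interpret ringhom \<Phi> by fact
  have "I_R n \<subseteq> {a. \<Phi> a \<in> low k}"
    by (rule I_R_subset) (auto simp: add mult assms(2) intro: low_0 low_add low_mult)
  then show ?thesis using assms(3) by blast
qed

section \<open>Specialization of the coefficients\<close>

definition ev :: "'a::comm_ring_1 \<Rightarrow> 'a poly fps \<Rightarrow> 'a fps" where
  "ev x f = Abs_fps (\<lambda>m. poly (fps_nth f m) x)"

lemma ev_nth [simp]: "fps_nth (ev x f) m = poly (fps_nth f m) x"
  by (simp add: ev_def)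

lemma ringhom_ev: "ringhom (ev x)"
proof
  show "ev x 1 = 1" by (rule fps_ext) (simp add: fps_one_nth)
  show "ev x (f + g) = ev x f + ev x g" for f g by (rule fps_ext) simp
  show "ev x (f * g) = ev x f * ev x g" for f g
    by (rule fps_ext) (simp add: fps_mult_nth poly_sum)
qed

lemma ev_low: "f \<in> low n \<Longrightarrow> ev x f \<in> low n"
  by (simp add: low_def)

text \<open>Each coefficient is a polynomial with infinitely many zeros. Both parts of the result
  are obtained from this interpolation.\<close>

lemma low_if_ev_low:
  fixes f :: "'a::field_char_0 poly fps"
  assumes "infinite A" "\<And>x. x \<in> A \<Longrightarrow> ev x f \<in> low n"
  shows "f \<in> low n"
proof -
  have "fps_nth f m = 0" if m: "m < n" for m
  proof (rule ccontr)
    assume "fps_nth f m \<noteq> 0"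
    then have "finite {x. poly (fps_nth f m) x = 0}" by (rule poly_roots_finite)
    moreover have "A \<subseteq> {x. poly (fps_nth f m) x = 0}" using assms(2) m by (auto simp: low_def)
    ultimately show False using assms(1) finite_subset by blast
  qed
  then show ?thesis by (simp add: low_def)
qed

lemma zero_if_all_low: "(\<And>n. f \<in> low n) \<Longrightarrow> f = 0"
  by (rule fps_ext) (auto simp: low_def)

lemma fps_poly_eqI:
  fixes f g :: "'a::field_char_0 poly fps"
  assumes "\<And>x. ev x f = ev x g"
  shows "f = g"
proof -
  interpret ringhom "ev x" for x :: 'a by (rule ringhom_ev)
  have "f - g \<in> low n" for n
    by (rule low_if_ev_low[OF infinite_UNIV_char_0]) (simp add: diff assms low_0)
  then show ?thesis using zero_if_all_low by fastforce
qed

text \<open>The series e^(c h) over any field of characteristic 0: rational for the unified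
  invariant, complex near the root of unity.\<close>

definition exps :: "'a::field_char_0 poly \<Rightarrow> 'a poly fps" where
  "exps c = Abs_fps (\<lambda>m. smult (1 / fact m) (c ^ m))"

lemma exp_h_eq: "exp_h = exps"
  by (simp add: fun_eq_iff exp_h_def exps_def)

lemma ev_exps: "ev x (exps c) = fps_exp (poly c x)"
  by (rule fps_ext) (simp add: exps_def)

lemma exps_add: "exps (c + e) = exps c * exps e"
proof (rule fps_poly_eqI)
  fix x :: 'a
  interpret ringhom "ev x" by (rule ringhom_ev)
  show "ev x (exps (c + e)) = ev x (exps c * exps e)"
    by (simp add: mult ev_exps fps_exp_add_mult)
qed

lemma exps_0: "exps 0 = 1"
proof (rule fps_poly_eqI)
  fix x :: 'a
  interpret ringhom "ev x" by (rule ringhom_ev)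
  show "ev x (exps 0) = ev x 1" by (simp add: ev_exps)
qed

section \<open>The unified invariant is q-holonomic\<close>

lemma R_to_series_eq: "R_to_series = evalL of_int (\<lambda>e. exps [:of_int (fst e), of_int (snd e):])"
  by (simp add: R_to_series_def exp_h_eq case_prod_unfold)

lemma ringhom_R_to_series: "ringhom R_to_series"
  unfolding R_to_series_eq
proof (intro ringhom_evalL ringhom_of_int)
  have "exps [:of_int (fst (a + b)), of_int (snd (a + b)):] =
      exps [:of_int (fst a), of_int (snd a):] * exps [:of_int (fst b), of_int (snd b) :: rat:]" for a b :: "int \<times> int"
    by (simp flip: exps_add)
  then show "character (\<lambda>e. exps [:of_int (fst e), of_int (snd e) :: rat:])"
    by (simp add: character_def exps_0)
qed

lemma R_to_series_qA: "R_to_series (qA k l) = exps [:of_int k, of_int l:]"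
  by (simp add: R_to_series_eq qA_def evalL_single)

lemma alpha_brace_prod: "alpha_brace k n = (\<Prod>i<n. qA (k - int i) 1 - qA (int i - k) (- 1))"
  by (simp add: alpha_brace_def qA_def)

text \<open>Each brace q^k A - q^(-k) A^(-1) has constant term 1 - 1 = 0 in h, so a product of n
  braces is divisible by h^n.\<close>

lemma R_to_series_low: "a \<in> I_R n \<Longrightarrow> R_to_series a \<in> low n"
proof (rule I_R_to_low[OF ringhom_R_to_series])
  interpret ringhom R_to_series by (rule ringhom_R_to_series)
  have *: "R_to_series (qA (l - int i) 1 - qA (int i - l) (- 1)) \<in> low 1" for l i
    by (simp add: diff R_to_series_qA low_def exps_def)
  show "R_to_series (alpha_brace l n) \<in> low n" for l
  proof (induction n)
    case 0
    then show ?case by (simp add: low_def)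
  next
    case (Suc n)
    then show ?case using low_mult_low[OF Suc *[of l n]] by (simp add: alpha_brace_prod mult)
  qed
qed

lemma unified_series_nth:
  assumes D: "knot_diagram D" and m: "m < n" and S: "finite S" "box D n \<subseteq> S" "S \<subseteq> crossings D \<rightarrow>\<^sub>E UNIV"
  shows "fps_nth (R_hat_to_series (unified_invariant D)) m = fps_nth (R_to_series (\<Sum>i\<in>S. state_term D i)) m"
proof -
  interpret ringhom R_to_series by (rule ringhom_R_to_series)
  have cong: "fps_nth (R_to_series a) m = fps_nth (R_to_series b) m" if "a - b \<in> I_R n" "m < n" for a b m n
    using R_to_series_low[OF that(1)] that(2) by (simp add: diff low_def)
  define y where "y = Abs_fps (\<lambda>m. fps_nth (R_to_series (box_sum D (Suc m))) m)"
  have y: "fps_nth y m = fps_nth (R_to_series a) m" if a: "a \<in> unified_invariant D n" and m: "m < n" for a n m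
  proof -
    have "a - box_sum D n \<in> I_R (Suc m)"
      using a m I_R_antimono[of "Suc m" n] unfolding unified_invariant_eq[OF D] by auto
    moreover have "box_sum D n - box_sum D (Suc m) \<in> I_R (Suc m)"
      using sum_minus_box_sum[OF D finite_box box_mono[of "Suc m" n] box_subset] m
      by (simp add: box_sum_def)
    ultimately have "a - box_sum D (Suc m) \<in> I_R (Suc m)" using I_R_add by fastforce
    from cong[OF this, of m] show ?thesis by (simp add: y_def)
  qed
  have box_in: "box_sum D n \<in> unified_invariant D n" for n
    unfolding unified_invariant_eq[OF D] by (simp add: I_R_0)
  have "R_hat_to_series (unified_invariant D) = y"
    unfolding R_hat_to_series_def
  proof (rule the_equality)
    show "\<forall>n. \<forall>a\<in>unified_invariant D n. \<forall>m<n. fps_nth y m = fps_nth (R_to_series a) m" using y by blast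
    fix z assume z: "\<forall>n. \<forall>a\<in>unified_invariant D n. \<forall>m<n. fps_nth z m = fps_nth (R_to_series a) m"
    show "z = y"
      using z[rule_format, OF box_in, of _ "Suc _"] y[OF box_in, of _ "Suc _"]
      by (intro fps_ext) (metis lessI)
  qed
  moreover have "(\<Sum>i\<in>S. state_term D i) \<in> unified_invariant D n"
    unfolding unified_invariant_eq[OF D] using sum_minus_box_sum[OF D S] by simp
  ultimately show ?thesis using y m by simp
qed

definition exp_char :: "laurent_q \<Rightarrow> rat fps" where
  "exp_char = evalL of_int (\<lambda>k. fps_exp (of_int k))"

lemma ringhom_exp_char: "ringhom exp_char"
  unfolding exp_char_def
  by (intro ringhom_evalL ringhom_of_int) (simp add: character_def fps_exp_add_mult)

lemma exp_char_single: "exp_char (Poly_Mapping.single k 1) = fps_exp (of_int k)"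
  by (simp add: exp_char_def evalL_single)

lemma ev_R_to_series: "ev (of_nat n) (R_to_series a) = exp_char (jones_laurent n a)"
proof (rule ringhom_int_eqI[where f = "\<lambda>a. ev (of_nat n) (R_to_series a)" and g = "\<lambda>a. exp_char (jones_laurent n a)"])
  show "ringhom (\<lambda>a. ev (of_nat n) (R_to_series a))" by (rule ringhom_comp[OF ringhom_ev ringhom_R_to_series])
  show "ringhom (\<lambda>a. exp_char (jones_laurent n a))" by (rule ringhom_comp[OF ringhom_exp_char ringhom_jones_laurent])
  fix e :: "int \<times> int"
  show "ev (of_nat n) (R_to_series (Poly_Mapping.single e 1)) = exp_char (jones_laurent n (Poly_Mapping.single e 1))"
    using R_to_series_qA[of "fst e" "snd e"] jones_laurent_qA[of n "fst e" "snd e"]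
    by (simp add: qA_def ev_exps exp_char_single)
qed

lemma finite_bounded_subset: "bounded_indices d D \<subseteq> crossings D \<rightarrow>\<^sub>E UNIV"
  by (auto simp: bounded_indices_def)

text \<open>At \<alpha> = n the series becomes the state sum at A = q^n, read in q = e^h.\<close>

lemma ev_unified_series:
  assumes D: "zero_framed_knot_diagram D"
  shows "ev (of_nat n) (R_hat_to_series (unified_invariant D)) = exp_char (colored_jones D n)"
proof (rule fps_ext)
  fix m
  \<comment> \<open>One finite set that suffices twice: the box fixes the coefficient of h^m, the
    bounded indices give the exact colored Jones polynomial.\<close>
  let ?S = "box D (Suc m) \<union> bounded_indices (Suc n) D"
  have S: "finite ?S" "?S \<subseteq> crossings D \<rightarrow>\<^sub>E UNIV"
    using finite_bounded_indices box_subset finite_bounded_subset by auto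
  have k: "knot_diagram D" using D by (simp add: zero_framed_knot_diagram_def)
  have "fps_nth (ev (of_nat n) (R_hat_to_series (unified_invariant D))) m =
      fps_nth (ev (of_nat n) (R_to_series (\<Sum>i\<in>?S. state_term D i))) m"
    using unified_series_nth[OF k lessI[of m] S(1) Un_upper1 S(2)] by simp
  also have "\<dots> = fps_nth (exp_char (colored_jones D n)) m"
    unfolding ev_R_to_series colored_jones_eq[OF D S(1) Un_upper2 S(2)] ..
  finally show "fps_nth (ev (of_nat n) (R_hat_to_series (unified_invariant D))) m =
    fps_nth (exp_char (colored_jones D n)) m" .
qed

lemma act_seq_eq:
  "act_seq P f n = (\<Sum>(i, j)\<in>Poly_Mapping.keys P.
     evalL of_int (\<lambda>k. Poly_Mapping.single (2 * k) 1) (Poly_Mapping.lookup P (i, j)) *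
     (Poly_Mapping.single (2 * int n) 1 ^ i * f (n + j)))"
proof -
  have E: "(E_op ^^ j) f n = f (n + j)" for j n
    by (induction j arbitrary: n) (simp_all add: E_op_def)
  have "(Q_op ^^ i) f n = Poly_Mapping.single (2 * int n) 1 ^ i * f n" for i and f :: "nat \<Rightarrow> laurent_q"
    by (induction i) (simp_all add: Q_op_def mult.assoc)
  then show ?thesis unfolding act_seq_def by (simp add: E)
qed

text \<open>Evaluation at \<alpha> = n turns q^(2 \<alpha>) into q^(2n) and the j-fold shift into
  evaluation at n + j, so the series becomes the image of the Jones recursion at n, which is
  zero.\<close>

theorem unified_invariant_holonomic:
  assumes D: "zero_framed_knot_diagram D" and ann: "\<forall>n\<ge>1. act_seq P (colored_jones D) n = 0"
  shows "act_series P (R_hat_to_series (unified_invariant D)) = 0"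
proof -
  let ?F = "R_hat_to_series (unified_invariant D)"
  interpret e: ringhom exp_char by (rule ringhom_exp_char)
  have Q: "ev x ((Q_tilde ^^ i) f) = fps_exp (2 * x) ^ i * ev x f" for x i f
  proof -
    interpret v: ringhom "ev x" by (rule ringhom_ev)
    show ?thesis by (induction i) (simp_all add: Q_tilde_def v.mult exp_h_eq ev_exps mult.assoc mult.commute)
  qed
  have E: "ev x ((E_tilde ^^ j) f) = ev (x + of_nat j) f" for x j f
    by (induction j arbitrary: x) (auto intro!: fps_ext simp: E_tilde_def poly_pcompose algebra_simps fps_eq_iff)
  have "ev (of_nat n) (act_series P ?F) = 0" if n: "n \<ge> 1" for n
  proof -
    interpret v: ringhom "ev (of_nat n)" by (rule ringhom_ev)
    have coef: "ev (of_nat n) (evalL of_int (\<lambda>k. exp_h [:2 * of_int k:]) c) =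
        exp_char (evalL of_int (\<lambda>k. Poly_Mapping.single (2 * k) 1) c)" for c
    proof (rule ringhom_int_eqI[where f = "\<lambda>c. ev (of_nat n) (evalL of_int (\<lambda>k. exp_h [:2 * of_int k:]) c)"
          and g = "\<lambda>c. exp_char (evalL of_int (\<lambda>k. Poly_Mapping.single (2 * k) 1) c)"])
      have "exp_h [:2 * of_int (a + b):] = exp_h [:2 * of_int a:] * exp_h [:2 * of_int b:]" for a b
        by (simp add: exp_h_eq algebra_simps flip: exps_add)
      then have ch: "character (\<lambda>k. exp_h [:2 * of_int k:])" by (simp add: character_def exp_h_eq exps_0)
      show "ringhom (\<lambda>c. ev (of_nat n) (evalL of_int (\<lambda>k. exp_h [:2 * of_int k:]) c))"
        by (rule ringhom_comp[OF ringhom_ev ringhom_evalL[OF ringhom_of_int ch]])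
      have "character (\<lambda>k::int. Poly_Mapping.single (2 * k) (1::int))" by (simp add: character_def mult_single distrib_left)
      then show "ringhom (\<lambda>c. exp_char (evalL of_int (\<lambda>k. Poly_Mapping.single (2 * k) 1) c))"
        by (intro ringhom_comp[OF ringhom_exp_char ringhom_evalL[OF ringhom_of_int]])
    qed (simp add: evalL_single exp_char_single exp_h_eq ev_exps)
    have "ev (of_nat n) (act_series P ?F) = exp_char (act_seq P (colored_jones D) n)"
      unfolding act_series_def act_seq_eq v.sum e.sum
    proof (intro sum.cong refl)
      fix ij assume "ij \<in> Poly_Mapping.keys P"
      obtain i j where ij: "ij = (i, j)" by fastforce
      have "of_nat n + of_nat j = (of_nat (n + j) :: rat)" by simp
      then show "ev (of_nat n) (case ij of (i, j) \<Rightarrow> evalL of_int (\<lambda>k. exp_h [:2 * of_int k:]) (Poly_Mapping.lookup P (i, j)) *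
          (Q_tilde ^^ i) ((E_tilde ^^ j) ?F)) =
        exp_char (case ij of (i, j) \<Rightarrow> evalL of_int (\<lambda>k. Poly_Mapping.single (2 * k) 1) (Poly_Mapping.lookup P (i, j)) *
          (Poly_Mapping.single (2 * int n) 1 ^ i * colored_jones D (n + j)))"
        unfolding ij by (simp only: case_prod_conv v.mult e.mult e.power coef Q E ev_unified_series[OF D])
          (simp add: exp_char_single)
    qed
    then show ?thesis using ann n by simp
  qed
  then have "act_series P ?F \<in> low k" for k
    by (intro low_if_ev_low[of "of_nat ` {1..}"]) (auto simp: low_0 finite_image_iff inj_on_def infinite_Ici)
  then show ?thesis by (rule zero_if_all_low)
qed

section \<open>Gaussian binomials at roots of unity\<close>

text \<open>Induction on n by the Pascal rule, whose factor w^(k+1) depends only on the remainder of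
  k. The four cases record which of the two remainders wraps around.\<close>

lemma gauss_q_Lucas:
  fixes w :: "'a::idom"
  assumes r: "1 \<le> r" and w: "w ^ r = 1" "\<And>i. 0 < i \<Longrightarrow> i < r \<Longrightarrow> w ^ i \<noteq> 1"
  shows "gauss w n k = gauss w (n mod r) (k mod r) * of_nat ((n div r) choose (k div r))"
proof (induction n arbitrary: k)
  case 0
  show ?case
  proof (cases "k mod r = 0")
    case True
    then show ?thesis using r by (cases "k = 0") (auto simp: gauss_eq_0 binomial_eq_0)
  next
    case False
    then have "0 < k" by (cases k) auto
    then show ?thesis using False by (simp add: gauss_eq_0)
  qed
next
  case (Suc n)
  \<comment> \<open>By \<open>gauss_absorb\<close> the multiple of this binomial by 1 - w^k contains
    the factor 1 - w^r = 0, while 1 - w^k is invertible enough to be cancelled.\<close>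
  have middle: "gauss w r k = 0" if "0 < k" "k < r" for k
  proof -
    have e: "Suc (k - 1) = k" "Suc (r - 1) = r" using that by auto
    have "(1 - w ^ k) * gauss w r k = (1 - w ^ r) * gauss w (r - 1) (k - 1)"
      using gauss_absorb[of "k - 1" "r - 1" w] that unfolding e by simp
    then show ?thesis using w that by simp
  qed
  show ?case
  proof (cases k)
    case 0
    then show ?thesis by simp
  next
    case (Suc k')
    define a where "a = n mod r"
    define b where "b = k' mod r"
    have ab: "a < r" "b < r" using r by (auto simp: a_def b_def)
    have wk: "w ^ Suc k' = w ^ Suc b"
    proof -
      have "w ^ Suc k' = (w ^ r) ^ (k' div r) * w ^ Suc b"
        unfolding b_def by (simp flip: power_mult power_Suc power_add)
      then show ?thesis using w by simp
    qed
    have rec: "gauss w (Suc n) k = gauss w a b * of_nat ((n div r) choose (k' div r)) +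
        w ^ Suc b * (gauss w a (Suc k' mod r) * of_nat ((n div r) choose (Suc k' div r)))"
      unfolding Suc gauss.simps wk Suc.IH[of k'] Suc.IH[of "Suc k'"] a_def b_def ..
    have n: "Suc a < r \<Longrightarrow> Suc n mod r = Suc a \<and> Suc n div r = n div r"
      "Suc a = r \<Longrightarrow> Suc n mod r = 0 \<and> Suc n div r = Suc (n div r)"
      unfolding a_def by (auto simp: mod_Suc div_Suc)
    have k: "Suc b < r \<Longrightarrow> Suc k' mod r = Suc b \<and> Suc k' div r = k' div r"
      "Suc b = r \<Longrightarrow> Suc k' mod r = 0 \<and> Suc k' div r = Suc (k' div r)"
      unfolding b_def by (auto simp: mod_Suc div_Suc)
    consider "Suc a < r" "Suc b < r" | "Suc a = r" "Suc b < r" | "Suc a < r" "Suc b = r" | "Suc a = r" "Suc b = r"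
      using ab by linarith
    then show ?thesis
    proof cases
      case 1
      then show ?thesis unfolding rec using n k Suc by (simp add: algebra_simps)
    next
      case 2
      \<comment> \<open>With a = r - 1 this sum is an inner entry of row r.\<close>
      have "gauss w a b + w ^ Suc b * gauss w a (Suc b) = 0"
        using middle[of "Suc b"] 2(2) unfolding 2(1)[symmetric] gauss.simps by simp
      then have "(gauss w a b + w ^ Suc b * gauss w a (Suc b)) * c = 0" for c by simp
      from this[of "of_nat ((n div r) choose (k' div r))"]
      show ?thesis unfolding rec using n k Suc 2 by (simp add: algebra_simps)
    next
      case 3
      have "gauss w a b = 0" using 3 by (intro gauss_eq_0) simp
      moreover have "w ^ Suc b = 1" using 3 w by simp
      ultimately show ?thesis unfolding rec using n k Suc 3 by simp
    next
      case 4
      have "a = b" using 4 by simp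
      then have "gauss w a b = 1" by simp
      moreover have "w ^ Suc b = 1" using 4 w by simp
      ultimately show ?thesis unfolding rec using n k Suc 4 by simp
    qed
  qed
qed

section \<open>Powers of the root of unity\<close>

lemma zeta_nz [simp]: "zeta r \<noteq> 0"
  by (simp add: zeta_def)

lemma zeta_power: "zeta r ^ k = cis (pi * real k / real r)"
proof -
  have "zeta r = cis (pi / real r)"
    unfolding cis_conv_exp zeta_def by (rule arg_cong[where f = exp]) simp
  moreover have "real k * (pi / real r) = pi * real k / real r" by simp
  ultimately show ?thesis by (simp only: DeMoivre)
qed

lemma zeta_power_r: "1 \<le> r \<Longrightarrow> zeta r ^ r = -1"
  by (simp add: zeta_power)

lemma zeta_powi_2r: "1 \<le> r \<Longrightarrow> zeta r powi (2 * int r * e) = 1"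
proof -
  assume r: "1 \<le> r"
  have "zeta r powi (2 * int r) = (zeta r ^ r) ^ 2"
  proof -
    have "2 * int r = int (r * 2)" by simp
    then show ?thesis by (simp only: power_int_of_nat power_mult)
  qed
  then have "zeta r powi (2 * int r) = 1" using zeta_power_r[OF r] by simp
  then show ?thesis unfolding power_int_mult by simp
qed

lemma zeta_powi_cong:
  assumes "1 \<le> r" "a = b + 2 * int r * e"
  shows "zeta r powi a = zeta r powi b"
  unfolding assms(2) using zeta_powi_2r[OF assms(1), of e] by (simp add: power_int_add)

lemma zeta_powi_r: "1 \<le> r \<Longrightarrow> zeta r powi (int r * int e) = (-1) ^ e"
  unfolding power_int_mult by (simp add: zeta_power_r)

lemma zeta_square_neq_1:
  assumes "0 < i" "i < r"
  shows "(zeta r ^ 2) ^ i \<noteq> 1"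
proof
  assume "(zeta r ^ 2) ^ i = 1"
  then have "zeta r ^ (2 * i) = 1" by (simp only: power_mult)
  then have "cis (pi * real (2 * i) / real r) = 1" by (simp only: zeta_power)
  then have "cos (pi * real (2 * i) / real r) = 1" by (metis cis.sel(1) one_complex.sel(1))
  then obtain m :: int where "pi * real (2 * i) / real r = real_of_int m * 2 * pi"
    unfolding cos_one_2pi_int by blast
  then have "real i = real_of_int m * real r" using assms by (simp add: field_simps)
  then have "int i = m * int r" by (metis of_int_eq_iff of_int_mult of_int_of_nat_eq)
  then show False using assms by (metis int_dvd_int_iff dvd_triv_right nat_dvd_not_less)
qed

lemma zeta_square_power_r: "1 \<le> r \<Longrightarrow> (zeta r ^ 2) ^ r = 1"
  using zeta_power_r by (metis power2_minus power_commutes power_mult mult.commute power_one)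

section \<open>The weights at a root of unity\<close>

type_synonym laurent_A = "int \<Rightarrow>\<^sub>0 complex"

definition at_zeta :: "nat \<Rightarrow> laurent_qA \<Rightarrow> laurent_A" where
  "at_zeta r = evalL of_int (\<lambda>e. Poly_Mapping.single (snd e) (zeta r powi fst e))"

lemma ringhom_at_zeta: "ringhom (at_zeta r)"
  unfolding at_zeta_def
  by (intro ringhom_evalL ringhom_of_int) (auto simp: character_def mult_single power_int_add)

lemma at_zeta_qA: "at_zeta r (qA k l) = Poly_Mapping.single l (zeta r powi k)"
  by (simp add: at_zeta_def qA_def evalL_single)

locale root_of_unity =
  fixes r :: nat
  assumes r: "1 \<le> r"
begin

abbreviation "\<Psi> \<equiv> at_zeta r"

sublocale \<Psi>: ringhom \<Psi> by (rule ringhom_at_zeta)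

abbreviation cst :: "complex \<Rightarrow> laurent_A" where "cst c \<equiv> Poly_Mapping.single 0 c"

abbreviation zc :: "int \<Rightarrow> laurent_A" where "zc e \<equiv> cst (zeta r powi e)"

lemma zc_add: "zc (a + b) = zc a * zc b"
  by (simp add: mult_single power_int_add)

lemma zc_mult_single: "zc a * Poly_Mapping.single l (zeta r powi b) = Poly_Mapping.single l (zeta r powi (a + b))"
  by (simp add: mult_single power_int_add)

lemma \<Psi>_gauss:
  "\<Psi> (gauss (qA 2 0) n k) = \<Psi> (gauss (qA 2 0) (n mod r) (k mod r)) * of_nat ((n div r) choose (k div r))"
proof -
  have c: "ringhom (Poly_Mapping.single (0::int) :: complex \<Rightarrow> _)" by (rule ringhom_single)
  have g: "\<Psi> (gauss (qA 2 0) n k) = cst (gauss (zeta r ^ 2) n k)" for n k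
    by (simp add: \<Psi>.gauss at_zeta_qA ringhom.gauss[OF c] power_int_def)
  have L: "gauss (zeta r ^ 2) n k = gauss (zeta r ^ 2) (n mod r) (k mod r) * of_nat ((n div r) choose (k div r))"
    by (rule gauss_q_Lucas[OF r zeta_square_power_r[OF r] zeta_square_neq_1])
  show ?thesis unfolding g by (subst L) (simp only: ringhom.mult[OF c] ringhom.of_nat[OF c])
qed

text \<open>Since zeta^r = -1, each of the n braces acquires the sign (-1)^e. Signs are kept as
  powers of zeta so that all exponents can be collected in one place.\<close>

lemma \<Psi>_alpha_shift: "\<Psi> (alpha_brace (k - int r * int e) n) = zc (int r * int e * int n) * \<Psi> (alpha_brace k n)"
proof (induction n)
  case (Suc n)
  have "\<Psi> (qA (k - int r * int e - int n) 1 - qA (int n - (k - int r * int e)) (- 1)) =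
      zc (int r * int e) * \<Psi> (qA (k - int n) 1 - qA (int n - k) (- 1))"
  proof -
    have "zeta r powi (k - int r * int e - int n) = zeta r powi (int r * int e + (k - int n))"
      by (rule zeta_powi_cong[OF r, of _ _ "- int e"]) simp
    moreover have "zeta r powi (int n - (k - int r * int e)) = zeta r powi (int r * int e + (int n - k))"
      by (rule arg_cong[where f = "\<lambda>x. zeta r powi x"]) simp
    ultimately show ?thesis
      by (simp add: \<Psi>.diff at_zeta_qA right_diff_distrib mult_single power_int_add)
  qed
  then show ?case
    using Suc by (simp add: alpha_brace_Suc \<Psi>.mult zc_add distrib_left mult.left_commute mult.assoc)
qed simp

text \<open>The product {\<alpha>; r} at q = zeta, which is A^r - A^(-r) times a power of
  zeta.\<close>

definition block :: laurent_A where "block = \<Psi> (alpha_brace 0 r)"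

text \<open>A product of r + 1 consecutive braces is split off at either end. Its outer two braces
  differ by the factor zeta^r only, and this nonzero factor of a domain is cancelled.\<close>

lemma \<Psi>_alpha_block: "\<Psi> (alpha_brace (- int k) r) = zc (int r * int k) * block"
proof (induction k)
  case (Suc k)
  have nz: "\<Psi> (alpha_brace (- int k) (Suc r)) = \<Psi> (qA (- int k) 1 - qA (int k) (- 1)) * \<Psi> (alpha_brace (- int (Suc k)) r)"
  proof -
    have "- int k - 1 = - int (Suc k)" by simp
    then show ?thesis by (simp only: alpha_brace_Suc' \<Psi>.mult minus_minus)
  qed
  have nz': "\<Psi> (alpha_brace (- int k) (Suc r)) =
      \<Psi> (alpha_brace (- int k) r) * (zc (int r) * \<Psi> (qA (- int k) 1 - qA (int k) (- 1)))"
  proof -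
    have "zeta r powi (- int k - int r) = zeta r powi (int r + - int k)"
      by (rule zeta_powi_cong[OF r, of _ _ "- 1"]) simp
    moreover have "zeta r powi (int r - - int k) = zeta r powi (int r + int k)"
      by (rule arg_cong[where f = "\<lambda>x. zeta r powi x"]) simp
    ultimately have "\<Psi> (qA (- int k - int r) 1 - qA (int r - - int k) (- 1)) = zc (int r) * \<Psi> (qA (- int k) 1 - qA (int k) (- 1))"
      by (simp only: \<Psi>.diff at_zeta_qA right_diff_distrib zc_mult_single)
    then show ?thesis unfolding alpha_brace_Suc \<Psi>.mult by simp
  qed
  have "\<Psi> (qA (- int k) 1 - qA (int k) (- 1)) \<noteq> 0"
  proof
    assume "\<Psi> (qA (- int k) 1 - qA (int k) (- 1)) = 0"
    then have "Poly_Mapping.lookup (\<Psi> (qA (- int k) 1 - qA (int k) (- 1))) 1 = 0" by simp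
    then show False by (simp add: \<Psi>.diff at_zeta_qA lookup_minus lookup_single)
  qed
  moreover have "\<Psi> (qA (- int k) 1 - qA (int k) (- 1)) * \<Psi> (alpha_brace (- int (Suc k)) r) =
      \<Psi> (qA (- int k) 1 - qA (int k) (- 1)) * (zc (int r) * \<Psi> (alpha_brace (- int k) r))"
    unfolding nz[symmetric] nz' by (simp only: ac_simps)
  ultimately have "\<Psi> (alpha_brace (- int (Suc k)) r) = zc (int r) * \<Psi> (alpha_brace (- int k) r)"
    by (metis mult_cancel_left)
  then show ?case using Suc by (simp add: zc_add distrib_left mult.assoc)
qed (simp add: block_def)

lemma \<Psi>_alpha_blocks:
  "\<Psi> (alpha_brace (- int k) (r * n)) = zc (int r * (int k * int n + int r * tri n)) * block ^ n"
proof (induction n)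
  case (Suc n)
  have "alpha_brace (- int k) (r * Suc n) = alpha_brace (- int k) (r * n) * alpha_brace (- int (k + r * n)) r"
    using alpha_brace_add[of "- int k" "r * n" r] by (simp add: algebra_simps)
  then have "\<Psi> (alpha_brace (- int k) (r * Suc n)) =
      zc (int r * (int k * int n + int r * tri n)) * block ^ n * (zc (int r * int (k + r * n)) * block)"
    by (simp only: \<Psi>.mult Suc \<Psi>_alpha_block)
  also have "\<dots> = (zc (int r * (int k * int n + int r * tri n)) * zc (int r * int (k + r * n))) * block ^ Suc n"
    by (simp add: ac_simps)
  also have "zc (int r * (int k * int n + int r * tri n)) * zc (int r * int (k + r * n)) =
      zc (int r * (int k * int (Suc n) + int r * tri (Suc n)))"
    unfolding zc_add[symmetric] by (simp add: tri_Suc algebra_simps)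
  finally show ?case .
qed simp

text \<open>The exponents of zeta from the braces and from the symmetric Gaussian binomial almost cancel.\<close>

lemma \<Psi>_fdiv:
  assumes "y1 + m1 < r"
  shows "\<Psi> (fdiv (m1 + r * m2) (y1 + r * y2)) = zc (int r * (int m1 * int m2 + int r * tri m2)) *
    \<Psi> (fdiv m1 y1) * of_nat ((y2 + m2) choose m2) * block ^ m2"
proof -
  let ?m = "m1 + r * m2" and ?y = "y1 + r * y2"
  have d: "(?y + ?m) mod r = y1 + m1" "(?y + ?m) div r = y2 + m2" "?m mod r = m1" "?m div r = m2"
  proof -
    have e: "?y + ?m = (y1 + m1) + r * (y2 + m2)" by (simp add: algebra_simps)
    show "(?y + ?m) mod r = y1 + m1" "(?y + ?m) div r = y2 + m2"
      unfolding e using assms r by simp_all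
    show "?m mod r = m1" "?m div r = m2" using assms r by simp_all
  qed
  define E2 where "E2 = - int r * (int m1 * int y2 + int m2 * int y1 + int r * int m2 * int y2)"
  define E1 where "E1 = int r * (int y2 * int ?m)"
  define E0 where "E0 = int r * (int (y1 + m1) * int m2 + int r * tri m2)"
  have q: "\<Psi> (qb (?y + ?m) ?m) = zc E2 * \<Psi> (qb (y1 + m1) m1) * of_nat ((y2 + m2) choose m2)"
  proof -
    have "\<Psi> (qb (?y + ?m) ?m) = zc (- int ?m * int ?y) *
        (\<Psi> (gauss (qA 2 0) (y1 + m1) m1) * of_nat ((y2 + m2) choose m2))"
      unfolding qb_def \<Psi>.mult \<Psi>_gauss[of "?y + ?m" ?m] d at_zeta_qA by (simp add: algebra_simps)
    also have "- int ?m * int ?y = E2 + - int m1 * int y1" unfolding E2_def by (simp add: algebra_simps)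
    finally have 1: "\<Psi> (qb (?y + ?m) ?m) = zc E2 * (zc (- int m1 * int y1) * \<Psi> (gauss (qA 2 0) (y1 + m1) m1)) * of_nat ((y2 + m2) choose m2)"
      unfolding zc_add by (simp add: ac_simps)
    have "\<Psi> (qb (y1 + m1) m1) = zc (- int m1 * int y1) * \<Psi> (gauss (qA 2 0) (y1 + m1) m1)"
      unfolding qb_def \<Psi>.mult at_zeta_qA by simp
    then show ?thesis unfolding 1 by (simp only: ac_simps)
  qed
  have a: "\<Psi> (alpha_brace (- int ?y) ?m) = zc (E1 + E0) * \<Psi> (alpha_brace (- int y1) m1) * block ^ m2"
  proof -
    have "- int ?y = - int y1 - int r * int y2" by simp
    then have "\<Psi> (alpha_brace (- int ?y) ?m) = zc E1 * \<Psi> (alpha_brace (- int y1) ?m)"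
      using \<Psi>_alpha_shift[of "- int y1" y2 ?m] unfolding E1_def by (simp only: mult.assoc)
    also have "alpha_brace (- int y1) ?m = alpha_brace (- int y1) m1 * alpha_brace (- int (y1 + m1)) (r * m2)"
    proof -
      have "- int y1 - int m1 = - int (y1 + m1)" by simp
      then show ?thesis using alpha_brace_add[of "- int y1" m1 "r * m2"] by (simp only:)
    qed
    finally show ?thesis unfolding \<Psi>.mult \<Psi>_alpha_blocks zc_add E0_def by (simp only: ac_simps)
  qed
  have "\<Psi> (fdiv ?m ?y) = zc E2 * zc (E1 + E0) * \<Psi> (fdiv m1 y1) * of_nat ((y2 + m2) choose m2) * block ^ m2"
    unfolding fdiv_def \<Psi>.mult using q a by (simp add: qbinom_R_eq_qb ac_simps)
  also have "zc E2 * zc (E1 + E0) = zc (int r * (int m1 * int m2 + int r * tri m2))"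
    unfolding zc_add[symmetric] E2_def E1_def E0_def by (rule arg_cong[where f = zc]) (simp add: algebra_simps)
  finally show ?thesis .
qed

text \<open>With a carry, the remainder of the upper entry drops below that of the lower one, and
  the binomial of the remainders in the q-Lucas theorem is 0.\<close>

lemma \<Psi>_fdiv_carry:
  assumes "r \<le> y mod r + m mod r"
  shows "\<Psi> (fdiv m y) = 0"
proof -
  obtain s where s: "y mod r + m mod r = r + s" using assms by (auto simp: le_iff_add)
  have y: "y mod r < r" "m mod r < r" using r by simp_all
  have sr: "s < r" using s y by linarith
  have "(y + m) mod r = (r + s) mod r" unfolding s[symmetric] by (simp add: mod_add_eq)
  also have "\<dots> = s" using sr by simp
  finally have "(y + m) mod r < m mod r" using s y by linarith
  then have "\<Psi> (gauss (qA 2 0) (y + m) m) = 0"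
    unfolding \<Psi>_gauss[of "y + m"] by (simp add: gauss_eq_0)
  then show ?thesis by (simp add: fdiv_def qbinom_R_eq_qb qb_def \<Psi>.mult)
qed

text \<open>The weights carried by the quotients of the labels by \<open>r\<close>; they are functions of A^r only.\<close>

fun quot_weight :: "piece \<Rightarrow> nat \<Rightarrow> nat list \<Rightarrow> laurent_A" where
  "quot_weight PosX i [b, a] = of_nat ((a + i) choose i) * (zc (tri r) * block) ^ i *
     Poly_Mapping.single (- int r * int (a + b)) 1"
| "quot_weight NegX i [a, b] = (-1) ^ (r * i) * of_nat ((a + i) choose i) * (zc (- tri r) * block) ^ i *
     Poly_Mapping.single (int r * int (a + b)) 1"
| "quot_weight _ _ _ = 1"

lemma tri_mult: "tri (r * n) = int n * tri r + int r * int r * tri n"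
proof (induction n)
  case (Suc n)
  have "tri (r * Suc n) = tri (r + r * n)" by simp
  then show ?case using Suc by (simp add: tri_add tri_Suc algebra_simps)
qed simp

lemma zc_power: "zc e ^ n = zc (int n * e)"
  by (induction n) (simp_all add: distrib_right zc_add[symmetric] del: zc_add)

text \<open>The exponent \<open>E\<close> left over by \<open>\<Psi>_fdiv\<close> is compensated by
  the cross terms of \<open>tri\<close> and of the product of labels, so that no power of zeta mixes
  remainders and quotients.\<close>

lemma quot_weight_PosX:
  assumes "a1 + i1 < r"
  shows "\<Psi> (label_weight PosX (i1 + r * i2) [b1 + r * b2, a1 + r * a2] zs) =
    \<Psi> (label_weight PosX i1 [b1, a1] zs') * quot_weight PosX i2 [b2, a2]"
proof -
  let ?i = "i1 + r * i2" and ?a = "a1 + r * a2" and ?b = "b1 + r * b2"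
  define e where "e = tri i1 + 2 * (int a1 + int i1) * (int b1 - int i1)"
  define E where "E = int r * (int i1 * int i2 + int r * tri i2)"
  have q: "\<Psi> (qA (tri ?i + 2 * (int ?a + int ?i) * (int ?b - int ?i)) (- int (?a + ?b))) =
      zc (int i2 * tri r - E) * \<Psi> (qA e (- int (a1 + b1))) * Poly_Mapping.single (- int r * int (a2 + b2)) 1"
  proof -
    \<comment> \<open>The quadratic form produces +\<open>E\<close>, while -\<open>E\<close> is
      wanted to cancel the factor from \<open>\<Psi>_fdiv\<close>. The first two terms of the
      witness account for 2\<open>E\<close>, the others for the mixed terms of the product of
      labels; all are multiples of 2r.\<close>
    have "zeta r powi (tri ?i + 2 * (int ?a + int ?i) * (int ?b - int ?i)) = zeta r powi (int i2 * tri r - E + e)"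
      by (rule zeta_powi_cong[OF r, of _ _ "int i1 * int i2 + int r * tri i2 +
          (int a2 + int i2) * (int b1 - int i1) + (int b2 - int i2) * (int a1 + int i1) +
          int r * (int a2 + int i2) * (int b2 - int i2)"])
        (simp only: tri_add tri_mult E_def e_def, simp add: algebra_simps)
    then show ?thesis unfolding at_zeta_qA zc_mult_single by (simp add: mult_single algebra_simps)
  qed
  have "\<Psi> (label_weight PosX ?i [?b, ?a] zs) = (zc E * \<Psi> (fdiv i1 a1) * of_nat ((a2 + i2) choose i2) * block ^ i2) *
      (zc (int i2 * tri r - E) * \<Psi> (qA e (- int (a1 + b1))) * Poly_Mapping.single (- int r * int (a2 + b2)) 1)"
    unfolding label_weight_PosX \<Psi>.mult \<Psi>_fdiv[OF assms] E_def[symmetric] q ..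
  also have "\<dots> = (\<Psi> (fdiv i1 a1) * \<Psi> (qA e (- int (a1 + b1)))) * (of_nat ((a2 + i2) choose i2) *
      ((zc E * zc (int i2 * tri r - E)) * block ^ i2) * Poly_Mapping.single (- int r * int (a2 + b2)) 1)"
    by (simp only: ac_simps)
  also have "zc E * zc (int i2 * tri r - E) = zc (tri r) ^ i2"
    unfolding zc_power zc_add[symmetric] by simp
  finally show ?thesis
    by (simp add: label_weight_PosX \<Psi>.mult e_def power_mult_distrib)
qed

lemma quot_weight_NegX:
  assumes "a1 + i1 < r"
  shows "\<Psi> (label_weight NegX (i1 + r * i2) [a1 + r * a2, b1 + r * b2] zs) =
    \<Psi> (label_weight NegX i1 [a1, b1] zs') * quot_weight NegX i2 [a2, b2]"
proof -
  let ?i = "i1 + r * i2" and ?a = "a1 + r * a2" and ?b = "b1 + r * b2"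
  define e where "e = - 2 * int a1 * int b1 - tri i1"
  define E where "E = int r * (int i1 * int i2 + int r * tri i2)"
  have q: "\<Psi> (qA (- 2 * int ?a * int ?b - tri ?i) (int (?a + ?b))) =
      zc (- (int i2 * tri r) - E) * \<Psi> (qA e (int (a1 + b1))) * Poly_Mapping.single (int r * int (a2 + b2)) 1"
  proof -
    have "zeta r powi (- 2 * int ?a * int ?b - tri ?i) = zeta r powi (- (int i2 * tri r) - E + e)"
      by (rule zeta_powi_cong[OF r, of _ _ "- (int a1 * int b2 + int a2 * int b1 + int r * int a2 * int b2)"])
        (simp only: tri_add tri_mult E_def e_def, simp add: algebra_simps)
    then show ?thesis unfolding at_zeta_qA zc_mult_single by (simp add: mult_single algebra_simps)
  qed
  have s: "\<Psi> ((-1) ^ ?i) = \<Psi> ((-1) ^ i1) * (-1) ^ (r * i2)"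
    unfolding power_add \<Psi>.mult by (simp add: \<Psi>.power \<Psi>.uminus)
  have "\<Psi> (label_weight NegX ?i [?a, ?b] zs) = (\<Psi> ((-1) ^ i1) * (-1) ^ (r * i2)) *
      (zc E * \<Psi> (fdiv i1 a1) * of_nat ((a2 + i2) choose i2) * block ^ i2) *
      (zc (- (int i2 * tri r) - E) * \<Psi> (qA e (int (a1 + b1))) * Poly_Mapping.single (int r * int (a2 + b2)) 1)"
    unfolding label_weight_NegX \<Psi>.mult \<Psi>_fdiv[OF assms] E_def[symmetric] q s ..
  also have "\<dots> = (\<Psi> ((-1) ^ i1) * \<Psi> (fdiv i1 a1) * \<Psi> (qA e (int (a1 + b1)))) * ((-1) ^ (r * i2) * of_nat ((a2 + i2) choose i2) *
      ((zc E * zc (- (int i2 * tri r) - E)) * block ^ i2) * Poly_Mapping.single (int r * int (a2 + b2)) 1)"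
    by (simp only: ac_simps)
  also have "zc E * zc (- (int i2 * tri r) - E) = zc (- tri r) ^ i2"
    unfolding zc_power zc_add[symmetric] by simp
  finally show ?thesis
    by (simp add: label_weight_NegX \<Psi>.mult e_def power_mult_distrib)
qed

text \<open>At caps and cups only zeta^(2x) occurs, which depends on x modulo r; so the quotients
  carry no weight there.\<close>

lemma quot_weight_digits:
  assumes lr: "label_rule P i ws zs"
    and nc: "P = PosX \<or> P = NegX \<Longrightarrow> (if P = PosX then ws ! 1 else ws ! 0) mod r + i mod r < r"
  shows "\<Psi> (label_weight P i ws zs) =
    \<Psi> (label_weight P (i mod r) (map (\<lambda>x. x mod r) ws) (map (\<lambda>x. x mod r) zs)) *
    quot_weight P (i div r) (map (\<lambda>x. x div r) ws)"
proof (cases "P = PosX \<or> P = NegX")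
  case True
  then show ?thesis
  proof
    assume P: "P = PosX"
    then obtain a b where ws: "ws = [b, a]" using label_rule_crossing(1)[OF lr] by blast
    have "a mod r + i mod r < r" using nc P ws by simp
    from quot_weight_PosX[OF this, of "i div r" "b mod r" "b div r" "a div r" zs] show ?thesis
      unfolding P ws by simp
  next
    assume P: "P = NegX"
    then obtain a b where ws: "ws = [a, b]" using label_rule_crossing(2)[OF lr] by blast
    have "a mod r + i mod r < r" using nc P ws by simp
    from quot_weight_NegX[OF this, of "i div r" "a div r" "b mod r" "b div r" zs] show ?thesis
      unfolding P ws by simp
  qed
next
  case False
  have z1: "zeta r powi (- 2 * int (m + r * e)) = zeta r powi (- 2 * int m)" for m e
    by (rule zeta_powi_cong[OF r, of _ _ "- int e"]) (simp add: algebra_simps)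
  have z: "zeta r powi (- 2 * int x) = zeta r powi (- 2 * int (x mod r))" for x
    using z1[of "x mod r" "x div r"] by (simp only: mod_mult_div_eq)
  have z2: "zeta r powi (2 * int (m + r * e)) = zeta r powi (2 * int m)" for m e
    by (rule zeta_powi_cong[OF r, of _ _ "int e"]) (simp add: algebra_simps)
  have z': "zeta r powi (2 * int x) = zeta r powi (2 * int (x mod r))" for x
    using z2[of "x mod r" "x div r"] by (simp only: mod_mult_div_eq)
  show ?thesis
  proof (cases P)
    case CapLR
    then obtain x where ws: "ws = [x, x]" "zs = []" using label_rule_crossing(3)[OF lr] by blast
    show ?thesis unfolding CapLR ws using z[of x] by (simp add: at_zeta_qA)
  next
    case CapRL
    then obtain x where ws: "ws = [x, x]" "zs = []" using label_rule_crossing(3)[OF lr] by blast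
    show ?thesis unfolding CapRL ws by simp
  next
    case CupLR
    then obtain x where ws: "ws = []" "zs = [x, x]" using label_rule_crossing(4)[OF lr] by blast
    show ?thesis unfolding CupLR ws using z'[of x] by (simp add: at_zeta_qA)
  next
    case CupRL
    then obtain x where ws: "ws = []" "zs = [x, x]" using label_rule_crossing(4)[OF lr] by blast
    show ?thesis unfolding CupRL ws by simp
  qed (use False in auto)
qed

end

section \<open>Factorization of the state sum at a root of unity\<close>

lemma labelling_cong:
  assumes "\<And>t. t \<in> crossings D \<Longrightarrow> i t = i' t" "labelling D i L"
  shows "labelling D i' L"
  unfolding labelling_iff
proof (intro conjI allI impI)
  fix t assume t: "t < length D"
  obtain p P where pP: "D ! t = (p, P)" by fastforce
  have "layer_rule (p, P) (i t) (L ! t) (L ! Suc t)" using assms(2) t pP unfolding labelling_iff by metis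
  then show "layer_rule (D ! t) (i' t) (L ! t) (L ! Suc t)"
    using label_rule_no_crossing[of P] assms(1)[of t] t pP
    by (cases "P = PosX \<or> P = NegX") (auto simp: layer_rule_iff crossings_def)
qed (use assms(2) in \<open>simp_all add: labelling_def\<close>)

lemma label_weight_no_crossing:
  assumes "label_rule P i ws zs" "P \<noteq> PosX" "P \<noteq> NegX"
  shows "label_weight P j ws zs = label_weight P k ws zs"
  using label_rule_crossing(3,4)[OF assms(1)] assms(2,3) by (cases P) auto

lemma lower_map: "t < length L \<Longrightarrow> lower D (map (map f) L) t = map f (lower D L t)"
  by (simp add: take_map drop_map)

lemma upper_map: "Suc t < length L \<Longrightarrow> upper D (map (map f) L) t = map f (upper D L t)"
  by (simp add: take_map drop_map)

lemma under_label_lower: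
  assumes L: "labelling D i L" and t: "t \<in> crossings D"
  shows "under_label D L t = (if snd (D ! t) = PosX then lower D L t ! 1 else lower D L t ! 0)"
proof -
  have tl: "t < length D" using t by (simp add: crossings_def)
  obtain p P where pP: "D ! t = (p, P)" by fastforce
  have "layer_rule (p, P) (i t) (L ! t) (L ! Suc t)"
    using L tl pP unfolding labelling_iff by metis
  then have "p + n_in P \<le> length (L ! t)" by (simp add: layer_rule_iff)
  moreover have "P = PosX \<or> P = NegX" using t by (auto simp: crossings_def pP)
  ultimately show ?thesis by (auto simp: under_label_def pP)
qed

definition zero_labels :: "diagram \<Rightarrow> nat list list" where
  "zero_labels D = map (\<lambda>t. replicate (length (orient D t)) 0) [0..<Suc (length D)]"

lemma zero_labels_nth: "t \<le> length D \<Longrightarrow> zero_labels D ! t = replicate (length (orient D t)) 0"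
  unfolding zero_labels_def by (subst nth_map) (simp_all add: nth_upt del: upt_Suc)

context knot_tangle
begin

lemma state_term_cong:
  assumes "\<And>t. t \<in> crossings D \<Longrightarrow> i t = i' t"
  shows "state_term D i = state_term D i'"
proof (cases "\<exists>L. labelling D i L")
  case True
  then obtain L where L: "labelling D i L" by blast
  have L': "labelling D i' L" by (rule labelling_cong[OF assms L])
  show ?thesis
    unfolding state_term_eq[OF L] state_term_eq[OF L']
  proof (intro prod.cong refl)
    fix t assume t: "t \<in> {..<length D}"
    show "label_weight (snd (D ! t)) (i t) (lower D L t) (upper D L t) =
      label_weight (snd (D ! t)) (i' t) (lower D L t) (upper D L t)"
    proof (cases "t \<in> crossings D")
      case False
      then show ?thesis using t labelling_rule[OF L, of t]
        by (intro label_weight_no_crossing) (auto simp: crossings_def)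
    qed (simp add: assms)
  qed
next
  case False
  then have "\<nexists>L. labelling D i' L" using labelling_cong[of D i' i] assms by fastforce
  then show ?thesis using False by (simp add: state_term_no_labelling)
qed

lemma zero_labelling: "labelling D (\<lambda>_. 0) (zero_labels D)"
  unfolding labelling_iff
proof (intro conjI allI impI)
  note nth = zero_labels_nth[of _ D]
  show "length (zero_labels D) = Suc (length D)" by (simp add: zero_labels_def)
  show "zero_labels D ! 0 = [0]" by (simp add: nth)
  show "zero_labels D ! length D = [0]" using tangle by (simp add: nth tangle_1_1_def)
  fix t assume t: "t < length D"
  obtain p P where pP: "D ! t = (p, P)" by fastforce
  obtain bs cs where o: "orient D t = bs @ below P @ cs" "orient D (Suc t) = bs @ above P @ cs"
    "length bs = p" using tangle_layerE[OF tangle t pP] .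
  have "label_rule P 0 (replicate (n_in P) 0) (replicate (n_out P) 0)"
    by (cases P) simp_all
  moreover have "zero_labels D ! t = replicate p 0 @ replicate (n_in P) 0 @ replicate (length cs) 0"
    "zero_labels D ! Suc t = replicate p 0 @ replicate (n_out P) 0 @ replicate (length cs) 0"
    using t o by (simp_all add: nth replicate_add)
  ultimately show "layer_rule (D ! t) 0 (zero_labels D ! t) (zero_labels D ! Suc t)"
    unfolding pP layer_rule.simps using length_replicate by metis
qed

lemma labelling_zero_lower:
  assumes L: "labelling D i L" and i: "\<And>t. t \<in> crossings D \<Longrightarrow> i t = 0" and t: "t \<le> length D"
  shows "set (L ! t) \<subseteq> {0}"
proof -
  have "labelling D (\<lambda>_. 0) L" by (rule labelling_cong[OF _ L]) (simp add: i)
  then have "L = zero_labels D" using zero_labelling labelling_unique by blast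
  moreover have "zero_labels D ! t = replicate (length (orient D t)) 0"
    by (rule zero_labels_nth[OF t])
  ultimately show ?thesis by auto
qed

end

locale knot_root = knot_tangle D + root_of_unity r for D r
begin

text \<open>The analogue of \<open>state_term\<close> for the quotients. It contains no pivotal
  monomials; these stay with the remainders.\<close>

definition quot_term :: "(nat \<Rightarrow> nat) \<Rightarrow> laurent_A" where
  "quot_term i = (if \<exists>L. labelling D i L
     then \<Prod>t<length D. quot_weight (snd (D ! t)) (i t) (lower D (THE L. labelling D i L) t) else 0)"

lemma quot_term_eq:
  "labelling D i L \<Longrightarrow> quot_term i = (\<Prod>t<length D. quot_weight (snd (D ! t)) (i t) (lower D L t))"
  unfolding quot_term_def using labelling_the by auto

lemma quot_term_no_labelling: "\<nexists>L. labelling D i L \<Longrightarrow> quot_term i = 0"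
  by (simp add: quot_term_def)

lemma quot_weight_no_crossing:
  "P \<noteq> PosX \<Longrightarrow> P \<noteq> NegX \<Longrightarrow> quot_weight P i ws = 1"
  by (cases P) auto

lemma quot_term_cong:
  assumes "\<And>t. t \<in> crossings D \<Longrightarrow> i t = i' t"
  shows "quot_term i = quot_term i'"
proof (cases "\<exists>L. labelling D i L")
  case True
  then obtain L where L: "labelling D i L" by blast
  have L': "labelling D i' L" by (rule labelling_cong[OF assms L])
  show ?thesis
    unfolding quot_term_eq[OF L] quot_term_eq[OF L']
  proof (intro prod.cong refl)
    fix t assume t: "t \<in> {..<length D}"
    show "quot_weight (snd (D ! t)) (i t) (lower D L t) = quot_weight (snd (D ! t)) (i' t) (lower D L t)"
      using assms[of t] t quot_weight_no_crossing[of "snd (D ! t)"]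
      by (cases "t \<in> crossings D") (auto simp: crossings_def)
  qed
next
  case False
  then have "\<nexists>L. labelling D i' L" using labelling_cong[of D i' i] assms by fastforce
  then show ?thesis using False by (simp add: quot_term_no_labelling)
qed

lemma state_term_carry:
  assumes L: "labelling D i L" and t: "t \<in> crossings D" and c: "r \<le> under_label D L t mod r + i t mod r"
  shows "\<Psi> (state_term D i) = 0"
proof -
  obtain c where "state_term D i = fdiv (i t) (under_label D L t) * c"
    using state_term_fdiv[OF L t knot] by blast
  then show ?thesis using \<Psi>_fdiv_carry[OF c] by (simp add: \<Psi>.mult)
qed

text \<open>The converse of splitting into digits. A nonzero factor on the remainders forbids
  carries, so \<open>labels_less\<close> keeps all remainder labels below r; hence they are the true
  remainders of the combined labels.\<close>

lemma combined_labelling: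
  assumes ne: "\<Psi> (state_term D (\<lambda>t. i t mod r)) * quot_term (\<lambda>t. i t div r) \<noteq> 0"
  shows "\<exists>L. labelling D i L \<and> (\<forall>t\<in>crossings D. under_label D L t mod r + i t mod r < r)"
proof -
  obtain L1 where L1: "labelling D (\<lambda>t. i t mod r) L1" using ne state_term_no_labelling by fastforce
  obtain L2 where L2: "labelling D (\<lambda>t. i t div r) L2" using ne quot_term_no_labelling by fastforce
  have ne1: "\<Psi> (state_term D (\<lambda>t. i t mod r)) \<noteq> 0" using ne by auto
  let ?L = "map2 (map2 (\<lambda>x y. x + r * y)) L1 L2"
  have L: "labelling D i ?L"
    using labelling_from_digits[OF L1 L2 tangle, of r] by (simp add: mod_mult_div_eq)
  have small: "under_label D L1 t + i t mod r < r" if "t \<in> crossings D" "under_label D L1 t < r" for t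
  proof (rule ccontr)
    assume "\<not> ?thesis"
    then have "r \<le> under_label D L1 t mod r + (i t mod r) mod r" using that by simp
    from state_term_carry[OF L1 that(1) this] ne1 show False by simp
  qed
  have less: "set (L1 ! t) \<subseteq> {..<r}" if "t \<le> length D" for t
    using labels_less[OF L1 _ small that] r by simp
  have "under_label D ?L t mod r + i t mod r < r" if t: "t \<in> crossings D" for t
  proof -
    have tl: "t < length D" using t by (simp add: crossings_def)
    obtain p P where pP: "D ! t = (p, P)" by fastforce
    define pos where "pos = (if P = PosX then p + 1 else p)"
    have "P = PosX \<or> P = NegX" using t by (auto simp: crossings_def pP)
    then have "pos < length (orient D t)"
      using tangle_layer_nth(1)[OF tangle tl pP, of 0] tangle_layer_nth(1)[OF tangle tl pP, of 1]
      by (auto simp: pos_def)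
    then have pos: "pos < length (L1 ! t)" "pos < length (L2 ! t)"
      using labelling_length[OF tangle L1, of t] labelling_length[OF tangle L2, of t] tl by auto
    have len: "length L1 = Suc (length D)" "length L2 = Suc (length D)"
      using L1 L2 by (auto simp: labelling_def)
    have u1: "under_label D L1 t = L1 ! t ! pos" by (simp add: under_label_def pP pos_def)
    have "under_label D ?L t = ?L ! t ! pos" by (simp add: under_label_def pP pos_def)
    also have "\<dots> = L1 ! t ! pos + r * (L2 ! t ! pos)" using tl len pos by simp
    finally have u: "under_label D ?L t = under_label D L1 t + r * (L2 ! t ! pos)" unfolding u1 .
    have "under_label D L1 t < r" using less[of t] pos(1) tl unfolding u1 by (force simp: subset_iff)
    then show ?thesis using small[OF t] unfolding u by simp
  qed
  then show ?thesis using L by blast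
qed

text \<open>If some labelling has no carry, the weights factorize layer by layer. Otherwise the left
  side is 0 by the q-Lucas theorem and the right side by \<open>combined_labelling\<close>.\<close>

lemma state_term_factor:
  "\<Psi> (state_term D i) = \<Psi> (state_term D (\<lambda>t. i t mod r)) * quot_term (\<lambda>t. i t div r)"
proof (cases "\<exists>L. labelling D i L \<and> (\<forall>t\<in>crossings D. under_label D L t mod r + i t mod r < r)")
  case True
  then obtain L where L: "labelling D i L"
    and nc: "\<And>t. t \<in> crossings D \<Longrightarrow> under_label D L t mod r + i t mod r < r" by blast
  have len: "length L = Suc (length D)" using L by (simp add: labelling_def)
  have "0 < r" using r by simp
  note dig = labelling_digits[OF tangle L this nc]
  have "\<Psi> (\<Prod>t<length D. label_weight (snd (D ! t)) (i t) (lower D L t) (upper D L t)) =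
    \<Psi> (\<Prod>t<length D. label_weight (snd (D ! t)) (i t mod r) (lower D (map (map (\<lambda>x. x mod r)) L) t)
      (upper D (map (map (\<lambda>x. x mod r)) L) t)) *
    (\<Prod>t<length D. quot_weight (snd (D ! t)) (i t div r) (lower D (map (map (\<lambda>x. x div r)) L) t))"
    unfolding \<Psi>.prod prod.distrib[symmetric]
  proof (intro prod.cong refl)
    fix t assume "t \<in> {..<length D}"
    then have t: "t < length D" by simp
    have low: "lower D (map (map f) L) t = map f (lower D L t)" for f using t len by (intro lower_map) simp
    have up: "upper D (map (map f) L) t = map f (upper D L t)" for f using t len by (intro upper_map) simp
    show "\<Psi> (label_weight (snd (D ! t)) (i t) (lower D L t) (upper D L t)) =
      \<Psi> (label_weight (snd (D ! t)) (i t mod r) (lower D (map (map (\<lambda>x. x mod r)) L) t) (upper D (map (map (\<lambda>x. x mod r)) L) t)) *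
      quot_weight (snd (D ! t)) (i t div r) (lower D (map (map (\<lambda>x. x div r)) L) t)"
      unfolding low up
    proof (rule quot_weight_digits[OF labelling_rule[OF L t]])
      assume "snd (D ! t) = PosX \<or> snd (D ! t) = NegX"
      then have "t \<in> crossings D" using t by (simp add: crossings_def)
      from nc[OF this] under_label_lower[OF L this]
      show "(if snd (D ! t) = PosX then lower D L t ! 1 else lower D L t ! 0) mod r + i t mod r < r"
        by simp
    qed
  qed
  then show ?thesis
    by (simp only: state_term_eq[OF L] state_term_eq[OF dig(1)] quot_term_eq[OF dig(2)])
next
  case False
  have "\<Psi> (state_term D i) = 0"
  proof (cases "\<exists>L. labelling D i L")
    case True
    then show ?thesis using False state_term_carry not_less by metis
  qed (simp add: state_term_no_labelling)
  then show ?thesis using combined_labelling[of i] False by metis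
qed

definition quot_sum :: "nat \<Rightarrow> laurent_A" where
  "quot_sum N = (\<Sum>i\<in>box D N. quot_term i)"

text \<open>Division with remainder is a bijection from the increments below r N to pairs of
  remainders below r and quotients below N, so the sum becomes a product.\<close>

lemma box_sum_factor: "\<Psi> (box_sum D (r * N)) = \<Psi> (box_sum D r) * quot_sum N"
proof -
  let ?C = "crossings D"
  have "\<Psi> (box_sum D (r * N)) = (\<Sum>i\<in>box D (r * N). \<Psi> (state_term D (\<lambda>t. i t mod r)) * quot_term (\<lambda>t. i t div r))"
    unfolding box_sum_def \<Psi>.sum state_term_factor[symmetric] ..
  also have "\<dots> = (\<Sum>(f, g)\<in>box D r \<times> box D N. \<Psi> (state_term D f) * quot_term g)"
  proof (rule sum.reindex_bij_witness[where
        j = "\<lambda>i. (restrict (\<lambda>t. i t mod r) ?C, restrict (\<lambda>t. i t div r) ?C)" and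
        i = "\<lambda>(f, g). restrict (\<lambda>t. f t + r * g t) ?C"])
    fix i assume i: "i \<in> box D (r * N)"
    then have i': "i \<in> extensional ?C" "\<And>t. t \<in> ?C \<Longrightarrow> i t < r * N" by (auto simp: box_def PiE_def)
    show "(case (restrict (\<lambda>t. i t mod r) ?C, restrict (\<lambda>t. i t div r) ?C) of (f, g) \<Rightarrow> restrict (\<lambda>t. f t + r * g t) ?C) = i"
      using i' by (auto simp: restrict_def extensional_def fun_eq_iff)
    show "(restrict (\<lambda>t. i t mod r) ?C, restrict (\<lambda>t. i t div r) ?C) \<in> box D r \<times> box D N"
      using i' r by (auto simp: box_def less_mult_imp_div_less mult.commute)
    show "(case (restrict (\<lambda>t. i t mod r) ?C, restrict (\<lambda>t. i t div r) ?C) of (f, g) \<Rightarrow> \<Psi> (state_term D f) * quot_term g) =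
        \<Psi> (state_term D (\<lambda>t. i t mod r)) * quot_term (\<lambda>t. i t div r)"
      using state_term_cong[of "restrict (\<lambda>t. i t mod r) ?C" "\<lambda>t. i t mod r"]
        quot_term_cong[of "restrict (\<lambda>t. i t div r) ?C" "\<lambda>t. i t div r"] by simp
  next
    fix fg assume "fg \<in> box D r \<times> box D N"
    then obtain f g where fg: "fg = (f, g)" "f \<in> box D r" "g \<in> box D N" by blast
    have f: "f \<in> extensional ?C" "\<And>t. t \<in> ?C \<Longrightarrow> f t < r" and g: "g \<in> extensional ?C" "\<And>t. t \<in> ?C \<Longrightarrow> g t < N"
      using fg by (auto simp: box_def PiE_def)
    have "restrict (\<lambda>t. restrict (\<lambda>t. f t + r * g t) ?C t mod r) ?C = f"
      "restrict (\<lambda>t. restrict (\<lambda>t. f t + r * g t) ?C t div r) ?C = g"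
      using f g r by (auto simp: restrict_def extensional_def fun_eq_iff)
    then show "(restrict (\<lambda>t. (case fg of (f, g) \<Rightarrow> restrict (\<lambda>t. f t + r * g t) ?C) t mod r) ?C,
        restrict (\<lambda>t. (case fg of (f, g) \<Rightarrow> restrict (\<lambda>t. f t + r * g t) ?C) t div r) ?C) = fg"
      by (simp add: fg)
    have "f t + r * g t < r * N" if "t \<in> ?C" for t
    proof -
      have "f t + r * g t < r * Suc (g t)" using f(2)[OF that] by simp
      also have "\<dots> \<le> r * N" using g(2)[OF that] by (intro mult_le_mono2) simp
      finally show ?thesis .
    qed
    then show "(case fg of (f, g) \<Rightarrow> restrict (\<lambda>t. f t + r * g t) ?C) \<in> box D (r * N)"
      by (auto simp: box_def fg)
  qed
  also have "\<dots> = \<Psi> (box_sum D r) * quot_sum N"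
    unfolding box_sum_def quot_sum_def \<Psi>.sum sum_product by (simp add: sum.cartesian_product)
  finally show ?thesis .
qed

end

subsection \<open>The shift A to zeta A\<close>

lemma ringhom_shift_A: "ringhom (shift_A r)"
  unfolding shift_A_def
  by (intro ringhom_evalL ringhom_single) (simp add: character_def mult_single power_int_add)

lemma shift_A_single: "shift_A r (Poly_Mapping.single k c) = Poly_Mapping.single k (c * zeta r powi k)"
  by (simp add: shift_A_def evalL_single mult_single)

context root_of_unity
begin

sublocale shift: ringhom "shift_A r" by (rule ringhom_shift_A)

lemma shift_\<Psi>_alpha: "shift_A r (\<Psi> (alpha_brace k n)) = \<Psi> (alpha_brace (k + 1) n)"
proof (induction n)
  case (Suc n)
  have "shift_A r (\<Psi> (qA (k - int n) 1 - qA (int n - k) (- 1))) = \<Psi> (qA (k + 1 - int n) 1 - qA (int n - (k + 1)) (- 1))"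
  proof -
    have e: "k + 1 - int n = (k - int n) + 1" "int n - (k + 1) = (int n - k) + - 1" by simp_all
    have z: "zeta r powi (a + b) = zeta r powi a * zeta r powi b" for a b
      by (simp add: power_int_add)
    show ?thesis unfolding e \<Psi>.diff shift.diff at_zeta_qA shift_A_single z ..
  qed
  then show ?case using Suc by (simp add: alpha_brace_Suc \<Psi>.mult shift.mult)
qed simp

text \<open>The shifted block is {\<alpha>+1; r}. It is compared with {\<alpha>+1-r; r}, which
  arises both from shifting it by r and, since 1 - r = -(r - 1), from shifting the block itself by r
  - 1.\<close>

lemma shift_block: "shift_A r block = - block"
proof -
  have 1: "\<Psi> (alpha_brace (1 - int r * int 1) r) = zc (int r * int 1 * int r) * \<Psi> (alpha_brace 1 r)"
    by (rule \<Psi>_alpha_shift)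
  have e: "1 - int r * int 1 = - int (r - 1)" using r by (simp add: of_nat_diff)
  have 2: "\<Psi> (alpha_brace (1 - int r * int 1) r) = zc (int r * int (r - 1)) * block"
    unfolding e by (rule \<Psi>_alpha_block)
  have "\<Psi> (alpha_brace 1 r) = zc (- (int r * int r)) * (zc (int r * int 1 * int r) * \<Psi> (alpha_brace 1 r))"
  proof -
    have "zc (- (int r * int r)) * zc (int r * int 1 * int r) = 1" unfolding zc_add[symmetric] by simp
    then show ?thesis by (simp only: mult.assoc[symmetric] mult_1_left)
  qed
  also have "\<dots> = zc (- (int r * int r)) * (zc (int r * int (r - 1)) * block)"
    unfolding 1[symmetric] 2 ..
  also have "\<dots> = zc (- int r) * block"
  proof -
    have "- (int r * int r) + int r * int (r - 1) = - int r" using r by (simp add: of_nat_diff algebra_simps)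
    then show ?thesis by (simp only: zc_add[symmetric] mult.assoc[symmetric])
  qed
  also have "zc (- int r) = - 1"
    using zeta_power_r[OF r] by (simp add: power_int_minus single_uminus)
  finally show ?thesis using shift_\<Psi>_alpha[of 0 r] by (simp add: block_def)
qed

text \<open>Each block and each factor A^r or A^(-r) changes sign, which gives i + (a + b) signs at
  a crossing.\<close>

lemma shift_quot_weight:
  assumes "label_rule P i ws zs"
  shows "shift_A r (quot_weight P i ws) =
    (-1) ^ (if P = PosX \<or> P = NegX then sum_list ws + i else 0) * quot_weight P i ws"
proof -
  have c: "shift_A r (cst c) = cst c" for c by (simp add: shift_A_single)
  have b: "shift_A r ((zc e * block) ^ i) = (-1) ^ i * (zc e * block) ^ i" for e
  proof -
    have "shift_A r (zc e * block) = - 1 * (zc e * block)" by (simp add: shift.mult c shift_block)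
    then show ?thesis unfolding shift.power by (simp only: power_mult_distrib)
  qed
  have m1: "(-1 :: laurent_A) = cst (- 1)" by (simp add: single_uminus)
  have s: "shift_A r (Poly_Mapping.single (int r * int n) 1) = (-1) ^ n * Poly_Mapping.single (int r * int n) 1" for n
  proof -
    have "(-1 :: laurent_A) ^ n = cst ((-1) ^ n)"
      by (induction n) (simp_all add: single_uminus)
    then show ?thesis by (simp add: shift_A_single zeta_powi_r[OF r] mult_single)
  qed
  have s': "shift_A r (Poly_Mapping.single (- int r * int n) 1) = (-1) ^ n * Poly_Mapping.single (- int r * int n) 1" for n
  proof -
    have "(-1 :: laurent_A) ^ n = cst ((-1) ^ n)"
      by (induction n) (simp_all add: single_uminus)
    moreover have "zeta r powi (- int r * int n) = (-1) ^ n"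
      using zeta_powi_r[OF r, of n] by (cases "even n") (simp_all add: power_int_minus)
    ultimately show ?thesis by (simp add: shift_A_single mult_single)
  qed
  show ?thesis
  proof (cases "P = PosX \<or> P = NegX")
    case True
    then show ?thesis
    proof
      assume P: "P = PosX"
      then obtain a b where ws: "ws = [b, a]" using label_rule_crossing(1)[OF assms] by blast
      show ?thesis unfolding P ws
        by (simp only: quot_weight.simps shift.mult shift.of_nat b s')
          (simp add: power_add ac_simps)
    next
      assume P: "P = NegX"
      then obtain a b where ws: "ws = [a, b]" using label_rule_crossing(2)[OF assms] by blast
      show ?thesis unfolding P ws
        by (simp only: quot_weight.simps shift.mult shift.of_nat b s)
          (simp add: power_add shift.power shift.uminus ac_simps)
    qed
  next
    case False
    then show ?thesis by (cases P) simp_all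
  qed
qed

text \<open>Evaluation at A = 1, which is the constant term in h when A = e^h.\<close>

definition at_one :: "laurent_A \<Rightarrow> complex" where
  "at_one = evalL (\<lambda>c. c) (\<lambda>_. 1)"

lemma ringhom_at_one: "ringhom at_one"
  unfolding at_one_def by (intro ringhom_evalL ringhom_id) (simp add: character_def)

sublocale one: ringhom at_one by (rule ringhom_at_one)

lemma at_one_single: "at_one (Poly_Mapping.single k c) = c"
  by (simp add: at_one_def evalL_single)

lemma at_one_block: "at_one block = 0"
proof -
  obtain n where "r = Suc n" using r by (cases r) auto
  then have "alpha_brace 0 r = (qA 0 1 - qA (- 0) (- 1)) * alpha_brace (0 - 1) n"
    by (simp only: alpha_brace_Suc')
  then show ?thesis
    by (simp add: block_def \<Psi>.mult \<Psi>.diff one.mult one.diff at_zeta_qA at_one_single)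
qed

end

context knot_root
begin

text \<open>The signs of all crossings multiply to 1 by \<open>labelling_parity\<close>.\<close>

lemma shift_quot_term: "shift_A r (quot_term i) = quot_term i"
proof (cases "\<exists>L. labelling D i L")
  case True
  then obtain L where L: "labelling D i L" by blast
  let ?c = "\<lambda>t. if snd (D ! t) = PosX \<or> snd (D ! t) = NegX then sum_list (lower D L t) + i t else 0"
  have "shift_A r (quot_term i) = (\<Prod>t<length D. (-1) ^ ?c t * quot_weight (snd (D ! t)) (i t) (lower D L t))"
    unfolding quot_term_eq[OF L] shift.prod
  proof (intro prod.cong refl)
    fix t assume "t \<in> {..<length D}"
    then show "shift_A r (quot_weight (snd (D ! t)) (i t) (lower D L t)) =
        (-1) ^ ?c t * quot_weight (snd (D ! t)) (i t) (lower D L t)"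
      by (intro shift_quot_weight[OF labelling_rule[OF L]]) simp
  qed
  also have "\<dots> = (-1) ^ (\<Sum>t<length D. ?c t) * quot_term i"
    unfolding prod.distrib quot_term_eq[OF L] power_sum ..
  also have "(-1 :: laurent_A) ^ (\<Sum>t<length D. ?c t) = 1"
    using labelling_parity[OF tangle L] by simp
  finally show ?thesis by simp
qed (simp add: quot_term_no_labelling)

text \<open>A positive increment brings in a block, which vanishes at A = 1. Only the zero labelling
  survives, and its weights are 1.\<close>

lemma at_one_quot_term:
  "at_one (quot_term i) = (if \<forall>t\<in>crossings D. i t = 0 then 1 else 0)"
proof (cases "\<forall>t\<in>crossings D. i t = 0")
  case True
  have L: "labelling D i (zero_labels D)"
    by (rule labelling_cong[OF _ zero_labelling]) (use True in auto)
  have "at_one (quot_weight (snd (D ! t)) (i t) (lower D (zero_labels D) t)) = 1" if t: "t < length D" for t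
  proof -
    obtain p P where pP: "D ! t = (p, P)" by fastforce
    have ws: "set (lower D (zero_labels D) t) \<subseteq> {0}"
      using labelling_zero_lower[OF L, of t] True t by (meson less_imp_le order_trans set_drop_subset set_take_subset)
    note r1 = labelling_rule[OF L t]
    have it: "P = PosX \<or> P = NegX \<Longrightarrow> i t = 0" using True t pP by (auto simp: crossings_def)
    show ?thesis
    proof (cases "P = PosX \<or> P = NegX")
      case True
      then show ?thesis
      proof
        assume P: "P = PosX"
        then obtain a b where "lower D (zero_labels D) t = [b, a]" using label_rule_crossing(1)[OF r1] by (auto simp: pP)
        moreover from this ws have "a = 0" "b = 0" by auto
        ultimately show ?thesis using it P by (simp add: pP)
      next
        assume P: "P = NegX"
        then obtain a b where "lower D (zero_labels D) t = [a, b]" using label_rule_crossing(2)[OF r1] by (auto simp: pP)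
        moreover from this ws have "a = 0" "b = 0" by auto
        ultimately show ?thesis using it P by (simp add: pP)
      qed
    next
      case False
      then show ?thesis by (simp add: pP quot_weight_no_crossing)
    qed
  qed
  then show ?thesis using True unfolding quot_term_eq[OF L] one.prod by simp
next
  case False
  then obtain t where t: "t \<in> crossings D" "i t \<noteq> 0" by blast
  show ?thesis
  proof (cases "\<exists>L. labelling D i L")
    case True
    then obtain L where L: "labelling D i L" by blast
    have tl: "t < length D" using t by (simp add: crossings_def)
    have "at_one (quot_weight (snd (D ! t)) (i t) (lower D L t)) = 0"
    proof (cases "snd (D ! t) = PosX")
      case True
      then show ?thesis using label_rule_crossing(1)[OF labelling_rule[OF L tl] True] t
        by (auto simp: one.mult one.power at_one_block)
    next
      case False
      then have "snd (D ! t) = NegX" using t by (auto simp: crossings_def)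
      then show ?thesis using label_rule_crossing(2)[OF labelling_rule[OF L tl]] t
        by (auto simp: one.mult one.power at_one_block)
    qed
    then have "at_one (quot_term i) = 0"
      unfolding quot_term_eq[OF L] one.prod using tl by (intro prod_zero) auto
    then show ?thesis using False by simp
  qed (use False in \<open>auto simp: quot_term_no_labelling\<close>)
qed

lemma shift_quot_sum: "shift_A r (quot_sum N) = quot_sum N"
  by (simp add: quot_sum_def shift.sum shift_quot_term)

lemma at_one_quot_sum:
  assumes "0 < N"
  shows "at_one (quot_sum N) = 1"
proof -
  let ?z = "restrict (\<lambda>_. 0) (crossings D)"
  have "at_one (quot_sum N) = (\<Sum>i\<in>box D N. if i = ?z then 1 else 0)"
    unfolding quot_sum_def one.sum
  proof (intro sum.cong refl)
    fix i assume "i \<in> box D N"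
    then have "(\<forall>t\<in>crossings D. i t = 0) \<longleftrightarrow> i = ?z"
      by (auto simp: box_def PiE_def extensional_def restrict_def fun_eq_iff)
    then show "at_one (quot_term i) = (if i = ?z then 1 else 0)" by (simp add: at_one_quot_term)
  qed
  also have "\<dots> = 1"
  proof -
    have "?z \<in> box D N" using assms by (auto simp: box_def)
    then show ?thesis by (simp add: sum.delta)
  qed
  finally show ?thesis .
qed

end

section \<open>The ADO invariants as state sums\<close>

definition to_AT :: "laurent_A \<Rightarrow> laurent_AT" where
  "to_AT = evalL (Poly_Mapping.single 0) (\<lambda>k. Poly_Mapping.single (k, 0) 1)"

lemma ringhom_to_AT: "ringhom to_AT"
  unfolding to_AT_def
  by (intro ringhom_evalL ringhom_single) (simp add: character_def mult_single flip: zero_prod_def)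

lemma to_AT_single: "to_AT (Poly_Mapping.single k c) = Poly_Mapping.single (k, 0) c"
  by (simp add: to_AT_def evalL_single mult_single)

lemma lookup_to_AT: "Poly_Mapping.lookup (to_AT p) (k, 0) = Poly_Mapping.lookup p k"
proof -
  interpret ringhom to_AT by (rule ringhom_to_AT)
  show ?thesis
    by (induction p rule: poly_mapping_additive_induct)
      (simp_all add: to_AT_single lookup_single lookup_add add when_def)
qed

lemma to_AT_inj: "to_AT p = to_AT p' \<Longrightarrow> p = p'"
  by (rule poly_mapping_eqI) (metis lookup_to_AT)

context root_of_unity
begin

definition ado_hom :: "laurent_qA \<Rightarrow> laurent_AT" where
  "ado_hom x = to_AT (\<Psi> x)"

lemma ringhom_ado: "ringhom ado_hom"
  using ringhom_comp[OF ringhom_to_AT ringhom_at_zeta[of r]] by (simp add: ado_hom_def[abs_def])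

lemma ado_hom_qA: "ado_hom (qA k l) = Poly_Mapping.single (l, 0) (zeta r powi k)"
  by (simp add: ado_hom_def at_zeta_qA to_AT_single)

lemma ado_hom_qbinom:
  assumes "k \<le> n" "n < r"
  shows "ado_hom (qbinom_R n k) = Poly_Mapping.single 0 (qbinom (zeta r) n k)"
proof -
  interpret a: ringhom ado_hom by (rule ringhom_ado)
  have c: "ringhom (Poly_Mapping.single (0 :: int \<times> int) :: complex \<Rightarrow> _)" by (rule ringhom_single)
  have "qbinom (zeta r) n k = zeta r powi (- int (k * (n - k))) * gauss ((zeta r)^2) n k"
    by (rule qbinom_eq_gauss) (use assms zeta_square_neq_1[of _ r] in auto)
  moreover have "ado_hom (qA 2 0) = Poly_Mapping.single 0 ((zeta r)^2)"
    by (simp add: ado_hom_qA zero_prod_def power_int_def)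
  ultimately show ?thesis
    unfolding qbinom_R_eq[OF assms(1)]
    by (simp add: a.mult a.gauss ado_hom_qA ringhom.mult[OF c] ringhom.gauss[OF c] flip: zero_prod_def)
qed

lemma ado_hom_alpha_brace: "ado_hom (alpha_brace k n) = zeta_brace_prod r k n"
proof -
  interpret a: ringhom ado_hom by (rule ringhom_ado)
  show ?thesis
    unfolding alpha_brace_prod zeta_brace_prod_def a.prod a.diff ado_hom_qA ..
qed

text \<open>The framing unit is the symbol T for zeta^(\<alpha>^2/2). The pivotal unit A^(-r) comes
  from K^(1-r), since zeta^(2 i r) = 1 makes K^r the scalar A^r.\<close>

lemma ado_model:
  "rt_model ado_hom (ado_data r) (Poly_Mapping.single (0, 1) 1) (Poly_Mapping.single (0, - 1) 1)
     (to_AT (Poly_Mapping.single (- int r) 1)) (to_AT (Poly_Mapping.single (int r) 1))"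
proof -
  interpret a: ringhom ado_hom by (rule ringhom_ado)
  show ?thesis
  proof unfold_locales
    show "Poly_Mapping.single (0, 1) 1 * Poly_Mapping.single (0, - 1) 1 = (1 :: laurent_AT)"
      by (simp add: mult_single flip: zero_prod_def)
    show "to_AT (Poly_Mapping.single (- int r) 1) * to_AT (Poly_Mapping.single (int r) 1) = 1"
      by (simp add: to_AT_single mult_single flip: zero_prod_def)
    show "0 < dim (ado_data r)" using r by (simp add: ado_data_def)
    show "ado_hom (fdiv m y) = 0" if "y < dim (ado_data r)" "m < dim (ado_data r)" "dim (ado_data r) \<le> y + m" for m y
    proof -
      have "\<Psi> (fdiv m y) = 0" using that by (intro \<Psi>_fdiv_carry) (simp add: ado_data_def)
      then show ?thesis using ringhom.zero[OF ringhom_to_AT] by (simp add: ado_hom_def)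
    qed
    show "piv (ado_data r) i = to_AT (Poly_Mapping.single (- int r) 1) * ado_hom (qA (- 2 * int i) 1)" for i
    proof -
      have "zeta r powi (- 2 * int i * (1 - int r)) = zeta r powi (- 2 * int i)"
        by (rule zeta_powi_cong[OF r, of _ _ "int i"]) (simp add: algebra_simps)
      then show ?thesis by (simp add: ado_data_def ado_hom_qA to_AT_single mult_single)
    qed
    show "piv_inv (ado_data r) i = to_AT (Poly_Mapping.single (int r) 1) * ado_hom (qA (2 * int i) (- 1))" for i
    proof -
      have "zeta r powi (- 2 * int i * (int r - 1)) = zeta r powi (2 * int i)"
        by (rule zeta_powi_cong[OF r, of _ _ "- int i"]) (simp add: algebra_simps)
      then show ?thesis by (simp add: ado_data_def ado_hom_qA to_AT_single mult_single)
    qed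
    fix x y k l assume b: "x < dim (ado_data r)" "y < dim (ado_data r)" "k < dim (ado_data r)" "l < dim (ado_data r)"
    then have b': "x < r" "y < r" "k < r" "l < r" by (simp_all add: ado_data_def)
    have e: "Rmat (ado_data r) (x, y) (k, l) = Poly_Mapping.single (- int (k + l), 1) (zeta r powi int (2 * k * l)) *
        (\<Sum>n<r. if x = k + n then Poly_Mapping.single 0 (zeta r ^ (n * (n - 1) div 2)) * F_div r n y l else 0)"
    proof -
      have "(\<Sum>n<r. Poly_Mapping.single 0 (zeta r ^ (n * (n - 1) div 2)) * mat_pow r E_mat n x k * F_div r n y l) =
        (\<Sum>n<r. if x = k + n then Poly_Mapping.single 0 (zeta r ^ (n * (n - 1) div 2)) * F_div r n y l else 0)"
        using b' by (intro sum.cong) (simp_all add: mat_pow_E del: mat_pow.simps)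
      then show ?thesis by (simp add: ado_data_def del: mat_pow.simps)
    qed
    show "Rmat (ado_data r) (x, y) (k, l) = (if k \<le> x \<and> k + l = x + y
      then Poly_Mapping.single (0, 1) 1 * ado_hom (label_weight PosX (x - k) [x, y] []) else 0)"
    proof (cases "k \<le> x")
      case False
      then show ?thesis unfolding e by (auto intro!: sum.neutral)
    next
      case True
      define n where "n = x - k"
      have n: "n < r" "x = k + n" using True b' by (auto simp: n_def)
      have "(\<Sum>n<r. if x = k + n then Poly_Mapping.single 0 (zeta r ^ (n * (n - 1) div 2)) * F_div r n y l else 0) =
          (\<Sum>j<r. if j = n then Poly_Mapping.single 0 (zeta r ^ (j * (j - 1) div 2)) * F_div r j y l else 0)"
        using n by (intro sum.cong) auto
      also have "\<dots> = Poly_Mapping.single 0 (zeta r ^ (n * (n - 1) div 2)) * F_div r n y l"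
        using n by (simp add: sum.delta)
      finally have e': "Rmat (ado_data r) (x, y) (k, l) = Poly_Mapping.single (- int (k + l), 1) (zeta r powi int (2 * k * l)) *
          (Poly_Mapping.single 0 (zeta r ^ (n * (n - 1) div 2)) * F_div r n y l)"
        unfolding e by simp
      show ?thesis
      proof (cases "l = y + n")
        case False
        then show ?thesis unfolding e' using n by (auto simp: F_div_def)
      next
        case l: True
        have F: "F_div r n y l = ado_hom (fdiv n y)"
          using l b' by (simp add: F_div_def fdiv_def a.mult ado_hom_qbinom ado_hom_alpha_brace add.commute)
        have "zeta r ^ (n * (n - 1) div 2) = zeta r powi tri n" by (simp add: tri_def)
        then have 1: "Poly_Mapping.single (- int (k + l), 1) (zeta r powi int (2 * k * l)) *
            Poly_Mapping.single 0 (zeta r ^ (n * (n - 1) div 2)) =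
            Poly_Mapping.single (- int (k + l), 1) (zeta r powi (int (2 * k * l) + tri n))"
          by (simp add: mult_single power_int_add)
        have 2: "Poly_Mapping.single (0, 1) 1 * ado_hom (qA (tri n + 2 * (int y + int n) * (int x - int n)) (- int (y + x))) =
            Poly_Mapping.single (- int (k + l), 1) (zeta r powi (int (2 * k * l) + tri n))"
          unfolding ado_hom_qA using n l by (simp add: mult_single algebra_simps)
        have "Rmat (ado_data r) (x, y) (k, l) = Poly_Mapping.single (- int (k + l), 1) (zeta r powi (int (2 * k * l) + tri n)) *
            ado_hom (fdiv n y)"
          unfolding e' F mult.assoc[symmetric] 1 ..
        also have "\<dots> = Poly_Mapping.single (0, 1) 1 * ado_hom (label_weight PosX (x - k) [x, y] [])"
          unfolding 2[symmetric] label_weight_PosX a.mult n_def[symmetric] by (simp only: ac_simps)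
        finally show ?thesis using True l n by simp
      qed
    qed
  qed
qed

lemma dim_ado [simp]: "dim (ado_data r) = r"
  by (simp add: ado_data_def)

end

section \<open>The ring generated by zeta\<close>

lemma ringhom_eval_int_poly: "ringhom (\<lambda>p :: int poly. poly (map_poly of_int p) (z :: complex))"
proof
  show "poly (map_poly of_int 1) z = 1" by simp
  fix x y :: "int poly"
  have "map_poly of_int (x + y) = map_poly of_int x + (map_poly of_int y :: complex poly)"
    by (rule poly_eqI) (simp add: coeff_map_poly)
  then show "poly (map_poly of_int (x + y)) z = poly (map_poly of_int x) z + poly (map_poly of_int y) z"
    by simp
  have "map_poly of_int (x * y) = map_poly of_int x * (map_poly of_int y :: complex poly)"
    by (rule poly_eqI) (simp add: coeff_map_poly coeff_mult)
  then show "poly (map_poly of_int (x * y)) z = poly (map_poly of_int x) z * poly (map_poly of_int y) z"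
    by simp
qed

lemma Z_zeta_closed:
  "a \<in> Z_zeta r \<Longrightarrow> b \<in> Z_zeta r \<Longrightarrow> a + b \<in> Z_zeta r"
  "a \<in> Z_zeta r \<Longrightarrow> b \<in> Z_zeta r \<Longrightarrow> a * b \<in> Z_zeta r"
  "a \<in> Z_zeta r \<Longrightarrow> - a \<in> Z_zeta r"
  "of_int m \<in> Z_zeta r"
proof -
  interpret e: ringhom "\<lambda>p :: int poly. poly (map_poly of_int p) (zeta r)" by (rule ringhom_eval_int_poly)
  show "a \<in> Z_zeta r \<Longrightarrow> b \<in> Z_zeta r \<Longrightarrow> a + b \<in> Z_zeta r"
    unfolding Z_zeta_def by (auto simp flip: e.add)
  show "a \<in> Z_zeta r \<Longrightarrow> b \<in> Z_zeta r \<Longrightarrow> a * b \<in> Z_zeta r"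
    unfolding Z_zeta_def by (auto simp flip: e.mult)
  show "a \<in> Z_zeta r \<Longrightarrow> - a \<in> Z_zeta r"
    unfolding Z_zeta_def by (auto simp flip: e.uminus)
  show "of_int m \<in> Z_zeta r"
    unfolding Z_zeta_def using e.of_int[of m] by (metis rangeI)
qed

lemma Z_zeta_0: "0 \<in> Z_zeta r"
  using Z_zeta_closed(4)[of 0] by simp

lemma Z_zeta_1: "1 \<in> Z_zeta r"
  using Z_zeta_closed(4)[of 1] by simp

lemma Z_zeta_sum: "(\<And>i. i \<in> S \<Longrightarrow> f i \<in> Z_zeta r) \<Longrightarrow> (\<Sum>i\<in>S. f i) \<in> Z_zeta r"
  by (induction S rule: infinite_finite_induct) (auto intro: Z_zeta_0 Z_zeta_closed)

lemma Z_zeta_powi: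
  assumes r: "1 \<le> r"
  shows "zeta r powi k \<in> Z_zeta r"
proof -
  have "zeta r = poly (map_poly of_int [:0, 1:]) (zeta r)"
    by (simp add: map_poly_pCons)
  then have "zeta r \<in> Z_zeta r" unfolding Z_zeta_def by (metis rangeI)
  then have pow: "zeta r ^ n \<in> Z_zeta r" for n
    by (induction n) (auto intro: Z_zeta_1 Z_zeta_closed)
  \<comment> \<open>Adding a multiple of 2r large enough to make the exponent nonnegative shows that
    negative powers of zeta also lie in the ring.\<close>
  have "1 * \<bar>k\<bar> \<le> 2 * int r * \<bar>k\<bar>" using r by (intro mult_right_mono) auto
  then have "0 \<le> k + 2 * int r * \<bar>k\<bar>" by linarith
  then have "zeta r powi (k + 2 * int r * \<bar>k\<bar>) \<in> Z_zeta r" using pow by (simp add: power_int_def)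
  then show ?thesis using zeta_powi_cong[OF r refl] by metis
qed

definition Zr :: "nat \<Rightarrow> laurent_A set" where
  "Zr r = {p. \<forall>k. Poly_Mapping.lookup p k \<in> Z_zeta r}"

lemma Zr_single: "c \<in> Z_zeta r \<Longrightarrow> Poly_Mapping.single k c \<in> Zr r"
  by (auto simp: Zr_def lookup_single when_def Z_zeta_0)

lemma Zr_add: "p \<in> Zr r \<Longrightarrow> q \<in> Zr r \<Longrightarrow> p + q \<in> Zr r"
  by (auto simp: Zr_def lookup_add intro: Z_zeta_closed)

lemma Zr_uminus: "p \<in> Zr r \<Longrightarrow> - p \<in> Zr r"
  by (auto simp: Zr_def intro: Z_zeta_closed)

lemma Zr_0: "0 \<in> Zr r"
  by (auto simp: Zr_def Z_zeta_0)

lemma Zr_1: "1 \<in> Zr r"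
  using Zr_single[OF Z_zeta_1, of 0] by simp

lemma Zr_sum: "(\<And>i. i \<in> S \<Longrightarrow> f i \<in> Zr r) \<Longrightarrow> (\<Sum>i\<in>S. f i) \<in> Zr r"
  by (induction S rule: infinite_finite_induct) (auto intro: Zr_0 Zr_add)

lemma Zr_mult:
  assumes "p \<in> Zr r" "q \<in> Zr r"
  shows "p * q \<in> Zr r"
proof -
  have "p * q = (\<Sum>k\<in>Poly_Mapping.keys p. Poly_Mapping.single k (Poly_Mapping.lookup p k)) *
      (\<Sum>l\<in>Poly_Mapping.keys q. Poly_Mapping.single l (Poly_Mapping.lookup q l))"
    by (simp flip: poly_mapping_sum_single)
  also have "\<dots> = (\<Sum>k\<in>Poly_Mapping.keys p. \<Sum>l\<in>Poly_Mapping.keys q.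
      Poly_Mapping.single (k + l) (Poly_Mapping.lookup p k * Poly_Mapping.lookup q l))"
    by (simp add: sum_product mult_single)
  also have "\<dots> \<in> Zr r"
    using assms by (intro Zr_sum Zr_single Z_zeta_closed) (auto simp: Zr_def)
  finally show ?thesis .
qed

lemma Zr_power: "p \<in> Zr r \<Longrightarrow> p ^ n \<in> Zr r"
  by (induction n) (auto intro: Zr_1 Zr_mult)

lemma Zr_evalL:
  assumes "\<And>k. m k \<in> Zr r"
  shows "evalL of_int m p \<in> Zr r"
  unfolding evalL_def
proof (intro Zr_sum Zr_mult assms)
  show "of_int c \<in> Zr r" for c
    using Zr_single[OF Z_zeta_closed(4)[of c], of 0] by (simp flip: single_of_int)
qed

lemma at_zeta_Zr: "1 \<le> r \<Longrightarrow> at_zeta r x \<in> Zr r"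
  unfolding at_zeta_def by (intro Zr_evalL Zr_single Z_zeta_powi)

lemma Z_zeta_evalL: "1 \<le> r \<Longrightarrow> evalL of_int (\<lambda>k. zeta r powi (2 * k)) p \<in> Z_zeta r"
  unfolding evalL_def by (intro Z_zeta_sum Z_zeta_closed(2) Z_zeta_closed(4) Z_zeta_powi)

lemma shift_A_Zr:
  assumes r: "1 \<le> r" and p: "p \<in> Zr r"
  shows "shift_A r p \<in> Zr r"
proof -
  have "shift_A r p = (\<Sum>k\<in>Poly_Mapping.keys p. Poly_Mapping.single k (Poly_Mapping.lookup p k * zeta r powi k))"
    by (simp add: shift_A_def evalL_def mult_single)
  also have "\<dots> \<in> Zr r"
    using p by (intro Zr_sum Zr_single Z_zeta_closed Z_zeta_powi r) (auto simp: Zr_def)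
  finally show ?thesis .
qed

lemma carrier_ring_Rr: "carrier (ring_Rr r) = Zr r"
  by (simp add: ring_Rr_def Zr_def)

context knot_root
begin

definition pivotal_unit :: laurent_A where
  "pivotal_unit = Poly_Mapping.single (- int r) 1 ^ piece_count D CapLR * Poly_Mapping.single (int r) 1 ^ piece_count D CupLR"

lemma bounded_indices_box: "bounded_indices d D \<subseteq> box D d"
proof
  fix i assume "i \<in> bounded_indices d D"
  then obtain L where i: "i \<in> crossings D \<rightarrow>\<^sub>E UNIV" and L: "labelling D i L"
    and b: "\<forall>t\<le>length D. set (L ! t) \<subseteq> {..<d}" by (auto simp: bounded_indices_def)
  have "i t < d" if t: "t \<in> crossings D" for t
  proof -
    have tl: "t < length D" using t by (simp add: crossings_def)
    then have "set (lower D L t) \<subseteq> {..<d}"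
      using b by (meson less_imp_le order_trans set_drop_subset set_take_subset)
    then show ?thesis using label_rule_le[OF labelling_rule[OF L tl]] t by (auto simp: crossings_def)
  qed
  then show "i \<in> box D d" using i by (auto simp: box_def)
qed

text \<open>Zero writhe removes T. The indices of the box that are not bounded may be added: their
  increments are below r, so a label passing r is a carry and the term is 0.\<close>

lemma ADO_eq:
  assumes w: "writhe D = 0"
  shows "ADO r D = pivotal_unit * \<Psi> (box_sum D r)" and "ADO r D \<in> Zr r"
proof -
  interpret rt_model ado_hom "ado_data r" "Poly_Mapping.single (0, 1) 1" "Poly_Mapping.single (0, - 1) 1"
    "to_AT (Poly_Mapping.single (- int r) 1)" "to_AT (Poly_Mapping.single (int r) 1)" by (rule ado_model)
  interpret AT: ringhom to_AT by (rule ringhom_to_AT)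
  have "piece_count D PosX = piece_count D NegX" using w by (simp add: writhe_eq_piece_count)
  then have one: "(\<Prod>t<length D. piece_unit (snd (D ! t))) = to_AT pivotal_unit"
    unfolding prod_pieces pivotal_unit_def
    using units(1) by (simp add: AT.mult AT.power mult.assoc flip: power_mult_distrib)
  have "\<Psi> (\<Sum>i\<in>bounded_indices r D. state_term D i) = \<Psi> (box_sum D r)"
    unfolding box_sum_def \<Psi>.sum
  proof (rule sum.mono_neutral_left)
    show "\<forall>i\<in>box D r - bounded_indices r D. \<Psi> (state_term D i) = 0"
    proof
      fix i assume i: "i \<in> box D r - bounded_indices r D"
      show "\<Psi> (state_term D i) = 0"
      proof (rule state_term_vanishes[OF \<Psi>.ringhom_axioms knot, of r])
        show "\<Psi> (fdiv (i t) y) = 0" if "t \<in> crossings D" "y < r" "r \<le> y + i t" for t y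
        proof -
          have "i t < r" using i that(1) by (auto simp: box_def)
          then show ?thesis using that by (intro \<Psi>_fdiv_carry) simp
        qed
      qed (use i r box_subset[of D r] in auto)
    qed
  qed (simp_all add: bounded_indices_box)
  then have "RT (ado_data r) D [0] [0] = to_AT (pivotal_unit * \<Psi> (box_sum D r))"
    using RT_state_sum[OF knot] by (simp add: one ado_hom_def AT.mult)
  then have c: "acts_by_scalar (ado_data r) D (to_AT (pivotal_unit * \<Psi> (box_sum D r)))"
    using RT_acts_by_scalar[OF knot] by simp
  have in_Zr: "pivotal_unit * \<Psi> (box_sum D r) \<in> Zr r"
    unfolding pivotal_unit_def by (intro Zr_mult Zr_power Zr_single Z_zeta_1 at_zeta_Zr r)
  have "ADO r D = pivotal_unit * \<Psi> (box_sum D r)"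
    unfolding ADO_def to_AT_def[symmetric] carrier_ring_Rr
  proof (rule the_equality)
    fix p assume "p \<in> Zr r \<and> acts_by_scalar (ado_data r) D (to_AT p)"
    then show "p = pivotal_unit * \<Psi> (box_sum D r)" using acts_by_scalar_unique[OF _ c] to_AT_inj by blast
  qed (use c in_Zr in blast)
  then show "ADO r D = pivotal_unit * \<Psi> (box_sum D r)" "ADO r D \<in> Zr r" using in_Zr by auto
qed

text \<open>Each left-to-right turn contributes A^r or its inverse and hence one sign;
  \<open>even_turning\<close> counts these turns.\<close>

lemma shift_pivotal_unit:
  assumes "writhe D = 0"
  shows "shift_A r pivotal_unit = pivotal_unit"
proof -
  have m: "shift_A r (Poly_Mapping.single (- int r) 1) = - 1 * Poly_Mapping.single (- int r) 1"
    "shift_A r (Poly_Mapping.single (int r) 1) = - 1 * Poly_Mapping.single (int r) 1"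
    using zeta_power_r[OF r] by (simp_all add: shift_A_single power_int_minus single_uminus)
  have "shift_A r pivotal_unit = (- 1) ^ (piece_count D CapLR + piece_count D CupLR) * pivotal_unit"
    unfolding pivotal_unit_def shift.mult shift.power m power_mult_distrib power_add by (simp only: ac_simps)
  then show ?thesis using even_turning[OF assms] by simp
qed

end

section \<open>Approaching the root of unity\<close>

definition exp_A :: "laurent_A \<Rightarrow> complex fps" where
  "exp_A = evalL fps_const (\<lambda>k. fps_exp (of_int k))"

lemma ringhom_fps_const: "ringhom (fps_const :: 'a::comm_ring_1 \<Rightarrow> 'a fps)"
  by unfold_locales simp_all

lemma ringhom_exp_A: "ringhom exp_A"
  unfolding exp_A_def
  by (intro ringhom_evalL ringhom_fps_const) (simp add: character_def fps_exp_add_mult)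

lemma exp_A_single: "exp_A (Poly_Mapping.single k c) = fps_const c * fps_exp (of_int k)"
  by (simp add: exp_A_def evalL_single)

lemma exp_A_nth: "fps_nth (exp_A p) m = (\<Sum>k\<in>Poly_Mapping.keys p. Poly_Mapping.lookup p k * of_int k ^ m) / fact m"
  by (simp add: exp_A_def evalL_def fps_sum_nth sum_divide_distrib)

text \<open>The coefficients in h are the moments of p, regarded as a weight on its exponents. So p
  annihilates every polynomial function on them, and one vanishing at all exponents but k0 isolates
  the coefficient at k0.\<close>

lemma exp_A_eq_0:
  assumes "exp_A p = 0"
  shows "p = 0"
proof -
  let ?K = "Poly_Mapping.keys p" and ?c = "Poly_Mapping.lookup p"
  have moments: "(\<Sum>k\<in>?K. ?c k * of_int k ^ m) = 0" for m
    using exp_A_nth[of p m] assms by simp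
  have poly: "(\<Sum>k\<in>?K. ?c k * poly f (of_int k)) = 0" for f
  proof -
    have "(\<Sum>k\<in>?K. ?c k * poly f (of_int k)) = (\<Sum>k\<in>?K. \<Sum>m\<le>degree f. coeff f m * (?c k * of_int k ^ m))"
      by (simp add: poly_altdef sum_distrib_left mult.left_commute)
    also have "\<dots> = (\<Sum>m\<le>degree f. coeff f m * (\<Sum>k\<in>?K. ?c k * of_int k ^ m))"
      unfolding sum_distrib_left by (rule sum.swap)
    finally show ?thesis by (simp add: moments)
  qed
  have "?K = {}"
  proof (rule ccontr)
    assume "?K \<noteq> {}"
    then obtain k0 where k0: "k0 \<in> ?K" by blast
    define f where "f = (\<Prod>k\<in>?K - {k0}. [:- of_int k, 1 :: complex:])"
    have f: "poly f (of_int k) = 0 \<longleftrightarrow> k \<in> ?K - {k0}" for k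
      by (auto simp: f_def poly_prod)
    have "(\<Sum>k\<in>?K. ?c k * poly f (of_int k)) = (\<Sum>k\<in>{k0}. ?c k * poly f (of_int k))"
      using k0 f by (intro sum.mono_neutral_right) auto
    then have "?c k0 * poly f (of_int k0) = 0" using poly[of f] by simp
    then show False using f[of k0] k0 by (simp add: in_keys_iff)
  qed
  then show ?thesis by simp
qed

lemma ev_fps_const: "ev x (fps_const [:c:]) = fps_const c"
  by (rule fps_ext) (simp add: ev_def)

lemma fps_const_poly_mult: "fps_const [:a * b:] = fps_const [:a :: 'a::comm_ring_1:] * fps_const [:b:]"
  by simp

context root_of_unity
begin

lemma zeta_exps_mult:
  "fps_const [:zeta r powi (k + l):] * exps [:x + y, of_int (k + l) :: complex:] =
   (fps_const [:zeta r powi k:] * exps [:x, of_int k:]) * (fps_const [:zeta r powi l:] * exps [:y, of_int l:])"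
proof -
  have "[:x + y, of_int (k + l) :: complex:] = [:x, of_int k:] + [:y, of_int l:]" by simp
  then show ?thesis
    by (simp only: power_int_add[OF disjI1[OF zeta_nz]] fps_const_poly_mult exps_add mult.assoc mult.left_commute)
qed

lemma exp_A_at_one: "fps_nth (exp_A p) 0 = at_one p"
  by (simp add: exp_A_nth at_one_def evalL_def)

lemma shift_power_single: "(shift_A r ^^ j) (Poly_Mapping.single k c) = Poly_Mapping.single k (c * zeta r powi (int j * k))"
proof (induction j)
  case (Suc j)
  have "int (Suc j) * k = int j * k + k" by (simp add: algebra_simps)
  then show ?case by (simp only: funpow.simps comp_apply Suc shift_A_single power_int_add[OF disjI1[OF zeta_nz]] mult.assoc)
qed simp

lemma ringhom_shift_power: "ringhom (shift_A r ^^ j)"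
proof (induction j)
  case 0
  then show ?case using ringhom_id by (simp add: id_def)
next
  case (Suc j)
  then show ?case using ringhom_comp[OF ringhom_shift_A Suc] by (simp add: comp_def)
qed

text \<open>
  q = zeta e^(x h) and A = zeta^j e^(h (1 + j x)), where x is the polynomial variable. At x = 1/n with
  2r dividing n this is A = q^(n + j), as for the colored Jones polynomials; at x = 0 it is q = zeta.
\<close>

definition near_zeta :: "nat \<Rightarrow> laurent_qA \<Rightarrow> complex poly fps" where
  "near_zeta j = evalL of_int (\<lambda>e. fps_const [:zeta r powi (fst e + int j * snd e):] *
     exps [:of_int (snd e), of_int (fst e + int j * snd e):])"

lemma ringhom_near_zeta: "ringhom (near_zeta j)"
  unfolding near_zeta_def
proof (intro ringhom_evalL ringhom_of_int)
  let ?m = "\<lambda>e :: int \<times> int. fps_const [:zeta r powi (fst e + int j * snd e):] *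
     exps [:of_int (snd e), of_int (fst e + int j * snd e) :: complex:]"
  have "?m (a + b) = ?m a * ?m b" for a b
  proof -
    have "fst (a + b) + int j * snd (a + b) = (fst a + int j * snd a) + (fst b + int j * snd b)"
      by (simp add: algebra_simps)
    then show ?thesis by (simp only: snd_add of_int_add[of "snd a"] zeta_exps_mult)
  qed
  moreover have "[:1 :: complex:] = 1" by simp
  ultimately show "character ?m" by (simp add: character_def exps_0)
qed

lemma near_zeta_qA: "near_zeta j (qA k l) = fps_const [:zeta r powi (k + int j * l):] * exps [:of_int l, of_int (k + int j * l):]"
  by (simp add: near_zeta_def qA_def evalL_single)

text \<open>Among r consecutive braces there is one whose exponent of zeta is a multiple of r. There
  zeta^e = zeta^(-e), so its constant term in h vanishes identically in x.\<close>

lemma near_zeta_block_low: "near_zeta j (alpha_brace l r) \<in> low 1"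
proof -
  interpret z: ringhom "near_zeta j" by (rule ringhom_near_zeta)
  define i where "i = nat ((l + int j) mod int r)"
  have i: "i < r" "int i = (l + int j) mod int r"
    using r by (simp_all add: i_def nat_less_iff)
  define e where "e = (l + int j) div int r"
  have e: "l - int i + int j = int r * e" unfolding i(2) e_def
    by (metis add.commute add_diff_eq diff_add_eq minus_mod_eq_mult_div)
  have "zeta r powi (l - int i + int j * 1) = zeta r powi (int i - l + int j * - 1)"
    by (rule zeta_powi_cong[OF r, of _ _ e]) (use e in \<open>simp add: algebra_simps\<close>)
  then have low: "near_zeta j (qA (l - int i) 1 - qA (int i - l) (- 1)) \<in> low 1"
    unfolding z.diff near_zeta_qA by (simp add: low_def exps_def)
  have split: "near_zeta j (alpha_brace l r) = near_zeta j (qA (l - int i) 1 - qA (int i - l) (- 1)) *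
      (\<Prod>i\<in>{..<r} - {i}. near_zeta j (qA (l - int i) 1 - qA (int i - l) (- 1)))"
    unfolding alpha_brace_prod z.prod
    by (rule prod.remove[OF finite_lessThan, where x = i]) (use i(1) in simp)
  show ?thesis unfolding split mult.commute[of "near_zeta j (qA (l - int i) 1 - qA (int i - l) (- 1))"]
    by (rule low_mult[OF low])
qed

text \<open>A product of r N braces consists of N blocks, each divisible by h. So the convergence of
  the unified invariant in the ideals I_n becomes h-adic convergence at the root of unity.\<close>

lemma near_zeta_low: "a \<in> I_R (r * N) \<Longrightarrow> near_zeta j a \<in> low N"
proof (rule I_R_to_low[OF ringhom_near_zeta])
  interpret z: ringhom "near_zeta j" by (rule ringhom_near_zeta)
  show "near_zeta j (alpha_brace l (r * N)) \<in> low N" for l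
  proof (induction N arbitrary: l)
    case 0
    then show ?case by (simp add: low_def)
  next
    case (Suc N)
    have "alpha_brace l (r * Suc N) = alpha_brace l r * alpha_brace (l - int r) (r * N)"
      using alpha_brace_add[of l r "r * N"] by simp
    then show ?case using low_mult_low[OF near_zeta_block_low Suc] by (simp add: z.mult)
  qed
qed

definition jones_near_zeta :: "nat \<Rightarrow> laurent_q \<Rightarrow> complex fps" where
  "jones_near_zeta n = evalL of_int (\<lambda>k. fps_const (zeta r powi k) * fps_exp (of_int k / of_nat n))"

lemma ringhom_jones_near_zeta: "ringhom (jones_near_zeta n)"
  unfolding jones_near_zeta_def
proof (intro ringhom_evalL ringhom_of_int)
  show "character (\<lambda>k. fps_const (zeta r powi k) * fps_exp (of_int k / of_nat n))"
    by (simp add: character_def power_int_add add_divide_distrib fps_exp_add_mult mult.assoc mult.left_commute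
        flip: fps_const_mult)
qed

lemma jones_near_zeta_single:
  "jones_near_zeta n (Poly_Mapping.single k 1) = fps_const (zeta r powi k) * fps_exp (of_int k / of_nat n)"
  by (simp add: jones_near_zeta_def evalL_single)

text \<open>As 2r divides n, zeta^n = 1 and q^(n+j) = zeta^j e^(h (1 + j/n)) for q = zeta e^(h/n),
  which is the value of A at x = 1/n.\<close>

lemma ev_near_zeta_jones:
  assumes n: "1 \<le> n" "2 * r dvd n"
  shows "ev (1 / of_nat n) (near_zeta j a) = jones_near_zeta n (jones_laurent (n + j) a)"
proof (rule ringhom_int_eqI[where f = "\<lambda>a. ev (1 / of_nat n) (near_zeta j a)"
      and g = "\<lambda>a. jones_near_zeta n (jones_laurent (n + j) a)"])
  interpret v: ringhom "ev (1 / of_nat n :: complex)" by (rule ringhom_ev)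
  show "ringhom (\<lambda>a. ev (1 / of_nat n) (near_zeta j a))" by (rule ringhom_comp[OF ringhom_ev ringhom_near_zeta])
  show "ringhom (\<lambda>a. jones_near_zeta n (jones_laurent (n + j) a))"
    by (rule ringhom_comp[OF ringhom_jones_near_zeta ringhom_jones_laurent])
  fix e :: "int \<times> int"
  obtain k l where e: "e = (k, l)" by fastforce
  obtain c where c: "n = 2 * r * c" using n(2) by (auto elim: dvdE)
  have z: "zeta r powi (k + int (n + j) * l) = zeta r powi (k + int j * l)"
    by (rule zeta_powi_cong[OF r, of _ _ "int c * l"]) (simp add: c algebra_simps)
  have d: "of_int (k + int (n + j) * l) / of_nat n = (of_int l + of_int (k + int j * l) / of_nat n :: complex)"
    using n(1) by (simp add: field_simps)
  have "ev (1 / of_nat n) (near_zeta j (qA k l)) = jones_near_zeta n (jones_laurent (n + j) (qA k l))"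
    unfolding near_zeta_qA jones_laurent_qA jones_near_zeta_single v.mult ev_exps ev_fps_const z d by simp
  then show "ev (1 / of_nat n) (near_zeta j (Poly_Mapping.single e 1)) =
      jones_near_zeta n (jones_laurent (n + j) (Poly_Mapping.single e 1))"
    by (simp add: e qA_def)
qed

text \<open>At x = 0 there remain q = zeta and A = zeta^j e^h: j shifts followed by A = e^h.\<close>

lemma ev_0_near_zeta: "ev 0 (near_zeta j a) = exp_A ((shift_A r ^^ j) (\<Psi> a))"
proof (rule ringhom_int_eqI[where f = "\<lambda>a. ev 0 (near_zeta j a)" and g = "\<lambda>a. exp_A ((shift_A r ^^ j) (\<Psi> a))"])
  interpret v: ringhom "ev (0 :: complex)" by (rule ringhom_ev)
  show "ringhom (\<lambda>a. ev 0 (near_zeta j a))" by (rule ringhom_comp[OF ringhom_ev ringhom_near_zeta])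
  show "ringhom (\<lambda>a. exp_A ((shift_A r ^^ j) (\<Psi> a)))"
    by (rule ringhom_comp[OF ringhom_exp_A ringhom_comp[OF ringhom_shift_power ringhom_at_zeta]])
  fix e :: "int \<times> int"
  obtain k l where e: "e = (k, l)" by fastforce
  have "ev 0 (near_zeta j (qA k l)) = exp_A ((shift_A r ^^ j) (\<Psi> (qA k l)))"
    by (simp add: near_zeta_qA v.mult ev_exps ev_fps_const at_zeta_qA shift_power_single exp_A_single power_int_add)
  then show "ev 0 (near_zeta j (Poly_Mapping.single e 1)) = exp_A ((shift_A r ^^ j) (\<Psi> (Poly_Mapping.single e 1)))"
    by (simp add: e qA_def)
qed

definition coef_near_zeta :: "laurent_q \<Rightarrow> complex poly fps" where
  "coef_near_zeta = evalL of_int (\<lambda>k. fps_const [:zeta r powi (2 * k):] * exps [:0, of_int (2 * k):])"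

lemma ringhom_coef_near_zeta: "ringhom coef_near_zeta"
  unfolding coef_near_zeta_def
proof (intro ringhom_evalL ringhom_of_int)
  let ?m = "\<lambda>k :: int. fps_const [:zeta r powi (2 * k):] * exps [:0, of_int (2 * k) :: complex:]"
  have "?m (a + b) = ?m a * ?m b" for a b
    using zeta_exps_mult[of "2 * a" "2 * b" 0 0] by (simp only: distrib_left add_0_right)
  moreover have "[:1 :: complex:] = 1" by simp
  ultimately show "character ?m" by (simp add: character_def exps_0)
qed

lemma ev_coef_near_zeta:
  shows "1 \<le> n \<Longrightarrow> ev (1 / of_nat n) (coef_near_zeta c) =
      jones_near_zeta n (evalL of_int (\<lambda>k. Poly_Mapping.single (2 * k) 1) c)"
    and "ev 0 (coef_near_zeta c) = fps_const (evalL of_int (\<lambda>k. zeta r powi (2 * k)) c)"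
proof -
  interpret v: ringhom "ev x :: complex poly fps \<Rightarrow> complex fps" for x by (rule ringhom_ev)
  have ch: "character (\<lambda>k::int. Poly_Mapping.single (2 * k) (1::int))"
    by (simp add: character_def mult_single distrib_left)
  have ch': "character (\<lambda>k. zeta r powi (2 * k))"
    by (simp add: character_def distrib_left power_int_add)
  show "ev (1 / of_nat n) (coef_near_zeta c) =
      jones_near_zeta n (evalL of_int (\<lambda>k. Poly_Mapping.single (2 * k) 1) c)" if "1 \<le> n"
  proof (rule ringhom_int_eqI[where f = "\<lambda>c. ev (1 / of_nat n) (coef_near_zeta c)" and
        g = "\<lambda>c. jones_near_zeta n (evalL of_int (\<lambda>k. Poly_Mapping.single (2 * k) 1) c)"])
    show "ringhom (\<lambda>c. ev (1 / of_nat n) (coef_near_zeta c))"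
      by (rule ringhom_comp[OF ringhom_ev ringhom_coef_near_zeta])
    show "ringhom (\<lambda>c. jones_near_zeta n (evalL of_int (\<lambda>k. Poly_Mapping.single (2 * k) 1) c))"
      by (rule ringhom_comp[OF ringhom_jones_near_zeta ringhom_evalL[OF ringhom_of_int ch]])
  qed (simp add: coef_near_zeta_def evalL_single v.mult ev_exps ev_fps_const jones_near_zeta_single)
  show "ev 0 (coef_near_zeta c) = fps_const (evalL of_int (\<lambda>k. zeta r powi (2 * k)) c)"
  proof (rule ringhom_int_eqI[where f = "\<lambda>c. ev 0 (coef_near_zeta c)" and
        g = "\<lambda>c. fps_const (evalL of_int (\<lambda>k. zeta r powi (2 * k)) c)"])
    show "ringhom (\<lambda>c. ev 0 (coef_near_zeta c))"
      by (rule ringhom_comp[OF ringhom_ev ringhom_coef_near_zeta])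
    show "ringhom (\<lambda>c. fps_const (evalL of_int (\<lambda>k. zeta r powi (2 * k)) c))"
      by (rule ringhom_comp[OF ringhom_fps_const ringhom_evalL[OF ringhom_of_int ch']])
  qed (simp add: coef_near_zeta_def evalL_single v.mult ev_exps ev_fps_const)
qed

end

lemma low_cancel_unit:
  fixes f g :: "'a::field fps"
  assumes "fps_nth f 0 \<noteq> 0" "f * g \<in> low n"
  shows "g \<in> low n"
proof -
  have "inverse f * (f * g) = g"
    unfolding mult.assoc[symmetric] inverse_mult_eq_1[OF assms(1)] by (rule mult_1_left)
  then show ?thesis using low_mult[OF assms(2), of "inverse f"] by metis
qed

lemma mult_through: "p * s = u * t \<Longrightarrow> p * (c * (x * s)) = u * (c * (x * t))" for p :: "'a::comm_monoid_mult"
  by (metis mult.left_commute)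

text \<open>The operator acting on Laurent polynomials instead of the completion;
  \<open>act_Rr_hat_to_Rr_hat\<close> identifies the two.\<close>

definition ado_recursion :: "nat \<Rightarrow> qoperator \<Rightarrow> laurent_A \<Rightarrow> laurent_A" where
  "ado_recursion r P p = (\<Sum>(i, j)\<in>Poly_Mapping.keys P.
     Poly_Mapping.single 0 (evalL of_int (\<lambda>k. zeta r powi (2 * k)) (Poly_Mapping.lookup P (i, j))) *
     (Poly_Mapping.single 2 1 ^ i * (shift_A r ^^ j) p))"

context knot_root
begin

text \<open>At x = 1/n the truncated state sums agree modulo h^N with colored Jones polynomials,
  whose recursion at n vanishes. Interpolation in x gives the statement with x left free.\<close>

lemma recursion_low:
  assumes w: "writhe D = 0" and ann: "\<forall>n\<ge>1. act_seq P (colored_jones D) n = 0"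
  shows "(\<Sum>(i, j)\<in>Poly_Mapping.keys P. coef_near_zeta (Poly_Mapping.lookup P (i, j)) *
      (exps [:2:] ^ i * near_zeta j (box_sum D (r * N)))) \<in> low N" (is "?G \<in> low N")
proof (rule low_if_ev_low)
  have D: "zero_framed_knot_diagram D" using knot w by (simp add: zero_framed_knot_diagram_def)
  \<comment> \<open>Reciprocals of the positive multiples of 2r; \<open>Suc m\<close> avoids the
    multiple 0.\<close>
  define pt where "pt = (\<lambda>m. 1 / of_nat (2 * r * Suc m) :: complex)"
  have "inj pt"
  proof (rule injI)
    fix a b assume "pt a = pt b"
    then have "(of_nat (2 * r * Suc a) :: complex) = of_nat (2 * r * Suc b)"
      unfolding pt_def by (metis divide_cancel_left zero_neq_one)
    then have "2 * r * Suc a = 2 * r * Suc b" by (simp only: of_nat_eq_iff)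
    then show "a = b" using r by simp
  qed
  then show "infinite (range pt)" by (simp add: range_inj_infinite)
  fix x assume "x \<in> range pt"
  then obtain n where n: "1 \<le> n" "2 * r dvd n" "x = 1 / of_nat n"
    unfolding pt_def using r by (auto intro!: that[of "2 * r * Suc _"])
  interpret v: ringhom "ev x" by (rule ringhom_ev)
  interpret t: ringhom "jones_near_zeta n" by (rule ringhom_jones_near_zeta)
  interpret z: ringhom "near_zeta j" for j by (rule ringhom_near_zeta)
  \<comment> \<open>The union of the box and the bounded indices gives the exact Jones polynomial
    and differs from the box sum by an element of I_(r N) only.\<close>
  have close: "ev x (near_zeta j (box_sum D (r * N))) - jones_near_zeta n (colored_jones D (n + j)) \<in> low N" for j
  proof -
    let ?S = "box D (r * N) \<union> bounded_indices (Suc (n + j)) D"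
    have S: "finite ?S" "?S \<subseteq> crossings D \<rightarrow>\<^sub>E UNIV"
      using finite_bounded_indices box_subset finite_bounded_subset by auto
    have "(\<Sum>i\<in>?S. state_term D i) - box_sum D (r * N) \<in> I_R (r * N)"
      by (rule sum_minus_box_sum[OF knot S(1) Un_upper1 S(2)])
    then have "ev x (near_zeta j ((\<Sum>i\<in>?S. state_term D i) - box_sum D (r * N))) \<in> low N"
      by (intro ev_low near_zeta_low)
    then have "0 - ev x (near_zeta j ((\<Sum>i\<in>?S. state_term D i) - box_sum D (r * N))) \<in> low N"
      by (intro low_diff low_0)
    moreover have "jones_near_zeta n (colored_jones D (n + j)) = ev x (near_zeta j (\<Sum>i\<in>?S. state_term D i))"
      unfolding colored_jones_eq[OF D S(1) Un_upper2 S(2)] n(3) ev_near_zeta_jones[OF n(1,2)] ..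
    ultimately show ?thesis by (simp add: z.diff v.diff)
  qed
  have coef: "ev x (coef_near_zeta c) = jones_near_zeta n (evalL of_int (\<lambda>k. Poly_Mapping.single (2 * k) 1) c)" for c
    unfolding n(3) by (rule ev_coef_near_zeta(1)[OF n(1)])
  \<comment> \<open>q^(2n) becomes zeta^(2n) e^(2h) = e^(2h), independently of n, and this is also
    A^2 at A = e^h.\<close>
  have Q: "ev x (exps [:2:]) = jones_near_zeta n (Poly_Mapping.single (2 * int n) 1)"
  proof -
    obtain c where c: "n = 2 * r * c" using n(2) by (auto elim: dvdE)
    have "zeta r powi (2 * int n) = zeta r powi 0"
      by (rule zeta_powi_cong[OF r, of _ _ "2 * int c"]) (simp add: c)
    then show ?thesis using n(1) by (simp add: ev_exps jones_near_zeta_single)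
  qed
  have "ev x ?G = ev x ?G - jones_near_zeta n (act_seq P (colored_jones D) n)"
    using ann n(1) by simp
  also have "\<dots> = (\<Sum>(i, j)\<in>Poly_Mapping.keys P. ev x (coef_near_zeta (Poly_Mapping.lookup P (i, j))) *
      (ev x (exps [:2:]) ^ i * (ev x (near_zeta j (box_sum D (r * N))) - jones_near_zeta n (colored_jones D (n + j)))))"
    unfolding act_seq_eq v.sum t.sum sum_subtractf[symmetric]
    by (intro sum.cong) (auto simp: v.mult v.power t.mult t.power coef Q right_diff_distrib)
  also have "\<dots> \<in> low N"
    using close by (intro low_sum) (auto intro: low_mult)
  finally show "ev x ?G \<in> low N" .
qed

theorem ado_recursion_zero:
  assumes w: "writhe D = 0" and ann: "\<forall>n\<ge>1. act_seq P (colored_jones D) n = 0"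
  shows "ado_recursion r P (ADO r D) = 0"
proof (rule exp_A_eq_0)
  interpret e: ringhom exp_A by (rule ringhom_exp_A)
  interpret v: ringhom "ev (0 :: complex)" by (rule ringhom_ev)
  interpret s: ringhom "shift_A r ^^ j" for j by (rule ringhom_shift_power)
  have "exp_A (ado_recursion r P (ADO r D)) \<in> low N" if N: "0 < N" for N
  proof -
    have su: "(shift_A r ^^ j) pivotal_unit = pivotal_unit" for j
      by (induction j) (simp_all add: shift_pivotal_unit[OF w])
    have sq: "(shift_A r ^^ j) (quot_sum N) = quot_sum N" for j
      by (induction j) (simp_all add: shift_quot_sum)
    \<comment> \<open>Both extra factors are fixed by the shift, so they come out of every summand
      of the recursion as common factors.\<close>
    have prod: "pivotal_unit * (shift_A r ^^ j) (\<Psi> (box_sum D (r * N))) = quot_sum N * (shift_A r ^^ j) (ADO r D)" for j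
    proof -
      have "pivotal_unit * (shift_A r ^^ j) (\<Psi> (box_sum D (r * N))) =
          (shift_A r ^^ j) pivotal_unit * (shift_A r ^^ j) (\<Psi> (box_sum D (r * N)))" by (simp only: su)
      also have "\<dots> = (shift_A r ^^ j) (quot_sum N * ADO r D)"
        unfolding box_sum_factor ADO_eq(1)[OF w] by (simp only: s.mult ac_simps)
      finally show ?thesis by (simp only: s.mult sq)
    qed
    let ?G = "\<Sum>(i, j)\<in>Poly_Mapping.keys P. coef_near_zeta (Poly_Mapping.lookup P (i, j)) *
      (exps [:2:] ^ i * near_zeta j (box_sum D (r * N)))"
    have "exp_A pivotal_unit * ev 0 ?G = exp_A (quot_sum N * ado_recursion r P (ADO r D))"
      unfolding ado_recursion_def v.sum e.sum sum_distrib_left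
    proof (intro sum.cong refl)
      fix ij assume "ij \<in> Poly_Mapping.keys P"
      obtain i j where ij: "ij = (i, j)" by fastforce
      have c: "fps_const c = exp_A (Poly_Mapping.single 0 c)" for c by (simp add: exp_A_single)
      have q: "ev 0 (exps [:2:]) = exp_A (Poly_Mapping.single 2 1)" by (simp add: ev_exps exp_A_single)
      show "exp_A pivotal_unit * ev 0 (case ij of (i, j) \<Rightarrow> coef_near_zeta (Poly_Mapping.lookup P (i, j)) *
            (exps [:2:] ^ i * near_zeta j (box_sum D (r * N)))) =
          exp_A (quot_sum N * (case ij of (i, j) \<Rightarrow>
            Poly_Mapping.single 0 (evalL of_int (\<lambda>k. zeta r powi (2 * k)) (Poly_Mapping.lookup P (i, j))) *
            (Poly_Mapping.single 2 1 ^ i * (shift_A r ^^ j) (ADO r D))))"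
        unfolding ij prod.case v.mult v.power ev_coef_near_zeta(2) ev_0_near_zeta c q
          e.mult[symmetric] e.power[symmetric]
        by (rule arg_cong[where f = exp_A]) (rule mult_through[OF prod])
    qed
    moreover have "exp_A pivotal_unit * ev 0 ?G \<in> low N"
      by (rule low_mult[OF ev_low[OF recursion_low[OF w ann]]])
    ultimately have "exp_A (quot_sum N) * exp_A (ado_recursion r P (ADO r D)) \<in> low N"
      by (simp only: e.mult)
    \<comment> \<open>The constant term is \<open>at_one (quot_sum N)\<close> = 1, so the factor is
      a unit among power series and can be cancelled modulo h^N.\<close>
    moreover have "fps_nth (exp_A (quot_sum N)) 0 \<noteq> 0"
      by (simp add: exp_A_at_one at_one_quot_sum[OF N])
    ultimately show ?thesis by (rule low_cancel_unit[rotated])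
  qed
  then have "exp_A (ado_recursion r P (ADO r D)) \<in> low N" for N
    by (cases "0 < N") (auto simp: low_def)
  then show "exp_A (ado_recursion r P (ADO r D)) = 0" by (rule zero_if_all_low)
qed

end

section \<open>Completions\<close>

locale filtered_ring = cring R for R :: "'a ring" (structure) and I :: "nat \<Rightarrow> 'a set" +
  assumes ideal_I: "ideal (I n) R" and decreasing: "I (Suc n) \<subseteq> I n"
begin

lemma ring_Quot: "ring (R Quot I n)"
  by (rule ideal.quotient_is_ring[OF ideal_I])

lemma carrier_completion:
  "x \<in> carrier (completion R I) \<longleftrightarrow> (\<forall>n. x n \<in> carrier (R Quot I n)) \<and> (\<forall>n. x (Suc n) \<subseteq> x n)"
  by (simp add: completion_def)

text \<open>The additive structure is what the finite sum in \<open>act_Rr_hat\<close> refers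
  to.\<close>

lemma abelian_monoid_completion: "abelian_monoid (completion R I)"
proof (rule abelian_monoidI)
  fix x y z
  assume x: "x \<in> carrier (completion R I)" and y: "y \<in> carrier (completion R I)"
  note q = ring_Quot[THEN ring.is_abelian_group, THEN abelian_group.axioms(1)]
  show "x \<oplus>\<^bsub>completion R I\<^esub> y \<in> carrier (completion R I)"
    unfolding carrier_completion
  proof (intro conjI allI)
    fix n
    show "(x \<oplus>\<^bsub>completion R I\<^esub> y) n \<in> carrier (R Quot I n)"
      using x y abelian_monoid.a_closed[OF q] by (simp add: completion_def)
    have "x (Suc n) \<subseteq> x n" "y (Suc n) \<subseteq> y n" using x y by (simp_all add: completion_def)
    then show "(x \<oplus>\<^bsub>completion R I\<^esub> y) (Suc n) \<subseteq> (x \<oplus>\<^bsub>completion R I\<^esub> y) n"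
      by (auto simp: completion_def FactRing_def set_add_def')
  qed
  show "x \<oplus>\<^bsub>completion R I\<^esub> y = y \<oplus>\<^bsub>completion R I\<^esub> x"
    using x y abelian_monoid.a_comm[OF q] by (simp add: completion_def)
  show "\<zero>\<^bsub>completion R I\<^esub> \<oplus>\<^bsub>completion R I\<^esub> x = x"
    using x abelian_monoid.l_zero[OF q] by (simp add: completion_def)
  assume z: "z \<in> carrier (completion R I)"
  show "x \<oplus>\<^bsub>completion R I\<^esub> y \<oplus>\<^bsub>completion R I\<^esub> z = x \<oplus>\<^bsub>completion R I\<^esub> (y \<oplus>\<^bsub>completion R I\<^esub> z)"
    using x y z abelian_monoid.a_assoc[OF q] by (simp add: completion_def)
next
  show "\<zero>\<^bsub>completion R I\<^esub> \<in> carrier (completion R I)"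
    using decreasing ring.ring_simprules(2)[OF ring_Quot] by (auto simp: completion_def FactRing_def)
qed

lemma to_completion_closed:
  assumes a: "a \<in> carrier R"
  shows "to_completion R I a \<in> carrier (completion R I)"
proof -
  have "I n +> a \<in> carrier (R Quot I n)" for n
    using ideal.rcos_ring_hom[OF ideal_I] a by (rule ring_hom_closed)
  moreover have "I (Suc n) +> a \<subseteq> I n +> a" for n
    using decreasing[of n] by (auto simp: a_r_coset_def' )
  ultimately show ?thesis by (simp add: completion_def to_completion_def)
qed

lemma to_completion_add:
  "\<lbrakk>a \<in> carrier R; b \<in> carrier R\<rbrakk> \<Longrightarrow>
     to_completion R I (a \<oplus> b) = to_completion R I a \<oplus>\<^bsub>completion R I\<^esub> to_completion R I b"
  using ring_hom_add[OF ideal.rcos_ring_hom[OF ideal_I]] by (simp add: completion_def to_completion_def)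

lemma to_completion_mult:
  "\<lbrakk>a \<in> carrier R; b \<in> carrier R\<rbrakk> \<Longrightarrow>
     to_completion R I (a \<otimes> b) = to_completion R I a \<otimes>\<^bsub>completion R I\<^esub> to_completion R I b"
  using ring_hom_mult[OF ideal.rcos_ring_hom[OF ideal_I]] by (simp add: completion_def to_completion_def)

lemma to_completion_zero: "to_completion R I \<zero> = \<zero>\<^bsub>completion R I\<^esub>"
  using ring_hom_zero[OF ideal.rcos_ring_hom[OF ideal_I] ring_axioms ring_Quot]
  by (simp add: completion_def to_completion_def)

lemma to_completion_finsum:
  assumes "finite S" "f \<in> S \<rightarrow> carrier R"
  shows "to_completion R I (\<Oplus>e\<in>S. f e) = (\<Oplus>\<^bsub>completion R I\<^esub>e\<in>S. to_completion R I (f e))"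
proof -
  interpret c: abelian_monoid "completion R I" by (rule abelian_monoid_completion)
  show ?thesis using assms
  proof (induction S)
    case empty
    then show ?case by (simp add: to_completion_zero)
  next
    case (insert e S)
    then have f: "f e \<in> carrier R" "f \<in> S \<rightarrow> carrier R" by auto
    have "(\<lambda>e. to_completion R I (f e)) \<in> S \<rightarrow> carrier (completion R I)"
      using f(2) to_completion_closed by auto
    then show ?case
      using insert f by (simp add: to_completion_add to_completion_closed finsum_closed)
  qed
qed

end

lemma ideal_ideal_pow:
  fixes R :: "'a ring"
  assumes "ring R" "ideal J R"
  shows "ideal (ideal_pow R J n) R"
proof (induction n)
  case 0
  show ?case unfolding ideal_pow.simps by (rule ring.oneideal[OF assms(1)])
next
  case (Suc n)
  show ?case unfolding ideal_pow.simps by (rule ring.ideal_prod_is_ideal[OF assms Suc])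
qed

lemma filtered_ring_ideal_pow:
  fixes R :: "'a ring"
  assumes "cring R" "ideal J R"
  shows "filtered_ring R (ideal_pow R J)"
proof (intro filtered_ring.intro filtered_ring_axioms.intro assms(1))
  interpret cring R by (rule assms(1))
  show id: "ideal (ideal_pow R J n) R" for n
    by (rule ideal_ideal_pow[OF ring_axioms assms(2)])
  show "ideal_pow R J (Suc n) \<subseteq> ideal_pow R J n" for n
    using ideal_prod_inter[OF assms(2) id[of n]] unfolding ideal_pow.simps by blast
qed

lemma ideal_pow_image:
  fixes R :: "'a ring"
  assumes h: "h \<in> ring_hom R R" "h ` J \<subseteq> J" and R: "ring R" "ideal J R"
  shows "h ` ideal_pow R J n \<subseteq> ideal_pow R J n"
proof (induction n)
  case 0
  then show ?case using ring_hom_closed[OF h(1)] by auto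
next
  case (Suc n)
  interpret ring R by (rule R(1))
  note id = ideal_ideal_pow[OF R]
  note carr = ideal.Icarr[OF R(2)] ideal.Icarr[OF id[of n]] subsetD[OF ideal_prod_in_carrier[OF R(2) id[of n]]]
  have "h s \<in> ideal_prod R J (ideal_pow R J n)" if "s \<in> ideal_prod R J (ideal_pow R J n)" for s
    using that
  proof (induction s rule: ideal_prod.induct)
    case (prod i j)
    then have "h i \<otimes>\<^bsub>R\<^esub> h j \<in> ideal_prod R J (ideal_pow R J n)"
      using h(2) Suc by (intro ideal_prod.prod) auto
    then show ?case using prod carr ring_hom_mult[OF h(1)] by simp
  next
    case (sum s t)
    then have "h s \<oplus>\<^bsub>R\<^esub> h t \<in> ideal_prod R J (ideal_pow R J n)"
      by (intro ideal_prod.sum) auto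
    then show ?case using sum carr ring_hom_add[OF h(1)] by simp
  qed
  then show ?case by auto
qed

section \<open>The ring of Laurent polynomials over Z[zeta]\<close>

lemma ring_Rr_simps [simp]:
  "x \<otimes>\<^bsub>ring_Rr r\<^esub> y = x * y" "x \<oplus>\<^bsub>ring_Rr r\<^esub> y = x + y" "\<one>\<^bsub>ring_Rr r\<^esub> = 1" "\<zero>\<^bsub>ring_Rr r\<^esub> = 0"
  by (simp_all add: ring_Rr_def ring_of_type_algebra_def)

lemma cring_ring_Rr: "cring (ring_Rr r)"
proof (rule cringI)
  show "abelian_group (ring_Rr r)"
  proof (rule abelian_groupI)
    fix x assume "x \<in> carrier (ring_Rr r)"
    then show "\<exists>y\<in>carrier (ring_Rr r). y \<oplus>\<^bsub>ring_Rr r\<^esub> x = \<zero>\<^bsub>ring_Rr r\<^esub>"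
      by (intro bexI[of _ "- x"]) (auto simp: carrier_ring_Rr Zr_uminus)
  qed (auto simp: carrier_ring_Rr Zr_add Zr_0 ac_simps)
  show "comm_monoid (ring_Rr r)"
    by (rule comm_monoidI) (auto simp: carrier_ring_Rr Zr_mult Zr_1 ac_simps)
qed (simp add: distrib_right)

abbreviation r_alpha :: "nat \<Rightarrow> laurent_A" where
  "r_alpha r \<equiv> Poly_Mapping.single (int r) 1 - Poly_Mapping.single (- int r) 1"

lemma r_alpha_Zr: "r_alpha r \<in> Zr r"
  by (metis Zr_add Zr_uminus Zr_single Z_zeta_1 diff_conv_add_uminus)

lemma ideal_r_alpha: "ideal (Idl\<^bsub>ring_Rr r\<^esub> {r_alpha r}) (ring_Rr r)"
proof -
  interpret cring "ring_Rr r" by (rule cring_ring_Rr)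
  show ?thesis using r_alpha_Zr by (intro genideal_ideal) (simp add: carrier_ring_Rr)
qed

lemma filtered_Rr: "filtered_ring (ring_Rr r) (I_Rr r)"
  unfolding I_Rr_def by (rule filtered_ring_ideal_pow[OF cring_ring_Rr ideal_r_alpha])

lemma finsum_ring_Rr:
  assumes "finite S" "f \<in> S \<rightarrow> Zr r"
  shows "(\<Oplus>\<^bsub>ring_Rr r\<^esub>e\<in>S. f e) = (\<Sum>e\<in>S. f e)"
proof -
  interpret cring "ring_Rr r" by (rule cring_ring_Rr)
  show ?thesis using assms
    by (induction S) (simp_all add: carrier_ring_Rr finsum_insert)
qed

context root_of_unity
begin

lemma shift_A_ring_hom: "shift_A r \<in> ring_hom (ring_Rr r) (ring_Rr r)"
proof -
  show ?thesis
    by (rule ring_hom_memI) (simp_all add: carrier_ring_Rr shift_A_Zr[OF r] shift.add shift.mult shift.one)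
qed

text \<open>The inverse of the shift is one of its powers, so invariance under the shift yields
  equality and not merely inclusion.\<close>

lemma shift_A_order: "(shift_A r ^^ (2 * r)) p = p"
proof -
  interpret s: ringhom "shift_A r ^^ (2 * r)" by (rule ringhom_shift_power)
  have "zeta r powi (int (2 * r) * k) = zeta r powi 0" for k
    by (rule zeta_powi_cong[OF r, of _ _ k]) simp
  then show ?thesis
    by (induction p rule: poly_mapping_additive_induct) (simp_all add: shift_power_single s.add s.zero)
qed

text \<open>The generator A^r - A^(-r) goes to its negative, which gives one inclusion; finite order
  of the shift gives the other. Equality is needed for \<open>E_bar\<close> to map cosets onto
  cosets.\<close>

lemma shift_A_I_Rr: "shift_A r ` I_Rr r n = I_Rr r n"
proof -
  interpret cring "ring_Rr r" by (rule cring_ring_Rr)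
  have neg: "shift_A r (r_alpha r) = - r_alpha r"
    unfolding shift.diff shift_A_single by (simp add: power_int_minus zeta_power_r[OF r] single_uminus)
  have "shift_A r ` (Idl\<^bsub>ring_Rr r\<^esub> {r_alpha r}) \<subseteq> Idl\<^bsub>ring_Rr r\<^esub> {r_alpha r}"
  proof -
    have "r_alpha r \<in> carrier (ring_Rr r)" by (simp add: r_alpha_Zr carrier_ring_Rr)
    then have idl: "Idl\<^bsub>ring_Rr r\<^esub> {r_alpha r} = {x * r_alpha r | x. x \<in> Zr r}"
      by (simp add: cgenideal_eq_genideal[symmetric] cgenideal_def carrier_ring_Rr)
    have "shift_A r (x * r_alpha r) = (- shift_A r x) * r_alpha r" for x
      unfolding shift.mult neg by (simp only: mult_minus_right mult_minus_left)
    then show ?thesis unfolding idl using Zr_uminus shift_A_Zr[OF r] by blast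
  qed
  then have sub: "shift_A r ` I_Rr r n \<subseteq> I_Rr r n"
    unfolding I_Rr_def by (rule ideal_pow_image[OF shift_A_ring_hom _ ring_axioms ideal_r_alpha])
  have pow: "p \<in> I_Rr r n \<Longrightarrow> (shift_A r ^^ j) p \<in> I_Rr r n" for p j
    using sub by (induction j) auto
  have "p \<in> shift_A r ` I_Rr r n" if "p \<in> I_Rr r n" for p
  proof
    show "(shift_A r ^^ (2 * r - 1)) p \<in> I_Rr r n" using that by (rule pow)
    have "2 * r = Suc (2 * r - 1)" using r by simp
    then show "p = shift_A r ((shift_A r ^^ (2 * r - 1)) p)"
      by (metis shift_A_order comp_apply funpow.simps(2))
  qed
  then show ?thesis using sub by blast
qed

lemma E_bar_to_Rr_hat:
  assumes p: "p \<in> Zr r"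
  shows "E_bar r (to_Rr_hat r p) = to_Rr_hat r (shift_A r p)"
proof -
  interpret filtered_ring "ring_Rr r" "I_Rr r" by (rule filtered_Rr)
  have "shift_A r ` (I_Rr r n +>\<^bsub>ring_Rr r\<^esub> p) = I_Rr r n +>\<^bsub>ring_Rr r\<^esub> shift_A r p" for n
    using a_coset_hom(2)[OF shift_A_ring_hom, of "I_Rr r n" p] p ideal.Icarr[OF ideal_I[of n]]
    by (auto simp: shift_A_I_Rr carrier_ring_Rr)
  then show ?thesis by (simp add: E_bar_def to_Rr_hat_def to_completion_def)
qed

lemma to_Rr_hat_mult:
  "p \<in> Zr r \<Longrightarrow> p' \<in> Zr r \<Longrightarrow> to_Rr_hat r p \<otimes>\<^bsub>Rr_hat r\<^esub> to_Rr_hat r p' = to_Rr_hat r (p * p')"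
  using filtered_ring.to_completion_mult[OF filtered_Rr, of p r p']
  by (simp add: Rr_hat_def to_Rr_hat_def carrier_ring_Rr)

lemma E_bar_power: "p \<in> Zr r \<Longrightarrow> (E_bar r ^^ j) (to_Rr_hat r p) = to_Rr_hat r ((shift_A r ^^ j) p)"
  and shift_power_Zr: "p \<in> Zr r \<Longrightarrow> (shift_A r ^^ j) p \<in> Zr r"
  by (induction j) (simp_all add: E_bar_to_Rr_hat shift_A_Zr[OF r])

lemma Q_bar_power:
  assumes "p \<in> Zr r"
  shows "(Q_bar r ^^ i) (to_Rr_hat r p) = to_Rr_hat r (Poly_Mapping.single 2 1 ^ i * p)"
proof (induction i)
  case (Suc i)
  have "Poly_Mapping.single 2 1 ^ i * p \<in> Zr r" by (intro Zr_mult Zr_power Zr_single Z_zeta_1 assms)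
  then show ?case
    using Suc by (simp add: Q_bar_def to_Rr_hat_mult Zr_single[OF Z_zeta_1] mult.assoc)
qed simp

text \<open>The canonical map into the completion respects sums, products and the shift, so the
  operator may be computed on representatives in R_r.\<close>

lemma act_Rr_hat_to_Rr_hat:
  assumes p: "p \<in> Zr r"
  shows "act_Rr_hat r P (to_Rr_hat r p) = to_Rr_hat r (ado_recursion r P p)"
proof -
  interpret filtered_ring "ring_Rr r" "I_Rr r" by (rule filtered_Rr)
  interpret c: abelian_monoid "Rr_hat r" unfolding Rr_hat_def by (rule abelian_monoid_completion)
  define f where "f = (\<lambda>(i :: nat, j :: nat). Poly_Mapping.single 0 (evalL of_int (\<lambda>k. zeta r powi (2 * k)) (Poly_Mapping.lookup P (i, j))) *
     (Poly_Mapping.single 2 1 ^ i * (shift_A r ^^ j) p))"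
  have f: "f e \<in> Zr r" for e
    unfolding f_def by (auto split: prod.split intro!: Zr_mult Zr_power Zr_single Z_zeta_1 Z_zeta_evalL r shift_power_Zr p)
  have "act_Rr_hat r P (to_Rr_hat r p) = (\<Oplus>\<^bsub>Rr_hat r\<^esub>e\<in>Poly_Mapping.keys P. to_Rr_hat r (f e))"
    unfolding act_Rr_hat_def
  proof (intro c.finsum_cong' refl)
    show "(\<lambda>e. to_Rr_hat r (f e)) \<in> Poly_Mapping.keys P \<rightarrow> carrier (Rr_hat r)"
      using to_completion_closed f by (simp add: Rr_hat_def to_Rr_hat_def carrier_ring_Rr)
    fix e :: "nat \<times> nat"
    obtain i j where e: "e = (i, j)" by fastforce
    have "Poly_Mapping.single 2 1 ^ i * (shift_A r ^^ j) p \<in> Zr r"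
      by (intro Zr_mult Zr_power Zr_single Z_zeta_1 shift_power_Zr p)
    then show "(case e of (i, j) \<Rightarrow> to_Rr_hat r (Poly_Mapping.single 0
         (evalL of_int (\<lambda>k. zeta r powi (2 * k)) (Poly_Mapping.lookup P (i, j)))) \<otimes>\<^bsub>Rr_hat r\<^esub>
         (Q_bar r ^^ i) ((E_bar r ^^ j) (to_Rr_hat r p))) = to_Rr_hat r (f e)"
      by (simp add: e f_def E_bar_power p Q_bar_power shift_power_Zr to_Rr_hat_mult[OF Zr_single[OF Z_zeta_evalL[OF r]]])
  qed
  also have "\<dots> = to_Rr_hat r (\<Oplus>\<^bsub>ring_Rr r\<^esub>e\<in>Poly_Mapping.keys P. f e)"
    unfolding Rr_hat_def to_Rr_hat_def using f
    by (intro to_completion_finsum[symmetric]) (auto simp: carrier_ring_Rr)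
  also have "(\<Oplus>\<^bsub>ring_Rr r\<^esub>e\<in>Poly_Mapping.keys P. f e) = ado_recursion r P p"
    using f by (subst finsum_ring_Rr) (auto simp: ado_recursion_def f_def)
  finally show ?thesis .
qed

lemma to_Rr_hat_zero: "to_Rr_hat r 0 = \<zero>\<^bsub>Rr_hat r\<^esub>"
  using filtered_ring.to_completion_zero[OF filtered_Rr, of r] by (simp add: Rr_hat_def to_Rr_hat_def)

end

theorem mainTheorem3:
  fixes D :: diagram and P :: qoperator
  assumes knot: "zero_framed_knot_diagram D"
    and annihilates: "\<forall>n\<ge>1. act_seq P (colored_jones D) n = 0"
  shows "act_series P (R_hat_to_series (unified_invariant D)) = 0 \<and>
    (\<forall>r\<ge>1. act_Rr_hat r P (to_Rr_hat r (ADO r D)) = \<zero>\<^bsub>Rr_hat r\<^esub>)"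
proof (intro conjI allI impI)
  show "act_series P (R_hat_to_series (unified_invariant D)) = 0"
    by (rule unified_invariant_holonomic[OF knot annihilates])
  fix r :: nat assume r: "1 \<le> r"
  have D: "knot_diagram D" "writhe D = 0" using knot by (simp_all add: zero_framed_knot_diagram_def)
  interpret knot_root D r by unfold_locales (rule D(1), rule r)
  show "act_Rr_hat r P (to_Rr_hat r (ADO r D)) = \<zero>\<^bsub>Rr_hat r\<^esub>"
    by (simp only: act_Rr_hat_to_Rr_hat[OF ADO_eq(2)[OF D(2)]] ado_recursion_zero[OF D(2) annihilates] to_Rr_hat_zero)
qed

end
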